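(* Let $\mathscr C$ be a non-empty set of finite sets of odd cardinality, let $\mathcal B=\mathcal B(\mathscr C)$ be the Brauer category over $\mathscr C$, let $\xi$ be the least cardinal strictly greater than $|A|$ for every $A\in\mathscr C$, and let $I_r=\{\alpha\in\mathcal B:\operatorname{rank}(\alpha)\le r\}$ for odd $1\le r<\xi$, with $I_\omega=\mathcal B$ if $\xi=\omega$. (i) The minimal ideal $I_1$ is (isomorphic to) a partial rectangular band, so its congruences are precisely those corresponding to the relations $\sigma_{\mathcal E_1,\mathcal E_2}$ described in the context. In particular, $\operatorname{Cong}(I_1)$ is isomorphic to the lattice direct product $$\prod_{A\in\mathscr C}\mathfrak{Eq}(\mathfrak{Eq}_2(A))\times\prod_{A\in\mathscr C}\mathfrak{Eq}(\mathfrak{Eq}_2(A)).$$ (ii) For odd $r\ge3$ with $r<\xi$ (and also for $r=\omega$ if $\xi=\omega$), $$\operatorname{Cong}(I_r)=\{\Delta_{I_r},\lambda^{I_r}_{I_1},\rho^{I_r}_{I_1},R^{I_r}_{I_1}\}\cup\{R^{I_r}_{I_q,N^\natural}:1\le q<r,\ q\text{ odd},\ N\unlhd\mathcal S_{q+2}\}\cup\{\widetilde\nabla_{I_r}\}.$$ The inclusion order is as follows: $\Delta_{I_r}\subset\lambda^{I_r}_{I_1},\rho^{I_r}_{I_1}\subset R^{I_r}_{I_1}$ with $\lambda^{I_r}_{I_1},\rho^{I_r}_{I_1}$ incomparable; the congruences $R^{I_r}_{I_q,N^\natural}$ form a chain with bottom $R^{I_r}_{I_1}=R^{I_r}_{I_1,\{\mathrm{id}_3\}^\natural}$,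 with $R^{I_r}_{I_q,N^\natural}\subseteq R^{I_r}_{I_{q'},N'^\natural}$ iff $q<q'$, or $q=q'$ and $N\le N'$; and $\widetilde\nabla_{I_r}$ is the top element.
   Context: **Brauer category.** Let $X=\bigcup_{A\in\mathscr C}A$ with disjoint copies $X'$, $X''$. For $A,B\in\mathscr C$, a Brauer partition $\alpha\in\mathcal B_{A,B}$ is a set partition of $A\cup B'$ into blocks of size 2; $\mathbf d(\alpha)=A$, $\mathbf r(\alpha)=B$. For $\alpha\in\mathcal B_{A,B}$, $\beta\in\mathcal B_{B,C}$, regard them as equivalences, rename each $b'$ in $\alpha$ and each $b$ in $\beta$ to $b''$ ($b\in B$), take the join of the resulting equivalences on $A\cup B''\cup C'$, and restrict to $A\cup C'$: this is $\alpha\beta\in\mathcal B_{A,C}$. $\mathcal B=\bigcup\mathcal B_{A,B}$. A block of $\alpha\in\mathcal B_{A,B}$ is a transversal if it meets both $A$ and $B'$; $\operatorname{rank}(\alpha)$ is the number of transversals. The $\mathscr J=\mathscr D$-classes of $\mathcal B$ are $D_q=\{\alpha:\operatorname{rank}(\alpha)=q\}$, $q$ odd, $1\le q<\xi$, all stable and regular. $\mathfrak{Eq}(Z)$ is the lattice of equivalences on $Z$. For $|A|$ odd, $\mathfrak{Eq}_2(A)$ is the set of equivalences on $A$ with exactly one singleton class and all other classes of size 2. $\mathcal S_q$ is the symmetric group on $\{1,\ldots,q\}$. **Groups.** For odd $1\le q<\xi$ fix $X_q\in\mathscr C$ with $n_q=|X_q|\ge q$, $X_q=\{x_1,\ldots,x_{n_q}\}$.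 For $\pi\in\mathcal S_q$, $\pi^\natural\in\mathcal B_{X_q,X_q}$ has blocks $\{x_i,x_{i\pi}'\}$ ($1\le i\le q$), and $\{x_{q+1},x_{q+2}\},\ldots,\{x_{n_q-1},x_{n_q}\}$, $\{x_{q+1}',x_{q+2}'\},\ldots,\{x_{n_q-1}',x_{n_q}'\}$. $N^\natural=\{\pi^\natural:\pi\in N\}$. $\mathcal S_q^\natural$ is a group $\mathscr H$-class in $D_q$. **Congruences.** For a partial semigroup (category without necessarily having identities) $S$, write $x\sim y$ if $\mathbf d(x)=\mathbf d(y)$ and $\mathbf r(x)=\mathbf r(y)$. A congruence on $S$ is an equivalence contained in $\sim$ and compatible with all defined left and right multiplications. $\operatorname{Cong}(S)$ is the lattice of congruences. $\Delta_S$ is equality, $\widetilde\nabla_S=\{(x,y):x\sim y\}$. For an ideal $I$ (non-empty, closed under defined multiplication by elements of $S$ on either side), $R_I^S=\widetilde\nabla_I\cup\Delta_S$. Green's relations: $x\mathrel{\mathscr R}y\Leftrightarrow xS^1=yS^1$, $x\mathrel{\mathscr L}y\Leftrightarrow S^1x=S^1y$, $x\mathrel{\mathscr J}y\Leftrightarrow S^1xS^1=S^1yS^1$, $\mathscr H=\mathscr R\cap\mathscr L$ ($S^1$ is $S$ with identities adjoined where needed). For $N$ a normal subgroup of a group $\mathscr H$-class in a $\mathscr J$-class $D$ minimal among those in $S\setminus I$, $\nu_N=\{(axb,ayb):x,y\in N,\ a,b\in S^1,\ axb,ayb\in D\}$ and $R^S_{I,N}=R_I^S\cup\nu_N$. With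 $M=I_1$ the minimal ideal of $S=I_r$: $\lambda_{I_1}^{S}=\{(x,y)\in M\times M:x\sim y,\ (x,y)\in\mathscr L\}\cup\Delta_S$ and $\rho_{I_1}^{S}=\{(x,y)\in M\times M:x\sim y,\ (x,y)\in\mathscr R\}\cup\Delta_S$. **Partial rectangular bands.** Given non-empty sets $X_A,Y_A$ ($A\in\mathscr C$), the $X_A$ pairwise disjoint and the $Y_A$ pairwise disjoint, the partial rectangular band is $\bigcup_{A,B}X_A\times Y_B$ with $\mathbf d(x,y)=A$, $\mathbf r(x,y)=B$ for $x\in X_A,y\in Y_B$, and $(x_1,y_1)(x_2,y_2)=(x_1,y_2)$ when $\mathbf r(x_1,y_1)=\mathbf d(x_2,y_2)$. For tuples $\mathcal E_1=(\varepsilon^A_1)_A$, $\mathcal E_2=(\varepsilon_2^A)_A$ with $\varepsilon_1^A\in\mathfrak{Eq}(X_A)$, $\varepsilon_2^A\in\mathfrak{Eq}(Y_A)$, $\sigma_{\mathcal E_1,\mathcal E_2}$ relates $(x_1,y_1)$, $(x_2,y_2)$ iff both lie in a common $X_A\times Y_B$ and $(x_1,x_2)\in\varepsilon_1^A$, $(y_1,y_2)\in\varepsilon_2^B$. Isomorphisms preserve $\mathbf d$, $\mathbf r$. *)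

theory Defs
  imports "HOL-Algebra.Sym_Groups" "HOL-Algebra.Lattice" "HOL-Library.Extended_Nat"
    "HOL-Library.Disjoint_Sets" "HOL-Library.FuncSet"
begin

section \<open>Partial semigroups\<close>

text \<open>Products are written in diagram order: \<open>x \<odot> y\<close> is meaningful exactly when
  \<open>pran x = pdom y\<close>; the values of \<open>pmult\<close> at other arguments are irrelevant.\<close>

record ('m, 'o) psemigroup = "'m partial_object" +
  pdom :: "'m \<Rightarrow> 'o"
  pran :: "'m \<Rightarrow> 'o"
  pmult :: "'m \<Rightarrow> 'm \<Rightarrow> 'm"  (infixl \<open>\<odot>\<index>\<close> 70)

definition psg_sim :: "('m, 'o, 'z) psemigroup_scheme \<Rightarrow> 'm rel" where
  "psg_sim S = {(x, y). x \<in> carrier S \<and> y \<in> carrier S \<and>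
                        pdom S x = pdom S y \<and> pran S x = pran S y}"

definition psg_iso ::
  "('m \<Rightarrow> 'n) \<Rightarrow> ('m, 'o, 'y) psemigroup_scheme \<Rightarrow> ('n, 'o, 'z) psemigroup_scheme \<Rightarrow> bool" where
  "psg_iso \<phi> S T \<longleftrightarrow>
     bij_betw \<phi> (carrier S) (carrier T) \<and>
     (\<forall>x\<in>carrier S. pdom T (\<phi> x) = pdom S x \<and> pran T (\<phi> x) = pran S x) \<and>
     (\<forall>x\<in>carrier S. \<forall>y\<in>carrier S. pran S x = pdom S y \<longrightarrow>
        \<phi> (x \<odot>\<^bsub>S\<^esub> y) = \<phi> x \<odot>\<^bsub>T\<^esub> \<phi> y)"

definition psg_ideal :: "('m, 'o, 'z) psemigroup_scheme \<Rightarrow> 'm set \<Rightarrow> bool" where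
  "psg_ideal S I \<longleftrightarrow> I \<noteq> {} \<and> I \<subseteq> carrier S \<and>
     (\<forall>x\<in>I. \<forall>s\<in>carrier S.
        (pran S s = pdom S x \<longrightarrow> s \<odot>\<^bsub>S\<^esub> x \<in> I) \<and>
        (pran S x = pdom S s \<longrightarrow> x \<odot>\<^bsub>S\<^esub> s \<in> I))"

definition Cong :: "('m, 'o, 'z) psemigroup_scheme \<Rightarrow> 'm rel set" where
  "Cong S = {\<sigma>. equiv (carrier S) \<sigma> \<and> \<sigma> \<subseteq> psg_sim S \<and>
     (\<forall>(x, y)\<in>\<sigma>. \<forall>s\<in>carrier S.
        (pran S s = pdom S x \<longrightarrow> (s \<odot>\<^bsub>S\<^esub> x, s \<odot>\<^bsub>S\<^esub> y) \<in> \<sigma>) \<and>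
        (pran S x = pdom S s \<longrightarrow> (x \<odot>\<^bsub>S\<^esub> s, y \<odot>\<^bsub>S\<^esub> s) \<in> \<sigma>))}"

subsection \<open>Green's relations\<close>

text \<open>An element of \<open>S\<^sup>1\<close> is encoded as an option: \<open>None\<close> acts as the identity at whichever
  object is required.  If \<open>S\<close> already has an identity there, \<open>None\<close> acts like it, so
  the sets below are the same as when identities are adjoined only where needed.\<close>

definition lcomp1 :: "('m, 'o, 'z) psemigroup_scheme \<Rightarrow> 'm option \<Rightarrow> 'm \<Rightarrow> bool" where
  "lcomp1 S a x \<longleftrightarrow> (case a of None \<Rightarrow> True | Some s \<Rightarrow> s \<in> carrier S \<and> pran S s = pdom S x)"

definition rcomp1 :: "('m, 'o, 'z) psemigroup_scheme \<Rightarrow> 'm \<Rightarrow> 'm option \<Rightarrow> bool" where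
  "rcomp1 S x b \<longleftrightarrow> (case b of None \<Rightarrow> True | Some s \<Rightarrow> s \<in> carrier S \<and> pran S x = pdom S s)"

definition lmult1 :: "('m, 'o, 'z) psemigroup_scheme \<Rightarrow> 'm option \<Rightarrow> 'm \<Rightarrow> 'm" where
  "lmult1 S a x = (case a of None \<Rightarrow> x | Some s \<Rightarrow> s \<odot>\<^bsub>S\<^esub> x)"

definition rmult1 :: "('m, 'o, 'z) psemigroup_scheme \<Rightarrow> 'm \<Rightarrow> 'm option \<Rightarrow> 'm" where
  "rmult1 S x b = (case b of None \<Rightarrow> x | Some s \<Rightarrow> x \<odot>\<^bsub>S\<^esub> s)"

definition green_R :: "('m, 'o, 'z) psemigroup_scheme \<Rightarrow> 'm rel" where
  "green_R S = {(x, y). x \<in> carrier S \<and> y \<in> carrier S \<and>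
     {rmult1 S x b |b. rcomp1 S x b} = {rmult1 S y b |b. rcomp1 S y b}}"

definition green_L :: "('m, 'o, 'z) psemigroup_scheme \<Rightarrow> 'm rel" where
  "green_L S = {(x, y). x \<in> carrier S \<and> y \<in> carrier S \<and>
     {lmult1 S a x |a. lcomp1 S a x} = {lmult1 S a y |a. lcomp1 S a y}}"

definition green_J :: "('m, 'o, 'z) psemigroup_scheme \<Rightarrow> 'm rel" where
  "green_J S = {(x, y). x \<in> carrier S \<and> y \<in> carrier S \<and>
     {lmult1 S a (rmult1 S x b) |a b. lcomp1 S a x \<and> rcomp1 S x b} =
     {lmult1 S a (rmult1 S y b) |a b. lcomp1 S a y \<and> rcomp1 S y b}}"

subsection \<open>Special congruences\<close>

definition Delta :: "('m, 'o, 'z) psemigroup_scheme \<Rightarrow> 'm rel" where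
  "Delta S = Id_on (carrier S)"

definition Nabla :: "('m, 'o, 'z) psemigroup_scheme \<Rightarrow> 'm rel" where
  "Nabla S = psg_sim S"

definition R_cong :: "('m, 'o, 'z) psemigroup_scheme \<Rightarrow> 'm set \<Rightarrow> 'm rel" where
  "R_cong S I = (psg_sim S \<inter> I \<times> I) \<union> Delta S"

text \<open>Here \<open>N\<close> is meant to be a normal subgroup of a group \<open>H\<close>-class inside a \<open>J\<close>-class \<open>D\<close>;
  \<open>D\<close> is recovered from \<open>N\<close> as the set of all elements \<open>J\<close>-related to an element of \<open>N\<close>.\<close>

definition J_class_of :: "('m, 'o, 'z) psemigroup_scheme \<Rightarrow> 'm set \<Rightarrow> 'm set" where
  "J_class_of S N = green_J S `` N"

definition nu :: "('m, 'o, 'z) psemigroup_scheme \<Rightarrow> 'm set \<Rightarrow> 'm rel" where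
  "nu S N = {(lmult1 S a (rmult1 S x b), lmult1 S a (rmult1 S y b)) |a b x y.
     x \<in> N \<and> y \<in> N \<and>
     lcomp1 S a x \<and> rcomp1 S x b \<and> lcomp1 S a y \<and> rcomp1 S y b \<and>
     lmult1 S a (rmult1 S x b) \<in> J_class_of S N \<and>
     lmult1 S a (rmult1 S y b) \<in> J_class_of S N}"

definition RN_cong :: "('m, 'o, 'z) psemigroup_scheme \<Rightarrow> 'm set \<Rightarrow> 'm set \<Rightarrow> 'm rel" where
  "RN_cong S I N = R_cong S I \<union> nu S N"

definition lambda_cong :: "('m, 'o, 'z) psemigroup_scheme \<Rightarrow> 'm set \<Rightarrow> 'm rel" where
  "lambda_cong S M = (psg_sim S \<inter> green_L S \<inter> M \<times> M) \<union> Delta S"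

definition rho_cong :: "('m, 'o, 'z) psemigroup_scheme \<Rightarrow> 'm set \<Rightarrow> 'm rel" where
  "rho_cong S M = (psg_sim S \<inter> green_R S \<inter> M \<times> M) \<union> Delta S"

section \<open>Lattices\<close>

definition set_lattice :: "'b set set \<Rightarrow> 'b set gorder" where
  "set_lattice F = \<lparr>carrier = F, eq = (=), le = (\<subseteq>)\<rparr>"

definition EqLat :: "'b set \<Rightarrow> 'b rel gorder" where
  "EqLat Z = set_lattice {\<epsilon>. equiv Z \<epsilon>}"

definition CongLat :: "('m, 'o, 'z) psemigroup_scheme \<Rightarrow> 'm rel gorder" where
  "CongLat S = set_lattice (Cong S)"

definition PiLat :: "'i set \<Rightarrow> ('i \<Rightarrow> 'b gorder) \<Rightarrow> ('i \<Rightarrow> 'b) gorder" where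
  "PiLat J L = \<lparr>carrier = (\<Pi>\<^sub>E j\<in>J. carrier (L j)), eq = (=),
               le = (\<lambda>f g. \<forall>j\<in>J. f j \<sqsubseteq>\<^bsub>L j\<^esub> g j)\<rparr>"

definition ProdLat :: "'b gorder \<Rightarrow> 'c gorder \<Rightarrow> ('b \<times> 'c) gorder" where
  "ProdLat L K = \<lparr>carrier = carrier L \<times> carrier K, eq = (=),
                 le = (\<lambda>(a, b) (a', b'). a \<sqsubseteq>\<^bsub>L\<^esub> a' \<and> b \<sqsubseteq>\<^bsub>K\<^esub> b')\<rparr>"

definition lattice_isomorphic :: "'b gorder \<Rightarrow> 'c gorder \<Rightarrow> bool" where
  "lattice_isomorphic L K \<longleftrightarrow> lattice L \<and> lattice K \<and>
     (\<exists>f. bij_betw f (carrier L) (carrier K) \<and>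
        (\<forall>x\<in>carrier L. \<forall>y\<in>carrier L.
           f (x \<squnion>\<^bsub>L\<^esub> y) = f x \<squnion>\<^bsub>K\<^esub> f y \<and> f (x \<sqinter>\<^bsub>L\<^esub> y) = f x \<sqinter>\<^bsub>K\<^esub> f y))"

section \<open>Partial rectangular bands\<close>

definition band_family :: "'o set \<Rightarrow> ('o \<Rightarrow> 'x set) \<Rightarrow> bool" where
  "band_family \<C> X \<longleftrightarrow> (\<forall>A\<in>\<C>. X A \<noteq> {}) \<and> disjoint_family_on X \<C>"

definition prband :: "'o set \<Rightarrow> ('o \<Rightarrow> 'x set) \<Rightarrow> ('o \<Rightarrow> 'y set) \<Rightarrow> ('x \<times> 'y, 'o) psemigroup" where
  "prband \<C> X Y =
     \<lparr>carrier = (\<Union>A\<in>\<C>. \<Union>B\<in>\<C>. X A \<times> Y B),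
      pdom = (\<lambda>(x, y). THE A. A \<in> \<C> \<and> x \<in> X A),
      pran = (\<lambda>(x, y). THE B. B \<in> \<C> \<and> y \<in> Y B),
      pmult = (\<lambda>(x1, y1) (x2, y2). (x1, y2))\<rparr>"

definition band_sigma :: "'o set \<Rightarrow> ('o \<Rightarrow> 'x set) \<Rightarrow> ('o \<Rightarrow> 'y set) \<Rightarrow>
    ('o \<Rightarrow> 'x rel) \<Rightarrow> ('o \<Rightarrow> 'y rel) \<Rightarrow> ('x \<times> 'y) rel" where
  "band_sigma \<C> X Y E1 E2 = {((x1, y1), (x2, y2)). \<exists>A\<in>\<C>. \<exists>B\<in>\<C>.
     x1 \<in> X A \<and> x2 \<in> X A \<and> y1 \<in> Y B \<and> y2 \<in> Y B \<and> (x1, x2) \<in> E1 A \<and> (y1, y2) \<in> E2 B}"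

section \<open>The Brauer category\<close>

text \<open>\<open>Unpr a\<close>, \<open>Pr a\<close> and \<open>DPr a\<close> are the copies \<open>a\<close>, \<open>a'\<close> and \<open>a''\<close> of \<open>a\<close>.\<close>

datatype 'a vertex = Unpr 'a | Pr 'a | DPr 'a

type_synonym 'a diagram = "'a vertex set set"

definition brauer_hom :: "'a set \<Rightarrow> 'a set \<Rightarrow> 'a diagram set" where
  "brauer_hom A B = {\<alpha>. partition_on (Unpr ` A \<union> Pr ` B) \<alpha> \<and> (\<forall>P\<in>\<alpha>. card P = 2)}"

definition bdom :: "'a diagram \<Rightarrow> 'a set" where
  "bdom \<alpha> = {a. Unpr a \<in> \<Union>\<alpha>}"

definition bran :: "'a diagram \<Rightarrow> 'a set" where
  "bran \<alpha> = {b. Pr b \<in> \<Union>\<alpha>}"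

definition eqv_of :: "'b set set \<Rightarrow> 'b rel" where
  "eqv_of P = {(u, v). \<exists>Q\<in>P. u \<in> Q \<and> v \<in> Q}"

fun pr_to_dpr :: "'a vertex \<Rightarrow> 'a vertex" where
  "pr_to_dpr (Pr b) = DPr b"
| "pr_to_dpr u = u"

fun unpr_to_dpr :: "'a vertex \<Rightarrow> 'a vertex" where
  "unpr_to_dpr (Unpr b) = DPr b"
| "unpr_to_dpr u = u"

text \<open>The union of the two renamed equivalences is reflexive on \<open>A \<union> B'' \<union> C'\<close> and symmetric,
  so its transitive closure is the join in the lattice of equivalences on that set.\<close>

definition brauer_mult :: "'a diagram \<Rightarrow> 'a diagram \<Rightarrow> 'a diagram" where
  "brauer_mult \<alpha> \<beta> =
     (let J = (eqv_of ((`) pr_to_dpr ` \<alpha>) \<union> eqv_of ((`) unpr_to_dpr ` \<beta>))\<^sup>+;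
          V = Unpr ` bdom \<alpha> \<union> Pr ` bran \<beta>
      in V // (J \<inter> V \<times> V))"

definition brauer :: "'a set set \<Rightarrow> ('a diagram, 'a set) psemigroup" where
  "brauer \<C> = \<lparr>carrier = (\<Union>A\<in>\<C>. \<Union>B\<in>\<C>. brauer_hom A B),
              pdom = bdom, pran = bran, pmult = brauer_mult\<rparr>"

definition brank :: "'a diagram \<Rightarrow> nat" where
  "brank \<alpha> = card {P \<in> \<alpha>. P \<inter> range Unpr \<noteq> {} \<and> P \<inter> range Pr \<noteq> {}}"

text \<open>Since all members of \<open>\<C>\<close> are finite, the cardinal \<open>\<xi>\<close> is at most \<open>\<omega>\<close>, represented by
  \<open>\<infinity>\<close>.\<close>

definition xi :: "'a set set \<Rightarrow> enat" where
  "xi \<C> = (LEAST k. \<forall>A\<in>\<C>. enat (card A) < k)"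

definition brauer_ideal :: "'a set set \<Rightarrow> enat \<Rightarrow> 'a diagram set" where
  "brauer_ideal \<C> r = {\<alpha> \<in> carrier (brauer \<C>). enat (brank \<alpha>) \<le> r}"

definition brauer_I :: "'a set set \<Rightarrow> enat \<Rightarrow> ('a diagram, 'a set) psemigroup" where
  "brauer_I \<C> r = (brauer \<C>)\<lparr>carrier := brauer_ideal \<C> r\<rparr>"

definition Eq2 :: "'a set \<Rightarrow> 'a rel set" where
  "Eq2 A = {\<epsilon>. equiv A \<epsilon> \<and> (\<exists>!c. c \<in> A // \<epsilon> \<and> card c = 1) \<and>
               (\<forall>c\<in>A // \<epsilon>. card c = 1 \<or> card c = 2)}"

text \<open>The element \<open>\<pi>\<^sup>\<natural>\<close> over a set enumerated as \<open>x 1, \<dots>, x n\<close>, for \<open>\<pi>\<close> a permutation of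
  \<open>{1..q}\<close>.  Multiplication in \<^const>\<open>sym_group\<close> is ordinary (right-to-left) composition, so
  this map is an anti-homomorphism; the sets \<open>N\<^sup>\<natural>\<close> for normal subgroups \<open>N\<close> do not depend on
  the direction of composition.\<close>

definition natural :: "(nat \<Rightarrow> 'a) \<Rightarrow> nat \<Rightarrow> nat \<Rightarrow> (nat \<Rightarrow> nat) \<Rightarrow> 'a diagram" where
  "natural x n q \<pi> =
     {{Unpr (x i), Pr (x (\<pi> i))} |i. 1 \<le> i \<and> i \<le> q} \<union>
     {{Unpr (x (q + 2*j + 1)), Unpr (x (q + 2*j + 2))} |j. q + 2*j + 2 \<le> n} \<union>
     {{Pr (x (q + 2*j + 1)), Pr (x (q + 2*j + 2))} |j. q + 2*j + 2 \<le> n}"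

end

theory Submission
  imports Defs
begin

text \<open>
  A diagram consists of a matching of upper points, a matching of lower points, and a bijection
  between the remaining points.  Counting the edges of a component of the joined graph shows that a
  product is again a perfect matching; hence any perfect matching all of whose blocks are joined by
  paths is the product, and products are computed by exhibiting paths.

  Inside the minimal ideal (rank 1) a diagram is a pair of near-perfect matchings, which gives the
  rectangular band.  Now let a congruence on \<open>I\<^sub>r\<close>, \<open>r \<ge> 3\<close>, be given.  A related pair of rank 1
  with different upper matchings can be multiplied by diagrams of rank 3 to produce all elementary
  moves between near-perfect matchings, and these moves connect all near-perfect matchings; hence the
  congruence contains \<open>\<lambda>\<close>, and dually \<open>\<rho>\<close>.  A related pair of larger rank \<open>q\<close> either consists of
  \<open>H\<close>-related diagrams, and then restricting the through strands gives a pair of rank \<open>q - 2\<close> that is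
  not \<open>H\<close>-related, or it can be multiplied to a pair of diagrams of ranks \<open>q\<close> and less than \<open>q\<close>; in
  the latter case every diagram of rank at most \<open>q\<close> descends to rank 1 and the congruence collapses
  \<open>I\<^sub>q\<close>.  So only the pairs inside one \<open>H\<close>-class of the first uncollapsed rank remain, and these
  are governed by a normal subgroup of a symmetric group of odd degree.
\<close>


section \<open>Matchings\<close>

text \<open>Oddness of the objects works twice. Ranks are odd, so no product falls below rank 1 and
  the rank next above \<open>q\<close> is \<open>q + 2\<close>. The degrees of the groups are odd as
  well, so degree 4 with its Klein four-group never occurs and the normal subgroups form chains.
  Paths in a product can be arbitrarily long. Multipliers are therefore tailored to one member of a
  related pair, so that only paths with at most one detour through the middle have to be followed,
  while the other member betrays itself by a single block. Associativity, where no such choice is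
  possible, is obtained without paths. A pair of rank 1 may show a difference on one side only,
  which is how \<lambda> and \<rho> survive. A pair of distinct diagrams that reaches above rank 1
  produces differences on both sides, one of them after reflection. The bound
  \<open>r \<ge> 3\<close> enters as the rank of the multipliers that realise elementary
  moves.\<close>

definition matching :: "'b set \<Rightarrow> 'b set set \<Rightarrow> bool" where
  "matching Z M \<longleftrightarrow> disjoint M \<and> \<Union>M \<subseteq> Z \<and> (\<forall>P\<in>M. card P = 2)"

lemma matching_pairE:
  assumes "matching Z M" "P \<in> M"
  obtains u v where "u \<noteq> v" "P = {u, v}"
  using assms unfolding matching_def by (metis card_2_iff)

lemma matching_block_eq:
  "matching Z M \<Longrightarrow> P \<in> M \<Longrightarrow> Q \<in> M \<Longrightarrow> u \<in> P \<Longrightarrow> u \<in> Q \<Longrightarrow> P = Q"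
  unfolding matching_def disjoint_def by blast

lemma matching_irrefl: "matching Z M \<Longrightarrow> {u, u} \<notin> M"
  unfolding matching_def by auto

lemma matching_unique:
  assumes "matching Z M" "{u, v} \<in> M" "{u, w} \<in> M"
  shows "v = w"
proof -
  have "{u, v} = {u, w}"
    using matching_block_eq[OF assms, of u] by simp
  then show ?thesis
    by (metis doubleton_eq_iff)
qed

lemma matching_partnerE:
  assumes "matching Z M" "u \<in> \<Union>M"
  obtains v where "v \<noteq> u" "{u, v} \<in> M" "v \<in> \<Union>M" "v \<in> Z"
proof -
  obtain P where P: "P \<in> M" "u \<in> P"
    using assms(2) by blast
  obtain a b where ab: "a \<noteq> b" "P = {a, b}"
    using matching_pairE[OF assms(1) P(1)] .
  define v where "v = (if u = a then b else a)"
  have "v \<noteq> u" "{u, v} \<in> M"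
    using ab P unfolding v_def by (auto simp: insert_commute)
  moreover have "v \<in> \<Union>M" "v \<in> Z"
    using \<open>{u, v} \<in> M\<close> assms(1) unfolding matching_def by blast+
  ultimately show ?thesis using that by blast
qed

lemma matching_finite: "finite Z \<Longrightarrow> matching Z M \<Longrightarrow> finite M"
  unfolding matching_def by (meson finite_UnionD finite_subset)

lemma card_Union_pairs:
  assumes "disjoint M" "\<forall>P\<in>M. card P = 2"
  shows "card (\<Union>M) = 2 * card M"
proof -
  have "card (\<Union>M) = sum card M"
  proof (rule card_Union_disjoint)
    show "pairwise disjnt M" using assms(1) .
    show "finite P" if "P \<in> M" for P
      using assms(2) that by (metis card.infinite zero_neq_numeral)
  qed
  then show ?thesis using assms(2) by simp
qed

lemma matching_card: "matching Z M \<Longrightarrow> card (\<Union>M) = 2 * card M"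
  unfolding matching_def using card_Union_pairs by blast

lemma matching_mono: "matching Z M \<Longrightarrow> Z \<subseteq> Z' \<Longrightarrow> matching Z' M"
  unfolding matching_def by blast

lemma matching_empty [simp]: "matching Z {}"
  by (simp add: matching_def)

lemma matching_insert:
  assumes "matching Z M" "u \<in> Z" "v \<in> Z" "u \<notin> \<Union>M" "v \<notin> \<Union>M" "u \<noteq> v"
  shows "matching Z (insert {u, v} M)"
proof -
  have "disjoint (insert {u, v} M)"
  proof (rule disjointI)
    fix P Q assume "P \<in> insert {u, v} M" "Q \<in> insert {u, v} M" "P \<noteq> Q"
    then show "P \<inter> Q = {}"
      using assms(1,4,5) unfolding matching_def disjoint_def by (elim insertE) blast+
  qed
  then show ?thesis
    using assms unfolding matching_def by simp
qed

lemma matching_Un: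
  assumes "matching Z M" "matching Z N" "\<Union>M \<inter> \<Union>N = {}"
  shows "matching Z (M \<union> N)"
proof -
  have "disjoint (M \<union> N)"
  proof (rule disjointI)
    fix P Q assume PQ: "P \<in> M \<union> N" "Q \<in> M \<union> N" "P \<noteq> Q"
    have "disjoint M" "disjoint N"
      using assms unfolding matching_def by auto
    moreover have "P \<inter> Q = {}" if "P \<in> M" "Q \<in> N" for P Q
      using that assms(3) by blast
    ultimately show "P \<inter> Q = {}"
      using PQ by (metis UnE Int_commute disjointD)
  qed
  then show ?thesis
    using assms unfolding matching_def by auto
qed

lemma matching_image:
  assumes "matching Z M" "inj_on g Z"
  shows "matching (g ` Z) ((`) g ` M)"
  unfolding matching_def
proof (intro conjI ballI)
  have sub: "P \<subseteq> Z" if "P \<in> M" for P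
    using that assms(1) unfolding matching_def by blast
  show "disjoint ((`) g ` M)"
  proof (rule disjointI)
    fix P Q assume "P \<in> (`) g ` M" "Q \<in> (`) g ` M" "P \<noteq> Q"
    then obtain P' Q' where "P = g ` P'" "Q = g ` Q'" "P' \<in> M" "Q' \<in> M" "P' \<noteq> Q'"
      by blast
    moreover from this have "P' \<inter> Q' = {}"
      using assms(1) unfolding matching_def disjoint_def by blast
    ultimately show "P \<inter> Q = {}"
      using inj_on_image_Int[OF assms(2), of P' Q'] sub by auto
  qed
  show "\<Union> ((`) g ` M) \<subseteq> g ` Z"
    using sub by blast
  fix P assume "P \<in> (`) g ` M"
  then obtain Q where Q: "Q \<in> M" "P = g ` Q" by blast
  then have "card P = card Q"
    using card_image inj_on_subset[OF assms(2) sub[OF Q(1)]] by blast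
  then show "card P = 2"
    using Q(1) assms(1) unfolding matching_def by simp
qed

text \<open>A block of \<open>N\<close> shares a point with some block of \<open>M\<close>, which is
  itself a block of \<open>N\<close>, so the two coincide. Equality of diagrams thus reduces to one
  inclusion of block sets.\<close>

lemma perfect_subset_eq:
  assumes "matching Z M" "matching Z N" "M \<subseteq> N" "\<Union>N \<subseteq> \<Union>M"
  shows "M = N"
proof -
  have "P \<in> M" if P: "P \<in> N" for P
  proof -
    obtain u v where "u \<noteq> v" "P = {u, v}"
      using matching_pairE[OF assms(2) P] .
    then have "u \<in> \<Union>M" using P assms(4) by blast
    then obtain Q where "Q \<in> M" "u \<in> Q" by blast
    then have "Q = P"
      using matching_block_eq[OF assms(2)] P \<open>P = {u, v}\<close> assms(3) by blast
    then show ?thesis using \<open>Q \<in> M\<close> by simp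
  qed
  then show ?thesis using assms(3) by blast
qed

lemma even_perfect_matching_exists:
  assumes "finite Z" "even (card Z)"
  shows "\<exists>M. matching Z M \<and> \<Union>M = Z"
  using assms
proof (induction "card Z" arbitrary: Z rule: less_induct)
  case less
  show ?case
  proof (cases "Z = {}")
    case False
    then obtain u where u: "u \<in> Z" by blast
    have "card (Z - {u}) = card Z - 1" using u less.prems by simp
    moreover have "card Z \<ge> 2"
      using False less.prems by (metis card_eq_0_iff dvd_imp_le neq0_conv)
    ultimately have "Z - {u} \<noteq> {}" using card.empty by force
    then obtain v where v: "v \<in> Z" "v \<noteq> u" by blast
    have "card (Z - {u, v}) = card Z - 2"
      using u v less.prems by (simp add: card_Diff_subset)
    then obtain M where M: "matching (Z - {u, v}) M" "\<Union>M = Z - {u, v}"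
      using less.hyps[of "Z - {u, v}"] less.prems \<open>card Z \<ge> 2\<close> by auto
    have "matching Z (insert {u, v} M)"
      using matching_insert[of Z M u v] matching_mono[OF M(1), of Z] M(2) u v by blast
    moreover have "\<Union>(insert {u, v} M) = Z" using M u v by auto
    ultimately show ?thesis by blast
  qed (auto intro: exI[of _ "{}"])
qed

text \<open>The last premise says that the graph with edge set \<open>E\<close> is connected on \<open>K\<close>.\<close>

lemma connected_edge_bound:
  assumes K: "finite K" "v \<in> K" and E: "finite E"
    and grow: "\<And>X. v \<in> X \<Longrightarrow> X \<subset> K \<Longrightarrow> \<exists>P\<in>E. \<exists>a b. P = {a, b} \<and> a \<in> X \<and> b \<in> K - X"
  shows "card K \<le> card E + 1"
proof -
  \<comment> \<open>Grow \<open>X\<close> from \<open>{v}\<close> one vertex at a time. The edge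
    that reaches the new vertex is not contained in the old set, so every vertex after the first
    brings an edge of its own.\<close>
  have "\<exists>X. v \<in> X \<and> X \<subseteq> K \<and> card X = Suc k \<and> k \<le> card {P \<in> E. P \<subseteq> X}"
    if "Suc k \<le> card K" for k
    using that
  proof (induction k)
    case 0
    show ?case using K by (intro exI[of _ "{v}"]) auto
  next
    case (Suc k)
    then obtain X where X: "v \<in> X" "X \<subseteq> K" "card X = Suc k" "k \<le> card {P \<in> E. P \<subseteq> X}"
      by auto
    then have "X \<subset> K" using Suc.prems by auto
    then obtain P a b where P: "P \<in> E" "P = {a, b}" "a \<in> X" "b \<in> K - X"
      using grow[OF X(1)] by auto
    have "insert P {P \<in> E. P \<subseteq> X} \<subseteq> {P \<in> E. P \<subseteq> insert b X}"
      using P by auto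
    then have "card (insert P {P \<in> E. P \<subseteq> X}) \<le> card {P \<in> E. P \<subseteq> insert b X}"
      using E by (intro card_mono) auto
    moreover have "card (insert P {P \<in> E. P \<subseteq> X}) = Suc (card {P \<in> E. P \<subseteq> X})"
      using P E by (intro card_insert_disjoint) auto
    moreover have "card (insert b X) = Suc (Suc k)"
      using X P K finite_subset[OF X(2) K(1)] by simp
    ultimately show ?case
      using X P by (intro exI[of _ "insert b X"]) auto
  qed
  moreover have "Suc (card K - 1) = card K"
    using K by (metis Suc_diff_1 card_gt_0_iff empty_iff)
  ultimately obtain X where "card K - 1 \<le> card {P \<in> E. P \<subseteq> X}" by force
  also have "\<dots> \<le> card E" using E by (intro card_mono) auto
  finally show ?thesis by simp
qed

lemma eqv_of_iff: "(u, v) \<in> eqv_of M \<longleftrightarrow> (\<exists>Q\<in>M. u \<in> Q \<and> v \<in> Q)"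
  by (simp add: eqv_of_def)

lemma sym_eqv_of: "sym (eqv_of M)"
  by (auto simp: sym_def eqv_of_def)

lemma sym_join: "sym ((eqv_of M \<union> eqv_of N)\<^sup>+)"
  by (intro sym_trancl sym_Un sym_eqv_of)

text \<open>The component \<open>K\<close> is counted instead of traced. Each matching covers its
  side of \<open>K\<close> with two points per edge, which makes the number of outer points even.
  Connectedness allows at most one vertex more than edges, which pushes that number down to 2, and
  \<open>v\<close> itself rules out 0.\<close>

lemma join_component_card:
  assumes M: "matching Y M" "\<Union>M = Y" and N: "matching Z N" "\<Union>N = Z"
    and fin: "finite Y" "finite Z"
    and v: "v \<in> (Y - Z) \<union> (Z - Y)"
  shows "card ((eqv_of M \<union> eqv_of N)\<^sup>+ `` {v} \<inter> ((Y - Z) \<union> (Z - Y))) = 2"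
proof -
  define J where "J = (eqv_of M \<union> eqv_of N)\<^sup>+"
  define K where "K = J `` {v}"
  define V where "V = (Y - Z) \<union> (Z - Y)"
  have "eqv_of M \<union> eqv_of N \<subseteq> (Y \<union> Z) \<times> (Y \<union> Z)"
    using M(2) N(2) by (auto simp: eqv_of_def)
  then have JYZ: "J \<subseteq> (Y \<union> Z) \<times> (Y \<union> Z)"
    unfolding J_def by (rule trancl_subset_Sigma)
  have "trans J" unfolding J_def by simp
  have KYZ: "K \<subseteq> Y \<union> Z" using JYZ unfolding K_def by blast
  then have finK: "finite K" using fin by (meson finite_Un finite_subset)
  have "(v, v) \<in> J"
    using v M(2) N(2) unfolding J_def by (force simp: eqv_of_iff)
  then have vK: "v \<in> K" by (simp add: K_def)
  have closed: "b \<in> K" if "a \<in> K" "a \<in> P" "b \<in> P" "P \<in> M \<union> N" for a b P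
  proof -
    have "(a, b) \<in> J" unfolding J_def by (rule r_into_trancl) (use that in \<open>auto simp: eqv_of_iff\<close>)
    then show ?thesis using that(1) \<open>trans J\<close> unfolding K_def by (auto dest: transD)
  qed
  \<comment> \<open>A block that meets the component lies inside it, so the points of
    \<open>K\<close> covered by \<open>L\<close> are counted by whole blocks.\<close>
  have half: "card (K \<inter> W) = 2 * card {P \<in> L. P \<subseteq> K}"
    if L: "matching W L" "\<Union>L = W" "L \<subseteq> M \<union> N" for W L
  proof -
    have "K \<inter> W = \<Union>{P \<in> L. P \<subseteq> K}"
    proof
      show "K \<inter> W \<subseteq> \<Union>{P \<in> L. P \<subseteq> K}"
      proof
        fix w assume w: "w \<in> K \<inter> W"
        then obtain P where P: "P \<in> L" "w \<in> P" using L(2) by blast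
        then have "P \<subseteq> K" using closed[of w P] w L(3) by blast
        then show "w \<in> \<Union>{P \<in> L. P \<subseteq> K}" using P by blast
      qed
    qed (use L(2) in blast)
    moreover have "disjoint {P \<in> L. P \<subseteq> K}" "\<forall>P\<in>{P \<in> L. P \<subseteq> K}. card P = 2"
      using L(1) unfolding matching_def disjoint_def by auto
    ultimately show ?thesis using card_Union_pairs by metis
  qed
  define EM where "EM = {P \<in> M. P \<subseteq> K}"
  define EN where "EN = {P \<in> N. P \<subseteq> K}"
  have finE: "finite (EM \<union> EN)"
    using matching_finite[OF fin(1) M(1)] matching_finite[OF fin(2) N(1)]
    unfolding EM_def EN_def by simp
  have "card K \<le> card (EM \<union> EN) + 1"
  proof (rule connected_edge_bound[OF finK vK finE])
    fix X assume X: "v \<in> X" "X \<subset> K"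
    then obtain w where w: "w \<in> K" "w \<notin> X" by blast
    then have "(v, w) \<in> J" by (simp add: K_def)
    then have "(v, w) \<in> (eqv_of M \<union> eqv_of N)\<^sup>*" unfolding J_def by (rule trancl_into_rtrancl)
    \<comment> \<open>A path from \<open>v\<close> to \<open>w\<close> has to leave \<open>X\<close>
      at some step, and that step stays within one block of \<open>M\<close> or
      \<open>N\<close>.\<close>
    then have "\<exists>a b. a \<in> X \<and> b \<notin> X \<and> (a, b) \<in> eqv_of M \<union> eqv_of N"
      using w(2) X(1)
    proof (induction rule: converse_rtrancl_induct)
      case (step y z)
      then show ?case by (cases "z \<in> X") auto
    qed auto
    then obtain a b P where P: "a \<in> X" "b \<notin> X" "P \<in> M \<union> N" "a \<in> P" "b \<in> P"
      by (auto simp: eqv_of_iff)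
    then have bK: "b \<in> K" using closed[of a P b] X by blast
    have "P \<subseteq> K" using closed[of a P] P X by blast
    have "\<exists>c d. c \<noteq> d \<and> P = {c, d}"
      using P(3) M(1) N(1) matching_pairE by (metis UnE)
    then have "P = {a, b}" using P by auto
    then show "\<exists>P\<in>EM \<union> EN. \<exists>a b. P = {a, b} \<and> a \<in> X \<and> b \<in> K - X"
      using P bK \<open>P \<subseteq> K\<close> unfolding EM_def EN_def by blast
  qed
  also have "\<dots> \<le> card EM + card EN + 1"
    by (simp add: card_Un_le)
  finally have le: "card K \<le> card EM + card EN + 1" .
  have cY: "card (K \<inter> Y) = 2 * card EM" and cZ: "card (K \<inter> Z) = 2 * card EN"
    using half[OF M] half[OF N] unfolding EM_def EN_def by auto
  have "card (K \<inter> Y) = card (K \<inter> (Y - Z)) + card (K \<inter> Y \<inter> Z)"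
    using finK by (subst card_Un_disjoint[symmetric]) (auto intro: arg_cong[where f = card])
  moreover have "card (K \<inter> Z) = card (K \<inter> (Z - Y)) + card (K \<inter> Y \<inter> Z)"
    using finK by (subst card_Un_disjoint[symmetric]) (auto intro: arg_cong[where f = card])
  moreover have "card (K \<inter> V) = card (K \<inter> (Y - Z)) + card (K \<inter> (Z - Y))"
    using finK unfolding V_def by (subst card_Un_disjoint[symmetric]) (auto intro: arg_cong[where f = card])
  \<comment> \<open>Points in both \<open>Y\<close> and \<open>Z\<close> are counted twice, outer
    points once.\<close>
  ultimately have sum: "card (K \<inter> V) + 2 * card (K \<inter> Y \<inter> Z) = 2 * card EM + 2 * card EN"
    using cY cZ by linarith
  then have "even (card (K \<inter> V) + 2 * card (K \<inter> Y \<inter> Z))" by simp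
  then have even: "even (card (K \<inter> V))" by simp
  have "card K = card (K \<inter> V) + card (K \<inter> Y \<inter> Z)"
    using finK KYZ unfolding V_def by (subst card_Un_disjoint[symmetric]) (auto intro: arg_cong[where f = card])
  then have "card (K \<inter> V) \<le> 2"
    using sum le by linarith
  moreover have "card (K \<inter> V) > 0"
    using finK vK v by (auto simp: V_def card_gt_0_iff)
  ultimately have "card (K \<inter> V) = 2"
    using even by (meson dvd_imp_le le_antisym)
  then show ?thesis unfolding K_def J_def V_def .
qed

section \<open>Products of diagrams\<close>

lemma brauer_hom_iff:
  "\<alpha> \<in> brauer_hom A B \<longleftrightarrow>
     matching (Unpr ` A \<union> Pr ` B) \<alpha> \<and> \<Union>\<alpha> = Unpr ` A \<union> Pr ` B"
  unfolding brauer_hom_def matching_def partition_on_def by auto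

lemma brauer_hom_matching: "\<alpha> \<in> brauer_hom A B \<Longrightarrow> matching (Unpr ` A \<union> Pr ` B) \<alpha>"
  and brauer_hom_Union: "\<alpha> \<in> brauer_hom A B \<Longrightarrow> \<Union>\<alpha> = Unpr ` A \<union> Pr ` B"
  by (simp_all add: brauer_hom_iff)

lemma bdom_hom [simp]: "\<alpha> \<in> brauer_hom A B \<Longrightarrow> bdom \<alpha> = A"
  using brauer_hom_Union[of \<alpha> A B] unfolding bdom_def by auto

lemma bran_hom [simp]: "\<alpha> \<in> brauer_hom A B \<Longrightarrow> bran \<alpha> = B"
  using brauer_hom_Union[of \<alpha> A B] unfolding bran_def by auto

lemma brauer_hom_subset_eq:
  assumes "\<alpha> \<in> brauer_hom A B" "\<beta> \<in> brauer_hom A B" "\<alpha> \<subseteq> \<beta>"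
  shows "\<alpha> = \<beta>"
  by (rule perfect_subset_eq[OF brauer_hom_matching[OF assms(1)] brauer_hom_matching[OF assms(2)] assms(3)])
    (simp add: brauer_hom_Union[OF assms(1)] brauer_hom_Union[OF assms(2)])

definition joinrel :: "'a diagram \<Rightarrow> 'a diagram \<Rightarrow> 'a vertex rel" where
  "joinrel \<alpha> \<beta> = (eqv_of ((`) pr_to_dpr ` \<alpha>) \<union> eqv_of ((`) unpr_to_dpr ` \<beta>))\<^sup>+"

lemma sym_joinrel: "(u, v) \<in> joinrel \<alpha> \<beta> \<Longrightarrow> (v, u) \<in> joinrel \<alpha> \<beta>"
  unfolding joinrel_def using sym_join symD by metis

lemma trans_joinrel:
  "(u, v) \<in> joinrel \<alpha> \<beta> \<Longrightarrow> (v, w) \<in> joinrel \<alpha> \<beta> \<Longrightarrow> (u, w) \<in> joinrel \<alpha> \<beta>"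
  unfolding joinrel_def by (rule trancl_trans)

lemma joinrel_left:
  assumes "P \<in> \<alpha>" "u \<in> P" "v \<in> P"
  shows "(pr_to_dpr u, pr_to_dpr v) \<in> joinrel \<alpha> \<beta>"
proof -
  have "(pr_to_dpr u, pr_to_dpr v) \<in> eqv_of ((`) pr_to_dpr ` \<alpha>)"
    unfolding eqv_of_iff using assms by blast
  then show ?thesis unfolding joinrel_def by (intro r_into_trancl UnI1)
qed

lemma joinrel_right:
  assumes "P \<in> \<beta>" "u \<in> P" "v \<in> P"
  shows "(unpr_to_dpr u, unpr_to_dpr v) \<in> joinrel \<alpha> \<beta>"
proof -
  have "(unpr_to_dpr u, unpr_to_dpr v) \<in> eqv_of ((`) unpr_to_dpr ` \<beta>)"
    unfolding eqv_of_iff using assms by blast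
  then show ?thesis unfolding joinrel_def by (intro r_into_trancl UnI2)
qed

context
  fixes \<alpha> \<beta> :: "'a diagram" and A B C :: "'a set"
  assumes \<alpha>: "\<alpha> \<in> brauer_hom A B" and \<beta>: "\<beta> \<in> brauer_hom B C"
begin

lemma joinrel_refl:
  assumes "u \<in> Unpr ` A \<union> Pr ` C"
  shows "(u, u) \<in> joinrel \<alpha> \<beta>"
  using assms
proof
  assume u: "u \<in> Unpr ` A"
  then obtain P where P: "P \<in> \<alpha>" "u \<in> P"
    using brauer_hom_Union[OF \<alpha>] by blast
  have "pr_to_dpr u = u" using u by auto
  then show ?thesis using joinrel_left[OF P P(2), of \<beta>] by simp
next
  assume u: "u \<in> Pr ` C"
  then obtain P where P: "P \<in> \<beta>" "u \<in> P"
    using brauer_hom_Union[OF \<beta>] by blast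
  have "unpr_to_dpr u = u" using u by auto
  then show ?thesis using joinrel_right[OF P P(2), of \<alpha>] by simp
qed

lemma brauer_mult_eq:
  "brauer_mult \<alpha> \<beta> = (\<lambda>u. joinrel \<alpha> \<beta> `` {u} \<inter> (Unpr ` A \<union> Pr ` C)) ` (Unpr ` A \<union> Pr ` C)"
proof -
  define V where "V = Unpr ` A \<union> Pr ` C"
  have "brauer_mult \<alpha> \<beta> = V // (joinrel \<alpha> \<beta> \<inter> V \<times> V)"
    unfolding brauer_mult_def Let_def joinrel_def V_def
    by (simp only: bdom_hom[OF \<alpha>] bran_hom[OF \<beta>])
  also have "\<dots> = (\<lambda>u. joinrel \<alpha> \<beta> `` {u} \<inter> V) ` V"
    unfolding quotient_def by auto
  finally show ?thesis unfolding V_def .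
qed

lemma brauer_mult_hom:
  assumes fin: "finite A" "finite B" "finite C"
  shows "brauer_mult \<alpha> \<beta> \<in> brauer_hom A C"
proof -
  define V where "V = Unpr ` A \<union> Pr ` C"
  define M where "M = (`) pr_to_dpr ` \<alpha>"
  define N where "N = (`) unpr_to_dpr ` \<beta>"
  define Y where "Y = pr_to_dpr ` (Unpr ` A \<union> Pr ` B)"
  define Z where "Z = unpr_to_dpr ` (Unpr ` B \<union> Pr ` C)"
  have "inj_on pr_to_dpr (Unpr ` A \<union> Pr ` B)" "inj_on unpr_to_dpr (Unpr ` B \<union> Pr ` C)"
    by (auto simp: inj_on_def)
  then have M: "matching Y M" and N: "matching Z N"
    unfolding M_def Y_def N_def Z_def
    using matching_image[OF brauer_hom_matching[OF \<alpha>]] matching_image[OF brauer_hom_matching[OF \<beta>]]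
    by blast+
  have "\<Union>M = pr_to_dpr ` \<Union>\<alpha>" "\<Union>N = unpr_to_dpr ` \<Union>\<beta>"
    unfolding M_def N_def by blast+
  then have UM: "\<Union>M = Y" and UN: "\<Union>N = Z"
    unfolding Y_def Z_def brauer_hom_Union[OF \<alpha>] brauer_hom_Union[OF \<beta>] .
  have finYZ: "finite Y" "finite Z"
    unfolding Y_def Z_def using fin by simp_all
  \<comment> \<open>The renamings identify exactly the two copies of \<open>B\<close>, so the outer
    vertices are those covered by only one of the renamed diagrams.\<close>
  have V: "V = (Y - Z) \<union> (Z - Y)"
    unfolding V_def Y_def Z_def by (auto simp: image_Un image_image)
  have card: "card (joinrel \<alpha> \<beta> `` {u} \<inter> V) = 2" if "u \<in> V" for u
    using join_component_card[OF M UM N UN finYZ, of u] that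
    unfolding V joinrel_def M_def N_def by simp
  have "disjoint (brauer_mult \<alpha> \<beta>)"
  proof (rule disjointI)
    fix P Q assume "P \<in> brauer_mult \<alpha> \<beta>" "Q \<in> brauer_mult \<alpha> \<beta>" "P \<noteq> Q"
    then obtain u v where uv: "P = joinrel \<alpha> \<beta> `` {u} \<inter> V" "Q = joinrel \<alpha> \<beta> `` {v} \<inter> V"
      unfolding brauer_mult_eq V_def by blast
    show "P \<inter> Q = {}"
    proof (rule ccontr)
      assume "P \<inter> Q \<noteq> {}"
      then obtain w where "(u, w) \<in> joinrel \<alpha> \<beta>" "(v, w) \<in> joinrel \<alpha> \<beta>"
        using uv by blast
      then have "(u, z) \<in> joinrel \<alpha> \<beta> \<longleftrightarrow> (v, z) \<in> joinrel \<alpha> \<beta>" for z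
        by (meson sym_joinrel trans_joinrel)
      then show False using uv \<open>P \<noteq> Q\<close> by blast
    qed
  qed
  moreover have "\<Union>(brauer_mult \<alpha> \<beta>) = V"
    using joinrel_refl unfolding brauer_mult_eq V_def by blast
  moreover have "\<forall>P\<in>brauer_mult \<alpha> \<beta>. card P = 2"
    using card unfolding brauer_mult_eq V_def by blast
  ultimately show ?thesis
    unfolding brauer_hom_iff matching_def V_def by simp
qed

lemma brauer_mult_blockI:
  assumes fin: "finite A" "finite B" "finite C"
    and uv: "u \<in> Unpr ` A \<union> Pr ` C" "v \<in> Unpr ` A \<union> Pr ` C" "u \<noteq> v" "(u, v) \<in> joinrel \<alpha> \<beta>"
  shows "{u, v} \<in> brauer_mult \<alpha> \<beta>"
proof -
  define P where "P = joinrel \<alpha> \<beta> `` {u} \<inter> (Unpr ` A \<union> Pr ` C)"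
  have P: "P \<in> brauer_mult \<alpha> \<beta>"
    unfolding brauer_mult_eq P_def using uv(1) by blast
  have "u \<in> P" "v \<in> P" unfolding P_def using uv joinrel_refl by auto
  moreover obtain a b where "P = {a, b}" "a \<noteq> b"
    using matching_pairE[OF brauer_hom_matching[OF brauer_mult_hom[OF fin]] P] by metis
  ultimately have "P = {u, v}" using uv(3) by auto
  then show ?thesis using P by simp
qed

end

subsection \<open>Diagrams as relations between predicates\<close>

text \<open>Pairs of predicates that are constant on all blocks determine a diagram, and the product of
  diagrams becomes relational composition; this yields associativity.\<close>

fun vval :: "('a \<Rightarrow> bool) \<Rightarrow> ('a \<Rightarrow> bool) \<Rightarrow> 'a vertex \<Rightarrow> bool" where
  "vval s t (Unpr a) = s a"
| "vval s t (Pr a) = t a"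
| "vval s t (DPr a) = undefined"

definition compatible :: "'a diagram \<Rightarrow> ('a \<Rightarrow> bool) \<Rightarrow> ('a \<Rightarrow> bool) \<Rightarrow> bool" where
  "compatible \<alpha> s t \<longleftrightarrow> (\<forall>P\<in>\<alpha>. \<forall>u\<in>P. \<forall>v\<in>P. vval s t u = vval s t v)"

lemma compatibleD:
  "compatible \<alpha> s t \<Longrightarrow> P \<in> \<alpha> \<Longrightarrow> u \<in> P \<Longrightarrow> v \<in> P \<Longrightarrow> vval s t u = vval s t v"
  unfolding compatible_def by blast

text \<open>The indicator of a single block \<open>Q\<close> of \<open>\<beta>\<close> is constant
  on all blocks of \<open>\<beta>\<close>. If \<open>\<alpha>\<close> admits it too, the block of
  \<open>\<alpha>\<close> through a point of \<open>Q\<close> cannot leave \<open>Q\<close>.\<close>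

lemma compatible_inj:
  assumes \<alpha>: "\<alpha> \<in> brauer_hom A B" and \<beta>: "\<beta> \<in> brauer_hom A B"
    and eq: "\<And>s t. compatible \<alpha> s t \<longleftrightarrow> compatible \<beta> s t"
  shows "\<alpha> = \<beta>"
proof (rule brauer_hom_subset_eq[OF \<alpha> \<beta>], rule subsetI)
  fix P assume P: "P \<in> \<alpha>"
  obtain u v where uv: "u \<noteq> v" "P = {u, v}"
    using matching_pairE[OF brauer_hom_matching[OF \<alpha>] P] .
  have "u \<in> \<Union>\<beta>" "v \<in> \<Union>\<beta>"
    using P uv brauer_hom_Union[OF \<alpha>] brauer_hom_Union[OF \<beta>] by auto
  then obtain Q where Q: "Q \<in> \<beta>" "u \<in> Q" by blast
  define s where "s a \<longleftrightarrow> Unpr a \<in> Q" for a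
  define t where "t a \<longleftrightarrow> Pr a \<in> Q" for a
  have val: "vval s t w \<longleftrightarrow> w \<in> Q" if "w \<in> \<Union>\<beta>" for w
    using that brauer_hom_Union[OF \<beta>] by (auto simp: s_def t_def)
  have "compatible \<beta> s t"
    unfolding compatible_def
  proof (intro ballI)
    fix R a b assume "R \<in> \<beta>" "a \<in> R" "b \<in> R"
    moreover from this have "a \<in> Q \<longleftrightarrow> b \<in> Q"
      using matching_block_eq[OF brauer_hom_matching[OF \<beta>] _ Q(1)] by metis
    ultimately show "vval s t a = vval s t b"
      using val[of a] val[of b] by blast
  qed
  then have "compatible \<alpha> s t" using eq by simp
  then have "vval s t u = vval s t v"
    using P uv by (intro compatibleD) auto
  then have "v \<in> Q"
    using val \<open>u \<in> \<Union>\<beta>\<close> \<open>v \<in> \<Union>\<beta>\<close> Q(2) by blast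
  moreover obtain a b where "Q = {a, b}" "a \<noteq> b"
    using matching_pairE[OF brauer_hom_matching[OF \<beta>] Q(1)] by metis
  ultimately have "P = Q" using uv Q(2) by auto
  then show "P \<in> \<beta>" using Q by simp
qed

lemma compatible_mult:
  assumes \<alpha>: "\<alpha> \<in> brauer_hom A B" and \<beta>: "\<beta> \<in> brauer_hom B C"
  shows "compatible (brauer_mult \<alpha> \<beta>) s t \<longleftrightarrow> (\<exists>m. compatible \<alpha> s m \<and> compatible \<beta> m t)"
proof
  define V where "V = Unpr ` A \<union> Pr ` C"
  assume c: "compatible (brauer_mult \<alpha> \<beta>) s t"
  \<comment> \<open>The outer values are spread along the join classes. A closed loop in the middle
    reaches no outer vertex and receives the constant value \<open>False\<close>.\<close>
  define w where "w u \<longleftrightarrow> (\<exists>v\<in>V. (u, v) \<in> joinrel \<alpha> \<beta> \<and> vval s t v)" for u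
  have w_cong: "w u = w v" if "(u, v) \<in> joinrel \<alpha> \<beta>" for u v
    unfolding w_def using that by (meson sym_joinrel trans_joinrel)
  have w_V: "w v = vval s t v" if "v \<in> V" for v
  proof -
    have "vval s t v = vval s t u" if "u \<in> V" "(v, u) \<in> joinrel \<alpha> \<beta>" for u
    proof -
      have "joinrel \<alpha> \<beta> `` {v} \<inter> V \<in> brauer_mult \<alpha> \<beta>"
        unfolding brauer_mult_eq[OF \<alpha> \<beta>] V_def[symmetric] using \<open>v \<in> V\<close> by blast
      moreover have "v \<in> joinrel \<alpha> \<beta> `` {v} \<inter> V" "u \<in> joinrel \<alpha> \<beta> `` {v} \<inter> V"
        using that \<open>v \<in> V\<close> joinrel_refl[OF \<alpha> \<beta>] unfolding V_def by auto
      ultimately show ?thesis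
        by (rule compatibleD[OF c])
    qed
    moreover have "(v, v) \<in> joinrel \<alpha> \<beta>" using joinrel_refl[OF \<alpha> \<beta>] that unfolding V_def .
    ultimately show ?thesis unfolding w_def using that by blast
  qed
  define m where "m b = w (DPr b)" for b
  have "compatible \<alpha> s m"
    unfolding compatible_def
  proof (intro ballI)
    fix P u v assume P: "P \<in> \<alpha>" "u \<in> P" "v \<in> P"
    have val: "vval s m x = w (pr_to_dpr x)" if "x \<in> \<Union>\<alpha>" for x
      using that brauer_hom_Union[OF \<alpha>] w_V by (auto simp: m_def V_def)
    have "(pr_to_dpr u, pr_to_dpr v) \<in> joinrel \<alpha> \<beta>"
      by (rule joinrel_left[OF P])
    then show "vval s m u = vval s m v"
      using val[of u] val[of v] w_cong P by blast
  qed
  moreover have "compatible \<beta> m t"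
    unfolding compatible_def
  proof (intro ballI)
    fix P u v assume P: "P \<in> \<beta>" "u \<in> P" "v \<in> P"
    have val: "vval m t x = w (unpr_to_dpr x)" if "x \<in> \<Union>\<beta>" for x
      using that brauer_hom_Union[OF \<beta>] w_V by (auto simp: m_def V_def)
    have "(unpr_to_dpr u, unpr_to_dpr v) \<in> joinrel \<alpha> \<beta>"
      by (rule joinrel_right[OF P])
    then show "vval m t u = vval m t v"
      using val[of u] val[of v] w_cong P by blast
  qed
  ultimately show "\<exists>m. compatible \<alpha> s m \<and> compatible \<beta> m t" by blast
next
  assume "\<exists>m. compatible \<alpha> s m \<and> compatible \<beta> m t"
  then obtain m where m: "compatible \<alpha> s m" "compatible \<beta> m t" by blast
  \<comment> \<open>Both labellings use \<open>m\<close> on the middle copy, so they glue to one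
    labelling that is invariant under every single step of the join.\<close>
  define w where "w u = (case u of Unpr a \<Rightarrow> s a | Pr b \<Rightarrow> t b | DPr b \<Rightarrow> m b)" for u
  have one_step: "w y = w z"
    if "(y, z) \<in> eqv_of ((`) pr_to_dpr ` \<alpha>) \<union> eqv_of ((`) unpr_to_dpr ` \<beta>)" for y z
  proof -
    have 1: "w (pr_to_dpr x) = vval s m x" if "x \<in> \<Union>\<alpha>" for x
      using that brauer_hom_Union[OF \<alpha>] by (auto simp: w_def)
    have 2: "w (unpr_to_dpr x) = vval m t x" if "x \<in> \<Union>\<beta>" for x
      using that brauer_hom_Union[OF \<beta>] by (auto simp: w_def)
    from that show ?thesis
    proof
      assume "(y, z) \<in> eqv_of ((`) pr_to_dpr ` \<alpha>)"
      then obtain P a b where P: "P \<in> \<alpha>" "a \<in> P" "b \<in> P" "y = pr_to_dpr a" "z = pr_to_dpr b"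
        by (auto simp: eqv_of_iff)
      then have "vval s m a = vval s m b" using compatibleD[OF m(1)] by blast
      then show ?thesis using 1[of a] 1[of b] P by blast
    next
      assume "(y, z) \<in> eqv_of ((`) unpr_to_dpr ` \<beta>)"
      then obtain P a b where P: "P \<in> \<beta>" "a \<in> P" "b \<in> P" "y = unpr_to_dpr a" "z = unpr_to_dpr b"
        by (auto simp: eqv_of_iff)
      then have "vval m t a = vval m t b" using compatibleD[OF m(2)] by blast
      then show ?thesis using 2[of a] 2[of b] P by blast
    qed
  qed
  have "w u = w v" if "(u, v) \<in> joinrel \<alpha> \<beta>" for u v
    using that unfolding joinrel_def
  proof (induction rule: trancl_induct)
    case (base y)
    then show ?case by (rule one_step)
  next
    case (step y z)
    then show ?case using one_step[OF step.hyps(2)] by simp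
  qed
  moreover have "vval s t u = w u" if "u \<in> Unpr ` A \<union> Pr ` C" for u
    using that by (auto simp: w_def)
  ultimately show "compatible (brauer_mult \<alpha> \<beta>) s t"
    unfolding compatible_def brauer_mult_eq[OF \<alpha> \<beta>]
    by (smt (verit, best) Image_singleton_iff Int_iff imageE)
qed

lemma brauer_mult_assoc:
  assumes "\<alpha> \<in> brauer_hom A B" "\<beta> \<in> brauer_hom B C" "\<gamma> \<in> brauer_hom C D"
    and "finite A" "finite B" "finite C" "finite D"
  shows "brauer_mult (brauer_mult \<alpha> \<beta>) \<gamma> = brauer_mult \<alpha> (brauer_mult \<beta> \<gamma>)"
proof (rule compatible_inj)
  note 1 = brauer_mult_hom[OF assms(1,2,4-6)] and 2 = brauer_mult_hom[OF assms(2,3,5-7)]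
  show "brauer_mult (brauer_mult \<alpha> \<beta>) \<gamma> \<in> brauer_hom A D"
    using brauer_mult_hom[OF 1 assms(3)] assms by simp
  show "brauer_mult \<alpha> (brauer_mult \<beta> \<gamma>) \<in> brauer_hom A D"
    using brauer_mult_hom[OF assms(1) 2] assms by simp
  show "compatible (brauer_mult (brauer_mult \<alpha> \<beta>) \<gamma>) s t \<longleftrightarrow>
      compatible (brauer_mult \<alpha> (brauer_mult \<beta> \<gamma>)) s t" for s t
    using compatible_mult[OF 1 assms(3)] compatible_mult[OF assms(1) 2]
      compatible_mult[OF assms(1,2)] compatible_mult[OF assms(2,3)] by metis
qed

subsection \<open>Reflection\<close>

fun flipv :: "'a vertex \<Rightarrow> 'a vertex" where
  "flipv (Unpr a) = Pr a"
| "flipv (Pr a) = Unpr a"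
| "flipv (DPr a) = DPr a"

text \<open>Reflection in a horizontal axis: an involution that reverses products and exchanges
  upper with lower parts. It supplies the dual half of most results below.\<close>

definition flip :: "'a diagram \<Rightarrow> 'a diagram" where
  "flip \<alpha> = (`) flipv ` \<alpha>"

lemma flipv_flipv [simp]: "flipv (flipv u) = u"
  by (cases u) auto

lemma inj_flipv: "inj_on flipv Z"
  by (metis flipv_flipv inj_onI)

lemma flip_flip [simp]: "flip (flip \<alpha>) = \<alpha>"
  by (simp add: flip_def image_image)

lemma flip_inject [simp]: "flip \<alpha> = flip \<beta> \<longleftrightarrow> \<alpha> = \<beta>"
  by (metis flip_flip)

lemma flip_hom: "\<alpha> \<in> brauer_hom A B \<Longrightarrow> flip \<alpha> \<in> brauer_hom B A"
proof -
  assume \<alpha>: "\<alpha> \<in> brauer_hom A B"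
  have "flipv ` (Unpr ` A \<union> Pr ` B) = Unpr ` B \<union> Pr ` A"
    by (auto simp: image_Un image_image)
  moreover have "\<Union>(flip \<alpha>) = flipv ` \<Union>\<alpha>"
    by (auto simp: flip_def)
  ultimately show ?thesis
    using matching_image[OF brauer_hom_matching[OF \<alpha>] inj_flipv] brauer_hom_Union[OF \<alpha>]
    unfolding brauer_hom_iff flip_def by simp
qed

lemma flip_hom_iff [simp]: "flip \<alpha> \<in> brauer_hom B A \<longleftrightarrow> \<alpha> \<in> brauer_hom A B"
  using flip_hom by (metis flip_flip)

lemma compatible_flip:
  assumes "\<alpha> \<in> brauer_hom A B"
  shows "compatible (flip \<alpha>) s t \<longleftrightarrow> compatible \<alpha> t s"
proof -
  have "vval s t (flipv u) = vval t s u" if "P \<in> \<alpha>" "u \<in> P" for P u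
    using that brauer_hom_Union[OF assms] by (cases u) auto
  then show ?thesis unfolding compatible_def flip_def by auto
qed

lemma flip_mult:
  assumes "\<alpha> \<in> brauer_hom A B" "\<beta> \<in> brauer_hom B C" "finite A" "finite B" "finite C"
  shows "flip (brauer_mult \<alpha> \<beta>) = brauer_mult (flip \<beta>) (flip \<alpha>)"
proof (rule compatible_inj)
  note m = brauer_mult_hom[OF assms]
  show "flip (brauer_mult \<alpha> \<beta>) \<in> brauer_hom C A" using m by simp
  show "brauer_mult (flip \<beta>) (flip \<alpha>) \<in> brauer_hom C A"
    using brauer_mult_hom[of "flip \<beta>" C B "flip \<alpha>" A] assms by simp
  show "compatible (flip (brauer_mult \<alpha> \<beta>)) s t \<longleftrightarrow>
      compatible (brauer_mult (flip \<beta>) (flip \<alpha>)) s t" for s t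
    unfolding compatible_flip[OF m] compatible_mult[OF assms(1,2)]
      compatible_mult[OF flip_hom[OF assms(2)] flip_hom[OF assms(1)]]
      compatible_flip[OF assms(1)] compatible_flip[OF assms(2)] by blast
qed

section \<open>The anatomy of a diagram\<close>

definition upper :: "'a diagram \<Rightarrow> 'a set set" where
  "upper \<alpha> = {P. Unpr ` P \<in> \<alpha>}"

definition lower :: "'a diagram \<Rightarrow> 'a set set" where
  "lower \<alpha> = {P. Pr ` P \<in> \<alpha>}"

text \<open>The description denotes the lower end of a strand only at free upper points, those
  outside \<open>\<Union>(upper \<alpha>)\<close>.\<close>

definition thr :: "'a diagram \<Rightarrow> 'a \<Rightarrow> 'a" where
  "thr \<alpha> a = (THE b. {Unpr a, Pr b} \<in> \<alpha>)"

text \<open>Normal form of a diagram; by \<open>hom_eq_diag\<close> every diagram arises in this way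
  from its two matchings and its strands.\<close>

definition diag :: "'a set \<Rightarrow> 'a set set \<Rightarrow> 'a set set \<Rightarrow> ('a \<Rightarrow> 'a) \<Rightarrow> 'a diagram" where
  "diag A U L f = (`) Unpr ` U \<union> (`) Pr ` L \<union> {{Unpr a, Pr (f a)} |a. a \<in> A - \<Union>U}"

lemma upper_iff: "{a, b} \<in> upper \<alpha> \<longleftrightarrow> {Unpr a, Unpr b} \<in> \<alpha>"
  by (simp add: upper_def)

lemma lower_iff: "{a, b} \<in> lower \<alpha> \<longleftrightarrow> {Pr a, Pr b} \<in> \<alpha>"
  by (simp add: lower_def)

lemma inj_vertex [simp]: "inj_on Unpr Z" "inj_on Pr Z"
  by (auto simp: inj_on_def)

lemma in_flip_iff: "P \<in> flip \<alpha> \<longleftrightarrow> flipv ` P \<in> \<alpha>"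
proof
  assume "flipv ` P \<in> \<alpha>"
  then have "flipv ` flipv ` P \<in> flip \<alpha>" unfolding flip_def by (rule imageI)
  then show "P \<in> flip \<alpha>" by (simp add: image_image)
qed (auto simp: flip_def image_image)

lemma upper_flip [simp]: "upper (flip \<alpha>) = lower \<alpha>"
  by (simp add: upper_def lower_def in_flip_iff image_image)

lemma lower_flip [simp]: "lower (flip \<alpha>) = upper \<alpha>"
  using upper_flip[of "flip \<alpha>"] by simp

lemma flip_thr_iff: "{Unpr b, Pr a} \<in> flip \<alpha> \<longleftrightarrow> {Unpr a, Pr b} \<in> \<alpha>"
  by (simp add: in_flip_iff insert_commute)

context
  fixes \<alpha> :: "'a diagram" and A B :: "'a set"
  assumes \<alpha>: "\<alpha> \<in> brauer_hom A B"
begin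

lemma hom_unique: "{u, v} \<in> \<alpha> \<Longrightarrow> {u, w} \<in> \<alpha> \<Longrightarrow> v = w"
  by (rule matching_unique[OF brauer_hom_matching[OF \<alpha>]])

lemma thr_eqI: "{Unpr a, Pr b} \<in> \<alpha> \<Longrightarrow> thr \<alpha> a = b"
  unfolding thr_def using hom_unique by blast

lemma thr_in: "{Unpr a, Pr b} \<in> \<alpha> \<Longrightarrow> a \<in> A \<and> b \<in> B"
  using brauer_hom_Union[OF \<alpha>] by blast

lemma matching_upper: "matching A (upper \<alpha>)"
  unfolding matching_def
proof (intro conjI ballI)
  show "disjoint (upper \<alpha>)"
  proof (rule disjointI)
    fix P Q assume "P \<in> upper \<alpha>" "Q \<in> upper \<alpha>" "P \<noteq> Q"
    then have "Unpr ` P \<inter> Unpr ` Q = {}"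
      using brauer_hom_matching[OF \<alpha>] unfolding upper_def matching_def
      by (metis disjointD inj_vertex(1) inj_on_image_eq_iff mem_Collect_eq subset_UNIV)
    then show "P \<inter> Q = {}" by blast
  qed
  show "\<Union>(upper \<alpha>) \<subseteq> A"
    using brauer_hom_Union[OF \<alpha>] unfolding upper_def by blast
  fix P assume "P \<in> upper \<alpha>"
  then have "card (Unpr ` P) = 2"
    using brauer_hom_matching[OF \<alpha>] unfolding upper_def matching_def by blast
  then show "card P = 2" by (simp add: card_image)
qed

lemma upper_not_thr:
  assumes "a \<in> \<Union>(upper \<alpha>)"
  shows "{Unpr a, Pr b} \<notin> \<alpha>"
proof
  assume b: "{Unpr a, Pr b} \<in> \<alpha>"
  obtain a' where "{a, a'} \<in> upper \<alpha>"
    using matching_partnerE[OF matching_upper assms] by metis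
  then show False using hom_unique[OF b] by (auto simp: upper_iff)
qed

lemma free_iff: "a \<in> A - \<Union>(upper \<alpha>) \<longleftrightarrow> (\<exists>b. {Unpr a, Pr b} \<in> \<alpha>)"
proof
  assume a: "a \<in> A - \<Union>(upper \<alpha>)"
  then have "Unpr a \<in> \<Union>\<alpha>" using brauer_hom_Union[OF \<alpha>] by blast
  then obtain v where v: "v \<noteq> Unpr a" "{Unpr a, v} \<in> \<alpha>" "v \<in> Unpr ` A \<union> Pr ` B"
    using matching_partnerE[OF brauer_hom_matching[OF \<alpha>]] by metis
  then show "\<exists>b. {Unpr a, Pr b} \<in> \<alpha>"
    using a by (auto simp: upper_iff[symmetric])
next
  assume "\<exists>b. {Unpr a, Pr b} \<in> \<alpha>"
  then show "a \<in> A - \<Union>(upper \<alpha>)"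
    using upper_not_thr thr_in by blast
qed

lemma thr_mem: "a \<in> A - \<Union>(upper \<alpha>) \<Longrightarrow> {Unpr a, Pr (thr \<alpha> a)} \<in> \<alpha>"
  using free_iff thr_eqI by blast

end

lemma matching_lower: "\<alpha> \<in> brauer_hom A B \<Longrightarrow> matching B (lower \<alpha>)"
  using matching_upper[OF flip_hom] by simp

lemma lower_not_thr: "\<alpha> \<in> brauer_hom A B \<Longrightarrow> b \<in> \<Union>(lower \<alpha>) \<Longrightarrow> {Unpr a, Pr b} \<notin> \<alpha>"
  using upper_not_thr[OF flip_hom, of \<alpha> A B b a] by (simp add: flip_thr_iff)

lemma free_lower_iff:
  "\<alpha> \<in> brauer_hom A B \<Longrightarrow> b \<in> B - \<Union>(lower \<alpha>) \<longleftrightarrow> (\<exists>a. {Unpr a, Pr b} \<in> \<alpha>)"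
  using free_iff[OF flip_hom, of \<alpha> A B b] by (simp add: flip_thr_iff)

lemma thr_bij:
  assumes \<alpha>: "\<alpha> \<in> brauer_hom A B"
  shows "bij_betw (thr \<alpha>) (A - \<Union>(upper \<alpha>)) (B - \<Union>(lower \<alpha>))"
proof (rule bij_betw_imageI)
  show "inj_on (thr \<alpha>) (A - \<Union>(upper \<alpha>))"
  proof (rule inj_onI)
    fix a b assume "a \<in> A - \<Union>(upper \<alpha>)" "b \<in> A - \<Union>(upper \<alpha>)" and eq: "thr \<alpha> a = thr \<alpha> b"
    then have "{Pr (thr \<alpha> a), Unpr a} \<in> \<alpha>" "{Pr (thr \<alpha> a), Unpr b} \<in> \<alpha>"
      using thr_mem[OF \<alpha>, of a] thr_mem[OF \<alpha>, of b] by (simp_all add: insert_commute)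
    then show "a = b" using hom_unique[OF \<alpha>] by blast
  qed
  show "thr \<alpha> ` (A - \<Union>(upper \<alpha>)) = B - \<Union>(lower \<alpha>)"
  proof (intro equalityI subsetI)
    fix b assume "b \<in> thr \<alpha> ` (A - \<Union>(upper \<alpha>))"
    then show "b \<in> B - \<Union>(lower \<alpha>)"
      using thr_mem[OF \<alpha>] free_lower_iff[OF \<alpha>] by blast
  next
    fix b assume "b \<in> B - \<Union>(lower \<alpha>)"
    then obtain a where a: "{Unpr a, Pr b} \<in> \<alpha>"
      using free_lower_iff[OF \<alpha>] by blast
    then have "a \<in> A - \<Union>(upper \<alpha>)" "thr \<alpha> a = b"
      using free_iff[OF \<alpha>] thr_eqI[OF \<alpha>] by blast+
    then show "b \<in> thr \<alpha> ` (A - \<Union>(upper \<alpha>))" by blast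
  qed
qed

lemma brank_upper:
  assumes \<alpha>: "\<alpha> \<in> brauer_hom A B"
  shows "brank \<alpha> = card (A - \<Union>(upper \<alpha>))"
proof -
  let ?g = "\<lambda>a. {Unpr a, Pr (thr \<alpha> a)}"
  have "{P \<in> \<alpha>. P \<inter> range Unpr \<noteq> {} \<and> P \<inter> range Pr \<noteq> {}} = ?g ` (A - \<Union>(upper \<alpha>))"
  proof (intro equalityI subsetI)
    fix P assume "P \<in> {P \<in> \<alpha>. P \<inter> range Unpr \<noteq> {} \<and> P \<inter> range Pr \<noteq> {}}"
    then obtain a b where P: "P \<in> \<alpha>" "Unpr a \<in> P" "Pr b \<in> P" by blast
    obtain u v where "P = {u, v}"
      using matching_pairE[OF brauer_hom_matching[OF \<alpha>] P(1)] by metis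
    then have "P = {Unpr a, Pr b}" using P by auto
    moreover from this have "a \<in> A - \<Union>(upper \<alpha>)" "thr \<alpha> a = b"
      using P(1) free_iff[OF \<alpha>] thr_eqI[OF \<alpha>] by blast+
    ultimately show "P \<in> ?g ` (A - \<Union>(upper \<alpha>))" by blast
  next
    fix P assume "P \<in> ?g ` (A - \<Union>(upper \<alpha>))"
    then obtain a where "a \<in> A - \<Union>(upper \<alpha>)" "P = ?g a" by blast
    then show "P \<in> {P \<in> \<alpha>. P \<inter> range Unpr \<noteq> {} \<and> P \<inter> range Pr \<noteq> {}}"
      using thr_mem[OF \<alpha>] by auto
  qed
  moreover have "inj_on ?g (A - \<Union>(upper \<alpha>))"
    by (auto simp: inj_on_def doubleton_eq_iff)
  ultimately show ?thesis unfolding brank_def by (simp add: card_image)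
qed

lemma brank_lower: "\<alpha> \<in> brauer_hom A B \<Longrightarrow> brank \<alpha> = card (B - \<Union>(lower \<alpha>))"
  using brank_upper bij_betw_same_card[OF thr_bij] by metis

lemma brank_flip [simp]: "\<alpha> \<in> brauer_hom A B \<Longrightarrow> brank (flip \<alpha>) = brank \<alpha>"
  using brank_upper[OF flip_hom, of \<alpha> A B] brank_lower[of \<alpha> A B] by simp

lemma matching_card_free:
  assumes "finite A" "matching A U"
  shows "card A = card (A - \<Union>U) + 2 * card U"
proof -
  have "\<Union>U \<subseteq> A" using assms(2) unfolding matching_def by blast
  then have "card A = card (A - \<Union>U) + card (\<Union>U)"
    by (metis assms(1) card_Diff_subset card_mono finite_subset le_add_diff_inverse2)
  then show ?thesis using matching_card[OF assms(2)] by simp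
qed

lemma odd_brank:
  assumes "\<alpha> \<in> brauer_hom A B" "finite A" "odd (card A)"
  shows "odd (brank \<alpha>)"
  using matching_card_free[OF assms(2) matching_upper[OF assms(1)]] assms(3)
    brank_upper[OF assms(1)] by (metis dvd_triv_left even_add)

text \<open>The number of free points is \<open>card A\<close> minus twice the number of blocks, so
  \<open>U'\<close> has no more blocks than \<open>U\<close>. Together with
  \<open>mult_upper\<close> this identifies the upper part of a product whose rank has not
  dropped.\<close>

lemma upper_eq_if_subset:
  assumes A: "finite A" and "matching A U" "matching A U'" "U \<subseteq> U'"
    and le: "card (A - \<Union>U) \<le> card (A - \<Union>U')"
  shows "U = U'"
proof -
  have "card U' \<le> card U"
    using matching_card_free[OF A assms(2)] matching_card_free[OF A assms(3)] le by linarith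
  then show ?thesis
    using matching_finite[OF A assms(3)] assms(4) by (simp add: card_seteq)
qed

subsection \<open>Constructing diagrams\<close>

lemma diag_upper_iff:
  assumes "matching A U" "matching B L"
  shows "Unpr ` P \<in> diag A U L f \<longleftrightarrow> P \<in> U"
proof -
  have "Unpr ` P \<notin> (`) Pr ` L"
  proof
    assume "Unpr ` P \<in> (`) Pr ` L"
    then obtain Q where Q: "Q \<in> L" "Unpr ` P = Pr ` Q" by blast
    then obtain u v where "Q = {u, v}" using matching_pairE[OF assms(2) Q(1)] by blast
    with Q(2) show False by auto
  qed
  moreover have "Unpr ` P \<notin> {{Unpr a, Pr (f a)} |a. a \<in> A - \<Union>U}" by auto
  moreover have "Unpr ` P \<in> (`) Unpr ` U \<longleftrightarrow> P \<in> U"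
    by (rule inj_image_mem_iff) (auto intro!: injI simp: inj_image_eq_iff)
  ultimately show ?thesis unfolding diag_def by blast
qed

lemma diag_lower_iff:
  assumes "matching A U" "matching B L"
  shows "Pr ` P \<in> diag A U L f \<longleftrightarrow> P \<in> L"
proof -
  have "Pr ` P \<notin> (`) Unpr ` U"
  proof
    assume "Pr ` P \<in> (`) Unpr ` U"
    then obtain Q where Q: "Q \<in> U" "Pr ` P = Unpr ` Q" by blast
    then obtain u v where "Q = {u, v}" using matching_pairE[OF assms(1) Q(1)] by blast
    with Q(2) show False by auto
  qed
  moreover have "Pr ` P \<notin> {{Unpr a, Pr (f a)} |a. a \<in> A - \<Union>U}" by auto
  moreover have "Pr ` P \<in> (`) Pr ` L \<longleftrightarrow> P \<in> L"
    by (rule inj_image_mem_iff) (auto intro!: injI simp: inj_image_eq_iff)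
  ultimately show ?thesis unfolding diag_def by blast
qed

lemma diag_thr: "a \<in> A - \<Union>U \<Longrightarrow> {Unpr a, Pr (f a)} \<in> diag A U L f"
  unfolding diag_def by blast

lemma diag_hom:
  assumes U: "matching A U" and L: "matching B L" and f: "bij_betw f (A - \<Union>U) (B - \<Union>L)"
  shows "diag A U L f \<in> brauer_hom A B"
proof -
  define T where "T = {{Unpr a, Pr (f a)} |a. a \<in> A - \<Union>U}"
  let ?Z = "Unpr ` A \<union> Pr ` B"
  have 1: "matching ?Z ((`) Unpr ` U)" and 2: "matching ?Z ((`) Pr ` L)"
    using matching_mono[OF matching_image[OF U, of Unpr]] matching_mono[OF matching_image[OF L, of Pr]]
    by simp_all
  have im: "f a \<in> B - \<Union>L" if "a \<in> A - \<Union>U" for a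
    using f that bij_betwE by blast
  have "disjoint T"
  proof (rule disjointI)
    fix P Q assume "P \<in> T" "Q \<in> T" "P \<noteq> Q"
    then obtain a b where "a \<in> A - \<Union>U" "b \<in> A - \<Union>U" "a \<noteq> b" "P = {Unpr a, Pr (f a)}" "Q = {Unpr b, Pr (f b)}"
      unfolding T_def by blast
    moreover from this have "f a \<noteq> f b"
      using f unfolding bij_betw_def inj_on_def by blast
    ultimately show "P \<inter> Q = {}" by auto
  qed
  moreover have "\<Union>T \<subseteq> ?Z"
    using im unfolding T_def by auto
  moreover have "\<forall>P\<in>T. card P = 2" unfolding T_def by auto
  ultimately have 3: "matching ?Z T" unfolding matching_def by blast
  have UT: "\<Union>T = Unpr ` (A - \<Union>U) \<union> Pr ` (B - \<Union>L)"
  proof -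
    have "\<Union>T = Unpr ` (A - \<Union>U) \<union> Pr ` f ` (A - \<Union>U)"
      unfolding T_def by blast
    then show ?thesis using f unfolding bij_betw_def by simp
  qed
  have UU: "\<Union>((`) Unpr ` U) = Unpr ` \<Union>U" and UL: "\<Union>((`) Pr ` L) = Pr ` \<Union>L"
    by blast+
  have "matching ?Z ((`) Unpr ` U \<union> (`) Pr ` L)"
    by (rule matching_Un[OF 1 2]) (auto simp: UU UL)
  then have "matching ?Z ((`) Unpr ` U \<union> (`) Pr ` L \<union> T)"
    by (rule matching_Un[OF _ 3]) (auto simp: UU UL UT)
  moreover have "\<Union>((`) Unpr ` U \<union> (`) Pr ` L \<union> T) = ?Z"
  proof -
    have "\<Union>U \<subseteq> A" "\<Union>L \<subseteq> B" using U L unfolding matching_def by blast+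
    then show ?thesis unfolding Union_Un_distrib UU UL UT by blast
  qed
  ultimately show ?thesis
    unfolding brauer_hom_iff diag_def T_def by blast
qed

context
  fixes A B :: "'a set" and U L f
  assumes U: "matching A U" and L: "matching B L" and f: "bij_betw f (A - \<Union>U) (B - \<Union>L)"
begin

lemma upper_diag: "upper (diag A U L f) = U"
  unfolding upper_def using diag_upper_iff[OF U L] by blast

lemma lower_diag: "lower (diag A U L f) = L"
  unfolding lower_def using diag_lower_iff[OF U L] by blast

lemma thr_diag: "a \<in> A - \<Union>U \<Longrightarrow> thr (diag A U L f) a = f a"
  by (rule thr_eqI[OF diag_hom[OF U L f] diag_thr])

lemma brank_diag: "brank (diag A U L f) = card (A - \<Union>U)"
  by (simp add: brank_upper[OF diag_hom[OF U L f]] upper_diag)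

lemma diag_eqI:
  assumes \<delta>: "\<delta> \<in> brauer_hom A B" and "U \<subseteq> upper \<delta>" "L \<subseteq> lower \<delta>"
    and "\<And>a. a \<in> A - \<Union>U \<Longrightarrow> {Unpr a, Pr (f a)} \<in> \<delta>"
  shows "\<delta> = diag A U L f"
proof (rule sym, rule brauer_hom_subset_eq[OF diag_hom[OF U L f] \<delta>])
  show "diag A U L f \<subseteq> \<delta>"
    using assms(2-4) unfolding diag_def upper_def lower_def by blast
qed

end

lemma hom_eq_diag:
  assumes \<alpha>: "\<alpha> \<in> brauer_hom A B"
  shows "\<alpha> = diag A (upper \<alpha>) (lower \<alpha>) (thr \<alpha>)"
  by (rule diag_eqI[OF matching_upper[OF \<alpha>] matching_lower[OF \<alpha>] thr_bij[OF \<alpha>] \<alpha>])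
    (use thr_mem[OF \<alpha>] in auto)

lemma hom_eqI:
  assumes \<alpha>: "\<alpha> \<in> brauer_hom A B" and \<beta>: "\<beta> \<in> brauer_hom A B"
    and "upper \<alpha> \<subseteq> upper \<beta>" "lower \<alpha> \<subseteq> lower \<beta>"
    and "\<And>a b. {Unpr a, Pr b} \<in> \<alpha> \<Longrightarrow> {Unpr a, Pr b} \<in> \<beta>"
  shows "\<alpha> = \<beta>"
proof -
  have "\<beta> = diag A (upper \<alpha>) (lower \<alpha>) (thr \<alpha>)"
    by (rule diag_eqI[OF matching_upper[OF \<alpha>] matching_lower[OF \<alpha>] thr_bij[OF \<alpha>] \<beta>])
      (use thr_mem[OF \<alpha>] assms in auto)
  then show ?thesis using hom_eq_diag[OF \<alpha>] by simp
qed

lemma hom_eqI':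
  assumes \<alpha>: "\<alpha> \<in> brauer_hom A B" and \<beta>: "\<beta> \<in> brauer_hom A B"
    and up: "upper \<alpha> = upper \<beta>" and lo: "lower \<alpha> = lower \<beta>"
    and thr: "\<And>a. a \<in> A - \<Union>(upper \<alpha>) \<Longrightarrow> thr \<alpha> a = thr \<beta> a"
  shows "\<alpha> = \<beta>"
proof (rule hom_eqI[OF \<alpha> \<beta>])
  fix a b assume ab: "{Unpr a, Pr b} \<in> \<alpha>"
  then have "a \<in> A - \<Union>(upper \<alpha>)" "thr \<alpha> a = b"
    using free_iff[OF \<alpha>] thr_eqI[OF \<alpha>] by blast+
  then show "{Unpr a, Pr b} \<in> \<beta>"
    using thr thr_mem[OF \<beta>, of a] up by simp
qed (use up lo in auto)

text \<open>A single strand has only one place to start and one to end, so the two matchings already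
  determine the diagram.\<close>

lemma rank_one_eqI:
  assumes \<alpha>: "\<alpha> \<in> brauer_hom A B" and \<beta>: "\<beta> \<in> brauer_hom A B" and "brank \<alpha> = 1"
    and up: "upper \<alpha> = upper \<beta>" and lo: "lower \<alpha> = lower \<beta>"
  shows "\<alpha> = \<beta>"
proof (rule hom_eqI'[OF \<alpha> \<beta> up lo])
  fix a assume a: "a \<in> A - \<Union>(upper \<alpha>)"
  have "thr \<alpha> a \<in> B - \<Union>(lower \<alpha>)" "thr \<beta> a \<in> B - \<Union>(lower \<alpha>)"
    using a bij_betwE[OF thr_bij[OF \<alpha>]] bij_betwE[OF thr_bij[OF \<beta>]] up lo by auto
  then show "thr \<alpha> a = thr \<beta> a"
    using brank_lower[OF \<alpha>] \<open>brank \<alpha> = 1\<close> by (metis card_1_singletonE singletonD)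
qed

subsection \<open>Paths in products\<close>

context
  fixes \<alpha> \<beta> :: "'a diagram" and A B C :: "'a set"
  assumes \<alpha>: "\<alpha> \<in> brauer_hom A B" and \<beta>: "\<beta> \<in> brauer_hom B C"
    and fin: "finite A" "finite B" "finite C"
begin

lemma join_left: "{u, v} \<in> \<alpha> \<Longrightarrow> (pr_to_dpr u, pr_to_dpr v) \<in> joinrel \<alpha> \<beta>"
  by (rule joinrel_left) auto

lemma join_right: "{u, v} \<in> \<beta> \<Longrightarrow> (unpr_to_dpr u, unpr_to_dpr v) \<in> joinrel \<alpha> \<beta>"
  by (rule joinrel_right) auto

lemma mult_upper: "upper \<alpha> \<subseteq> upper (brauer_mult \<alpha> \<beta>)"
proof
  fix P assume P: "P \<in> upper \<alpha>"
  then obtain a b where ab: "a \<noteq> b" "P = {a, b}"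
    using matching_pairE[OF matching_upper[OF \<alpha>]] by metis
  then have m: "{Unpr a, Unpr b} \<in> \<alpha>" using P by (simp add: upper_iff)
  have "P \<subseteq> A" using P matching_upper[OF \<alpha>] unfolding matching_def by blast
  then have "{Unpr a, Unpr b} \<in> brauer_mult \<alpha> \<beta>"
    using join_left[OF m] ab by (intro brauer_mult_blockI[OF \<alpha> \<beta> fin]) auto
  then show "P \<in> upper (brauer_mult \<alpha> \<beta>)" using ab by (simp add: upper_iff)
qed

lemma mult_lower: "lower \<beta> \<subseteq> lower (brauer_mult \<alpha> \<beta>)"
proof
  fix P assume P: "P \<in> lower \<beta>"
  then obtain a b where ab: "a \<noteq> b" "P = {a, b}"
    using matching_pairE[OF matching_lower[OF \<beta>]] by metis
  then have m: "{Pr a, Pr b} \<in> \<beta>" using P by (simp add: lower_iff)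
  have "P \<subseteq> C" using P matching_lower[OF \<beta>] unfolding matching_def by blast
  then have "{Pr a, Pr b} \<in> brauer_mult \<alpha> \<beta>"
    using join_right[OF m] ab by (intro brauer_mult_blockI[OF \<alpha> \<beta> fin]) auto
  then show "P \<in> lower (brauer_mult \<alpha> \<beta>)" using ab by (simp add: lower_iff)
qed

lemma mult_thr:
  assumes "{Unpr a, Pr b} \<in> \<alpha>" "{Unpr b, Pr c} \<in> \<beta>"
  shows "{Unpr a, Pr c} \<in> brauer_mult \<alpha> \<beta>"
proof (rule brauer_mult_blockI[OF \<alpha> \<beta> fin])
  show "(Unpr a, Pr c) \<in> joinrel \<alpha> \<beta>"
    using trans_joinrel join_left[OF assms(1)] join_right[OF assms(2)] by fastforce
qed (use thr_in[OF \<alpha> assms(1)] thr_in[OF \<beta> assms(2)] in auto)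

text \<open>Two strands of \<open>\<alpha>\<close> run into the ends of one block of
  \<open>\<beta>\<close> and are thereby joined. This is how later multipliers make the rank of a
  product drop.\<close>

lemma mult_cup:
  assumes "{Unpr a, Pr b} \<in> \<alpha>" "{b, b'} \<in> upper \<beta>" "{Unpr a', Pr b'} \<in> \<alpha>"
  shows "{a, a'} \<in> upper (brauer_mult \<alpha> \<beta>)"
  unfolding upper_iff
proof (rule brauer_mult_blockI[OF \<alpha> \<beta> fin])
  have "(Unpr a, DPr b) \<in> joinrel \<alpha> \<beta>" "(Unpr a', DPr b') \<in> joinrel \<alpha> \<beta>"
    using join_left[OF assms(1)] join_left[OF assms(3)] by auto
  moreover have "(DPr b, DPr b') \<in> joinrel \<alpha> \<beta>"
    using join_right[of "Unpr b" "Unpr b'"] assms(2) by (simp add: upper_iff)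
  ultimately show "(Unpr a, Unpr a') \<in> joinrel \<alpha> \<beta>"
    by (meson sym_joinrel trans_joinrel)
  show "Unpr a \<noteq> Unpr a'"
  proof
    assume "Unpr a = Unpr a'"
    then have "b = b'" using hom_unique[OF \<alpha> assms(1)] assms(3) by fastforce
    then show False using assms(2) matching_irrefl[OF matching_upper[OF \<beta>]] by simp
  qed
qed (use thr_in[OF \<alpha> assms(1)] thr_in[OF \<alpha> assms(3)] in auto)

text \<open>The path goes down a strand, across a block of \<open>\<beta>\<close>, back along a
  lower block of \<open>\<alpha>\<close> and down again. It serves a multiplier that leads a strand
  aside and must still fix a given diagram.\<close>

lemma mult_zigzag:
  assumes "{Unpr a, Pr b} \<in> \<alpha>" "{b, b1} \<in> upper \<beta>" "{b1, b2} \<in> lower \<alpha>" "{Unpr b2, Pr c} \<in> \<beta>"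
  shows "{Unpr a, Pr c} \<in> brauer_mult \<alpha> \<beta>"
proof (rule brauer_mult_blockI[OF \<alpha> \<beta> fin])
  have "(Unpr a, DPr b) \<in> joinrel \<alpha> \<beta>" "(DPr b2, Pr c) \<in> joinrel \<alpha> \<beta>"
    using join_left[OF assms(1)] join_right[OF assms(4)] by auto
  moreover have "(DPr b, DPr b1) \<in> joinrel \<alpha> \<beta>" "(DPr b1, DPr b2) \<in> joinrel \<alpha> \<beta>"
    using join_right[of "Unpr b" "Unpr b1"] join_left[of "Pr b1" "Pr b2"] assms(2,3)
    by (simp_all add: upper_iff lower_iff)
  ultimately show "(Unpr a, Pr c) \<in> joinrel \<alpha> \<beta>"
    by (meson trans_joinrel)
qed (use thr_in[OF \<alpha> assms(1)] thr_in[OF \<beta> assms(4)] in auto)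

lemma brank_mult_left: "brank (brauer_mult \<alpha> \<beta>) \<le> brank \<alpha>"
proof -
  have "A - \<Union>(upper (brauer_mult \<alpha> \<beta>)) \<subseteq> A - \<Union>(upper \<alpha>)"
    using mult_upper by blast
  then show ?thesis
    using fin by (simp add: brank_upper[OF \<alpha>] brank_upper[OF brauer_mult_hom[OF \<alpha> \<beta> fin]] card_mono)
qed

lemma brank_mult_right: "brank (brauer_mult \<alpha> \<beta>) \<le> brank \<beta>"
proof -
  have "C - \<Union>(lower (brauer_mult \<alpha> \<beta>)) \<subseteq> C - \<Union>(lower \<beta>)"
    using mult_lower by blast
  then show ?thesis
    using fin by (simp add: brank_lower[OF \<beta>] brank_lower[OF brauer_mult_hom[OF \<alpha> \<beta> fin]] card_mono)
qed

lemma mult_upper_eq: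
  assumes "brank \<alpha> \<le> brank (brauer_mult \<alpha> \<beta>)"
  shows "upper (brauer_mult \<alpha> \<beta>) = upper \<alpha>"
proof -
  note m = brauer_mult_hom[OF \<alpha> \<beta> fin]
  show ?thesis
    using upper_eq_if_subset[OF fin(1) matching_upper[OF \<alpha>] matching_upper[OF m] mult_upper] assms
    by (simp add: brank_upper[OF \<alpha>] brank_upper[OF m])
qed

lemma mult_lower_eq:
  assumes "brank \<beta> \<le> brank (brauer_mult \<alpha> \<beta>)"
  shows "lower (brauer_mult \<alpha> \<beta>) = lower \<beta>"
proof -
  note m = brauer_mult_hom[OF \<alpha> \<beta> fin]
  show ?thesis
    using upper_eq_if_subset[OF fin(3) matching_lower[OF \<beta>] matching_lower[OF m] mult_lower] assms
    by (simp add: brank_lower[OF \<beta>] brank_lower[OF m])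
qed

lemma brank_mult_less_left:
  assumes "{a, a'} \<in> upper (brauer_mult \<alpha> \<beta>)" "a \<in> A - \<Union>(upper \<alpha>)"
  shows "brank (brauer_mult \<alpha> \<beta>) < brank \<alpha>"
proof (rule ccontr)
  assume "\<not> ?thesis"
  then have "upper (brauer_mult \<alpha> \<beta>) = upper \<alpha>" using mult_upper_eq by simp
  then show False using assms by auto
qed

end

text \<open>If the lower part of one diagram covers the same points as the upper part of the next,
  the product has no zigzags.\<close>

lemma diag_mult:
  assumes U: "matching A U" and L: "matching B L" and f: "bij_betw f (A - \<Union>U) (B - \<Union>L)"
    and V: "matching B V" and W: "matching C W" and g: "bij_betw g (B - \<Union>V) (C - \<Union>W)"
    and LV: "\<Union>L = \<Union>V" and fin: "finite A" "finite B" "finite C"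
  shows "brauer_mult (diag A U L f) (diag B V W g) = diag A U W (g \<circ> f)"
proof -
  note 1 = diag_hom[OF U L f] and 2 = diag_hom[OF V W g]
  have gf: "bij_betw (g \<circ> f) (A - \<Union>U) (C - \<Union>W)"
    using bij_betw_trans f g unfolding LV by blast
  show ?thesis
  proof (rule diag_eqI[OF U W gf brauer_mult_hom[OF 1 2 fin]])
    show "U \<subseteq> upper (brauer_mult (diag A U L f) (diag B V W g))"
      using mult_upper[OF 1 2 fin] unfolding upper_diag[OF U L f] .
    show "W \<subseteq> lower (brauer_mult (diag A U L f) (diag B V W g))"
      using mult_lower[OF 1 2 fin] unfolding lower_diag[OF V W g] .
    fix a assume a: "a \<in> A - \<Union>U"
    then have "f a \<in> B - \<Union>V" using f LV bij_betwE by fastforce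
    then have "{Unpr a, Pr (g (f a))} \<in> brauer_mult (diag A U L f) (diag B V W g)"
      using a by (intro mult_thr[OF 1 2 fin diag_thr diag_thr])
    then show "{Unpr a, Pr ((g \<circ> f) a)} \<in> brauer_mult (diag A U L f) (diag B V W g)" by simp
  qed
qed

lemma mult_cap:
  assumes \<alpha>: "\<alpha> \<in> brauer_hom A B" and \<beta>: "\<beta> \<in> brauer_hom B C"
    and fin: "finite A" "finite B" "finite C"
    and "{Unpr b, Pr c} \<in> \<beta>" "{b, b'} \<in> lower \<alpha>" "{Unpr b', Pr c'} \<in> \<beta>"
  shows "{c, c'} \<in> lower (brauer_mult \<alpha> \<beta>)"
  using mult_cup[OF flip_hom[OF \<beta>] flip_hom[OF \<alpha>] fin(3,2,1), of c b b' c'] assms(6-8)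
  by (simp add: flip_thr_iff flip_mult[OF \<alpha> \<beta> fin, symmetric])

lemma ex_matching_free:
  assumes "finite A" "P \<subseteq> A" "even (card (A - P))"
  obtains U where "matching A U" "A - \<Union>U = P"
proof -
  obtain U where U: "matching (A - P) U" "\<Union>U = A - P"
    using even_perfect_matching_exists[of "A - P"] assms by auto
  have "matching A U" using matching_mono[OF U(1)] by blast
  moreover have "A - \<Union>U = P" using U(2) assms(2) by blast
  ultimately show ?thesis using that by blast
qed

section \<open>Near-perfect matchings\<close>

definition near_perfect :: "'b set \<Rightarrow> 'b set set \<Rightarrow> bool" where
  "near_perfect A U \<longleftrightarrow> matching A U \<and> card (A - \<Union>U) = 1"

lemma near_perfectE:
  assumes "near_perfect A U"
  obtains z where "A - \<Union>U = {z}" "matching A U"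
  using assms unfolding near_perfect_def by (metis card_1_singletonE)

lemma matching_remove_pair:
  assumes "matching A U" "{x, y} \<in> U"
  shows "matching A (U - {{x, y}})" "A - \<Union>(U - {{x, y}}) = (A - \<Union>U) \<union> {x, y}"
proof -
  show "matching A (U - {{x, y}})"
    using assms(1) unfolding matching_def disjoint_def by auto
  have "z \<notin> {x, y}" if "z \<in> P" "P \<in> U - {{x, y}}" for z P
    using matching_block_eq[OF assms(1) _ assms(2), of P z] that by blast
  moreover have "x \<in> A" "y \<in> A" using assms unfolding matching_def by blast+
  ultimately show "A - \<Union>(U - {{x, y}}) = (A - \<Union>U) \<union> {x, y}" by blast
qed

text \<open>A move exchanges one block and thereby shifts the free point; the number of blocks of
  \<open>U\<close> outside \<open>W\<close> serves as the measure. No symmetry of \<open>R\<close>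
  is assumed, since the three points in \<open>move\<close> may be named in any order.\<close>

lemma near_perfect_connected:
  assumes fin: "finite A"
    and refl: "\<And>U. near_perfect A U \<Longrightarrow> R U U"
    and trans: "\<And>U V W. R U V \<Longrightarrow> R V W \<Longrightarrow> R U W"
    and move: "\<And>V u1 u2 u3. matching A V \<Longrightarrow> A - \<Union>V = {u1, u2, u3} \<Longrightarrow> distinct [u1, u2, u3] \<Longrightarrow>
      R (insert {u1, u2} V) (insert {u2, u3} V)"
    and U: "near_perfect A U" and W: "near_perfect A W"
  shows "R U W"
proof -
  obtain z' where z': "A - \<Union>W = {z'}" and mW: "matching A W"
    using near_perfectE[OF W] .
  \<comment> \<open>Removing the block \<open>{x, y}\<close> leaves the three free points
    \<open>y\<close>, \<open>x\<close>, \<open>z\<close>. The move then pairs \<open>x\<close> with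
    \<open>z\<close> and frees \<open>y\<close>.\<close>
  have slide: "R U (insert {x, z} (U - {{x, y}})) \<and> near_perfect A (insert {x, z} (U - {{x, y}})) \<and>
      A - \<Union>(insert {x, z} (U - {{x, y}})) = {y}"
    if "near_perfect A U" "A - \<Union>U = {z}" "{x, y} \<in> U" for U x y z
  proof -
    have mU: "matching A U" using that(1) unfolding near_perfect_def by simp
    note V = matching_remove_pair[OF mU that(3)]
    have "x \<noteq> y" using mU that(3) unfolding matching_def by force
    have "z \<notin> {x, y}" using that(2,3) by blast
    have V': "A - \<Union>(U - {{x, y}}) = {y, x, z}" using V(2) that(2) by blast
    have "R (insert {y, x} (U - {{x, y}})) (insert {x, z} (U - {{x, y}}))"
      using move[OF V(1) V'] \<open>x \<noteq> y\<close> \<open>z \<notin> {x, y}\<close> by auto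
    moreover have "insert {y, x} (U - {{x, y}}) = U"
      using that(3) by (auto simp: insert_commute)
    moreover have "A - \<Union>(insert {x, z} (U - {{x, y}})) = (A - \<Union>(U - {{x, y}})) - {x, z}"
      by blast
    then have free: "A - \<Union>(insert {x, z} (U - {{x, y}})) = {y}"
      unfolding V' using \<open>x \<noteq> y\<close> \<open>z \<notin> {x, y}\<close> by auto
    moreover have "matching A (insert {x, z} (U - {{x, y}}))"
    proof (rule matching_insert[OF V(1)])
      have "x \<in> A - \<Union>(U - {{x, y}})" "z \<in> A - \<Union>(U - {{x, y}})" unfolding V' by simp_all
      then show "x \<in> A" "z \<in> A" "x \<notin> \<Union>(U - {{x, y}})" "z \<notin> \<Union>(U - {{x, y}})" by simp_all
    qed (use \<open>z \<notin> {x, y}\<close> in auto)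
    ultimately show ?thesis unfolding near_perfect_def by simp
  qed
  \<comment> \<open>Since \<open>z\<close> is not free in \<open>W\<close>, it has a partner
    \<open>w\<close> there. Pairing \<open>z\<close> with \<open>w\<close> creates a block of
    \<open>W\<close> and destroys only \<open>{w, v}\<close>, which is not in \<open>W\<close>
    because the partner of \<open>w\<close> in \<open>W\<close> is \<open>z\<close>.\<close>
  have decr: "\<exists>U'. near_perfect A U' \<and> R U U' \<and> card (U' - W) < card (U - W)"
    if U: "near_perfect A U" "A - \<Union>U = {z}" "z \<noteq> z'" for U z
  proof -
    have mU: "matching A U" using U(1) unfolding near_perfect_def by simp
    have "z \<in> A" using U(2) by blast
    then have "z \<in> \<Union>W" using U(3) z' by blast
    then obtain w where w: "w \<noteq> z" "{z, w} \<in> W" "w \<in> A"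
      using matching_partnerE[OF mW] by metis
    then have "w \<in> \<Union>U" using U(2) by blast
    then obtain v where v: "v \<noteq> w" "{w, v} \<in> U"
      using matching_partnerE[OF mU] by metis
    have "v \<noteq> z" using v(2) U(2) by blast
    have "{w, v} \<notin> W"
      using matching_unique[OF mW, of w v z] w(2) \<open>v \<noteq> z\<close> by (auto simp: insert_commute)
    define U' where "U' = insert {w, z} (U - {{w, v}})"
    have "U' - W \<subseteq> (U - W) - {{w, v}}"
      using w(2) unfolding U'_def by (auto simp: insert_commute)
    then have "U' - W \<subset> U - W" using v(2) \<open>{w, v} \<notin> W\<close> by blast
    then have "card (U' - W) < card (U - W)"
      using matching_finite[OF fin mU] by (intro psubset_card_mono) auto
    then show ?thesis
      using slide[OF U(1,2) v(2)] unfolding U'_def by blast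
  qed
  show ?thesis
    using U
  proof (induction "card (U - W)" arbitrary: U rule: less_induct)
    case less
    obtain z where z: "A - \<Union>U = {z}" and mU: "matching A U"
      using near_perfectE[OF less.prems] .
    consider "U = W" | "U \<noteq> W" "z \<noteq> z'" | "U \<noteq> W" "z = z'" by blast
    then show ?case
    proof cases
      case 1
      then show ?thesis using refl[OF W] by simp
    next
      case 2
      then show ?thesis using decr[OF less.prems z] less.hyps trans by blast
    next
      \<comment> \<open>The free points agree, so \<open>decr\<close> does not apply directly.
        Breaking a block \<open>{x, y}\<close> outside \<open>W\<close> moves the free point to
        \<open>y\<close> without raising the measure, and the following \<open>decr\<close> lowers
        it.\<close>
      case 3
      have "\<Union>W = \<Union>U"
        using z z' 3 mU mW unfolding matching_def by blast
      then have "\<not> U \<subseteq> W"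
        using perfect_subset_eq[OF mU mW] 3(1) by blast
      then obtain P where P: "P \<in> U" "P \<notin> W" by blast
      then obtain x y where xy: "{x, y} \<in> U" "{x, y} \<notin> W" "x \<noteq> y"
        using matching_pairE[OF mU] by metis
      define U1 where "U1 = insert {x, z} (U - {{x, y}})"
      have U1: "R U U1" "near_perfect A U1" "A - \<Union>U1 = {y}"
        using slide[OF less.prems z xy(1)] unfolding U1_def by auto
      have "y \<noteq> z'" using xy(1) z 3(2) by blast
      then obtain U2 where U2: "near_perfect A U2" "R U1 U2" "card (U2 - W) < card (U1 - W)"
        using decr[OF U1(2,3)] by blast
      have finU: "finite U" using matching_finite[OF fin mU] .
      have "U1 - W \<subseteq> insert {x, z} ((U - W) - {{x, y}})" unfolding U1_def by blast
      then have "card (U1 - W) \<le> card (insert {x, z} ((U - W) - {{x, y}}))"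
        using finU by (intro card_mono) auto
      also have "\<dots> \<le> Suc (card ((U - W) - {{x, y}}))"
        by (rule card_insert_le_m1) auto
      also have "\<dots> = card (U - W)"
        using finU xy by (intro card_Suc_Diff1) auto
      finally have "card (U2 - W) < card (U - W)" using U2(3) by linarith
      then show ?thesis using less.hyps[OF _ U2(1)] U1(1) U2(2) trans by blast
    qed
  qed
qed

section \<open>Congruences on ideals of the Brauer category\<close>

abbreviation bmult :: "'a diagram \<Rightarrow> 'a diagram \<Rightarrow> 'a diagram"  (infixl \<open>\<cdot>\<close> 70) where
  "\<alpha> \<cdot> \<beta> \<equiv> brauer_mult \<alpha> \<beta>"

lemma brauer_I_sel [simp]:
  "carrier (brauer_I \<C> r) = brauer_ideal \<C> r" "pdom (brauer_I \<C> r) = bdom"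
  "pran (brauer_I \<C> r) = bran" "pmult (brauer_I \<C> r) = brauer_mult"
  by (simp_all add: brauer_I_def brauer_def)

lemma brauer_sel [simp]:
  "carrier (brauer \<C>) = (\<Union>A\<in>\<C>. \<Union>B\<in>\<C>. brauer_hom A B)" "pdom (brauer \<C>) = bdom"
  "pran (brauer \<C>) = bran" "pmult (brauer \<C>) = brauer_mult"
  by (simp_all add: brauer_def)

lemma brauer_ideal_iff:
  "\<alpha> \<in> brauer_ideal \<C> r \<longleftrightarrow>
    (\<exists>A\<in>\<C>. \<exists>B\<in>\<C>. \<alpha> \<in> brauer_hom A B) \<and> enat (brank \<alpha>) \<le> r"
  by (simp add: brauer_ideal_def)

lemma brauer_idealI:
  "A \<in> \<C> \<Longrightarrow> B \<in> \<C> \<Longrightarrow> \<alpha> \<in> brauer_hom A B \<Longrightarrow> enat (brank \<alpha>) \<le> r \<Longrightarrow> \<alpha> \<in> brauer_ideal \<C> r"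
  by (auto simp: brauer_ideal_iff)

lemma brauer_idealE:
  assumes "\<alpha> \<in> brauer_ideal \<C> r"
  obtains A B where "A \<in> \<C>" "B \<in> \<C>" "\<alpha> \<in> brauer_hom A B" "enat (brank \<alpha>) \<le> r"
  using assms by (auto simp: brauer_ideal_iff)

definition flip_rel :: "'a diagram rel \<Rightarrow> 'a diagram rel" where
  "flip_rel \<sigma> = {(\<alpha>, \<beta>). (flip \<alpha>, flip \<beta>) \<in> \<sigma>}"

lemma flip_rel_iff [simp]: "(\<alpha>, \<beta>) \<in> flip_rel \<sigma> \<longleftrightarrow> (flip \<alpha>, flip \<beta>) \<in> \<sigma>"
  by (simp add: flip_rel_def)

locale odd_objects =
  fixes \<C> :: "'a set set"
  assumes odd_sets: "\<And>A. A \<in> \<C> \<Longrightarrow> finite A \<and> odd (card A)"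
begin

lemma fin: "A \<in> \<C> \<Longrightarrow> finite A" and odd_card: "A \<in> \<C> \<Longrightarrow> odd (card A)"
  using odd_sets by blast+

lemma mult_hom:
  "A \<in> \<C> \<Longrightarrow> B \<in> \<C> \<Longrightarrow> C \<in> \<C> \<Longrightarrow> \<alpha> \<in> brauer_hom A B \<Longrightarrow> \<beta> \<in> brauer_hom B C \<Longrightarrow>
    \<alpha> \<cdot> \<beta> \<in> brauer_hom A C"
  using brauer_mult_hom fin by metis

lemma odd_rank: "A \<in> \<C> \<Longrightarrow> \<alpha> \<in> brauer_hom A B \<Longrightarrow> odd (brank \<alpha>)"
  using odd_brank odd_sets by metis

lemma rank_pos: "A \<in> \<C> \<Longrightarrow> \<alpha> \<in> brauer_hom A B \<Longrightarrow> 1 \<le> brank \<alpha>"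
  using odd_rank by (metis One_nat_def Suc_leI odd_pos)

lemma mult_ideal:
  assumes "A \<in> \<C>" "B \<in> \<C>" "C \<in> \<C>" "\<alpha> \<in> brauer_hom A B" "\<beta> \<in> brauer_hom B C"
    and "enat (brank \<alpha>) \<le> r \<or> enat (brank \<beta>) \<le> r"
  shows "\<alpha> \<cdot> \<beta> \<in> brauer_ideal \<C> r"
proof (rule brauer_idealI[OF assms(1,3)])
  show "\<alpha> \<cdot> \<beta> \<in> brauer_hom A C" using mult_hom assms by blast
  have "brank (\<alpha> \<cdot> \<beta>) \<le> brank \<alpha>" "brank (\<alpha> \<cdot> \<beta>) \<le> brank \<beta>"
    using brank_mult_left brank_mult_right assms fin by metis+
  then have "enat (brank (\<alpha> \<cdot> \<beta>)) \<le> enat (brank \<alpha>)" "enat (brank (\<alpha> \<cdot> \<beta>)) \<le> enat (brank \<beta>)"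
    by simp_all
  then show "enat (brank (\<alpha> \<cdot> \<beta>)) \<le> r" using assms(6) order_trans by blast
qed

lemma Cong_iff:
  "\<sigma> \<in> Cong (brauer_I \<C> r) \<longleftrightarrow>
    equiv (brauer_ideal \<C> r) \<sigma> \<and>
    (\<forall>\<alpha> \<beta>. (\<alpha>, \<beta>) \<in> \<sigma> \<longrightarrow> bdom \<alpha> = bdom \<beta> \<and> bran \<alpha> = bran \<beta>) \<and>
    (\<forall>\<alpha> \<beta>. (\<alpha>, \<beta>) \<in> \<sigma> \<longrightarrow> (\<forall>s\<in>brauer_ideal \<C> r.
       (bran s = bdom \<alpha> \<longrightarrow> (s \<cdot> \<alpha>, s \<cdot> \<beta>) \<in> \<sigma>) \<and> (bran \<alpha> = bdom s \<longrightarrow> (\<alpha> \<cdot> s, \<beta> \<cdot> s) \<in> \<sigma>)))"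
  (is "_ \<longleftrightarrow> ?E \<and> ?D \<and> ?M")
proof -
  have ball: "(\<forall>(x, y)\<in>\<sigma>. P x y) \<longleftrightarrow> (\<forall>x y. (x, y) \<in> \<sigma> \<longrightarrow> P x y)" for P by auto
  have "\<sigma> \<subseteq> psg_sim (brauer_I \<C> r) \<longleftrightarrow> ?D" if "?E"
    using equiv_type[OF that] unfolding psg_sim_def subset_iff split_paired_All by auto
  then show ?thesis
    unfolding Cong_def mem_Collect_eq ball brauer_I_sel by blast
qed

lemma flip_ideal [simp]: "flip \<alpha> \<in> brauer_ideal \<C> r \<longleftrightarrow> \<alpha> \<in> brauer_ideal \<C> r"
proof -
  have "flip \<alpha> \<in> brauer_ideal \<C> r" if "\<alpha> \<in> brauer_ideal \<C> r" for \<alpha>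
    using that flip_hom by (fastforce simp: brauer_ideal_iff)
  then show ?thesis by (metis flip_flip)
qed

lemma bdom_flip: "\<alpha> \<in> brauer_ideal \<C> r \<Longrightarrow> bdom (flip \<alpha>) = bran \<alpha>"
  and bran_flip: "\<alpha> \<in> brauer_ideal \<C> r \<Longrightarrow> bran (flip \<alpha>) = bdom \<alpha>"
  using bdom_hom[OF flip_hom] bran_hom[OF flip_hom] by (auto elim!: brauer_idealE)

lemma flip_mult_ideal:
  assumes "\<alpha> \<in> brauer_ideal \<C> r" "\<beta> \<in> brauer_ideal \<C> r" "bran \<alpha> = bdom \<beta>"
  shows "flip (\<alpha> \<cdot> \<beta>) = flip \<beta> \<cdot> flip \<alpha>"
  using assms(3) by (rule_tac brauer_idealE[OF assms(1)], rule_tac brauer_idealE[OF assms(2)])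
    (simp add: flip_mult fin)

lemma flip_rel_Cong:
  assumes "\<sigma> \<in> Cong (brauer_I \<C> r)"
  shows "flip_rel \<sigma> \<in> Cong (brauer_I \<C> r)"
proof -
  have E: "equiv (brauer_ideal \<C> r) \<sigma>"
    and D: "\<And>\<alpha> \<beta>. (\<alpha>, \<beta>) \<in> \<sigma> \<Longrightarrow> bdom \<alpha> = bdom \<beta> \<and> bran \<alpha> = bran \<beta>"
    and L: "\<And>\<alpha> \<beta> s. (\<alpha>, \<beta>) \<in> \<sigma> \<Longrightarrow> s \<in> brauer_ideal \<C> r \<Longrightarrow> bran s = bdom \<alpha> \<Longrightarrow> (s \<cdot> \<alpha>, s \<cdot> \<beta>) \<in> \<sigma>"
    and R: "\<And>\<alpha> \<beta> s. (\<alpha>, \<beta>) \<in> \<sigma> \<Longrightarrow> s \<in> brauer_ideal \<C> r \<Longrightarrow> bran \<alpha> = bdom s \<Longrightarrow> (\<alpha> \<cdot> s, \<beta> \<cdot> s) \<in> \<sigma>"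
    using assms unfolding Cong_iff by blast+
  note sub = equiv_type[OF E]
  have mem: "\<alpha> \<in> brauer_ideal \<C> r" "\<beta> \<in> brauer_ideal \<C> r" if "(flip \<alpha>, flip \<beta>) \<in> \<sigma>" for \<alpha> \<beta>
    using that sub by auto
  have "equiv (brauer_ideal \<C> r) (flip_rel \<sigma>)"
  proof (rule equivI)
    show "flip_rel \<sigma> \<subseteq> brauer_ideal \<C> r \<times> brauer_ideal \<C> r"
      using mem by auto
    show "refl_on (brauer_ideal \<C> r) (flip_rel \<sigma>)"
      using E by (auto simp: refl_on_def equiv_def)
    show "sym (flip_rel \<sigma>)"
      using E by (auto simp: sym_def equiv_def)
    show "trans (flip_rel \<sigma>)"
      using E unfolding trans_def equiv_def by (auto; blast)
  qed
  moreover have "bdom \<alpha> = bdom \<beta> \<and> bran \<alpha> = bran \<beta>" if "(flip \<alpha>, flip \<beta>) \<in> \<sigma>" for \<alpha> \<beta>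
    using D[OF that] mem[OF that] bdom_flip bran_flip by metis
  moreover have "(flip (s \<cdot> \<alpha>), flip (s \<cdot> \<beta>)) \<in> \<sigma>"
    if "(flip \<alpha>, flip \<beta>) \<in> \<sigma>" "s \<in> brauer_ideal \<C> r" "bran s = bdom \<alpha>" for \<alpha> \<beta> s
    using R[OF that(1), of "flip s"] that D[OF that(1)] mem[OF that(1)]
      flip_mult_ideal bdom_flip bran_flip by (metis flip_ideal)
  moreover have "(flip (\<alpha> \<cdot> s), flip (\<beta> \<cdot> s)) \<in> \<sigma>"
    if "(flip \<alpha>, flip \<beta>) \<in> \<sigma>" "s \<in> brauer_ideal \<C> r" "bran \<alpha> = bdom s" for \<alpha> \<beta> s
    using L[OF that(1), of "flip s"] that D[OF that(1)] mem[OF that(1)]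
      flip_mult_ideal bdom_flip bran_flip by (metis flip_ideal)
  ultimately show ?thesis unfolding Cong_iff flip_rel_iff by blast
qed

end

text \<open>The bound \<open>3 \<le> r\<close> admits multipliers of rank 3, which carry three
  points at once to prescribed places. Elementary moves between matchings need exactly this, so the
  minimal ideal is treated apart.\<close>

locale brauer_cong = odd_objects \<C> for \<C> :: "'a set set" +
  fixes r :: enat and \<sigma> :: "'a diagram rel"
  assumes r3: "3 \<le> r" and cong: "\<sigma> \<in> Cong (brauer_I \<C> r)"
begin

lemma flip_cong: "brauer_cong \<C> r (flip_rel \<sigma>)"
  using r3 flip_rel_Cong[OF cong] by unfold_locales

lemma cong_equiv: "equiv (brauer_ideal \<C> r) \<sigma>"
  using cong unfolding Cong_iff by simp

lemma cong_refl: "\<alpha> \<in> brauer_ideal \<C> r \<Longrightarrow> (\<alpha>, \<alpha>) \<in> \<sigma>"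
  using cong_equiv unfolding equiv_def refl_on_def by blast

lemma cong_sym: "(\<alpha>, \<beta>) \<in> \<sigma> \<Longrightarrow> (\<beta>, \<alpha>) \<in> \<sigma>"
  using cong_equiv by (meson equivE symD)

lemma cong_trans: "(\<alpha>, \<beta>) \<in> \<sigma> \<Longrightarrow> (\<beta>, \<gamma>) \<in> \<sigma> \<Longrightarrow> (\<alpha>, \<gamma>) \<in> \<sigma>"
  using cong_equiv by (meson equivE transD)

lemma cong_mem: "(\<alpha>, \<beta>) \<in> \<sigma> \<Longrightarrow> \<alpha> \<in> brauer_ideal \<C> r \<and> \<beta> \<in> brauer_ideal \<C> r"
  using equiv_type[OF cong_equiv] by blast

lemma cong_rank: "(\<alpha>, \<beta>) \<in> \<sigma> \<Longrightarrow> enat (brank \<alpha>) \<le> r \<and> enat (brank \<beta>) \<le> r"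
  using cong_mem brauer_ideal_iff by blast

lemma cong_homE:
  assumes "(\<alpha>, \<beta>) \<in> \<sigma>"
  obtains A B where "A \<in> \<C>" "B \<in> \<C>" "\<alpha> \<in> brauer_hom A B" "\<beta> \<in> brauer_hom A B"
proof -
  have "bdom \<alpha> = bdom \<beta>" "bran \<alpha> = bran \<beta>"
    using cong assms unfolding Cong_iff by auto
  then show ?thesis
    using cong_mem[OF assms] that by (auto simp: brauer_ideal_iff)
qed

lemma cong_left:
  assumes "(\<alpha>, \<beta>) \<in> \<sigma>" "A' \<in> \<C>" "A \<in> \<C>" "\<alpha> \<in> brauer_hom A B" "s \<in> brauer_hom A' A" "enat (brank s) \<le> r"
  shows "(s \<cdot> \<alpha>, s \<cdot> \<beta>) \<in> \<sigma>"
proof -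
  have "s \<in> brauer_ideal \<C> r" "bran s = bdom \<alpha>"
    using assms by (auto simp: brauer_ideal_iff)
  then show ?thesis using cong assms(1) unfolding Cong_iff by blast
qed

lemma cong_right:
  assumes "(\<alpha>, \<beta>) \<in> \<sigma>" "B \<in> \<C>" "B' \<in> \<C>" "\<alpha> \<in> brauer_hom A B" "s \<in> brauer_hom B B'" "enat (brank s) \<le> r"
  shows "(\<alpha> \<cdot> s, \<beta> \<cdot> s) \<in> \<sigma>"
proof -
  have "s \<in> brauer_ideal \<C> r" "bran \<alpha> = bdom s"
    using assms by (auto simp: brauer_ideal_iff)
  then show ?thesis using cong assms(1) unfolding Cong_iff by blast
qed

lemma one_le_r: "enat 1 \<le> r"
proof -
  have "enat 1 \<le> 3" by (simp add: numeral_eq_enat)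
  then show ?thesis using r3 by (rule order_trans)
qed

lemma rank_le_r: "q \<le> 3 \<Longrightarrow> enat q \<le> r"
proof -
  assume "q \<le> 3"
  then have "enat q \<le> 3" by (simp add: numeral_eq_enat)
  then show ?thesis using r3 by (rule order_trans)
qed

end

context odd_objects
begin

text \<open>A near-perfect matching cannot grow inside an odd object, since the rank would fall
  below 1.\<close>

lemma near_perfect_upper:
  assumes "A \<in> \<C>" "\<alpha> \<in> brauer_hom A B" "near_perfect A U" "U \<subseteq> upper \<alpha>"
  shows "upper \<alpha> = U" "brank \<alpha> = 1"
proof -
  have U: "matching A U" "card (A - \<Union>U) = 1" using assms(3) unfolding near_perfect_def by auto
  have "U = upper \<alpha>"
    using upper_eq_if_subset[OF fin[OF assms(1)] U(1) matching_upper[OF assms(2)] assms(4)] U(2)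
      rank_pos[OF assms(1,2)] brank_upper[OF assms(2)] by simp
  then show "upper \<alpha> = U" "brank \<alpha> = 1"
    using U(2) brank_upper[OF assms(2)] by auto
qed

lemma near_perfect_lower:
  assumes "B \<in> \<C>" "\<alpha> \<in> brauer_hom A B" "near_perfect B L" "L \<subseteq> lower \<alpha>"
  shows "lower \<alpha> = L" "brank \<alpha> = 1"
proof -
  have "L \<subseteq> upper (flip \<alpha>)" using assms(4) by simp
  from near_perfect_upper[OF assms(1) flip_hom[OF assms(2)] assms(3) this]
  show "lower \<alpha> = L" "brank \<alpha> = 1"
    unfolding upper_flip brank_flip[OF assms(2)] .
qed

lemma rank_one_upper: "\<alpha> \<in> brauer_hom A B \<Longrightarrow> brank \<alpha> = 1 \<longleftrightarrow> near_perfect A (upper \<alpha>)"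
  using brank_upper[of \<alpha> A B] matching_upper[of \<alpha> A B] unfolding near_perfect_def by simp

lemma rank_one_lower: "\<alpha> \<in> brauer_hom A B \<Longrightarrow> brank \<alpha> = 1 \<longleftrightarrow> near_perfect B (lower \<alpha>)"
  using brank_lower[of \<alpha> A B] matching_lower[of \<alpha> A B] unfolding near_perfect_def by simp

lemma ex_rank_one:
  assumes "near_perfect A U" "near_perfect B L"
  obtains \<epsilon> where "\<epsilon> \<in> brauer_hom A B" "upper \<epsilon> = U" "lower \<epsilon> = L" "brank \<epsilon> = 1"
proof -
  obtain y where y: "A - \<Union>U = {y}" "matching A U" using near_perfectE[OF assms(1)] .
  obtain z where z: "B - \<Union>L = {z}" "matching B L" using near_perfectE[OF assms(2)] .
  have f: "bij_betw (\<lambda>_. z) (A - \<Union>U) (B - \<Union>L)"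
    unfolding y(1) z(1) by (simp add: bij_betw_def)
  show ?thesis
    using that[OF diag_hom[OF y(2) z(2) f] upper_diag[OF y(2) z(2) f] lower_diag[OF y(2) z(2) f]]
      brank_diag[OF y(2) z(2) f] y(1) by simp
qed

lemma ex_near_perfect:
  assumes "A \<in> \<C>" "matching A V" "z \<in> A - \<Union>V"
  obtains U where "near_perfect A U" "V \<subseteq> U" "A - \<Union>U = {z}"
proof -
  have fA: "finite A" using fin[OF assms(1)] .
  have "\<Union>V \<subseteq> A" using assms(2) unfolding matching_def by blast
  have "odd (card (A - \<Union>V))"
    using matching_card_free[OF fA assms(2)] odd_card[OF assms(1)]
    by (metis dvd_triv_left even_add)
  then have "even (card (A - \<Union>V - {z}))"
    using assms(3) fA by (simp add: card_Diff_singleton)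
  then obtain W where W: "matching (A - \<Union>V - {z}) W" "\<Union>W = A - \<Union>V - {z}"
    using even_perfect_matching_exists[of "A - \<Union>V - {z}"] fA by auto
  have "matching A (V \<union> W)"
    by (rule matching_Un[OF assms(2) matching_mono[OF W(1)]]) (use W(2) in auto)
  moreover have "A - \<Union>(V \<union> W) = {z}"
    using W(2) assms(3) \<open>\<Union>V \<subseteq> A\<close> by auto
  ultimately show ?thesis using that[of "V \<union> W"] unfolding near_perfect_def by simp
qed

lemma ex_near_perfect_plain:
  assumes "A \<in> \<C>"
  obtains U where "near_perfect A U"
proof -
  obtain z where "z \<in> A" using odd_card[OF assms] by (metis card.empty even_zero equals0I)
  then have "z \<in> A - \<Union>{}" by simp
  from ex_near_perfect[OF assms matching_empty this] show ?thesis using that by metis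
qed

end

lemma three_subset:
  assumes "3 \<le> card F"
  obtains a b c where "a \<in> F" "b \<in> F" "c \<in> F" "distinct [a, b, c]"
proof -
  obtain T where T: "T \<subseteq> F" "card T = 3"
    using obtain_subset_with_card_n[OF assms] by blast
  then obtain a b c where "T = {a, b, c}" "distinct [a, b, c]"
    by (auto simp: card_3_iff)
  then show ?thesis using T that by blast
qed

section \<open>Consequences of related pairs in rank one\<close>

context brauer_cong
begin

text \<open>Multiplying by \<open>s\<close> on the left and \<open>t\<close> on the right turns the
  given pair into an elementary move. The strands of \<open>s\<close> lead three free points
  \<open>u1\<close>, \<open>u2\<close>, \<open>u3\<close> to \<open>b\<close>, \<open>a1\<close>,
  \<open>a2\<close>, where \<open>\<alpha>\<close> has the block \<open>{b, a1}\<close> and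
  \<open>\<beta>\<close> the block \<open>{a1, a2}\<close>. The products then contain
  \<open>{u1, u2}\<close> and \<open>{u2, u3}\<close>, and \<open>near_perfect_connected\<close>
  chains such moves.\<close>

lemma rank_one_upper_collapse:
  assumes \<sigma>: "(\<alpha>, \<beta>) \<in> \<sigma>" and rk: "brank \<alpha> = 1" "brank \<beta> = 1" and ne: "upper \<alpha> \<noteq> upper \<beta>"
    and obj: "A' \<in> \<C>" "B' \<in> \<C>" and \<gamma>: "\<gamma> \<in> brauer_hom A' B'" "brank \<gamma> = 1"
    and \<delta>: "\<delta> \<in> brauer_hom A' B'" "brank \<delta> = 1" and lo: "lower \<gamma> = lower \<delta>"
  shows "(\<gamma>, \<delta>) \<in> \<sigma>"
proof -
  obtain A B where AB: "A \<in> \<C>" "B \<in> \<C>" and \<alpha>: "\<alpha> \<in> brauer_hom A B" and \<beta>: "\<beta> \<in> brauer_hom A B"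
    using cong_homE[OF \<sigma>] .
  note fA = fin[OF AB(1)] and fB = fin[OF AB(2)] and fA' = fin[OF obj(1)] and fB' = fin[OF obj(2)]
  have npa: "near_perfect A (upper \<alpha>)" and npb: "near_perfect A (upper \<beta>)"
    using rk rank_one_upper \<alpha> \<beta> by blast+
  obtain z where z: "A - \<Union>(upper \<alpha>) = {z}" using near_perfectE[OF npa] by metis
  have "\<not> upper \<beta> \<subseteq> upper \<alpha>"
    using near_perfect_upper[OF AB(1) \<alpha> npb] ne by blast
  then obtain P where P: "P \<in> upper \<beta>" "P \<notin> upper \<alpha>" by blast
  obtain p q where pq: "p \<noteq> q" "P = {p, q}"
    using matching_pairE[OF matching_upper[OF \<beta>] P(1)] .
  have "p \<in> A" "q \<in> A" using P(1) pq matching_upper[OF \<beta>] unfolding matching_def by blast+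
  \<comment> \<open>The only free point \<open>z\<close> of \<open>\<alpha>\<close> is at most one
    end of \<open>P\<close>; the other end, named \<open>a1\<close>, has a partner in
    \<open>\<alpha>\<close>.\<close>
  have "\<exists>a1 a2. {a1, a2} = P \<and> a1 \<noteq> a2 \<and> a1 \<in> \<Union>(upper \<alpha>)"
  proof (cases "p = z")
    case True
    then have "q \<notin> A - \<Union>(upper \<alpha>)" using pq(1) z by simp
    then have "q \<in> \<Union>(upper \<alpha>)" using \<open>q \<in> A\<close> by blast
    then show ?thesis using pq by (metis insert_commute)
  next
    case False
    then have "p \<notin> A - \<Union>(upper \<alpha>)" using z by simp
    then have "p \<in> \<Union>(upper \<alpha>)" using \<open>p \<in> A\<close> by blast
    then show ?thesis using pq by blast
  qed
  then obtain a1 a2 where a: "{a1, a2} \<in> upper \<beta>" "{a1, a2} \<notin> upper \<alpha>" "a1 \<noteq> a2" "a1 \<in> \<Union>(upper \<alpha>)"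
    "a1 \<in> A" "a2 \<in> A"
    using P pq \<open>p \<in> A\<close> \<open>q \<in> A\<close> by (metis insertCI insertE singletonD)
  obtain b where b: "b \<noteq> a1" "{a1, b} \<in> upper \<alpha>" "b \<in> A"
    using matching_partnerE[OF matching_upper[OF \<alpha>] a(4)] by metis
  have "b \<noteq> a2" using a(2) b(2) by blast
  have "card {b, a1, a2} = 3" using a(3) b(1) \<open>b \<noteq> a2\<close> by simp
  \<comment> \<open>An odd set without three points is even, so \<open>W\<close> can match all the
    rest and leave exactly these three points to the strands of \<open>s\<close>.\<close>
  then have "even (card (A - {b, a1, a2}))"
    using odd_card[OF AB(1)] a b fA card_mono[OF fA, of "{b, a1, a2}"]
    by (subst card_Diff_subset) auto
  then obtain W where W: "matching A W" "A - \<Union>W = {b, a1, a2}"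
    using ex_matching_free[OF fA, of "{b, a1, a2}"] a b by auto
  obtain T where T: "near_perfect B T" using ex_near_perfect_plain[OF AB(2)] .
  have npL: "near_perfect B' (lower \<gamma>)" using rank_one_lower \<gamma> by blast
  \<comment> \<open>A right factor of rank 1 imposes its own lower matching on every product, here
    the common one of \<open>\<gamma>\<close> and \<open>\<delta>\<close>.\<close>
  obtain t where t: "t \<in> brauer_hom B B'" "lower t = lower \<gamma>" "brank t = 1"
    using ex_rank_one[OF T npL] by metis
  obtain y where y: "B' - \<Union>(lower \<gamma>) = {y}" "matching B' (lower \<gamma>)" using near_perfectE[OF npL] .
  \<comment> \<open>By \<open>rank_one_eqI\<close> only one diagram fits the description, so the
    choice is determined and upper matchings can stand for diagrams.\<close>
  define elt where "elt U = (SOME \<epsilon>. \<epsilon> \<in> brauer_hom A' B' \<and> upper \<epsilon> = U \<and> lower \<epsilon> = lower \<gamma> \<and> brank \<epsilon> = 1)" for U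
  have elt: "elt U \<in> brauer_hom A' B' \<and> upper (elt U) = U \<and> lower (elt U) = lower \<gamma> \<and> brank (elt U) = 1"
    if "near_perfect A' U" for U
    unfolding elt_def by (rule someI_ex) (metis ex_rank_one[OF that npL])
  have eltI: "\<epsilon> = elt U" if "\<epsilon> \<in> brauer_hom A' B'" "near_perfect A' U" "upper \<epsilon> = U" "lower \<epsilon> = lower \<gamma>" for \<epsilon> U
  proof (rule rank_one_eqI[OF that(1)])
    show "brank \<epsilon> = 1" using rank_one_upper[OF that(1)] that(2,3) by blast
  qed (use elt[OF that(2)] that(3,4) in metis)+
  have "(elt (upper \<gamma>), elt (upper \<delta>)) \<in> \<sigma>"
  proof (rule near_perfect_connected[OF fA', where R = "\<lambda>U V. (elt U, elt V) \<in> \<sigma>"])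
    show "near_perfect A' (upper \<gamma>)" "near_perfect A' (upper \<delta>)"
      using rank_one_upper \<gamma> \<delta> by blast+
    show "(elt U, elt U) \<in> \<sigma>" if "near_perfect A' U" for U
      using elt[OF that] one_le_r by (intro cong_refl brauer_idealI[OF obj]) auto
    show "(elt U, elt W) \<in> \<sigma>" if "(elt U, elt V) \<in> \<sigma>" "(elt V, elt W) \<in> \<sigma>" for U V W
      using cong_trans that by blast
  next
    fix V u1 u2 u3
    assume V: "matching A' V" "A' - \<Union>V = {u1, u2, u3}" "distinct [u1, u2, u3]"
    define f where "f u = (if u = u1 then b else if u = u2 then a1 else a2)" for u
    have f: "bij_betw f (A' - \<Union>V) (A - \<Union>W)"
      unfolding V(2) W(2) f_def bij_betw_def inj_on_def using V(3) a(3) b(1) \<open>b \<noteq> a2\<close> by auto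
    define s where "s = diag A' V W f"
    have s: "s \<in> brauer_hom A' A" unfolding s_def by (rule diag_hom[OF V(1) W(1) f])
    have "brank s = 3"
      unfolding s_def brank_diag[OF V(1) W(1) f] V(2) using V(3) by simp
    then have rs: "enat (brank s) \<le> r" using rank_le_r by simp
    have us: "upper s = V" unfolding s_def by (rule upper_diag[OF V(1) W(1) f])
    have fs: "{Unpr u1, Pr b} \<in> s" "{Unpr u2, Pr a1} \<in> s" "{Unpr u3, Pr a2} \<in> s"
      using diag_thr[of u1 A' V f W] diag_thr[of u2 A' V f W] diag_thr[of u3 A' V f W] V(2,3)
      unfolding s_def f_def by auto
    note s\<alpha> = mult_hom[OF obj(1) AB s \<alpha>] and s\<beta> = mult_hom[OF obj(1) AB s \<beta>]
    have "{u1, u2} \<in> upper (s \<cdot> \<alpha>)"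
      using b(2) by (intro mult_cup[OF s \<alpha> fA' fA fB fs(1) _ fs(2)]) (simp add: insert_commute)
    moreover have "{u2, u3} \<in> upper (s \<cdot> \<beta>)"
      using a(1) by (intro mult_cup[OF s \<beta> fA' fA fB fs(2) _ fs(3)])
    ultimately have up: "insert {u1, u2} V \<subseteq> upper (s \<cdot> \<alpha> \<cdot> t)" "insert {u2, u3} V \<subseteq> upper (s \<cdot> \<beta> \<cdot> t)"
      using mult_upper[OF s \<alpha> fA' fA fB] mult_upper[OF s \<beta> fA' fA fB] us
        mult_upper[OF s\<alpha> t(1) fA' fB fB'] mult_upper[OF s\<beta> t(1) fA' fB fB'] by blast+
    have np: "near_perfect A' (insert {u, v} V)" if "{u, v} \<subseteq> {u1, u2, u3}" "u \<noteq> v" for u v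
    proof -
      have uv: "u \<in> A' - \<Union>V" "v \<in> A' - \<Union>V" unfolding V(2) using that by blast+
      have "matching A' (insert {u, v} V)"
        using uv that(2) by (intro matching_insert[OF V(1)]) auto
      moreover have "A' - \<Union>(insert {u, v} V) = (A' - \<Union>V) - {u, v}" by blast
      moreover have "card ({u1, u2, u3} - {u, v}) = 1"
        using that V(3) by (subst card_Diff_subset) auto
      ultimately show ?thesis unfolding near_perfect_def V(2) by simp
    qed
    have np1: "near_perfect A' (insert {u1, u2} V)" and np2: "near_perfect A' (insert {u2, u3} V)"
      using np[of u1 u2] np[of u2 u3] V(3) by auto
    have lo_t: "lower \<gamma> \<subseteq> lower (s \<cdot> \<alpha> \<cdot> t)" "lower \<gamma> \<subseteq> lower (s \<cdot> \<beta> \<cdot> t)"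
      using mult_lower[OF s\<alpha> t(1) fA' fB fB'] mult_lower[OF s\<beta> t(1) fA' fB fB'] t(2) by auto
    note hm = mult_hom[OF obj(1) AB(2) obj(2) s\<alpha> t(1)] mult_hom[OF obj(1) AB(2) obj(2) s\<beta> t(1)]
    have "s \<cdot> \<alpha> \<cdot> t = elt (insert {u1, u2} V)" "s \<cdot> \<beta> \<cdot> t = elt (insert {u2, u3} V)"
      by (rule eltI[OF hm(1) np1 near_perfect_upper(1)[OF obj(1) hm(1) np1 up(1)]
            near_perfect_lower(1)[OF obj(2) hm(1) npL lo_t(1)]])
        (rule eltI[OF hm(2) np2 near_perfect_upper(1)[OF obj(1) hm(2) np2 up(2)]
            near_perfect_lower(1)[OF obj(2) hm(2) npL lo_t(2)]])
    moreover have "(s \<cdot> \<alpha> \<cdot> t, s \<cdot> \<beta> \<cdot> t) \<in> \<sigma>"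
      using cong_right[OF cong_left[OF \<sigma> obj(1) AB(1) \<alpha> s rs] AB(2) obj(2) s\<alpha> t(1)] t(3) one_le_r by simp
    ultimately show "(elt (insert {u1, u2} V), elt (insert {u2, u3} V)) \<in> \<sigma>" by simp
  qed
  moreover have "\<gamma> = elt (upper \<gamma>)" "\<delta> = elt (upper \<delta>)"
    using eltI[OF \<gamma>(1) _ refl refl] eltI[OF \<delta>(1) _ refl lo[symmetric]] \<gamma> \<delta> rank_one_upper by blast+
  ultimately show ?thesis by simp
qed

lemma rank_one_lower_collapse:
  assumes "(\<alpha>, \<beta>) \<in> \<sigma>" "brank \<alpha> = 1" "brank \<beta> = 1" "lower \<alpha> \<noteq> lower \<beta>"
    and "A' \<in> \<C>" "B' \<in> \<C>" "\<gamma> \<in> brauer_hom A' B'" "brank \<gamma> = 1"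
    and "\<delta> \<in> brauer_hom A' B'" "brank \<delta> = 1" and "upper \<gamma> = upper \<delta>"
  shows "(\<gamma>, \<delta>) \<in> \<sigma>"
proof -
  interpret flip: brauer_cong \<C> r "flip_rel \<sigma>" by (rule flip_cong)
  obtain A B where AB: "\<alpha> \<in> brauer_hom A B" "\<beta> \<in> brauer_hom A B"
    using cong_homE[OF assms(1)] by metis
  have "(flip \<gamma>, flip \<delta>) \<in> flip_rel \<sigma>"
    by (rule flip.rank_one_upper_collapse[of "flip \<alpha>" "flip \<beta>" B' A'])
      (use assms AB in auto)
  then show ?thesis by simp
qed

text \<open>Says that \<open>\<sigma>\<close> contains the congruence \<open>R_cong\<close> of the
  ideal of all diagrams of rank at most \<open>q\<close>, as far as they lie in the carrier.\<close>

definition collapsed :: "nat \<Rightarrow> bool" where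
  "collapsed q \<longleftrightarrow> (\<forall>A\<in>\<C>. \<forall>B\<in>\<C>. \<forall>\<gamma>\<in>brauer_hom A B. \<forall>\<delta>\<in>brauer_hom A B.
     enat (brank \<gamma>) \<le> r \<longrightarrow> enat (brank \<delta>) \<le> r \<longrightarrow> brank \<gamma> \<le> q \<longrightarrow> brank \<delta> \<le> q \<longrightarrow> (\<gamma>, \<delta>) \<in> \<sigma>)"

text \<open>An upper difference yields all of \<lambda>, a lower difference all of \<rho>. Two
  diagrams of rank 1 with common domain and range are linked through a third one that takes its
  upper matching from one and its lower matching from the other.\<close>

lemma collapsed_one:
  assumes u: "(\<alpha>, \<beta>) \<in> \<sigma>" "brank \<alpha> = 1" "brank \<beta> = 1" "upper \<alpha> \<noteq> upper \<beta>"
    and l: "(\<alpha>', \<beta>') \<in> \<sigma>" "brank \<alpha>' = 1" "brank \<beta>' = 1" "lower \<alpha>' \<noteq> lower \<beta>'"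
  shows "collapsed 1"
  unfolding collapsed_def
proof (intro ballI impI)
  fix A B \<gamma> \<delta>
  assume AB: "A \<in> \<C>" "B \<in> \<C>" and \<gamma>: "\<gamma> \<in> brauer_hom A B" and \<delta>: "\<delta> \<in> brauer_hom A B"
    and "brank \<gamma> \<le> 1" "brank \<delta> \<le> 1"
  then have rk: "brank \<gamma> = 1" "brank \<delta> = 1" using rank_pos AB by (meson le_antisym)+
  obtain \<epsilon> where \<epsilon>: "\<epsilon> \<in> brauer_hom A B" "upper \<epsilon> = upper \<delta>" "lower \<epsilon> = lower \<gamma>" "brank \<epsilon> = 1"
    using ex_rank_one rank_one_upper[OF \<delta>] rank_one_lower[OF \<gamma>] rk by metis
  have "(\<gamma>, \<epsilon>) \<in> \<sigma>"
    using rank_one_upper_collapse[OF u AB \<gamma> rk(1) \<epsilon>(1,4)] \<epsilon>(3) by simp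
  moreover have "(\<epsilon>, \<delta>) \<in> \<sigma>"
    using rank_one_lower_collapse[OF l AB \<epsilon>(1,4) \<delta> rk(2)] \<epsilon>(2) by simp
  ultimately show "(\<gamma>, \<delta>) \<in> \<sigma>" by (rule cong_trans)
qed

text \<open>Two multipliers of rank 1 join different pairs of strands of \<open>\<alpha>\<close>, so
  the products match \<open>thr \<alpha> a\<close> with different points. Multiplied to
  \<open>\<beta>\<close>, both keep the lower matching of \<open>\<beta>\<close>, which therefore
  disagrees with at least one of the two.\<close>

lemma drop_to_rank_one_lower:
  assumes \<sigma>: "(\<alpha>, \<beta>) \<in> \<sigma>" and rk: "3 \<le> brank \<alpha>" "brank \<beta> = 1"
  shows "\<exists>\<gamma> \<delta>. (\<gamma>, \<delta>) \<in> \<sigma> \<and> brank \<gamma> = 1 \<and> brank \<delta> = 1 \<and> lower \<gamma> \<noteq> lower \<delta>"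
proof -
  obtain A B where AB: "A \<in> \<C>" "B \<in> \<C>" and \<alpha>: "\<alpha> \<in> brauer_hom A B" and \<beta>: "\<beta> \<in> brauer_hom A B"
    using cong_homE[OF \<sigma>] .
  note fA = fin[OF AB(1)] and fB = fin[OF AB(2)]
  have "3 \<le> card (A - \<Union>(upper \<alpha>))" using rk(1) brank_upper[OF \<alpha>] by simp
  then obtain a b c where abc: "a \<in> A - \<Union>(upper \<alpha>)" "b \<in> A - \<Union>(upper \<alpha>)" "c \<in> A - \<Union>(upper \<alpha>)"
    "distinct [a, b, c]"
    by (rule three_subset)
  obtain W where W: "near_perfect A W" using ex_near_perfect_plain[OF AB(1)] .
  have ex: "\<exists>s. s \<in> brauer_hom A A \<and> brank s = 1 \<and> {a, x} \<in> lower s" if x: "x \<in> A" "x \<noteq> a" "y \<in> A" "y \<noteq> a" "y \<noteq> x" for x y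
  proof -
    have "matching A {{a, x}}" using matching_insert[OF matching_empty, of a A x] abc(1) x by auto
    then obtain U where U: "near_perfect A U" "{{a, x}} \<subseteq> U"
      using ex_near_perfect[OF AB(1), of "{{a, x}}" y] x by auto
    then show ?thesis using ex_rank_one[OF W U(1)] by (metis insert_subset)
  qed
  obtain s1 where s1: "s1 \<in> brauer_hom A A" "brank s1 = 1" "{a, b} \<in> lower s1"
    using ex[of b c] abc by auto
  obtain s2 where s2: "s2 \<in> brauer_hom A A" "brank s2 = 1" "{a, c} \<in> lower s2"
    using ex[of c b] abc by auto
  have step: "(s \<cdot> \<alpha>, s \<cdot> \<beta>) \<in> \<sigma> \<and> brank (s \<cdot> \<alpha>) = 1 \<and> brank (s \<cdot> \<beta>) = 1 \<and>
      lower (s \<cdot> \<beta>) = lower \<beta> \<and> {thr \<alpha> a, thr \<alpha> x} \<in> lower (s \<cdot> \<alpha>)"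
    if s: "s \<in> brauer_hom A A" "brank s = 1" "{a, x} \<in> lower s" and x: "x \<in> A - \<Union>(upper \<alpha>)" for s x
  proof -
    have "(s \<cdot> \<alpha>, s \<cdot> \<beta>) \<in> \<sigma>"
      using cong_left[OF \<sigma> AB(1,1) \<alpha> s(1)] s(2) one_le_r by simp
    moreover have "brank (s \<cdot> \<alpha>) \<le> 1" "brank (s \<cdot> \<beta>) \<le> 1"
      using brank_mult_left[OF s(1) \<alpha> fA fA fB] brank_mult_left[OF s(1) \<beta> fA fA fB] s(2) by auto
    then have rk1: "brank (s \<cdot> \<alpha>) = 1" "brank (s \<cdot> \<beta>) = 1"
      using rank_pos[OF AB(1) mult_hom[OF AB(1,1,2) s(1) \<alpha>]]
        rank_pos[OF AB(1) mult_hom[OF AB(1,1,2) s(1) \<beta>]] by linarith+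
    moreover have "lower (s \<cdot> \<beta>) = lower \<beta>"
      using mult_lower_eq[OF s(1) \<beta> fA fA fB] rk1 rk(2) by simp
    moreover have "{thr \<alpha> a, thr \<alpha> x} \<in> lower (s \<cdot> \<alpha>)"
      by (rule mult_cap[OF s(1) \<alpha> fA fA fB thr_mem[OF \<alpha> abc(1)] s(3) thr_mem[OF \<alpha> x]])
    ultimately show ?thesis by simp
  qed
  note 1 = step[OF s1 abc(2)] and 2 = step[OF s2 abc(3)]
  have "thr \<alpha> b \<noteq> thr \<alpha> c"
    using thr_bij[OF \<alpha>] abc unfolding bij_betw_def inj_on_def by auto
  have "lower (s1 \<cdot> \<alpha>) \<noteq> lower (s2 \<cdot> \<alpha>)"
    using matching_unique[OF matching_lower[OF mult_hom[OF AB(1,1,2) s2(1) \<alpha>]]] 1 2 \<open>thr \<alpha> b \<noteq> thr \<alpha> c\<close>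
    by metis
  then have "lower (s1 \<cdot> \<alpha>) \<noteq> lower (s1 \<cdot> \<beta>) \<or> lower (s2 \<cdot> \<alpha>) \<noteq> lower (s2 \<cdot> \<beta>)"
    using 1 2 by metis
  then show ?thesis using 1 2 by metis
qed

text \<open>The argument for lower differences applies to the pair and to its reflection, so both
  kinds of difference occur.\<close>

lemma drop_to_rank_one:
  assumes \<sigma>: "(\<alpha>, \<beta>) \<in> \<sigma>" and rk: "3 \<le> brank \<alpha>" "brank \<beta> = 1"
  shows "collapsed 1"
proof -
  interpret flip: brauer_cong \<C> r "flip_rel \<sigma>" by (rule flip_cong)
  obtain A B where AB: "\<alpha> \<in> brauer_hom A B" "\<beta> \<in> brauer_hom A B"
    using cong_homE[OF \<sigma>] by metis
  obtain \<gamma> \<delta> where l: "(\<gamma>, \<delta>) \<in> \<sigma>" "brank \<gamma> = 1" "brank \<delta> = 1" "lower \<gamma> \<noteq> lower \<delta>"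
    using drop_to_rank_one_lower[OF \<sigma> rk] by blast
  obtain \<gamma>' \<delta>' where u: "(\<gamma>', \<delta>') \<in> flip_rel \<sigma>" "brank \<gamma>' = 1" "brank \<delta>' = 1" "lower \<gamma>' \<noteq> lower \<delta>'"
    using flip.drop_to_rank_one_lower[of "flip \<alpha>" "flip \<beta>"] \<sigma> rk AB by auto
  obtain A' B' where AB': "\<gamma>' \<in> brauer_hom A' B'" "\<delta>' \<in> brauer_hom A' B'"
    using flip.cong_homE[OF u(1)] by metis
  show ?thesis
    by (rule collapsed_one[OF _ _ _ _ l, of "flip \<gamma>'" "flip \<delta>'"]) (use u AB' in auto)
qed

end

section \<open>Descent of related pairs through the ranks\<close>

lemma matching_free_odd:
  assumes "finite A" "P \<subseteq> A" "odd (card A)" "odd (card P)"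
  shows "even (card (A - P))"
proof -
  have "card (A - P) = card A - card P" "card P \<le> card A"
    using assms(1,2) finite_subset by (auto intro!: card_Diff_subset card_mono)
  then show ?thesis using assms(3,4) by simp
qed

context odd_objects
begin

text \<open>The strands of \<open>s\<close> carry the free points of \<open>\<gamma>\<close> onto
  \<open>Q\<close>, the rest of \<open>A\<close> is matched off, and \<open>t\<close> undoes the
  detour. Any \<open>Q\<close> of the right size works; this freedom allows
  \<open>rank_descent\<close> to steer two chosen points through.\<close>

lemma factor_through:
  assumes obj: "A \<in> \<C>" "B \<in> \<C>" "A' \<in> \<C>" "B' \<in> \<C>"
    and \<alpha>: "\<alpha> \<in> brauer_hom A B" and \<gamma>: "\<gamma> \<in> brauer_hom A' B'"
    and Q: "Q \<subseteq> A - \<Union>(upper \<alpha>)" "card Q = brank \<gamma>"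
  obtains s t where "s \<in> brauer_hom A' A" "t \<in> brauer_hom B B'" "brank s = brank \<gamma>" "brank t = brank \<gamma>"
    "\<And>x. x \<in> Q \<Longrightarrow> \<exists>u. {Unpr u, Pr x} \<in> s" "s \<cdot> \<alpha> \<cdot> t = \<gamma>"
proof -
  note fA = fin[OF obj(1)] and fB = fin[OF obj(2)] and fA' = fin[OF obj(3)] and fB' = fin[OF obj(4)]
  define F where "F = A' - \<Union>(upper \<gamma>)"
  define P where "P = thr \<alpha> ` Q"
  have oddQ: "odd (card Q)" using Q(2) odd_rank[OF obj(3) \<gamma>] by simp
  have inj: "bij_betw (thr \<alpha>) Q P"
    using thr_bij[OF \<alpha>] Q(1) unfolding P_def by (meson bij_betw_def inj_on_subset)
  have PB: "P \<subseteq> B" using thr_bij[OF \<alpha>] Q(1) unfolding P_def bij_betw_def by blast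
  have cP: "card P = card Q" using bij_betw_same_card[OF inj] by simp
  obtain W where W: "matching A W" "A - \<Union>W = Q"
    using ex_matching_free[OF fA _ matching_free_odd[OF fA _ odd_card[OF obj(1)] oddQ]] Q(1) by blast
  obtain W' where W': "matching B W'" "B - \<Union>W' = P"
    using ex_matching_free[OF fB PB matching_free_odd[OF fB PB odd_card[OF obj(2)]]] oddQ cP by metis
  have "card F = card Q" using Q(2) brank_upper[OF \<gamma>] unfolding F_def by simp
  moreover have "finite F" "finite Q" using fA' fA Q(1) finite_subset unfolding F_def by blast+
  ultimately obtain k where k: "bij_betw k F Q" using finite_same_card_bij by blast
  \<comment> \<open>Chosen so that \<open>k\<close>, then \<open>thr \<alpha>\<close>, then
    \<open>k'\<close> compose to \<open>thr \<gamma>\<close>.\<close>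
  define k' where "k' = thr \<gamma> \<circ> (inv_into F k \<circ> inv_into Q (thr \<alpha>))"
  have k': "bij_betw k' P (B' - \<Union>(lower \<gamma>))"
    unfolding k'_def
    using bij_betw_trans[OF bij_betw_trans[OF bij_betw_inv_into[OF inj] bij_betw_inv_into[OF k]]]
      thr_bij[OF \<gamma>] unfolding F_def by blast
  have bk: "bij_betw k (A' - \<Union>(upper \<gamma>)) (A - \<Union>W)" using k W(2) unfolding F_def by simp
  have bk': "bij_betw k' (B - \<Union>W') (B' - \<Union>(lower \<gamma>))" using k' W'(2) by simp
  note mu = matching_upper[OF \<gamma>] and ml = matching_lower[OF \<gamma>]
  define s where "s = diag A' (upper \<gamma>) W k"
  define t where "t = diag B W' (lower \<gamma>) k'"
  have s: "s \<in> brauer_hom A' A" unfolding s_def by (rule diag_hom[OF mu W(1) bk])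
  have t: "t \<in> brauer_hom B B'" unfolding t_def by (rule diag_hom[OF W'(1) ml bk'])
  have us: "upper s = upper \<gamma>" unfolding s_def by (rule upper_diag[OF mu W(1) bk])
  have lt: "lower t = lower \<gamma>" unfolding t_def by (rule lower_diag[OF W'(1) ml bk'])
  have "brank s = brank \<gamma>" unfolding brank_upper[OF s] brank_upper[OF \<gamma>] us ..
  moreover have "brank t = brank \<gamma>" unfolding brank_lower[OF t] brank_lower[OF \<gamma>] lt ..
  moreover have "\<exists>u. {Unpr u, Pr x} \<in> s" if "x \<in> Q" for x
  proof -
    have "x \<in> k ` F" using k that unfolding bij_betw_def by simp
    then obtain u where "u \<in> F" "x = k u" by blast
    then show ?thesis using diag_thr[of u A' "upper \<gamma>" k W] unfolding s_def F_def by blast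
  qed
  moreover have "s \<cdot> \<alpha> \<cdot> t = \<gamma>"
  proof (rule sym, rule hom_eqI[OF \<gamma>])
    note s\<alpha> = mult_hom[OF obj(3,1,2) s \<alpha>]
    show "s \<cdot> \<alpha> \<cdot> t \<in> brauer_hom A' B'" by (rule mult_hom[OF obj(3,2,4) s\<alpha> t])
    show "upper \<gamma> \<subseteq> upper (s \<cdot> \<alpha> \<cdot> t)"
      using mult_upper[OF s \<alpha> fA' fA fB] mult_upper[OF s\<alpha> t fA' fB fB'] us by blast
    show "lower \<gamma> \<subseteq> lower (s \<cdot> \<alpha> \<cdot> t)"
      using mult_lower[OF s\<alpha> t fA' fB fB'] lt by blast
    fix a b assume ab: "{Unpr a, Pr b} \<in> \<gamma>"
    then have a: "a \<in> F" and b: "thr \<gamma> a = b"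
      using free_iff[OF \<gamma>] thr_eqI[OF \<gamma>] unfolding F_def by blast+
    have ka: "k a \<in> Q" using k a bij_betwE by blast
    then have "thr \<alpha> (k a) \<in> P" unfolding P_def by blast
    have 1: "{Unpr a, Pr (k a)} \<in> s"
      using diag_thr[of a A' "upper \<gamma>" k W] a unfolding s_def F_def by blast
    have 2: "{Unpr (k a), Pr (thr \<alpha> (k a))} \<in> \<alpha>"
      using thr_mem[OF \<alpha>] ka Q(1) by blast
    have "k' (thr \<alpha> (k a)) = b"
      using bij_betw_inv_into_left[OF inj ka] bij_betw_inv_into_left[OF k a] b
      unfolding k'_def by simp
    then have 3: "{Unpr (thr \<alpha> (k a)), Pr b} \<in> t"
      using diag_thr[of "thr \<alpha> (k a)" B W' k' "lower \<gamma>"] \<open>thr \<alpha> (k a) \<in> P\<close> W'(2) unfolding t_def by metis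
    show "{Unpr a, Pr b} \<in> s \<cdot> \<alpha> \<cdot> t"
      by (rule mult_thr[OF s\<alpha> t fA' fB fB' mult_thr[OF s \<alpha> fA' fA fB 1 2] 3])
  qed
  ultimately show ?thesis using that[OF s t] by blast
qed

end

lemma bij_betw_id_on: "bij_betw (\<lambda>x. x) Z Z"
  by (simp add: bij_betw_def)

context brauer_cong
begin

text \<open>After an adjustment of \<open>\<beta>\<close> some block \<open>{a1, a2}\<close> of it
  joins two points that are free in \<open>\<alpha>\<close>. Factoring \<open>\<gamma>\<close>
  through strands of \<open>\<alpha>\<close> that include these two gives \<open>\<gamma>\<close> on
  one side, while on the other side the two strands are joined.\<close>

lemma rank_descent:
  assumes \<sigma>: "(\<alpha>, \<beta>) \<in> \<sigma>" and less: "brank \<beta> < brank \<alpha>"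
    and obj': "A' \<in> \<C>" "B' \<in> \<C>" and \<gamma>: "\<gamma> \<in> brauer_hom A' B'"
    and rk: "2 \<le> brank \<gamma>" "brank \<gamma> \<le> brank \<alpha>"
  shows "\<exists>\<delta>. (\<gamma>, \<delta>) \<in> \<sigma> \<and> brank \<delta> < brank \<gamma>"
proof -
  obtain A B where obj: "A \<in> \<C>" "B \<in> \<C>" and \<alpha>: "\<alpha> \<in> brauer_hom A B" and \<beta>: "\<beta> \<in> brauer_hom A B"
    using cong_homE[OF \<sigma>] .
  note fA = fin[OF obj(1)] and fB = fin[OF obj(2)] and fA' = fin[OF obj'(1)] and fB' = fin[OF obj'(2)]
  note mu = matching_upper[OF \<alpha>]
  have rkr: "enat (brank \<alpha>) \<le> r" using cong_rank[OF \<sigma>] by simp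
  \<comment> \<open>A partial identity on the free points of \<open>\<alpha>\<close> with the blocks
    of \<open>upper \<alpha>\<close> on both sides. It fixes \<open>\<alpha>\<close> and forces
    these blocks upon \<open>\<beta>\<close>.\<close>
  define e where "e = diag A (upper \<alpha>) (upper \<alpha>) (\<lambda>x. x)"
  note b = bij_betw_id_on[of "A - \<Union>(upper \<alpha>)"]
  have e: "e \<in> brauer_hom A A" unfolding e_def by (rule diag_hom[OF mu mu b])
  have ue: "upper e = upper \<alpha>" unfolding e_def by (rule upper_diag[OF mu mu b])
  have re: "brank e = brank \<alpha>" unfolding brank_upper[OF e] brank_upper[OF \<alpha>] ue ..
  have "e \<cdot> \<alpha> = \<alpha>"
  proof (rule sym, rule hom_eqI[OF \<alpha> mult_hom[OF obj(1,1,2) e \<alpha>]])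
    fix a b assume ab: "{Unpr a, Pr b} \<in> \<alpha>"
    then have "a \<in> A - \<Union>(upper \<alpha>)" using free_iff[OF \<alpha>] by blast
    then have "{Unpr a, Pr a} \<in> e" unfolding e_def by (rule diag_thr)
    then show "{Unpr a, Pr b} \<in> e \<cdot> \<alpha>" using ab by (rule mult_thr[OF e \<alpha> fA fA fB])
  qed (use mult_upper[OF e \<alpha> fA fA fB] mult_lower[OF e \<alpha> fA fA fB] ue in auto)
  define \<beta>1 where "\<beta>1 = e \<cdot> \<beta>"
  have \<beta>1: "\<beta>1 \<in> brauer_hom A B" unfolding \<beta>1_def by (rule mult_hom[OF obj(1,1,2) e \<beta>])
  have \<sigma>1: "(\<alpha>, \<beta>1) \<in> \<sigma>"
    using cong_left[OF \<sigma> obj(1,1) \<alpha> e] re rkr \<open>e \<cdot> \<alpha> = \<alpha>\<close> unfolding \<beta>1_def by simp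
  have up1: "upper \<alpha> \<subseteq> upper \<beta>1"
    using mult_upper[OF e \<beta> fA fA fB] ue unfolding \<beta>1_def by simp
  have "brank \<beta>1 < brank \<alpha>"
    using brank_mult_right[OF e \<beta> fA fA fB] less unfolding \<beta>1_def by simp
  \<comment> \<open>The smaller rank makes some free point \<open>a1\<close> of
    \<open>\<alpha>\<close> matched in \<open>\<beta>1\<close>. Its partner is free in
    \<open>\<alpha>\<close> too, because every block of \<open>\<alpha>\<close> is a block of
    \<open>\<beta>1\<close>.\<close>
  then have "\<not> A - \<Union>(upper \<alpha>) \<subseteq> A - \<Union>(upper \<beta>1)"
    using fA card_mono[of "A - \<Union>(upper \<beta>1)" "A - \<Union>(upper \<alpha>)"] brank_upper[OF \<alpha>] brank_upper[OF \<beta>1] by auto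
  then obtain a1 where a1: "a1 \<in> A - \<Union>(upper \<alpha>)" "a1 \<in> \<Union>(upper \<beta>1)" by blast
  obtain a2 where a2: "a2 \<noteq> a1" "{a1, a2} \<in> upper \<beta>1" "a2 \<in> A"
    using matching_partnerE[OF matching_upper[OF \<beta>1] a1(2)] by metis
  have "a2 \<notin> \<Union>(upper \<alpha>)"
  proof
    assume "a2 \<in> \<Union>(upper \<alpha>)"
    then obtain P where P: "P \<in> upper \<alpha>" "a2 \<in> P" by blast
    then have "P = {a1, a2}"
      using matching_block_eq[OF matching_upper[OF \<beta>1] _ a2(2)] up1 by blast
    then show False using P a1 by blast
  qed
  then have F2: "{a1, a2} \<subseteq> A - \<Union>(upper \<alpha>)" using a1 a2 by blast
  \<comment> \<open>The set \<open>Q\<close> has to hold both \<open>a1\<close> and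
    \<open>a2\<close>, hence the bound \<open>2 \<le> brank \<gamma>\<close>.\<close>
  have "card {a1, a2} \<le> brank \<gamma>" "brank \<gamma> \<le> card (A - \<Union>(upper \<alpha>))"
    using a2(1) rk brank_upper[OF \<alpha>] by auto
  then obtain Q where Q: "{a1, a2} \<subseteq> Q" "Q \<subseteq> A - \<Union>(upper \<alpha>)" "card Q = brank \<gamma>"
    using exists_subset_between[OF _ _ F2, of "brank \<gamma>"] fA by blast
  obtain s t where s: "s \<in> brauer_hom A' A" and t: "t \<in> brauer_hom B B'"
    and rst: "brank s = brank \<gamma>" "brank t = brank \<gamma>"
    and im: "\<And>x. x \<in> Q \<Longrightarrow> \<exists>u. {Unpr u, Pr x} \<in> s" and eq: "s \<cdot> \<alpha> \<cdot> t = \<gamma>"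
    using factor_through[OF obj obj' \<alpha> \<gamma> Q(2,3)] by metis
  have "enat (brank \<gamma>) \<le> enat (brank \<alpha>)" using rk by simp
  then have "enat (brank \<gamma>) \<le> r" using rkr by (rule order_trans)
  then have rs: "enat (brank s) \<le> r" "enat (brank t) \<le> r" using rst by simp_all
  note s\<alpha> = mult_hom[OF obj'(1) obj s \<alpha>] and s\<beta> = mult_hom[OF obj'(1) obj s \<beta>1]
  have "(s \<cdot> \<alpha> \<cdot> t, s \<cdot> \<beta>1 \<cdot> t) \<in> \<sigma>"
    by (rule cong_right[OF cong_left[OF \<sigma>1 obj'(1) obj(1) \<alpha> s rs(1)] obj(2) obj'(2) s\<alpha> t rs(2)])
  moreover have "brank (s \<cdot> \<beta>1 \<cdot> t) < brank \<gamma>"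
  proof -
    obtain u1 where u1: "{Unpr u1, Pr a1} \<in> s"
      using im[of a1] Q(1) by auto
    obtain u2 where u2: "{Unpr u2, Pr a2} \<in> s"
      using im[of a2] Q(1) by auto
    have "u1 \<in> A' - \<Union>(upper s)" using u1 free_iff[OF s] by blast
    then have "brank (s \<cdot> \<beta>1) < brank s"
      by (rule brank_mult_less_left[OF s \<beta>1 fA' fA fB mult_cup[OF s \<beta>1 fA' fA fB u1 a2(2) u2]])
    then show ?thesis
      using brank_mult_left[OF s\<beta> t fA' fB fB'] rst by simp
  qed
  ultimately show ?thesis using eq by auto
qed

text \<open>Repeated descent relates every diagram of rank at most \<open>brank \<alpha>\<close> to
  one of rank 1. For \<open>\<alpha>\<close> itself this is a pair of rank at least 3 and rank 1, so
  rank 1 is collapsed and all these diagrams meet there.\<close>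

lemma drop_collapse:
  assumes \<sigma>: "(\<alpha>, \<beta>) \<in> \<sigma>" and less: "brank \<beta> < brank \<alpha>"
  shows "collapsed (brank \<alpha>)"
proof -
  have to_one: "\<exists>\<epsilon>. (\<gamma>, \<epsilon>) \<in> \<sigma> \<and> brank \<epsilon> = 1"
    if "\<gamma> \<in> brauer_ideal \<C> r" "brank \<gamma> \<le> brank \<alpha>" for \<gamma>
    using that
  proof (induction "brank \<gamma>" arbitrary: \<gamma> rule: less_induct)
    case less
    show ?case
    proof (cases "brank \<gamma> = 1")
      case True
      then show ?thesis using cong_refl[OF less.prems(1)] by blast
    next
      case False
      obtain A B where AB: "A \<in> \<C>" "B \<in> \<C>" "\<gamma> \<in> brauer_hom A B"
        using less.prems(1) by (rule brauer_idealE)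
      then have "2 \<le> brank \<gamma>" using rank_pos[OF AB(1,3)] False by linarith
      then obtain \<delta> where \<delta>: "(\<gamma>, \<delta>) \<in> \<sigma>" "brank \<delta> < brank \<gamma>"
        using rank_descent[OF \<sigma> \<open>brank \<beta> < brank \<alpha>\<close> AB _ less.prems(2)] by blast
      then obtain \<epsilon> where "(\<delta>, \<epsilon>) \<in> \<sigma>" "brank \<epsilon> = 1"
        using less.hyps[of \<delta>] cong_mem[OF \<delta>(1)] less.prems(2) by auto
      then show ?thesis using cong_trans[OF \<delta>(1)] by blast
    qed
  qed
  obtain A B where AB: "A \<in> \<C>" "\<alpha> \<in> brauer_hom A B" "\<beta> \<in> brauer_hom A B"
    using cong_homE[OF \<sigma>] by metis
  have "1 \<le> brank \<beta>" "odd (brank \<alpha>)" using rank_pos odd_rank AB by blast+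
  then have "2 \<le> brank \<alpha>" "brank \<alpha> \<noteq> 2" using less by auto
  then have "3 \<le> brank \<alpha>" by linarith
  moreover obtain \<epsilon> where "(\<alpha>, \<epsilon>) \<in> \<sigma>" "brank \<epsilon> = 1"
    using to_one[of \<alpha>] cong_mem[OF \<sigma>] by blast
  ultimately have one: "collapsed 1" using drop_to_rank_one by blast
  show ?thesis
    unfolding collapsed_def
  proof (intro ballI impI)
    fix A B \<gamma> \<delta>
    assume AB: "A \<in> \<C>" "B \<in> \<C>" and \<gamma>: "\<gamma> \<in> brauer_hom A B" and \<delta>: "\<delta> \<in> brauer_hom A B"
      and r: "enat (brank \<gamma>) \<le> r" "enat (brank \<delta>) \<le> r" "brank \<gamma> \<le> brank \<alpha>" "brank \<delta> \<le> brank \<alpha>"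
    obtain \<epsilon>1 where 1: "(\<gamma>, \<epsilon>1) \<in> \<sigma>" "brank \<epsilon>1 = 1"
      using to_one[OF brauer_idealI[OF AB \<gamma> r(1)] r(3)] by blast
    obtain \<epsilon>2 where 2: "(\<delta>, \<epsilon>2) \<in> \<sigma>" "brank \<epsilon>2 = 1"
      using to_one[OF brauer_idealI[OF AB \<delta> r(2)] r(4)] by blast
    have "\<epsilon>1 \<in> brauer_hom A B" "\<epsilon>2 \<in> brauer_hom A B"
      using cong_homE[OF 1(1)] cong_homE[OF 2(1)] \<gamma> \<delta> by (metis bdom_hom bran_hom)+
    then have "(\<epsilon>1, \<epsilon>2) \<in> \<sigma>"
      using one AB 1(2) 2(2) one_le_r unfolding collapsed_def by simp
    then show "(\<gamma>, \<delta>) \<in> \<sigma>"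
      using 1(1) 2(1) cong_trans cong_sym by blast
  qed
qed

text \<open>Equal ranks give no descent by themselves. A multiplier \<open>s\<close> is built that
  fixes \<open>\<alpha>\<close> and yet leads two strands into the ends of a block
  \<open>{a1, a2}\<close> that only \<open>\<beta>\<close> has. Then
  \<open>s \<cdot> \<beta>\<close> has smaller rank than
  \<open>s \<cdot> \<alpha> = \<alpha>\<close>, and \<open>drop_collapse\<close> applies.\<close>

lemma upper_collapse:
  assumes \<sigma>: "(\<alpha>, \<beta>) \<in> \<sigma>" and rk: "brank \<alpha> = brank \<beta>" "3 \<le> brank \<alpha>" and ne: "upper \<alpha> \<noteq> upper \<beta>"
  shows "collapsed (brank \<alpha>)"
proof -
  obtain A B where obj: "A \<in> \<C>" "B \<in> \<C>" and \<alpha>: "\<alpha> \<in> brauer_hom A B" and \<beta>: "\<beta> \<in> brauer_hom A B"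
    using cong_homE[OF \<sigma>] .
  note fA = fin[OF obj(1)] and fB = fin[OF obj(2)]
  note mu = matching_upper[OF \<alpha>]
  define F where "F = A - \<Union>(upper \<alpha>)"
  have rkr: "enat (brank \<alpha>) \<le> r" using cong_rank[OF \<sigma>] by simp
  have "\<not> upper \<beta> \<subseteq> upper \<alpha>"
    using upper_eq_if_subset[OF fA matching_upper[OF \<beta>] mu] ne rk(1)
      brank_upper[OF \<alpha>] brank_upper[OF \<beta>] by auto
  then obtain a1 a2 where a: "{a1, a2} \<in> upper \<beta>" "{a1, a2} \<notin> upper \<alpha>" "a1 \<noteq> a2"
    using matching_pairE[OF matching_upper[OF \<beta>]] by (metis subsetI)
  then have aA: "a1 \<in> A" "a2 \<in> A" using matching_upper[OF \<beta>] unfolding matching_def by blast+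
  have "3 \<le> card F" using rk(2) brank_upper[OF \<alpha>] unfolding F_def by simp
  then obtain x y z where xyz: "x \<in> F" "y \<in> F" "z \<in> F" "distinct [x, y, z]"
    by (rule three_subset)
  \<comment> \<open>The strands of \<open>z1\<close> and \<open>z2\<close> will be led to
    \<open>a1\<close> and \<open>a2\<close>. An end that is already free in \<open>\<alpha>\<close>
    must be its own start.\<close>
  have "\<exists>z1 z2. z1 \<in> F \<and> z2 \<in> F \<and> z1 \<noteq> z2 \<and> (a1 \<in> F \<longrightarrow> z1 = a1) \<and> (a2 \<in> F \<longrightarrow> z2 = a2)"
  proof -
    define z1 where "z1 = (if a1 \<in> F then a1 else if x \<noteq> a2 then x else y)"
    define z2 where "z2 = (if a2 \<in> F then a2 else if x \<noteq> z1 then x else y)"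
    have "z1 \<in> F \<and> z2 \<in> F \<and> z1 \<noteq> z2 \<and> (a1 \<in> F \<longrightarrow> z1 = a1) \<and> (a2 \<in> F \<longrightarrow> z2 = a2)"
      using xyz a(3) unfolding z1_def z2_def by auto
    then show ?thesis by blast
  qed
  then obtain z1 z2 where zz: "z1 \<in> F" "z2 \<in> F" "z1 \<noteq> z2" "a1 \<in> F \<Longrightarrow> z1 = a1" "a2 \<in> F \<Longrightarrow> z2 = a2"
    by blast
  have dist: "z1 \<noteq> a2" "z2 \<noteq> a1" using zz by blast+
  \<comment> \<open>The exchange of \<open>z1\<close> with \<open>a1\<close> and of
    \<open>z2\<close> with \<open>a2\<close>; by \<open>dist\<close> the two do not interfere. If
    \<open>z1 = a1\<close>, the first exchange is void, and likewise for the second.\<close>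
  define \<tau> where "\<tau> w = (if w = z1 then a1 else if w = a1 then z1 else if w = z2 then a2 else if w = a2 then z2 else w)" for w
  have \<tau>_inv: "\<tau> (\<tau> w) = w" for w
    using zz(3) a(3) dist unfolding \<tau>_def by auto
  have \<tau>z: "\<tau> z1 = a1" "\<tau> z2 = a2"
    using zz(3) a(3) dist unfolding \<tau>_def by auto
  have \<tau>_mem: "\<tau> w \<in> A" if "w \<in> A" for w
    using that aA zz unfolding \<tau>_def F_def by auto
  have \<tau>A: "\<tau> ` A = A"
  proof (intro equalityI subsetI)
    fix w assume "w \<in> A"
    then show "w \<in> \<tau> ` A" using imageI[OF \<tau>_mem, of w \<tau>] unfolding \<tau>_inv by simp
  qed (use \<tau>_mem in blast)
  have inj: "inj \<tau>" by (rule injI) (metis \<tau>_inv)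
  define M where "M = (`) \<tau> ` upper \<alpha>"
  have M: "matching A M"
    using matching_image[OF mu inj_on_subset[OF inj subset_UNIV]] unfolding M_def \<tau>A .
  have "A - \<Union>M = \<tau> ` F"
  proof -
    have "\<Union>M = \<tau> ` \<Union>(upper \<alpha>)" by (simp add: M_def image_Union)
    then show ?thesis unfolding F_def image_set_diff[OF inj] \<tau>A by simp
  qed
  then have b: "bij_betw \<tau> (A - \<Union>(upper \<alpha>)) (A - \<Union>M)"
    unfolding bij_betw_def F_def using inj_on_subset[OF inj subset_UNIV] by simp
  define s where "s = diag A (upper \<alpha>) M \<tau>"
  have s: "s \<in> brauer_hom A A" unfolding s_def by (rule diag_hom[OF mu M b])
  have us: "upper s = upper \<alpha>" unfolding s_def by (rule upper_diag[OF mu M b])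
  have ls: "lower s = M" unfolding s_def by (rule lower_diag[OF mu M b])
  have rs: "brank s = brank \<alpha>" unfolding brank_upper[OF s] brank_upper[OF \<alpha>] us ..
  have ts: "{Unpr w, Pr (\<tau> w)} \<in> s" if "w \<in> F" for w
    unfolding s_def by (rule diag_thr) (use that in \<open>simp add: F_def\<close>)
  \<comment> \<open>The strand of \<open>w\<close> is led to \<open>a'\<close>, crosses to the
    partner \<open>b'\<close> of \<open>a'\<close> in \<open>\<alpha>\<close>, returns to
    \<open>w\<close> along the block \<open>{b', w}\<close> of \<open>M\<close> and continues as in
    \<open>\<alpha>\<close>.\<close>
  have zig: "{Unpr w, Pr c} \<in> s \<cdot> \<alpha>"
    if w: "w \<in> F" "{Unpr w, Pr c} \<in> \<alpha>" "\<tau> w = a'" "w \<noteq> a'" "a' \<notin> F" "a' \<in> A" "a' \<in> {a1, a2}" for w c a'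
  proof -
    have "a' \<in> \<Union>(upper \<alpha>)" using w unfolding F_def by blast
    then obtain b' where b': "b' \<noteq> a'" "{a', b'} \<in> upper \<alpha>"
      using matching_partnerE[OF mu] by metis
    have "b' \<notin> F" using b'(2) unfolding F_def by blast
    \<comment> \<open>This is where \<open>{a1, a2}\<close> not being a block of
      \<open>\<alpha>\<close> matters: otherwise \<open>b'\<close> would be the other of the two
      ends.\<close>
    moreover have "b' \<notin> {a1, a2}"
      using b' a(2) w(7) by (auto simp: insert_commute)
    ultimately have "\<tau> b' = b'" using zz unfolding \<tau>_def by auto
    moreover have "\<tau> a' = w" using w(3) \<tau>_inv by metis
    ultimately have "\<tau> ` {a', b'} = {b', w}" by auto
    then have "{b', w} \<in> lower s" using b'(2) unfolding ls M_def by (metis image_eqI)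
    moreover have "{Unpr w, Pr a'} \<in> s" using ts[OF w(1)] w(3) by simp
    ultimately show ?thesis
      using mult_zigzag[OF s \<alpha> fA fA fB _ b'(2) _ w(2)] by blast
  qed
  have "s \<cdot> \<alpha> = \<alpha>"
  proof (rule sym, rule hom_eqI[OF \<alpha> mult_hom[OF obj(1,1,2) s \<alpha>]])
    fix w c assume wc: "{Unpr w, Pr c} \<in> \<alpha>"
    then have w: "w \<in> F" using free_iff[OF \<alpha>] unfolding F_def by blast
    show "{Unpr w, Pr c} \<in> s \<cdot> \<alpha>"
    proof (cases "\<tau> w = w")
      case True
      then have "{Unpr w, Pr w} \<in> s" using ts[OF w] by simp
      then show ?thesis using wc by (rule mult_thr[OF s \<alpha> fA fA fB])
    next
      case False
      have "w = z1 \<or> w = z2"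
      proof (rule ccontr)
        assume n: "\<not> ?thesis"
        then have "w \<noteq> a1" "w \<noteq> a2" using w zz(4,5) by blast+
        then show False using n False unfolding \<tau>_def by simp
      qed
      then show ?thesis
      proof
        assume [simp]: "w = z1"
        have "a1 \<notin> F" using False zz(4) \<tau>z by force
        then show ?thesis using zig[OF w wc, of a1] False \<tau>z aA by simp
      next
        assume [simp]: "w = z2"
        have "a2 \<notin> F" using False zz(5) \<tau>z by force
        then show ?thesis using zig[OF w wc, of a2] False \<tau>z aA by simp
      qed
    qed
  qed (use mult_upper[OF s \<alpha> fA fA fB] mult_lower[OF s \<alpha> fA fA fB] us in auto)
  then have "(\<alpha>, s \<cdot> \<beta>) \<in> \<sigma>"
    using cong_left[OF \<sigma> obj(1,1) \<alpha> s] rs rkr by simp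
  moreover have "brank (s \<cdot> \<beta>) < brank \<alpha>"
  proof -
    have "{Unpr z1, Pr a1} \<in> s" "{Unpr z2, Pr a2} \<in> s"
      using ts[OF zz(1)] ts[OF zz(2)] \<tau>z by simp_all
    then have "{z1, z2} \<in> upper (s \<cdot> \<beta>)"
      using a(1) by (intro mult_cup[OF s \<beta> fA fA fB])
    moreover have "z1 \<in> A - \<Union>(upper s)" using zz(1) us unfolding F_def by simp
    ultimately show ?thesis
      using brank_mult_less_left[OF s \<beta> fA fA fB] rs by simp
  qed
  ultimately show ?thesis by (rule drop_collapse)
qed

lemma flip_collapsed:
  assumes "brauer_cong.collapsed \<C> r (flip_rel \<sigma>) q"
  shows "collapsed q"
proof -
  interpret flip: brauer_cong \<C> r "flip_rel \<sigma>" by (rule flip_cong)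
  show ?thesis
    unfolding collapsed_def
  proof (intro ballI impI)
    fix A B \<gamma> \<delta>
    assume "A \<in> \<C>" "B \<in> \<C>" "\<gamma> \<in> brauer_hom A B" "\<delta> \<in> brauer_hom A B"
      "enat (brank \<gamma>) \<le> r" "enat (brank \<delta>) \<le> r" "brank \<gamma> \<le> q" "brank \<delta> \<le> q"
    moreover from this have "flip \<gamma> \<in> brauer_hom B A" "flip \<delta> \<in> brauer_hom B A" by simp_all
    ultimately have "(flip \<gamma>, flip \<delta>) \<in> flip_rel \<sigma>"
      using assms brank_flip[of \<gamma> A B] brank_flip[of \<delta> A B] unfolding flip.collapsed_def by metis
    then show "(\<gamma>, \<delta>) \<in> \<sigma>" by simp
  qed
qed

lemma lower_collapse:
  assumes \<sigma>: "(\<alpha>, \<beta>) \<in> \<sigma>" and rk: "brank \<alpha> = brank \<beta>" "3 \<le> brank \<alpha>" and ne: "lower \<alpha> \<noteq> lower \<beta>"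
  shows "collapsed (brank \<alpha>)"
proof -
  interpret flip: brauer_cong \<C> r "flip_rel \<sigma>" by (rule flip_cong)
  obtain A B where AB: "\<alpha> \<in> brauer_hom A B" "\<beta> \<in> brauer_hom A B"
    using cong_homE[OF \<sigma>] by metis
  show ?thesis
    using flip.upper_collapse[of "flip \<alpha>" "flip \<beta>"] assms AB by (intro flip_collapsed) simp
qed

text \<open>Joining two strands \<open>a\<close> and \<open>c\<close> turns a difference of through
  maps into a difference of lower matchings. In \<open>s \<cdot> \<beta>\<close> the point
  \<open>thr \<beta> a\<close> becomes matched, whereas in \<open>s \<cdot> \<alpha>\<close> it
  stays the end of the strand from \<open>x\<close>.\<close>

lemma H_related_lower:
  assumes \<sigma>: "(\<alpha>, \<beta>) \<in> \<sigma>" and up: "upper \<alpha> = upper \<beta>" and lo: "lower \<alpha> = lower \<beta>"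
    and rk: "3 \<le> brank \<alpha>" and ne: "\<alpha> \<noteq> \<beta>"
  shows "\<exists>\<gamma> \<delta>. (\<gamma>, \<delta>) \<in> \<sigma> \<and> brank \<gamma> = brank \<alpha> - 2 \<and> brank \<delta> = brank \<alpha> - 2 \<and> lower \<gamma> \<noteq> lower \<delta>"
proof -
  obtain A B where obj: "A \<in> \<C>" "B \<in> \<C>" and \<alpha>: "\<alpha> \<in> brauer_hom A B" and \<beta>: "\<beta> \<in> brauer_hom A B"
    using cong_homE[OF \<sigma>] .
  note fA = fin[OF obj(1)] and fB = fin[OF obj(2)]
  note mu = matching_upper[OF \<alpha>]
  define F where "F = A - \<Union>(upper \<alpha>)"
  have finF: "finite F" using fA unfolding F_def by simp
  have rkr: "enat (brank \<alpha>) \<le> r" using cong_rank[OF \<sigma>] by simp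
  obtain a where a: "a \<in> F" "thr \<alpha> a \<noteq> thr \<beta> a"
    using hom_eqI'[OF \<alpha> \<beta> up lo] ne unfolding F_def by blast
  have "thr \<beta> a \<in> B - \<Union>(lower \<alpha>)"
    using bij_betwE[OF thr_bij[OF \<beta>]] a(1) up lo unfolding F_def by simp
  then obtain x where x: "x \<in> F" "thr \<alpha> x = thr \<beta> a"
    using thr_bij[OF \<alpha>] unfolding F_def bij_betw_def by (metis imageE)
  have "card F = brank \<alpha>" using brank_upper[OF \<alpha>] unfolding F_def by simp
  \<comment> \<open>Rank at least 3 leaves a third free point \<open>c\<close>, so the strand at
    \<open>x\<close> survives the joining of \<open>a\<close> and \<open>c\<close>.\<close>
  then have "\<not> F \<subseteq> {a, x}"
    using rk card_mono[of "{a, x}" F] card_insert_le_m1[of 2 "{x}" a] by fastforce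
  then obtain c where c: "c \<in> F" "c \<noteq> a" "c \<noteq> x" by blast
  define U where "U = insert {a, c} (upper \<alpha>)"
  have U: "matching A U"
    unfolding U_def using a(1) c by (intro matching_insert[OF mu]) (auto simp: F_def)
  have FU: "A - \<Union>U = F - {a, c}" unfolding U_def F_def by blast
  define s where "s = diag A U U (\<lambda>w. w)"
  note b = bij_betw_id_on[of "A - \<Union>U"]
  have s: "s \<in> brauer_hom A A" unfolding s_def by (rule diag_hom[OF U U b])
  have ls: "lower s = U" unfolding s_def by (rule lower_diag[OF U U b])
  have "card (F - {a, c}) = card F - card {a, c}"
    using a(1) c finF by (intro card_Diff_subset) auto
  then have cF: "card (F - {a, c}) = brank \<alpha> - 2" using \<open>card F = brank \<alpha>\<close> c by simp
  have rs: "brank s = brank \<alpha> - 2"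
    unfolding s_def brank_diag[OF U U b] FU cF ..
  have ts: "{Unpr w, Pr w} \<in> s" if "w \<in> F - {a, c}" for w
    unfolding s_def using that FU by (intro diag_thr) simp
  have rank: "brank (s \<cdot> \<gamma>) = brank \<alpha> - 2" and cap: "{thr \<gamma> a, thr \<gamma> c} \<in> lower (s \<cdot> \<gamma>)"
    if \<gamma>: "\<gamma> \<in> brauer_hom A B" "upper \<gamma> = upper \<alpha>" for \<gamma>
  proof -
    have tg: "{Unpr w, Pr (thr \<gamma> w)} \<in> \<gamma>" if "w \<in> F" for w
      using thr_mem[OF \<gamma>(1)] that \<gamma>(2) unfolding F_def by simp
    note h = mult_hom[OF obj(1,1,2) s \<gamma>(1)]
    have "F - {a, c} \<subseteq> A - \<Union>(upper (s \<cdot> \<gamma>))"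
    proof
      fix w assume w: "w \<in> F - {a, c}"
      then have "{Unpr w, Pr (thr \<gamma> w)} \<in> s \<cdot> \<gamma>"
        using mult_thr[OF s \<gamma>(1) fA fA fB ts[OF w] tg] by blast
      then show "w \<in> A - \<Union>(upper (s \<cdot> \<gamma>))" using free_iff[OF h] by blast
    qed
    then have "brank \<alpha> - 2 \<le> brank (s \<cdot> \<gamma>)"
      using card_mono[of "A - \<Union>(upper (s \<cdot> \<gamma>))" "F - {a, c}"] fA cF brank_upper[OF h] by simp
    then show "brank (s \<cdot> \<gamma>) = brank \<alpha> - 2"
      using brank_mult_left[OF s \<gamma>(1) fA fA fB] rs by simp
    show "{thr \<gamma> a, thr \<gamma> c} \<in> lower (s \<cdot> \<gamma>)"
      by (rule mult_cap[OF s \<gamma>(1) fA fA fB tg[OF a(1)] _ tg[OF c(1)]]) (simp add: ls U_def)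
  qed
  have "lower (s \<cdot> \<alpha>) \<noteq> lower (s \<cdot> \<beta>)"
  proof
    assume "lower (s \<cdot> \<alpha>) = lower (s \<cdot> \<beta>)"
    then have "thr \<beta> a \<in> \<Union>(lower (s \<cdot> \<alpha>))" using cap[OF \<beta>] up by auto
    moreover have "x \<in> F - {a, c}" using x a c by auto
    then have "{Unpr x, Pr (thr \<beta> a)} \<in> s \<cdot> \<alpha>"
      using mult_thr[OF s \<alpha> fA fA fB ts[of x]] thr_mem[OF \<alpha>, of x] x unfolding F_def by auto
    ultimately show False
      using lower_not_thr[OF mult_hom[OF obj(1,1,2) s \<alpha>]] by blast
  qed
  moreover have "enat (brank s) \<le> enat (brank \<alpha>)" using rs by simp
  then have "(s \<cdot> \<alpha>, s \<cdot> \<beta>) \<in> \<sigma>"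
    using cong_left[OF \<sigma> obj(1,1) \<alpha> s] rkr order_trans by blast
  ultimately show ?thesis using rank[OF \<alpha>] rank[OF \<beta>] up by auto
qed

text \<open>From rank 3 the derived pair has rank 1, where a lower difference alone yields only
  \<rho>; the reflected pair adds the upper difference. From rank 5 on the derived pair has rank at
  least 3 and \<open>lower_collapse\<close> applies.\<close>

lemma H_related_collapse:
  assumes \<sigma>: "(\<alpha>, \<beta>) \<in> \<sigma>" and up: "upper \<alpha> = upper \<beta>" and lo: "lower \<alpha> = lower \<beta>"
    and rk: "3 \<le> brank \<alpha>" and ne: "\<alpha> \<noteq> \<beta>"
  shows "collapsed (brank \<alpha> - 2)"
proof -
  interpret flip: brauer_cong \<C> r "flip_rel \<sigma>" by (rule flip_cong)
  obtain A B where AB: "A \<in> \<C>" "\<alpha> \<in> brauer_hom A B" "\<beta> \<in> brauer_hom A B"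
    using cong_homE[OF \<sigma>] by metis
  obtain \<gamma> \<delta> where l: "(\<gamma>, \<delta>) \<in> \<sigma>" "brank \<gamma> = brank \<alpha> - 2" "brank \<delta> = brank \<alpha> - 2" "lower \<gamma> \<noteq> lower \<delta>"
    using H_related_lower[OF assms] by blast
  show ?thesis
  proof (cases "brank \<alpha> = 3")
    case True
    obtain \<gamma>' \<delta>' where u: "(\<gamma>', \<delta>') \<in> flip_rel \<sigma>" "brank \<gamma>' = brank \<alpha> - 2" "brank \<delta>' = brank \<alpha> - 2" "lower \<gamma>' \<noteq> lower \<delta>'"
      using flip.H_related_lower[of "flip \<alpha>" "flip \<beta>"] assms AB by auto
    obtain A' B' where AB': "\<gamma>' \<in> brauer_hom A' B'" "\<delta>' \<in> brauer_hom A' B'"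
      using flip.cong_homE[OF u(1)] by metis
    have "collapsed 1"
      by (rule collapsed_one[OF _ _ _ _ l(1) _ _ l(4), of "flip \<gamma>'" "flip \<delta>'"])
        (use u AB' l(2,3) True in auto)
    then show ?thesis using True by simp
  next
    case False
    have "odd (brank \<alpha>)" using odd_rank AB by blast
    then have "3 \<le> brank \<alpha> - 2" using rk False by presburger
    then show ?thesis using lower_collapse[OF l(1) _ _ l(4)] l(2,3) by simp
  qed
qed

end

section \<open>The congruences of a normal subgroup\<close>

lemma diag_cong: "(\<And>a. a \<in> A - \<Union>U \<Longrightarrow> f a = g a) \<Longrightarrow> diag A U L f = diag A U L g"
proof -
  assume "\<And>a. a \<in> A - \<Union>U \<Longrightarrow> f a = g a"
  then have "{{Unpr a, Pr (f a)} |a. a \<in> A - \<Union>U} = {{Unpr a, Pr (g a)} |a. a \<in> A - \<Union>U}"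
    by (intro Collect_cong ex_cong) auto
  then show ?thesis unfolding diag_def by simp
qed

lemma ex_indexed_diagram:
  assumes U: "matching A U" and L: "matching B L"
    and h: "bij_betw h {1..p::nat} (A - \<Union>U)" and k: "bij_betw k {1..p} (B - \<Union>L)"
  shows "\<exists>\<epsilon>\<in>brauer_hom A B. upper \<epsilon> = U \<and> lower \<epsilon> = L \<and> brank \<epsilon> = p \<and>
    (\<forall>i\<in>{1..p}. {Unpr (h i), Pr (k i)} \<in> \<epsilon>)"
proof -
  define f where "f = k \<circ> inv_into {1..p} h"
  have f: "bij_betw f (A - \<Union>U) (B - \<Union>L)"
    unfolding f_def by (rule bij_betw_trans[OF bij_betw_inv_into[OF h] k])
  have "{Unpr (h i), Pr (k i)} \<in> diag A U L f" if "i \<in> {1..p}" for i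
  proof -
    have "f (h i) = k i" unfolding f_def using bij_betw_inv_into_left[OF h that] by simp
    moreover have "h i \<in> A - \<Union>U" using bij_betwE[OF h] that by blast
    ultimately show ?thesis using diag_thr[of "h i" A U f L] by simp
  qed
  moreover have "brank (diag A U L f) = p"
    unfolding brank_diag[OF U L f] using bij_betw_same_card[OF h] by simp
  ultimately show ?thesis
    using diag_hom[OF U L f] upper_diag[OF U L f] lower_diag[OF U L f] by blast
qed

lemma triple_mult_eqI:
  assumes a: "a \<in> brauer_hom A B" and m: "m \<in> brauer_hom B C" and b: "b \<in> brauer_hom C D"
    and \<gamma>: "\<gamma> \<in> brauer_hom A D" and fin: "finite A" "finite B" "finite C" "finite D"
    and up: "upper \<gamma> = upper a" and lo: "lower \<gamma> = lower b"
    and thr: "\<And>u w. {Unpr u, Pr w} \<in> \<gamma> \<Longrightarrow>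
      \<exists>v v'. {Unpr u, Pr v} \<in> a \<and> {Unpr v, Pr v'} \<in> m \<and> {Unpr v', Pr w} \<in> b"
  shows "a \<cdot> m \<cdot> b = \<gamma>"
proof (rule sym, rule hom_eqI[OF \<gamma>])
  note am = brauer_mult_hom[OF a m fin(1-3)]
  show "a \<cdot> m \<cdot> b \<in> brauer_hom A D" by (rule brauer_mult_hom[OF am b fin(1,3,4)])
  show "upper \<gamma> \<subseteq> upper (a \<cdot> m \<cdot> b)"
    using mult_upper[OF a m fin(1-3)] mult_upper[OF am b fin(1,3,4)] up by blast
  show "lower \<gamma> \<subseteq> lower (a \<cdot> m \<cdot> b)"
    using mult_lower[OF am b fin(1,3,4)] lo by blast
  fix u w assume "{Unpr u, Pr w} \<in> \<gamma>"
  then obtain v v' where "{Unpr u, Pr v} \<in> a" "{Unpr v, Pr v'} \<in> m" "{Unpr v', Pr w} \<in> b"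
    using thr by blast
  then show "{Unpr u, Pr w} \<in> a \<cdot> m \<cdot> b"
    using mult_thr[OF am b fin(1,3,4)] mult_thr[OF a m fin(1-3)] by blast
qed

lemma normal_sym_group:
  assumes "N \<lhd> sym_group p"
  shows normal_permutes: "\<And>\<pi>. \<pi> \<in> N \<Longrightarrow> \<pi> permutes {1..p}"
    and normal_id: "id \<in> N"
    and normal_comp: "\<And>\<pi> \<rho>. \<pi> \<in> N \<Longrightarrow> \<rho> \<in> N \<Longrightarrow> \<pi> \<circ> \<rho> \<in> N"
    and normal_inv: "\<And>\<pi>. \<pi> \<in> N \<Longrightarrow> inv' \<pi> \<in> N"
    and normal_conj: "\<And>\<pi> \<tau>. \<pi> \<in> N \<Longrightarrow> \<tau> permutes {1..p} \<Longrightarrow> inv' \<tau> \<circ> \<pi> \<circ> \<tau> \<in> N"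
proof -
  interpret normal N "sym_group p" by (rule assms)
  show perm: "\<pi> permutes {1..p}" if "\<pi> \<in> N" for \<pi>
    using subset that sym_group_carrier by blast
  show "id \<in> N" using subgroup.one_closed[OF is_subgroup] unfolding sym_group_one .
  show "\<pi> \<circ> \<rho> \<in> N" if "\<pi> \<in> N" "\<rho> \<in> N" for \<pi> \<rho>
    using subgroup.m_closed[OF is_subgroup that] by (simp add: sym_group_mult)
  show "inv' \<pi> \<in> N" if "\<pi> \<in> N" for \<pi>
    using subgroup.m_inv_closed[OF is_subgroup that] sym_group_inv_equality[of \<pi> p] perm[OF that] by (simp add: sym_group_carrier)
  show "inv' \<tau> \<circ> \<pi> \<circ> \<tau> \<in> N" if "\<pi> \<in> N" "\<tau> permutes {1..p}" for \<pi> \<tau>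
    using inv_op_closed1[of \<tau> \<pi>] that sym_group_inv_equality[of \<tau> p]
    by (simp add: sym_group_carrier sym_group_mult)
qed

section \<open>Stability of the twist relation\<close>

context odd_objects
begin

text \<open>Independent description of the restriction of \<open>nu S N\<close> to elements of rank \<open>p\<close>: for
  \<open>H\<close>-related diagrams with through maps \<open>f\<close> and \<open>g\<close>, the permutation \<open>g\<inverse> f\<close> of the free
  upper points is, in some (equivalently any) numbering \<open>h\<close> of these points, an element of \<open>N\<close>.\<close>

definition twist :: "(nat \<Rightarrow> nat) set \<Rightarrow> nat \<Rightarrow> 'a diagram rel" where
  "twist N p = {(\<alpha>, \<beta>). \<exists>A\<in>\<C>. \<exists>B\<in>\<C>. \<alpha> \<in> brauer_hom A B \<and> \<beta> \<in> brauer_hom A B \<and>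
     brank \<alpha> = p \<and> upper \<alpha> = upper \<beta> \<and> lower \<alpha> = lower \<beta> \<and>
     (\<exists>h. bij_betw h {1..p} (A - \<Union>(upper \<alpha>)) \<and>
       (\<exists>\<pi>\<in>N. \<forall>i\<in>{1..p}. thr \<alpha> (h i) = thr \<beta> (h (\<pi> i))))}"

lemma twistI:
  assumes "A \<in> \<C>" "B \<in> \<C>" "\<alpha> \<in> brauer_hom A B" "\<beta> \<in> brauer_hom A B"
    "brank \<alpha> = p" "upper \<alpha> = upper \<beta>" "lower \<alpha> = lower \<beta>"
    "bij_betw h {1..p} (A - \<Union>(upper \<alpha>))" "\<pi> \<in> N"
    "\<And>i. i \<in> {1..p} \<Longrightarrow> thr \<alpha> (h i) = thr \<beta> (h (\<pi> i))"
  shows "(\<alpha>, \<beta>) \<in> twist N p"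
  using assms unfolding twist_def by blast

lemma twistE:
  assumes "(\<alpha>, \<beta>) \<in> twist N p"
  obtains A B h \<pi> where "A \<in> \<C>" "B \<in> \<C>" "\<alpha> \<in> brauer_hom A B" "\<beta> \<in> brauer_hom A B"
    "brank \<alpha> = p" "brank \<beta> = p" "upper \<alpha> = upper \<beta>" "lower \<alpha> = lower \<beta>"
    "bij_betw h {1..p} (A - \<Union>(upper \<alpha>))" "\<pi> \<in> N"
    "\<forall>i\<in>{1..p}. thr \<alpha> (h i) = thr \<beta> (h (\<pi> i))"
proof -
  obtain A B h \<pi> where *: "A \<in> \<C>" "B \<in> \<C>" "\<alpha> \<in> brauer_hom A B" "\<beta> \<in> brauer_hom A B"
    "brank \<alpha> = p" "upper \<alpha> = upper \<beta>" "lower \<alpha> = lower \<beta>"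
    "bij_betw h {1..p} (A - \<Union>(upper \<alpha>))" "\<pi> \<in> N"
    "\<forall>i\<in>{1..p}. thr \<alpha> (h i) = thr \<beta> (h (\<pi> i))"
    using assms unfolding twist_def by blast
  moreover have "brank \<beta> = p" using *(5,6) brank_upper[OF *(3)] brank_upper[OF *(4)] by simp
  ultimately show ?thesis using that by blast
qed

lemma ex_numbering:
  assumes "A \<in> \<C>" "\<alpha> \<in> brauer_hom A B"
  shows "\<exists>h. bij_betw h {1..brank \<alpha>} (A - \<Union>(upper \<alpha>))"
  using finite_same_card_bij[of "{1..brank \<alpha>}" "A - \<Union>(upper \<alpha>)"] brank_upper[OF assms(2)] fin[OF assms(1)]
  by simp

lemma renumbering:
  assumes h: "bij_betw h {1..p::nat} F" and h': "bij_betw h' {1..p} F"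
  obtains \<tau> where "\<tau> permutes {1..p}" "\<And>i. i \<in> {1..p} \<Longrightarrow> h' i = h (\<tau> i)"
proof -
  define \<tau> where "\<tau> i = (if i \<in> {1..p} then inv_into {1..p} h (h' i) else i)" for i
  have "bij_betw (inv_into {1..p} h \<circ> h') {1..p} {1..p}"
    by (rule bij_betw_trans[OF h' bij_betw_inv_into[OF h]])
  then have "bij_betw \<tau> {1..p} {1..p}"
    by (subst bij_betw_cong[of _ _ "inv_into {1..p} h \<circ> h'"]) (simp_all add: \<tau>_def)
  then have "\<tau> permutes {1..p}"
    by (rule bij_imp_permutes) (auto simp: \<tau>_def)
  moreover have "h' i = h (\<tau> i)" if "i \<in> {1..p}" for i
    using bij_betw_inv_into_right[OF h, of "h' i"] bij_betwE[OF h'] that unfolding \<tau>_def by auto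
  ultimately show ?thesis using that by blast
qed

text \<open>Renumbering by \<open>\<tau>\<close> conjugates the permutation by
  \<open>\<tau>\<close>, and normality of \<open>N\<close> absorbs this. The existential numbering
  in \<open>twist\<close> may thus be traded for any convenient one.\<close>

lemma twist_all:
  assumes N: "N \<lhd> sym_group p" and tw: "(\<alpha>, \<beta>) \<in> twist N p" and \<alpha>: "\<alpha> \<in> brauer_hom A B"
    and h': "bij_betw h' {1..p} (A - \<Union>(upper \<alpha>))"
  shows "\<exists>\<pi>\<in>N. \<forall>i\<in>{1..p}. thr \<alpha> (h' i) = thr \<beta> (h' (\<pi> i))"
proof -
  obtain A' B' h \<pi> where h: "A' \<in> \<C>" "B' \<in> \<C>" "\<alpha> \<in> brauer_hom A' B'" "\<beta> \<in> brauer_hom A' B'"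
    "brank \<alpha> = p" "brank \<beta> = p" "upper \<alpha> = upper \<beta>" "lower \<alpha> = lower \<beta>"
    "bij_betw h {1..p} (A' - \<Union>(upper \<alpha>))" "\<pi> \<in> N"
    "\<forall>i\<in>{1..p}. thr \<alpha> (h i) = thr \<beta> (h (\<pi> i))"
    using tw by (rule twistE)
  have "A' = A" using bdom_hom[OF h(3)] bdom_hom[OF \<alpha>] by simp
  then obtain \<tau> where \<tau>: "\<tau> permutes {1..p}" "\<And>i. i \<in> {1..p} \<Longrightarrow> h' i = h (\<tau> i)"
    using renumbering[OF h(9)] h' by blast
  show ?thesis
  proof (intro bexI ballI)
    show N': "inv' \<tau> \<circ> \<pi> \<circ> \<tau> \<in> N" using normal_conj[OF N h(10) \<tau>(1)] .
    fix i assume i: "i \<in> {1..p}"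
    have ti: "\<tau> i \<in> {1..p}" using permutes_in_image[OF \<tau>(1)] i by blast
    have "(inv' \<tau> \<circ> \<pi> \<circ> \<tau>) i \<in> {1..p}"
      using permutes_in_image[OF normal_permutes[OF N N']] i by blast
    then have "h' ((inv' \<tau> \<circ> \<pi> \<circ> \<tau>) i) = h (\<tau> ((inv' \<tau> \<circ> \<pi> \<circ> \<tau>) i))" by (rule \<tau>(2))
    also have "\<dots> = h (\<pi> (\<tau> i))" using permutes_inverses(1)[OF \<tau>(1)] by simp
    finally show "thr \<alpha> (h' i) = thr \<beta> (h' ((inv' \<tau> \<circ> \<pi> \<circ> \<tau>) i))"
      using h(11)[rule_format, OF ti] \<tau>(2)[OF i] by simp
  qed
qed

lemma twist_sym:
  assumes N: "N \<lhd> sym_group p" and tw: "(\<alpha>, \<beta>) \<in> twist N p"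
  shows "(\<beta>, \<alpha>) \<in> twist N p"
proof -
  obtain A B h \<pi> where *: "A \<in> \<C>" "B \<in> \<C>" "\<alpha> \<in> brauer_hom A B" "\<beta> \<in> brauer_hom A B"
    "brank \<alpha> = p" "brank \<beta> = p" "upper \<alpha> = upper \<beta>" "lower \<alpha> = lower \<beta>"
    "bij_betw h {1..p} (A - \<Union>(upper \<alpha>))" "\<pi> \<in> N"
    "\<forall>i\<in>{1..p}. thr \<alpha> (h i) = thr \<beta> (h (\<pi> i))"
    using tw by (rule twistE)
  note \<pi> = normal_permutes[OF N *(10)]
  have hb: "bij_betw h {1..p} (A - \<Union>(upper \<beta>))" using *(7,9) by simp
  show ?thesis
  proof (rule twistI[OF *(1,2,4,3,6) *(7)[symmetric] *(8)[symmetric] hb normal_inv[OF N *(10)]])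
    fix i assume "i \<in> {1..p}"
    then have "inv' \<pi> i \<in> {1..p}"
      using permutes_in_image[OF permutes_inv[OF \<pi>]] by blast
    from *(11)[rule_format, OF this] show "thr \<beta> (h i) = thr \<alpha> (h (inv' \<pi> i))"
      using permutes_inverses(1)[OF \<pi>] by simp
  qed
qed

lemma twist_trans:
  assumes N: "N \<lhd> sym_group p" and tw: "(\<alpha>, \<beta>) \<in> twist N p" "(\<beta>, \<gamma>) \<in> twist N p"
  shows "(\<alpha>, \<gamma>) \<in> twist N p"
proof -
  obtain A B h \<pi> where *: "A \<in> \<C>" "B \<in> \<C>" "\<alpha> \<in> brauer_hom A B" "\<beta> \<in> brauer_hom A B"
    "brank \<alpha> = p" "brank \<beta> = p" "upper \<alpha> = upper \<beta>" "lower \<alpha> = lower \<beta>"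
    "bij_betw h {1..p} (A - \<Union>(upper \<alpha>))" "\<pi> \<in> N"
    "\<forall>i\<in>{1..p}. thr \<alpha> (h i) = thr \<beta> (h (\<pi> i))"
    using tw(1) by (rule twistE)
  note \<pi> = normal_permutes[OF N *(10)]
  have hb: "bij_betw h {1..p} (A - \<Union>(upper \<beta>))" using *(7,9) by simp
  \<comment> \<open>The second pair has to be read in the numbering of the first before the
    permutations can be composed.\<close>
  obtain \<rho> where \<rho>: "\<rho> \<in> N" "\<And>i. i \<in> {1..p} \<Longrightarrow> thr \<beta> (h i) = thr \<gamma> (h (\<rho> i))"
    using twist_all[OF N tw(2) *(4) hb] by blast
  obtain A' B' where **: "\<beta> \<in> brauer_hom A' B'" "\<gamma> \<in> brauer_hom A' B'"
    "upper \<beta> = upper \<gamma>" "lower \<beta> = lower \<gamma>"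
    using tw(2) by (rule twistE)
  have \<gamma>: "\<gamma> \<in> brauer_hom A B" using ** *(4) bdom_hom bran_hom by metis
  show ?thesis
  proof (rule twistI[OF *(1-3) \<gamma> *(5) _ _ *(9) normal_comp[OF N \<rho>(1) *(10)]])
    fix i assume i: "i \<in> {1..p}"
    then have "\<pi> i \<in> {1..p}" using permutes_in_image[OF \<pi>] by blast
    then show "thr \<alpha> (h i) = thr \<gamma> (h ((\<rho> \<circ> \<pi>) i))"
      using *(11)[rule_format, OF i] \<rho>(2) by simp
  qed (use * ** in auto)
qed

lemma thr_flip:
  assumes \<alpha>: "\<alpha> \<in> brauer_hom A B" and a: "a \<in> A - \<Union>(upper \<alpha>)"
  shows "thr (flip \<alpha>) (thr \<alpha> a) = a"
  by (rule thr_eqI[OF flip_hom[OF \<alpha>]]) (simp add: flip_thr_iff thr_mem[OF \<alpha> a])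

text \<open>Numbering the lower free points along the strands of \<open>\<alpha>\<close> turns the
  permutation into its inverse.\<close>

lemma twist_flip:
  assumes N: "N \<lhd> sym_group p" and tw: "(\<alpha>, \<beta>) \<in> twist N p"
  shows "(flip \<alpha>, flip \<beta>) \<in> twist N p"
proof -
  obtain A B h \<pi> where *: "A \<in> \<C>" "B \<in> \<C>" "\<alpha> \<in> brauer_hom A B" "\<beta> \<in> brauer_hom A B"
    "brank \<alpha> = p" "brank \<beta> = p" "upper \<alpha> = upper \<beta>" "lower \<alpha> = lower \<beta>"
    "bij_betw h {1..p} (A - \<Union>(upper \<alpha>))" "\<pi> \<in> N"
    "\<forall>i\<in>{1..p}. thr \<alpha> (h i) = thr \<beta> (h (\<pi> i))"
    using tw by (rule twistE)
  note \<pi> = normal_permutes[OF N *(10)]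
  have hF: "h i \<in> A - \<Union>(upper \<alpha>)" if "i \<in> {1..p}" for i using bij_betwE[OF *(9)] that by blast
  have k: "bij_betw (thr \<alpha> \<circ> h) {1..p} (B - \<Union>(upper (flip \<alpha>)))"
    using bij_betw_trans[OF *(9) thr_bij[OF *(3)]] by simp
  show ?thesis
  proof (rule twistI[OF *(2,1) flip_hom[OF *(3)] flip_hom[OF *(4)] _ _ _ k normal_inv[OF N *(10)]])
    fix i assume i: "i \<in> {1..p}"
    define j where "j = inv' \<pi> i"
    have j: "j \<in> {1..p}" "\<pi> j = i"
      using permutes_in_image[OF permutes_inv[OF \<pi>]] i permutes_inverses(1)[OF \<pi>] unfolding j_def by auto
    have "thr (flip \<alpha>) (thr \<alpha> (h i)) = h i" using thr_flip[OF *(3) hF[OF i]] .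
    moreover have "thr (flip \<beta>) (thr \<beta> (h (\<pi> j))) = h (\<pi> j)"
      using thr_flip[OF *(4)] hF[OF i] *(7) j(2) by simp
    ultimately show "thr (flip \<alpha>) ((thr \<alpha> \<circ> h) i) = thr (flip \<beta>) ((thr \<alpha> \<circ> h) (inv' \<pi> i))"
      using *(11)[rule_format, OF j(1)] j(2) unfolding j_def[symmetric] by simp
  qed (use * in auto)
qed

text \<open>Writing \<open>\<beta> = \<alpha> \<cdot> \<gamma>\<close>, with \<open>\<gamma>\<close>
  permuting the lower free points, moves the difference of the pair to the side away from
  \<open>s\<close>. By associativity \<open>s \<cdot> \<beta>\<close> is
  \<open>s \<cdot> \<alpha>\<close> followed by the same \<open>\<gamma>\<close>, so either both
  ranks drop or the same difference persists.\<close>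

lemma twist_left:
  assumes N: "N \<lhd> sym_group p" and tw: "(\<alpha>, \<beta>) \<in> twist N p" and \<alpha>: "\<alpha> \<in> brauer_hom A B"
    and A': "A' \<in> \<C>" and s: "s \<in> brauer_hom A' A"
  shows "(s \<cdot> \<alpha>, s \<cdot> \<beta>) \<in> twist N p \<or> brank (s \<cdot> \<alpha>) < p \<and> brank (s \<cdot> \<beta>) < p"
proof -
  obtain A1 B1 where "A1 \<in> \<C>" "B1 \<in> \<C>" "\<alpha> \<in> brauer_hom A1 B1" "\<beta> \<in> brauer_hom A1 B1"
    and rk: "brank \<alpha> = p" "brank \<beta> = p" and up: "upper \<alpha> = upper \<beta>" and lo: "lower \<alpha> = lower \<beta>"
    using tw by (rule twistE)
  then have obj: "A \<in> \<C>" "B \<in> \<C>" and \<beta>: "\<beta> \<in> brauer_hom A B"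
    using \<alpha> bdom_hom bran_hom by metis+
  note fA = fin[OF obj(1)] and fB = fin[OF obj(2)] and fA' = fin[OF A']
  define F where "F = A - \<Union>(upper \<alpha>)"
  define G where "G = B - \<Union>(lower \<alpha>)"
  have bf: "bij_betw (thr \<alpha>) F G" and bg: "bij_betw (thr \<beta>) F G"
    using thr_bij[OF \<alpha>] thr_bij[OF \<beta>] up lo unfolding F_def G_def by simp_all
  define e where "e = thr \<beta> \<circ> inv_into F (thr \<alpha>)"
  have be: "bij_betw e (B - \<Union>(lower \<alpha>)) (B - \<Union>(lower \<alpha>))"
    using bij_betw_trans[OF bij_betw_inv_into[OF bf] bg] unfolding e_def G_def .
  have e_thr: "e (thr \<alpha> a) = thr \<beta> a" if "a \<in> F" for a
    unfolding e_def using bij_betw_inv_into_left[OF bf that] by simp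
  note mu = matching_upper[OF \<alpha>] and ml = matching_lower[OF \<alpha>]
  define \<gamma> where "\<gamma> = diag B (lower \<alpha>) (lower \<alpha>) e"
  have \<gamma>: "\<gamma> \<in> brauer_hom B B" unfolding \<gamma>_def by (rule diag_hom[OF ml ml be])
  have "\<alpha> \<cdot> \<gamma> = diag A (upper \<alpha>) (lower \<alpha>) (thr \<alpha>) \<cdot> \<gamma>"
    using hom_eq_diag[OF \<alpha>] by simp
  also have "\<dots> = diag A (upper \<alpha>) (lower \<alpha>) (e \<circ> thr \<alpha>)"
    unfolding \<gamma>_def by (rule diag_mult[OF mu ml thr_bij[OF \<alpha>] ml ml be refl fA fB fB])
  also have "\<dots> = diag A (upper \<alpha>) (lower \<alpha>) (thr \<beta>)"
    by (rule diag_cong) (simp add: e_thr F_def)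
  also have "\<dots> = \<beta>" using hom_eq_diag[OF \<beta>] up lo by simp
  finally have "\<beta> = \<alpha> \<cdot> \<gamma>" by simp
  note s\<alpha> = mult_hom[OF A' obj s \<alpha>] and s\<beta> = mult_hom[OF A' obj s \<beta>]
  have eq: "s \<cdot> \<beta> = s \<cdot> \<alpha> \<cdot> \<gamma>"
    unfolding \<open>\<beta> = \<alpha> \<cdot> \<gamma>\<close> by (rule brauer_mult_assoc[symmetric, OF s \<alpha> \<gamma> fA' fA fB fB])
  have le: "brank (s \<cdot> \<alpha>) \<le> p" using brank_mult_right[OF s \<alpha> fA' fA fB] rk by simp
  show ?thesis
  proof (cases "brank (s \<cdot> \<alpha>) = p")
    case False
    then have "brank (s \<cdot> \<alpha>) < p" using le by simp
    moreover from this have "brank (s \<cdot> \<beta>) < p"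
      using brank_mult_left[OF s\<alpha> \<gamma> fA' fB fB] unfolding eq by simp
    ultimately show ?thesis by simp
  next
    case True
    have lo': "lower (s \<cdot> \<alpha>) = lower \<alpha>"
      using mult_lower_eq[OF s \<alpha> fA' fA fB] True rk by simp
    define F' where "F' = A' - \<Union>(upper (s \<cdot> \<alpha>))"
    note mu' = matching_upper[OF s\<alpha>] and ml' = matching_lower[OF s\<alpha>]
    have bk: "bij_betw (thr (s \<cdot> \<alpha>)) F' G"
      using thr_bij[OF s\<alpha>] unfolding lo' F'_def G_def .
    note bk' = thr_bij[OF s\<alpha>, unfolded lo']
    have ek: "bij_betw (e \<circ> thr (s \<cdot> \<alpha>)) (A' - \<Union>(upper (s \<cdot> \<alpha>))) (B - \<Union>(lower \<alpha>))"
      by (rule bij_betw_trans[OF bk' be])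
    have "s \<cdot> \<alpha> = diag A' (upper (s \<cdot> \<alpha>)) (lower \<alpha>) (thr (s \<cdot> \<alpha>))"
      using hom_eq_diag[OF s\<alpha>] unfolding lo' .
    then have "s \<cdot> \<beta> = diag A' (upper (s \<cdot> \<alpha>)) (lower \<alpha>) (thr (s \<cdot> \<alpha>)) \<cdot> \<gamma>"
      using eq by simp
    also have "\<dots> = diag A' (upper (s \<cdot> \<alpha>)) (lower \<alpha>) (e \<circ> thr (s \<cdot> \<alpha>))"
      unfolding \<gamma>_def by (rule diag_mult[OF mu' ml bk' ml ml be refl fA' fB fB])
    finally have s\<beta>_eq: "s \<cdot> \<beta> = diag A' (upper (s \<cdot> \<alpha>)) (lower \<alpha>) (e \<circ> thr (s \<cdot> \<alpha>))" .
    have u\<beta>: "upper (s \<cdot> \<beta>) = upper (s \<cdot> \<alpha>)" and l\<beta>: "lower (s \<cdot> \<beta>) = lower \<alpha>"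
      unfolding s\<beta>_eq by (rule upper_diag[OF mu' ml ek], rule lower_diag[OF mu' ml ek])
    have t\<beta>: "thr (s \<cdot> \<beta>) u = e (thr (s \<cdot> \<alpha>) u)" if "u \<in> F'" for u
      using thr_diag[OF mu' ml ek, of u] that unfolding s\<beta>_eq F'_def by simp
    obtain h' where h': "bij_betw h' {1..p} F'"
      using ex_numbering[OF A' s\<alpha>] True unfolding F'_def by blast
    \<comment> \<open>Free upper points of \<open>s \<cdot> \<alpha>\<close> and of
      \<open>\<alpha>\<close> receive the same number when their strands end at the same lower
      point.\<close>
    define h where "h = inv_into F (thr \<alpha>) \<circ> (thr (s \<cdot> \<alpha>) \<circ> h')"
    have h: "bij_betw h {1..p} F"
      unfolding h_def by (rule bij_betw_trans[OF bij_betw_trans[OF h' bk] bij_betw_inv_into[OF bf]])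
    have fh: "thr \<alpha> (h i) = thr (s \<cdot> \<alpha>) (h' i)" if "i \<in> {1..p}" for i
      using bij_betw_inv_into_right[OF bf, of "thr (s \<cdot> \<alpha>) (h' i)"] bij_betwE[OF bk] bij_betwE[OF h'] that
      unfolding h_def by simp
    obtain \<pi> where \<pi>: "\<pi> \<in> N" "\<And>i. i \<in> {1..p} \<Longrightarrow> thr \<alpha> (h i) = thr \<beta> (h (\<pi> i))"
      using twist_all[OF N tw \<alpha>] h unfolding F_def by blast
    have "(s \<cdot> \<alpha>, s \<cdot> \<beta>) \<in> twist N p"
    proof (rule twistI[OF A' obj(2) s\<alpha> s\<beta> True u\<beta>[symmetric] _ _ \<pi>(1)])
      show "lower (s \<cdot> \<alpha>) = lower (s \<cdot> \<beta>)" using lo' l\<beta> by simp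
      show "bij_betw h' {1..p} (A' - \<Union>(upper (s \<cdot> \<alpha>)))" using h' unfolding F'_def .
      fix i assume i: "i \<in> {1..p}"
      then have pi: "\<pi> i \<in> {1..p}" using permutes_in_image[OF normal_permutes[OF N \<pi>(1)]] by blast
      have "thr (s \<cdot> \<beta>) (h' (\<pi> i)) = e (thr (s \<cdot> \<alpha>) (h' (\<pi> i)))"
        using t\<beta> bij_betwE[OF h'] pi by blast
      also have "\<dots> = e (thr \<alpha> (h (\<pi> i)))" using fh[OF pi] by simp
      also have "\<dots> = thr \<beta> (h (\<pi> i))" using e_thr bij_betwE[OF h] pi by blast
      also have "\<dots> = thr (s \<cdot> \<alpha>) (h' i)" using \<pi>(2)[OF i] fh[OF i] by simp
      finally show "thr (s \<cdot> \<alpha>) (h' i) = thr (s \<cdot> \<beta>) (h' (\<pi> i))" by simp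
    qed
    then show ?thesis by simp
  qed
qed

lemma R_cong_iff:
  "(\<alpha>, \<beta>) \<in> R_cong (brauer_I \<C> r) (brauer_ideal \<C> (enat q)) \<longleftrightarrow>
    \<alpha> \<in> brauer_ideal \<C> r \<and> \<beta> \<in> brauer_ideal \<C> r \<and> bdom \<alpha> = bdom \<beta> \<and> bran \<alpha> = bran \<beta> \<and>
    (\<alpha> = \<beta> \<or> brank \<alpha> \<le> q \<and> brank \<beta> \<le> q)"
proof -
  have "\<alpha> \<in> brauer_ideal \<C> (enat q) \<longleftrightarrow> brank \<alpha> \<le> q" if "\<alpha> \<in> brauer_ideal \<C> r" for \<alpha>
    using that by (simp add: brauer_ideal_iff)
  then show ?thesis
    unfolding R_cong_def psg_sim_def Delta_def by auto
qed

text \<open>The relation \<open>RN_cong\<close> in a form free of the two-sided products in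
  \<open>nu\<close>; the agreement is \<open>RN_eq_RT\<close>. The degree \<open>q + 2\<close> is
  the least possible rank above an odd \<open>q\<close>.\<close>

definition RT :: "enat \<Rightarrow> nat \<Rightarrow> (nat \<Rightarrow> nat) set \<Rightarrow> 'a diagram rel" where
  "RT r q N = R_cong (brauer_I \<C> r) (brauer_ideal \<C> (enat q)) \<union> twist N (q + 2)"

lemma twist_ideal:
  assumes "(\<alpha>, \<beta>) \<in> twist N p" "enat p \<le> r"
  shows "\<alpha> \<in> brauer_ideal \<C> r" "\<beta> \<in> brauer_ideal \<C> r" "bdom \<alpha> = bdom \<beta>" "bran \<alpha> = bran \<beta>"
  using assms unfolding twist_def by (auto simp: brauer_ideal_iff brank_upper)

lemma RT_mem:
  assumes "(\<alpha>, \<beta>) \<in> RT r q N" "enat (q + 2) \<le> r"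
  shows "\<alpha> \<in> brauer_ideal \<C> r" "\<beta> \<in> brauer_ideal \<C> r" "bdom \<alpha> = bdom \<beta>" "bran \<alpha> = bran \<beta>"
proof -
  have "\<alpha> \<in> brauer_ideal \<C> r \<and> \<beta> \<in> brauer_ideal \<C> r \<and> bdom \<alpha> = bdom \<beta> \<and> bran \<alpha> = bran \<beta>"
  proof (cases "(\<alpha>, \<beta>) \<in> twist N (q + 2)")
    case True
    then show ?thesis using twist_ideal[OF _ assms(2)] by metis
  next
    case False
    then show ?thesis using assms(1) unfolding RT_def Un_iff R_cong_iff by blast
  qed
  then show "\<alpha> \<in> brauer_ideal \<C> r" "\<beta> \<in> brauer_ideal \<C> r" "bdom \<alpha> = bdom \<beta>" "bran \<alpha> = bran \<beta>"
    by blast+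
qed

lemma RT_flip:
  assumes N: "N \<lhd> sym_group (q + 2)" and "(\<alpha>, \<beta>) \<in> RT r q N"
  shows "(flip \<alpha>, flip \<beta>) \<in> RT r q N"
proof (cases "(\<alpha>, \<beta>) \<in> twist N (q + 2)")
  case True
  then show ?thesis using twist_flip[OF N] unfolding RT_def by blast
next
  case False
  then have R: "(\<alpha>, \<beta>) \<in> R_cong (brauer_I \<C> r) (brauer_ideal \<C> (enat q))"
    using assms(2) unfolding RT_def by blast
  then have mem: "\<alpha> \<in> brauer_ideal \<C> r" "\<beta> \<in> brauer_ideal \<C> r" unfolding R_cong_iff by blast+
  moreover from this have "brank (flip \<alpha>) = brank \<alpha>" "brank (flip \<beta>) = brank \<beta>"
    by (auto simp: brauer_ideal_iff)
  ultimately have "(flip \<alpha>, flip \<beta>) \<in> R_cong (brauer_I \<C> r) (brauer_ideal \<C> (enat q))"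
    using R bdom_flip[OF mem(1)] bdom_flip[OF mem(2)] bran_flip[OF mem(1)] bran_flip[OF mem(2)]
    unfolding R_cong_iff by simp
  then show ?thesis unfolding RT_def by blast
qed

lemma RT_left:
  assumes N: "N \<lhd> sym_group (q + 2)" and q: "odd q" "enat (q + 2) \<le> r" and \<alpha>\<beta>: "(\<alpha>, \<beta>) \<in> RT r q N"
    and s: "s \<in> brauer_ideal \<C> r" "bran s = bdom \<alpha>"
  shows "(s \<cdot> \<alpha>, s \<cdot> \<beta>) \<in> RT r q N"
proof -
  have mem: "\<alpha> \<in> brauer_ideal \<C> r" "\<beta> \<in> brauer_ideal \<C> r" "bdom \<alpha> = bdom \<beta>" "bran \<alpha> = bran \<beta>"
    using RT_mem[OF \<alpha>\<beta> q(2)] .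
  obtain A B where AB: "A \<in> \<C>" "B \<in> \<C>" "\<alpha> \<in> brauer_hom A B"
    using mem(1) by (rule brauer_idealE)
  then have \<beta>: "\<beta> \<in> brauer_hom A B"
    using mem by (auto elim!: brauer_idealE)
  obtain A' where A': "A' \<in> \<C>" "s \<in> brauer_hom A' A"
    using s AB(3) by (auto elim!: brauer_idealE)
  have rs: "enat (brank s) \<le> r" using s(1) by (simp add: brauer_ideal_iff)
  note s\<alpha> = mult_hom[OF A'(1) AB(1,2) A'(2) AB(3)] and s\<beta> = mult_hom[OF A'(1) AB(1,2) A'(2) \<beta>]
  have ideal: "s \<cdot> \<alpha> \<in> brauer_ideal \<C> r" "s \<cdot> \<beta> \<in> brauer_ideal \<C> r"
    using mult_ideal[OF A'(1) AB(1,2) A'(2) AB(3)] mult_ideal[OF A'(1) AB(1,2) A'(2) \<beta>] rs by blast+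
  have "(s \<cdot> \<alpha>, s \<cdot> \<beta>) \<in> twist N (q + 2) \<or> s \<cdot> \<alpha> = s \<cdot> \<beta> \<or> brank (s \<cdot> \<alpha>) \<le> q \<and> brank (s \<cdot> \<beta>) \<le> q"
  proof (cases "(\<alpha>, \<beta>) \<in> twist N (q + 2)")
    case True
    \<comment> \<open>Ranks are odd, so \<open>q + 1\<close> cannot occur.\<close>
    have "brank \<gamma> \<le> q" if "\<gamma> \<in> brauer_hom A' B" "brank \<gamma> < q + 2" for \<gamma>
    proof -
      have "odd (brank \<gamma>)" using odd_rank[OF A'(1) that(1)] .
      then have "brank \<gamma> \<noteq> q + 1" using q(1) by auto
      then show ?thesis using that(2) by linarith
    qed
    then show ?thesis using twist_left[OF N True AB(3) A'] s\<alpha> s\<beta> by blast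
  next
    case False
    then have "\<alpha> = \<beta> \<or> brank \<alpha> \<le> q \<and> brank \<beta> \<le> q"
      using \<alpha>\<beta> unfolding RT_def Un_iff R_cong_iff by blast
    then show ?thesis
      using brank_mult_right[OF A'(2) AB(3) fin[OF A'(1)] fin[OF AB(1)] fin[OF AB(2)]]
        brank_mult_right[OF A'(2) \<beta> fin[OF A'(1)] fin[OF AB(1)] fin[OF AB(2)]] by auto
  qed
  then show ?thesis
    using ideal s\<alpha> s\<beta> unfolding RT_def Un_iff R_cong_iff by auto
qed

lemma RT_Cong:
  assumes N: "N \<lhd> sym_group (q + 2)" and q: "odd q" "enat (q + 2) \<le> r"
  shows "RT r q N \<in> Cong (brauer_I \<C> r)"
proof -
  have mem: "\<alpha> \<in> brauer_ideal \<C> r" "\<beta> \<in> brauer_ideal \<C> r" "bdom \<alpha> = bdom \<beta>" "bran \<alpha> = bran \<beta>"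
    if "(\<alpha>, \<beta>) \<in> RT r q N" for \<alpha> \<beta>
    using RT_mem[OF that q(2)] .
  have rk: "brank \<alpha> = q + 2" "brank \<beta> = q + 2" if "(\<alpha>, \<beta>) \<in> twist N (q + 2)" for \<alpha> \<beta>
    using twistE[OF that] by metis+
  have "equiv (brauer_ideal \<C> r) (RT r q N)"
  proof (rule equivI)
    show "RT r q N \<subseteq> brauer_ideal \<C> r \<times> brauer_ideal \<C> r" using mem by auto
    show "refl_on (brauer_ideal \<C> r) (RT r q N)"
      by (simp add: refl_on_def RT_def R_cong_iff)
    show "sym (RT r q N)"
      using twist_sym[OF N] unfolding sym_def RT_def Un_iff R_cong_iff by metis
    show "trans (RT r q N)"
    proof (rule transI)
      fix \<alpha> \<beta> \<gamma> assume 1: "(\<alpha>, \<beta>) \<in> RT r q N" and 2: "(\<beta>, \<gamma>) \<in> RT r q N"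
      show "(\<alpha>, \<gamma>) \<in> RT r q N"
      proof (cases "\<alpha> = \<beta> \<or> \<beta> = \<gamma>")
        case True
        then show ?thesis using 1 2 by blast
      next
        case False
        \<comment> \<open>Mixed chains are impossible: twisted diagrams have rank
          \<open>q + 2\<close>, collapsed ones rank at most \<open>q\<close>.\<close>
        consider "(\<alpha>, \<beta>) \<in> twist N (q + 2)" "(\<beta>, \<gamma>) \<in> twist N (q + 2)"
          | "brank \<alpha> \<le> q" "brank \<beta> \<le> q" "brank \<gamma> \<le> q"
          using 1 2 False rk[of \<alpha> \<beta>] rk[of \<beta> \<gamma>] unfolding RT_def Un_iff R_cong_iff by fastforce
        then show ?thesis
        proof cases
          case 1
          then show ?thesis using twist_trans[OF N] unfolding RT_def by blast
        next
          case 2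
          then show ?thesis using mem[OF 1] mem[OF \<open>(\<beta>, \<gamma>) \<in> RT r q N\<close>]
            unfolding RT_def Un_iff R_cong_iff by simp
        qed
      qed
    qed
  qed
  \<comment> \<open>Compatibility on the right is compatibility on the left for the reflected
    diagrams, as \<open>RT\<close> is invariant under reflection.\<close>
  moreover have "(\<alpha> \<cdot> s, \<beta> \<cdot> s) \<in> RT r q N"
    if ab: "(\<alpha>, \<beta>) \<in> RT r q N" and s: "s \<in> brauer_ideal \<C> r" "bran \<alpha> = bdom s" for \<alpha> \<beta> s
  proof -
    have "(flip s \<cdot> flip \<alpha>, flip s \<cdot> flip \<beta>) \<in> RT r q N"
      using RT_left[OF N q RT_flip[OF N ab], of "flip s"] s bdom_flip[OF mem(1)[OF ab]] bran_flip[OF s(1)] by simp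
    then have "(flip (\<alpha> \<cdot> s), flip (\<beta> \<cdot> s)) \<in> RT r q N"
      using flip_mult_ideal[OF mem(1)[OF ab] s(1)] flip_mult_ideal[OF mem(2)[OF ab] s(1)] s(2) mem(4)[OF ab] by simp
    from RT_flip[OF N this] show ?thesis by simp
  qed
  ultimately show ?thesis
    unfolding Cong_iff using mem RT_left[OF N q] by blast
qed

end

section \<open>Principal two-sided ideals\<close>

context odd_objects
begin

text \<open>The principal ideal \<open>S^1 \<gamma> S^1\<close>, whose equality defines
  \<open>green_J\<close>.\<close>

definition two_sided :: "enat \<Rightarrow> 'a diagram \<Rightarrow> 'a diagram set" where
  "two_sided r \<gamma> = {lmult1 (brauer_I \<C> r) c (rmult1 (brauer_I \<C> r) \<gamma> d) |c d.
     lcomp1 (brauer_I \<C> r) c \<gamma> \<and> rcomp1 (brauer_I \<C> r) \<gamma> d}"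

text \<open>In a multiple of \<open>\<alpha> = a \<cdot> \<gamma> \<cdot> b\<close> the factors
  \<open>a\<close> and \<open>b\<close> are absorbed into the outer ones. An absent outer factor
  \<open>None\<close> is replaced by \<open>a\<close> or \<open>b\<close> itself.\<close>

lemma two_sided_subset:
  assumes obj: "A \<in> \<C>" "B \<in> \<C>" "C \<in> \<C>" "D \<in> \<C>"
    and a: "a \<in> brauer_hom A B" and \<gamma>: "\<gamma> \<in> brauer_hom B C" and b: "b \<in> brauer_hom C D"
    and r: "enat (brank a) \<le> r" "enat (brank b) \<le> r" and eq: "a \<cdot> \<gamma> \<cdot> b = \<alpha>"
  shows "two_sided r \<alpha> \<subseteq> two_sided r \<gamma>"
proof
  fix \<delta> assume "\<delta> \<in> two_sided r \<alpha>"
  then obtain c d where cd: "lcomp1 (brauer_I \<C> r) c \<alpha>" "rcomp1 (brauer_I \<C> r) \<alpha> d"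
    and \<delta>: "\<delta> = lmult1 (brauer_I \<C> r) c (rmult1 (brauer_I \<C> r) \<alpha> d)"
    unfolding two_sided_def by blast
  note F = fin[OF obj(1)] fin[OF obj(2)] fin[OF obj(3)] fin[OF obj(4)]
  note a\<gamma> = mult_hom[OF obj(1-3) a \<gamma>]
  have \<alpha>: "\<alpha> \<in> brauer_hom A D" using mult_hom[OF obj(1,3,4) a\<gamma> b] eq by simp
  have aI: "a \<in> brauer_ideal \<C> r" and bI: "b \<in> brauer_ideal \<C> r"
    using brauer_idealI obj a b r by blast+
  define c' where "c' = (case c of None \<Rightarrow> Some a | Some s \<Rightarrow> Some (s \<cdot> a))"
  define d' where "d' = (case d of None \<Rightarrow> Some b | Some t \<Rightarrow> Some (b \<cdot> t))"
  have c: "(c = None \<and> c' = Some a) \<or>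
      (\<exists>s E. c = Some s \<and> c' = Some (s \<cdot> a) \<and> E \<in> \<C> \<and> s \<in> brauer_hom E A \<and> s \<cdot> a \<in> brauer_ideal \<C> r)"
  proof (cases c)
    case (Some s)
    then have s: "s \<in> brauer_ideal \<C> r" "bran s = A" using cd(1) \<alpha> by (auto simp: lcomp1_def)
    then obtain E where "E \<in> \<C>" "s \<in> brauer_hom E A" by (auto elim!: brauer_idealE)
    then show ?thesis using mult_ideal[OF _ obj(1,2) _ a] r(1) Some unfolding c'_def by auto
  qed (simp add: c'_def)
  have d: "(d = None \<and> d' = Some b) \<or>
      (\<exists>t E. d = Some t \<and> d' = Some (b \<cdot> t) \<and> E \<in> \<C> \<and> t \<in> brauer_hom D E \<and> b \<cdot> t \<in> brauer_ideal \<C> r)"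
  proof (cases d)
    case (Some t)
    then have t: "t \<in> brauer_ideal \<C> r" "bdom t = D" using cd(2) \<alpha> by (auto simp: rcomp1_def)
    then obtain E where "E \<in> \<C>" "t \<in> brauer_hom D E" by (auto elim!: brauer_idealE)
    then show ?thesis using mult_ideal[OF obj(3,4) _ b] r(2) Some unfolding d'_def by auto
  qed (simp add: d'_def)
  have R: "\<exists>E. E \<in> \<C> \<and> rmult1 (brauer_I \<C> r) \<gamma> d' \<in> brauer_hom B E \<and>
      rcomp1 (brauer_I \<C> r) \<gamma> d' \<and> rmult1 (brauer_I \<C> r) \<alpha> d = a \<cdot> rmult1 (brauer_I \<C> r) \<gamma> d'"
    using d
  proof (elim disjE exE conjE)
    assume [simp]: "d = None" "d' = Some b"
    have "a \<cdot> \<gamma> \<cdot> b = a \<cdot> (\<gamma> \<cdot> b)" by (rule brauer_mult_assoc[OF a \<gamma> b F])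
    then show ?thesis
      using mult_hom[OF obj(2-4) \<gamma> b] obj(4) bI b \<gamma> eq by (auto simp: rmult1_def rcomp1_def)
  next
    fix t E assume [simp]: "d = Some t" "d' = Some (b \<cdot> t)" and E: "E \<in> \<C>" and t: "t \<in> brauer_hom D E"
      and bt: "b \<cdot> t \<in> brauer_ideal \<C> r"
    note btE = mult_hom[OF obj(3,4) E b t] and fE = fin[OF E]
    have "a \<cdot> \<gamma> \<cdot> b \<cdot> t = a \<cdot> \<gamma> \<cdot> (b \<cdot> t)" by (rule brauer_mult_assoc[OF a\<gamma> b t F(1,3,4) fE])
    also have "\<dots> = a \<cdot> (\<gamma> \<cdot> (b \<cdot> t))" by (rule brauer_mult_assoc[OF a \<gamma> btE F(1-3) fE])
    finally show ?thesis
      using mult_hom[OF obj(2,3) E \<gamma> btE] E bt btE \<gamma> eq by (auto simp: rmult1_def rcomp1_def)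
  qed
  then obtain E where E: "E \<in> \<C>" "rmult1 (brauer_I \<C> r) \<gamma> d' \<in> brauer_hom B E"
    "rcomp1 (brauer_I \<C> r) \<gamma> d'" "rmult1 (brauer_I \<C> r) \<alpha> d = a \<cdot> rmult1 (brauer_I \<C> r) \<gamma> d'" by blast
  have "lcomp1 (brauer_I \<C> r) c' \<gamma> \<and> \<delta> = lmult1 (brauer_I \<C> r) c' (rmult1 (brauer_I \<C> r) \<gamma> d')"
    using c
  proof (elim disjE exE conjE)
    assume [simp]: "c = None" "c' = Some a"
    show ?thesis using aI a \<gamma> \<delta> E(4) by (simp add: lcomp1_def lmult1_def)
  next
    fix s G assume [simp]: "c = Some s" "c' = Some (s \<cdot> a)" and G: "G \<in> \<C>" and s: "s \<in> brauer_hom G A"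
      and sa: "s \<cdot> a \<in> brauer_ideal \<C> r"
    have "s \<cdot> a \<cdot> rmult1 (brauer_I \<C> r) \<gamma> d' = s \<cdot> (a \<cdot> rmult1 (brauer_I \<C> r) \<gamma> d')"
      by (rule brauer_mult_assoc[OF s a E(2) fin[OF G] F(1,2) fin[OF E(1)]])
    then show ?thesis
      using sa mult_hom[OF G obj(1,2) s a] \<gamma> \<delta> E(4) by (simp add: lcomp1_def lmult1_def)
  qed
  then show "\<delta> \<in> two_sided r \<gamma>" unfolding two_sided_def using E(3) by blast
qed

end

section \<open>The diagrams of permutations over a numbered object\<close>

locale numbered_object = odd_objects \<C> for \<C> :: "'a set set" +
  fixes Z :: "'a set" and x :: "nat \<Rightarrow> 'a" and p :: nat
  assumes Z: "Z \<in> \<C>" and x: "bij_betw x {1..card Z} Z" and p: "odd p" "p \<le> card Z"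
begin

text \<open>The padding pairs of the diagrams \<open>natural\<close>, serving as upper and as lower
  matching. Since \<open>card Z - p\<close> is even, they use up all points numbered beyond
  \<open>p\<close>.\<close>

definition tail :: "'a set set" where
  "tail = {{x (p + 2*j + 1), x (p + 2*j + 2)} |j. p + 2*j + 2 \<le> card Z}"

abbreviation nt :: "(nat \<Rightarrow> nat) \<Rightarrow> 'a diagram" where
  "nt \<equiv> natural x (card Z) p"

lemma x_inj: "i \<in> {1..card Z} \<Longrightarrow> j \<in> {1..card Z} \<Longrightarrow> x i = x j \<longleftrightarrow> i = j"
  using x unfolding bij_betw_def inj_on_def by blast

lemma x_mem: "i \<in> {1..card Z} \<Longrightarrow> x i \<in> Z"
  using x bij_betwE by blast

lemma Union_tail: "\<Union>tail = x ` {p+1..card Z}"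
proof (intro equalityI subsetI)
  fix v assume "v \<in> \<Union>tail"
  then show "v \<in> x ` {p+1..card Z}" unfolding tail_def by auto
next
  fix v assume "v \<in> x ` {p+1..card Z}"
  then obtain k where "k \<in> {p+1..card Z}" and v: "v = x k" by blast
  then have k: "p < k" "k \<le> card Z" by auto
  \<comment> \<open>The index of the pair that contains \<open>x k\<close>, positions beyond
    \<open>p\<close> being paired consecutively.\<close>
  define j where "j = (k - p - 1) div 2"
  have e: "even (card Z - p)" using odd_card[OF Z] p by simp
  have "k = p + 2*j + 1 \<or> k = p + 2*j + 2" "p + 2*j + 2 \<le> card Z"
    using k e p(2) unfolding j_def by presburger+
  then show "v \<in> \<Union>tail" using v unfolding tail_def by blast
qed

lemma matching_tail: "matching Z tail"
  unfolding matching_def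
proof (intro conjI ballI)
  show "disjoint tail"
  proof (rule disjointI)
    fix P Q assume "P \<in> tail" "Q \<in> tail" and ne: "P \<noteq> Q"
    then obtain i j where ij: "P = {x (p + 2*i + 1), x (p + 2*i + 2)}" "p + 2*i + 2 \<le> card Z"
      "Q = {x (p + 2*j + 1), x (p + 2*j + 2)}" "p + 2*j + 2 \<le> card Z"
      unfolding tail_def by blast
    have "i \<noteq> j" using ne ij by blast
    show "P \<inter> Q = {}"
    proof (rule ccontr)
      assume "P \<inter> Q \<noteq> {}"
      then obtain k l where kl: "k \<in> {p + 2*i + 1, p + 2*i + 2}" "l \<in> {p + 2*j + 1, p + 2*j + 2}" "x k = x l"
        using ij(1,3) by blast
      then have "k = l" using x_inj[of k l] ij(2,4) by auto
      then show False using kl(1,2) \<open>i \<noteq> j\<close> by auto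
    qed
  qed
  show "\<Union>tail \<subseteq> Z" using Union_tail x_mem by auto
  fix P assume "P \<in> tail"
  then obtain i where i: "P = {x (p + 2*i + 1), x (p + 2*i + 2)}" "p + 2*i + 2 \<le> card Z"
    unfolding tail_def by blast
  have "x (p + 2*i + 1) \<noteq> x (p + 2*i + 2)" using x_inj i(2) by simp
  then show "card P = 2" using i(1) by simp
qed

lemma free_tail: "Z - \<Union>tail = x ` {1..p}"
proof -
  have "Z = x ` {1..card Z}" using x unfolding bij_betw_def by simp
  also have "\<dots> = x ` ({1..p} \<union> {p+1..card Z})" using p(2) by (intro arg_cong[where f = "(`) x"]) auto
  finally have "Z = x ` {1..p} \<union> x ` {p+1..card Z}" by (simp add: image_Un)
  moreover have "x ` {1..p} \<inter> x ` {p+1..card Z} = {}"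
    using x_inj p(2) by fastforce
  ultimately show ?thesis unfolding Union_tail by blast
qed

lemma x_bij: "bij_betw x {1..p} (Z - \<Union>tail)"
  unfolding free_tail bij_betw_def using inj_on_subset[of x "{1..card Z}" "{1..p}"] x p(2)
  by (auto simp: bij_betw_def)

lemma natural_diagram:
  assumes "\<pi> permutes {1..p}"
  shows nt_hom: "nt \<pi> \<in> brauer_hom Z Z" and upper_nt: "upper (nt \<pi>) = tail"
    and lower_nt: "lower (nt \<pi>) = tail" and brank_nt: "brank (nt \<pi>) = p"
    and nt_thr: "\<And>i. i \<in> {1..p} \<Longrightarrow> {Unpr (x i), Pr (x (\<pi> i))} \<in> nt \<pi>"
    and thr_nt: "\<And>i. i \<in> {1..p} \<Longrightarrow> thr (nt \<pi>) (x i) = x (\<pi> i)"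
proof -
  define f where "f = x \<circ> (\<pi> \<circ> inv_into {1..p} x)"
  have f: "bij_betw f (Z - \<Union>tail) (Z - \<Union>tail)"
    unfolding f_def
    by (rule bij_betw_trans[OF bij_betw_trans[OF bij_betw_inv_into[OF x_bij] permutes_imp_bij[OF assms]] x_bij])
  have fx: "f (x i) = x (\<pi> i)" if "i \<in> {1..p}" for i
    using bij_betw_inv_into_left[OF x_bij that] unfolding f_def by simp
  have "{{Unpr a, Pr (f a)} |a. a \<in> Z - \<Union>tail} = {{Unpr (x i), Pr (x (\<pi> i))} |i. 1 \<le> i \<and> i \<le> p}"
    unfolding free_tail using fx by (auto; metis atLeastAtMost_iff imageI)
  moreover have "(`) g ` tail = {{g (x (p + 2*j + 1)), g (x (p + 2*j + 2))} |j. p + 2*j + 2 \<le> card Z}"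
    for g :: "'a \<Rightarrow> 'a vertex"
  proof -
    have "(`) g ` {F j |j. P j} = {g ` F j |j. P j}" for F :: "nat \<Rightarrow> 'a set" and P by blast
    then show ?thesis unfolding tail_def by simp
  qed
  ultimately have eq: "nt \<pi> = diag Z tail tail f"
    unfolding natural_def diag_def by (simp only: Un_ac)
  note m = matching_tail
  show "nt \<pi> \<in> brauer_hom Z Z" "upper (nt \<pi>) = tail" "lower (nt \<pi>) = tail"
    unfolding eq by (rule diag_hom[OF m m f], rule upper_diag[OF m m f], rule lower_diag[OF m m f])
  show "brank (nt \<pi>) = p"
    unfolding eq brank_diag[OF m m f] using bij_betw_same_card[OF x_bij] by simp
  fix i assume i: "i \<in> {1..p}"
  then have "x i \<in> Z - \<Union>tail" unfolding free_tail by simp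
  then show "{Unpr (x i), Pr (x (\<pi> i))} \<in> nt \<pi>" "thr (nt \<pi>) (x i) = x (\<pi> i)"
    unfolding eq using diag_thr[of "x i" Z tail f tail] thr_diag[OF m m f, of "x i"] fx[OF i] by simp_all
qed

lemma nt_thrE:
  assumes \<pi>: "\<pi> permutes {1..p}" and "{Unpr u, Pr w} \<in> nt \<pi>"
  obtains i where "i \<in> {1..p}" "u = x i" "w = x (\<pi> i)"
proof -
  have "u \<in> Z - \<Union>tail" using free_iff[OF nt_hom[OF \<pi>]] assms(2) upper_nt[OF \<pi>] by auto
  then obtain i where i: "i \<in> {1..p}" "u = x i" unfolding free_tail by blast
  moreover have "w = x (\<pi> i)"
    using hom_unique[OF nt_hom[OF \<pi>] assms(2)] nt_thr[OF \<pi> i(1)] i(2) by fastforce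
  ultimately show ?thesis using that by blast
qed

text \<open>Diagrams multiply in reading order while functions compose from the right, hence the
  reversed composition. The padding pairs agree on both sides, so every path is straight.\<close>

lemma nt_mult:
  assumes \<pi>: "\<pi> permutes {1..p}" and \<rho>: "\<rho> permutes {1..p}"
  shows "nt \<pi> \<cdot> nt \<rho> = nt (\<rho> \<circ> \<pi>)"
proof (rule sym, rule hom_eqI)
  note c = permutes_compose[OF \<pi> \<rho>] and f = fin[OF Z]
  note h = nt_hom[OF \<pi>] nt_hom[OF \<rho>]
  show "nt (\<rho> \<circ> \<pi>) \<in> brauer_hom Z Z" by (rule nt_hom[OF c])
  show "nt \<pi> \<cdot> nt \<rho> \<in> brauer_hom Z Z" by (rule mult_hom[OF Z Z Z h])
  show "upper (nt (\<rho> \<circ> \<pi>)) \<subseteq> upper (nt \<pi> \<cdot> nt \<rho>)" "lower (nt (\<rho> \<circ> \<pi>)) \<subseteq> lower (nt \<pi> \<cdot> nt \<rho>)"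
    using mult_upper[OF h f f f] mult_lower[OF h f f f]
    by (simp_all add: upper_nt[OF c] lower_nt[OF c] upper_nt[OF \<pi>] lower_nt[OF \<rho>])
  fix u w assume "{Unpr u, Pr w} \<in> nt (\<rho> \<circ> \<pi>)"
  then obtain i where i: "i \<in> {1..p}" "u = x i" "w = x ((\<rho> \<circ> \<pi>) i)" by (rule nt_thrE[OF c])
  have "\<pi> i \<in> {1..p}" using permutes_in_image[OF \<pi>] i(1) by blast
  then have "{Unpr (x (\<pi> i)), Pr (x (\<rho> (\<pi> i)))} \<in> nt \<rho>" by (rule nt_thr[OF \<rho>])
  then show "{Unpr u, Pr w} \<in> nt \<pi> \<cdot> nt \<rho>"
    using mult_thr[OF h f f f nt_thr[OF \<pi> i(1)]] i by simp
qed

lemma twist_nt_pair: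
  assumes N: "N \<lhd> sym_group p" and "\<pi> \<in> N" "\<rho> \<in> N"
  shows "(nt \<pi>, nt \<rho>) \<in> twist N p"
proof -
  note \<pi> = normal_permutes[OF N assms(2)] and \<rho> = normal_permutes[OF N assms(3)]
  have xb: "bij_betw x {1..p} (Z - \<Union>(upper (nt \<pi>)))" using x_bij upper_nt[OF \<pi>] by simp
  show ?thesis
  proof (rule twistI[OF Z Z nt_hom[OF \<pi>] nt_hom[OF \<rho>] brank_nt[OF \<pi>] _ _ xb
        normal_comp[OF N normal_inv[OF N assms(3)] assms(2)]])
    fix i assume i: "i \<in> {1..p}"
    have "\<pi> i \<in> {1..p}" using permutes_in_image[OF \<pi>] i by blast
    then have "(inv' \<rho> \<circ> \<pi>) i \<in> {1..p}"
      using permutes_in_image[OF permutes_inv[OF \<rho>]] by simp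
    then show "thr (nt \<pi>) (x i) = thr (nt \<rho>) (x ((inv' \<rho> \<circ> \<pi>) i))"
      using thr_nt[OF \<pi> i] thr_nt[OF \<rho>] permutes_inverses(1)[OF \<rho>] by simp
  qed (simp_all add: upper_nt[OF \<pi>] upper_nt[OF \<rho>] lower_nt[OF \<pi>] lower_nt[OF \<rho>])
qed

text \<open>Reading the through maps in the numbering \<open>x\<close> recovers \<open>N\<close>
  from the relation. This is what later shows that inclusion of congruences reflects inclusion of
  subgroups.\<close>

lemma twist_nt_iff:
  assumes N: "N \<lhd> sym_group p" and \<pi>: "\<pi> permutes {1..p}"
  shows "(nt \<pi>, nt id) \<in> twist N p \<longleftrightarrow> \<pi> \<in> N"
proof
  assume tw: "(nt \<pi>, nt id) \<in> twist N p"
  have xb: "bij_betw x {1..p} (Z - \<Union>(upper (nt \<pi>)))" using x_bij upper_nt[OF \<pi>] by simp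
  obtain \<rho> where \<rho>: "\<rho> \<in> N" "\<And>i. i \<in> {1..p} \<Longrightarrow> thr (nt \<pi>) (x i) = thr (nt id) (x (\<rho> i))"
    using twist_all[OF N tw nt_hom[OF \<pi>] xb] by blast
  note \<rho>p = normal_permutes[OF N \<rho>(1)]
  have "\<pi> i = \<rho> i" for i
  proof (cases "i \<in> {1..p}")
    case True
    then have m: "\<pi> i \<in> {1..p}" "\<rho> i \<in> {1..p}"
      using permutes_in_image[OF \<pi>] permutes_in_image[OF \<rho>p] by blast+
    then have "x (\<pi> i) = x (\<rho> i)"
      using \<rho>(2)[OF True] thr_nt[OF \<pi> True] thr_nt[OF permutes_id m(2)] by simp
    then show ?thesis using x_inj[of "\<pi> i" "\<rho> i"] m p(2) by auto
  next
    case False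
    then show ?thesis using permutes_not_in[OF \<pi>] permutes_not_in[OF \<rho>p] by metis
  qed
  then have "\<pi> = \<rho>" by (rule ext)
  then show "\<pi> \<in> N" using \<rho>(1) by simp
qed (use twist_nt_pair[OF N _ normal_id[OF N]] in blast)

text \<open>The multipliers number the free points on both sides. Lower points are numbered along
  the strands of \<open>\<beta>\<close>, so \<open>\<beta>\<close> becomes the identity diagram and
  \<open>\<alpha>\<close> the diagram of \<open>\<pi>\<close>; numbering in the opposite direction
  leads back. Pairs with equal outer matchings in rank \<open>p\<close> thereby become questions
  about one group over \<open>Z\<close>.\<close>

lemma transport:
  assumes obj: "A \<in> \<C>" "B \<in> \<C>" and \<alpha>: "\<alpha> \<in> brauer_hom A B" and \<beta>: "\<beta> \<in> brauer_hom A B"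
    and up: "upper \<alpha> = upper \<beta>" and lo: "lower \<alpha> = lower \<beta>"
    and h: "bij_betw h {1..p} (A - \<Union>(upper \<alpha>))" and \<pi>: "\<pi> permutes {1..p}"
    and eq: "\<forall>i\<in>{1..p}. thr \<alpha> (h i) = thr \<beta> (h (\<pi> i))"
  shows "\<exists>a\<in>brauer_hom A Z. \<exists>b\<in>brauer_hom Z B. \<exists>a'\<in>brauer_hom Z A. \<exists>b'\<in>brauer_hom B Z.
    brank a = p \<and> brank b = p \<and> brank a' = p \<and> brank b' = p \<and>
    a \<cdot> nt \<pi> \<cdot> b = \<alpha> \<and> a \<cdot> nt id \<cdot> b = \<beta> \<and> a' \<cdot> \<alpha> \<cdot> b' = nt \<pi> \<and> a' \<cdot> \<beta> \<cdot> b' = nt id"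
proof -
  note mu = matching_upper[OF \<alpha>] and ml = matching_lower[OF \<alpha>] and mt = matching_tail
  note F = fin[OF obj(1)] fin[OF obj(2)] and fZ = fin[OF Z]
  define k where "k = thr \<beta> \<circ> h"
  have k: "bij_betw k {1..p} (B - \<Union>(lower \<alpha>))"
    using bij_betw_trans[OF h, of "thr \<beta>" "B - \<Union>(lower \<alpha>)"] thr_bij[OF \<beta>] up lo unfolding k_def by simp
  obtain a where a: "a \<in> brauer_hom A Z" "upper a = upper \<alpha>" "lower a = tail" "brank a = p"
    "\<forall>i\<in>{1..p}. {Unpr (h i), Pr (x i)} \<in> a"
    using ex_indexed_diagram[OF mu mt h x_bij] by blast
  obtain b where b: "b \<in> brauer_hom Z B" "upper b = tail" "lower b = lower \<alpha>" "brank b = p"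
    "\<forall>i\<in>{1..p}. {Unpr (x i), Pr (k i)} \<in> b"
    using ex_indexed_diagram[OF mt ml x_bij k] by blast
  obtain a' where a': "a' \<in> brauer_hom Z A" "upper a' = tail" "lower a' = upper \<alpha>" "brank a' = p"
    "\<forall>i\<in>{1..p}. {Unpr (x i), Pr (h i)} \<in> a'"
    using ex_indexed_diagram[OF mt mu x_bij h] by blast
  obtain b' where b': "b' \<in> brauer_hom B Z" "upper b' = lower \<alpha>" "lower b' = tail" "brank b' = p"
    "\<forall>i\<in>{1..p}. {Unpr (k i), Pr (x i)} \<in> b'"
    using ex_indexed_diagram[OF ml mt k x_bij] by blast
  have hF: "h i \<in> A - \<Union>(upper \<alpha>)" if "i \<in> {1..p}" for i
    using bij_betwE[OF h] that by blast
  have main: "a \<cdot> nt \<rho> \<cdot> b = \<gamma> \<and> a' \<cdot> \<gamma> \<cdot> b' = nt \<rho>"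
    if \<gamma>: "\<gamma> \<in> brauer_hom A B" "upper \<gamma> = upper \<alpha>" "lower \<gamma> = lower \<alpha>" and \<rho>: "\<rho> permutes {1..p}"
      and eq: "\<forall>i\<in>{1..p}. thr \<gamma> (h i) = k (\<rho> i)" for \<gamma> \<rho>
  proof
    have \<rho>_mem: "\<rho> i \<in> {1..p}" if "i \<in> {1..p}" for i using permutes_in_image[OF \<rho>] that by blast
    have g: "{Unpr (h i), Pr (k (\<rho> i))} \<in> \<gamma>" if "i \<in> {1..p}" for i
      using thr_mem[OF \<gamma>(1), of "h i"] hF[OF that] eq that \<gamma>(2) by simp
    show "a \<cdot> nt \<rho> \<cdot> b = \<gamma>"
    proof (rule triple_mult_eqI[OF a(1) nt_hom[OF \<rho>] b(1) \<gamma>(1) F(1) fZ fZ F(2)])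
      fix u w assume uw: "{Unpr u, Pr w} \<in> \<gamma>"
      then have "u \<in> A - \<Union>(upper \<alpha>)" using free_iff[OF \<gamma>(1)] \<gamma>(2) by auto
      then have "u \<in> h ` {1..p}" using h unfolding bij_betw_def by simp
      then obtain i where i: "i \<in> {1..p}" "u = h i" by blast
      have "w = k (\<rho> i)" using hom_unique[OF \<gamma>(1) uw] g[OF i(1)] i(2) by fastforce
      then show "\<exists>v v'. {Unpr u, Pr v} \<in> a \<and> {Unpr v, Pr v'} \<in> nt \<rho> \<and> {Unpr v', Pr w} \<in> b"
        using a(5) b(5) nt_thr[OF \<rho> i(1)] i \<rho>_mem[OF i(1)] by blast
    qed (use \<gamma> a b in auto)
    show "a' \<cdot> \<gamma> \<cdot> b' = nt \<rho>"
    proof (rule triple_mult_eqI[OF a'(1) \<gamma>(1) b'(1) nt_hom[OF \<rho>] fZ F fZ])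
      fix u w assume "{Unpr u, Pr w} \<in> nt \<rho>"
      then obtain i where i: "i \<in> {1..p}" "u = x i" "w = x (\<rho> i)" by (rule nt_thrE[OF \<rho>])
      then show "\<exists>v v'. {Unpr u, Pr v} \<in> a' \<and> {Unpr v, Pr v'} \<in> \<gamma> \<and> {Unpr v', Pr w} \<in> b'"
        using a'(5) b'(5) g[OF i(1)] \<rho>_mem[OF i(1)] by blast
    qed (use a' b' upper_nt[OF \<rho>] lower_nt[OF \<rho>] in auto)
  qed
  have "a \<cdot> nt \<pi> \<cdot> b = \<alpha> \<and> a' \<cdot> \<alpha> \<cdot> b' = nt \<pi>"
    by (rule main[OF \<alpha> refl refl \<pi>]) (use eq in \<open>simp add: k_def\<close>)
  moreover have "a \<cdot> nt id \<cdot> b = \<beta> \<and> a' \<cdot> \<beta> \<cdot> b' = nt id"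
    by (rule main[OF \<beta> up[symmetric] lo[symmetric] permutes_id]) (simp add: k_def)
  ultimately show ?thesis using a(1,4) b(1,4) a'(1,4) b'(1,4) by blast
qed

text \<open>One inclusion holds because \<open>RT\<close> is a congruence that contains all pairs of
  diagrams of elements of \<open>N\<close>. For the other, \<open>transport\<close> writes a twisted
  pair as a two-sided multiple of such a pair, and the way back keeps it in the same
  J-class.\<close>

lemma RN_eq_RT:
  assumes N: "N \<lhd> sym_group p" and pq: "p = q + 2" and pr: "enat p \<le> r"
  shows "RN_cong (brauer_I \<C> r) (brauer_ideal \<C> (enat q)) (nt ` N) = RT r q N"
proof -
  define S where "S = brauer_I \<C> r"
  have q: "odd q" "enat (q + 2) \<le> r" using p pq pr by auto
  have N': "N \<lhd> sym_group (q + 2)" using N pq by simp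
  have cong: "RT r q N \<in> Cong S" unfolding S_def by (rule RT_Cong[OF N' q])
  note C = cong[unfolded S_def Cong_iff]
  have "nu S (nt ` N) \<subseteq> RT r q N"
  proof
    fix \<delta> assume "\<delta> \<in> nu S (nt ` N)"
    then obtain a b y z where \<delta>: "\<delta> = (lmult1 S a (rmult1 S y b), lmult1 S a (rmult1 S z b))"
      and yz: "y \<in> nt ` N" "z \<in> nt ` N" and comp: "lcomp1 S a y" "rcomp1 S y b"
      unfolding nu_def by blast
    have "(y, z) \<in> RT r q N"
      using twist_nt_pair[OF N] yz unfolding RT_def pq[symmetric] by blast
    moreover have yh: "y \<in> brauer_hom Z Z" using yz(1) nt_hom normal_permutes[OF N] by blast
    ultimately have 1: "(rmult1 S y b, rmult1 S z b) \<in> RT r q N \<and> bdom (rmult1 S y b) = Z"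
    proof (cases b)
      case (Some t)
      then have t: "t \<in> brauer_ideal \<C> r" "bdom t = Z" using comp(2) yh by (auto simp: rcomp1_def S_def)
      then obtain E where E: "E \<in> \<C>" "t \<in> brauer_hom Z E" by (auto elim!: brauer_idealE)
      have "bdom (y \<cdot> t) = Z" using mult_hom[OF Z Z E(1) yh E(2)] by simp
      moreover have "(y \<cdot> t, z \<cdot> t) \<in> RT r q N"
        using C \<open>(y, z) \<in> RT r q N\<close> t yh by auto
      ultimately show ?thesis using Some by (simp add: rmult1_def S_def)
    qed (simp add: rmult1_def)
    show "\<delta> \<in> RT r q N"
    proof (cases a)
      case (Some s)
      then have "s \<in> brauer_ideal \<C> r" "bran s = Z" using comp(1) yh by (auto simp: lcomp1_def S_def)
      then show ?thesis using C 1 Some unfolding \<delta> by (auto simp: lmult1_def S_def)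
    qed (use 1 \<delta> in \<open>simp add: lmult1_def\<close>)
  qed
  moreover have "twist N p \<subseteq> nu S (nt ` N)"
  proof
    fix \<delta> assume "\<delta> \<in> twist N p"
    then obtain \<alpha> \<beta> where \<delta>: "\<delta> = (\<alpha>, \<beta>)" and tw: "(\<alpha>, \<beta>) \<in> twist N p" by (metis prod.exhaust)
    obtain A B h \<pi> where *: "A \<in> \<C>" "B \<in> \<C>" "\<alpha> \<in> brauer_hom A B" "\<beta> \<in> brauer_hom A B"
      "brank \<alpha> = p" "brank \<beta> = p" "upper \<alpha> = upper \<beta>" "lower \<alpha> = lower \<beta>"
      "bij_betw h {1..p} (A - \<Union>(upper \<alpha>))" "\<pi> \<in> N"
      "\<forall>i\<in>{1..p}. thr \<alpha> (h i) = thr \<beta> (h (\<pi> i))"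
      using tw by (rule twistE)
    note \<pi> = normal_permutes[OF N *(10)]
    obtain a b a' b' where ab: "a \<in> brauer_hom A Z" "b \<in> brauer_hom Z B" "a' \<in> brauer_hom Z A"
      "b' \<in> brauer_hom B Z" "brank a = p" "brank b = p" "brank a' = p" "brank b' = p"
      "a \<cdot> nt \<pi> \<cdot> b = \<alpha>" "a \<cdot> nt id \<cdot> b = \<beta>" "a' \<cdot> \<alpha> \<cdot> b' = nt \<pi>" "a' \<cdot> \<beta> \<cdot> b' = nt id"
      using transport[OF *(1-4,7-9) \<pi> *(11)] by blast
    have I: "a \<in> brauer_ideal \<C> r" "b \<in> brauer_ideal \<C> r" "\<alpha> \<in> brauer_ideal \<C> r" "\<beta> \<in> brauer_ideal \<C> r"
      using ab(1,2,5,6) * Z pr brauer_idealI by metis+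
    have el: "lmult1 S (Some a) (rmult1 S (nt \<rho>) (Some b)) = \<gamma> \<and> lcomp1 S (Some a) (nt \<rho>) \<and>
        rcomp1 S (nt \<rho>) (Some b) \<and> \<gamma> \<in> J_class_of S (nt ` N)"
      if \<rho>: "\<rho> \<in> N" and \<gamma>: "\<gamma> \<in> brauer_hom A B" "\<gamma> \<in> brauer_ideal \<C> r"
        and eq: "a \<cdot> nt \<rho> \<cdot> b = \<gamma>" "a' \<cdot> \<gamma> \<cdot> b' = nt \<rho>" for \<gamma> \<rho>
    proof -
      note \<rho>h = nt_hom[OF normal_permutes[OF N \<rho>]]
      have nI: "nt \<rho> \<in> brauer_ideal \<C> r"
        using brauer_idealI[OF Z Z \<rho>h] brank_nt[OF normal_permutes[OF N \<rho>]] pr by simp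
      \<comment> \<open>Each diagram is a two-sided multiple of the other, so the principal ideals
        agree.\<close>
      have "two_sided r (nt \<rho>) = two_sided r \<gamma>"
        using two_sided_subset[OF *(1) Z Z *(2) ab(1) \<rho>h ab(2) _ _ eq(1), of r]
          two_sided_subset[OF Z *(1,2) Z ab(3) \<gamma>(1) ab(4) _ _ eq(2), of r] ab(5-8) pr by auto
      then have "(nt \<rho>, \<gamma>) \<in> green_J S"
        using nI \<gamma>(2) unfolding green_J_def two_sided_def S_def by simp
      then have "\<gamma> \<in> J_class_of S (nt ` N)" unfolding J_class_of_def using \<rho> by blast
      moreover have "a \<cdot> (nt \<rho> \<cdot> b) = \<gamma>"
        using brauer_mult_assoc[OF ab(1) \<rho>h ab(2) fin[OF *(1)] fin[OF Z] fin[OF Z] fin[OF *(2)]] eq(1) by simp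
      ultimately show ?thesis
        using I(1,2) ab(1,2) \<rho>h by (simp add: lmult1_def rmult1_def lcomp1_def rcomp1_def S_def)
    qed
    note 1 = el[OF *(10,3) I(3) ab(9,11)] and 2 = el[OF normal_id[OF N] *(4) I(4) ab(10,12)]
    show "\<delta> \<in> nu S (nt ` N)"
      unfolding \<delta> nu_def mem_Collect_eq
      by (rule exI[of _ "Some a"], rule exI[of _ "Some b"], rule exI[of _ "nt \<pi>"], rule exI[of _ "nt id"])
        (use 1 2 *(10) normal_id[OF N] in simp)
  qed
  ultimately show ?thesis
    unfolding RN_cong_def S_def[symmetric] RT_def pq[symmetric] by blast
qed

end

section \<open>The congruences inside the minimal ideal\<close>

lemma rel_eqI: "(\<And>a b. (a, b) \<in> R \<longleftrightarrow> (a, b) \<in> S) \<Longrightarrow> R = S"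
  by auto

context odd_objects
begin

lemma ideal_one_iff: "\<alpha> \<in> brauer_ideal \<C> 1 \<longleftrightarrow> (\<exists>A\<in>\<C>. \<exists>B\<in>\<C>. \<alpha> \<in> brauer_hom A B) \<and> brank \<alpha> = 1"
  unfolding brauer_ideal_iff one_enat_def using rank_pos by (metis enat_ord_simps(1) le_antisym order_refl)

lemma rank_one_mult:
  assumes obj: "A \<in> \<C>" "B \<in> \<C>" "C \<in> \<C>" and \<alpha>: "\<alpha> \<in> brauer_hom A B" and \<beta>: "\<beta> \<in> brauer_hom B C"
  shows rank_one_mult_left: "brank \<alpha> = 1 \<Longrightarrow> brank (\<alpha> \<cdot> \<beta>) = 1 \<and> upper (\<alpha> \<cdot> \<beta>) = upper \<alpha>"
    and rank_one_mult_right: "brank \<beta> = 1 \<Longrightarrow> brank (\<alpha> \<cdot> \<beta>) = 1 \<and> lower (\<alpha> \<cdot> \<beta>) = lower \<beta>"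
proof -
  note h = mult_hom[OF obj \<alpha> \<beta>]
  note F = fin[OF obj(1)] fin[OF obj(2)] fin[OF obj(3)]
  show "brank (\<alpha> \<cdot> \<beta>) = 1 \<and> upper (\<alpha> \<cdot> \<beta>) = upper \<alpha>" if "brank \<alpha> = 1"
    using near_perfect_upper[OF obj(1) h _ mult_upper[OF \<alpha> \<beta> F]] rank_one_upper[OF \<alpha>] that by blast
  show "brank (\<alpha> \<cdot> \<beta>) = 1 \<and> lower (\<alpha> \<cdot> \<beta>) = lower \<beta>" if "brank \<beta> = 1"
    using near_perfect_lower[OF obj(3) h _ mult_lower[OF \<alpha> \<beta> F]] rank_one_lower[OF \<beta>] that by blast
qed

text \<open>A left factor of rank 1 overwrites the upper matching and leaves the lower one of
  \<open>\<alpha>\<close> alone, so any factor with the upper matching of \<open>\<beta>\<close>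
  will do.\<close>

lemma rank_one_left_factor:
  assumes obj: "A \<in> \<C>" "B \<in> \<C>" and \<alpha>: "\<alpha> \<in> brauer_hom A B" and \<beta>: "\<beta> \<in> brauer_hom A B"
    and rk: "brank \<alpha> = 1" "brank \<beta> = 1" and lo: "lower \<alpha> = lower \<beta>"
  obtains \<gamma> where "\<gamma> \<in> brauer_hom A A" "brank \<gamma> = 1" "\<gamma> \<cdot> \<alpha> = \<beta>"
proof -
  have np: "near_perfect A (upper \<beta>)" using rank_one_upper[OF \<beta>] rk by simp
  obtain \<gamma> where \<gamma>: "\<gamma> \<in> brauer_hom A A" "upper \<gamma> = upper \<beta>" "brank \<gamma> = 1"
    using ex_rank_one[OF np np] by metis
  have "\<gamma> \<cdot> \<alpha> = \<beta>"
    using rank_one_mult_left[OF obj(1,1,2) \<gamma>(1) \<alpha> \<gamma>(3)] rank_one_mult_right[OF obj(1,1,2) \<gamma>(1) \<alpha> rk(1)] \<gamma>(2) lo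
    by (intro rank_one_eqI[OF mult_hom[OF obj(1,1,2) \<gamma>(1) \<alpha>] \<beta>]) auto
  then show ?thesis using that \<gamma> by blast
qed

lemma rank_one_right_factor:
  assumes obj: "A \<in> \<C>" "B \<in> \<C>" and \<alpha>: "\<alpha> \<in> brauer_hom A B" and \<beta>: "\<beta> \<in> brauer_hom A B"
    and rk: "brank \<alpha> = 1" "brank \<beta> = 1" and up: "upper \<alpha> = upper \<beta>"
  obtains \<gamma> where "\<gamma> \<in> brauer_hom B B" "brank \<gamma> = 1" "\<alpha> \<cdot> \<gamma> = \<beta>"
proof -
  have np: "near_perfect B (lower \<beta>)" using rank_one_lower[OF \<beta>] rk by simp
  obtain \<gamma> where \<gamma>: "\<gamma> \<in> brauer_hom B B" "lower \<gamma> = lower \<beta>" "brank \<gamma> = 1"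
    using ex_rank_one[OF np np] by metis
  have "\<alpha> \<cdot> \<gamma> = \<beta>"
    using rank_one_mult_right[OF obj(1,2,2) \<alpha> \<gamma>(1) \<gamma>(3)] rank_one_mult_left[OF obj(1,2,2) \<alpha> \<gamma>(1) rk(1)] \<gamma>(2) up
    by (intro rank_one_eqI[OF mult_hom[OF obj(1,2,2) \<alpha> \<gamma>(1)] \<beta>]) auto
  then show ?thesis using that \<gamma> by blast
qed

lemma green_L_lower_subset:
  assumes obj: "A \<in> \<C>" "B \<in> \<C>" and \<alpha>: "\<alpha> \<in> brauer_hom A B" and \<beta>: "\<beta> \<in> brauer_hom A B"
    and rk: "brank \<alpha> = 1" "brank \<beta> = 1" and lo: "lower \<alpha> = lower \<beta>" and r: "enat 1 \<le> r"
  shows "{lmult1 (brauer_I \<C> r) a \<beta> |a. lcomp1 (brauer_I \<C> r) a \<beta>} \<subseteq>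
    {lmult1 (brauer_I \<C> r) a \<alpha> |a. lcomp1 (brauer_I \<C> r) a \<alpha>}" (is "?L \<subseteq> ?R")
proof
  fix \<delta> assume "\<delta> \<in> ?L"
  then obtain a where a: "\<delta> = lmult1 (brauer_I \<C> r) a \<beta>" "lcomp1 (brauer_I \<C> r) a \<beta>" by blast
  obtain \<gamma> where \<gamma>: "\<gamma> \<in> brauer_hom A A" "brank \<gamma> = 1" "\<gamma> \<cdot> \<alpha> = \<beta>"
    using rank_one_left_factor[OF obj \<alpha> \<beta> rk lo] .
  show "\<delta> \<in> ?R"
  proof (cases a)
    case None
    have "\<gamma> \<in> brauer_ideal \<C> r" using brauer_idealI[OF obj(1,1) \<gamma>(1)] \<gamma>(2) r by simp
    then have "\<delta> = lmult1 (brauer_I \<C> r) (Some \<gamma>) \<alpha>" "lcomp1 (brauer_I \<C> r) (Some \<gamma>) \<alpha>"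
      using a(1) None \<gamma>(3) bran_hom[OF \<gamma>(1)] bdom_hom[OF \<alpha>] by (simp_all add: lmult1_def lcomp1_def)
    then show ?thesis by blast
  next
    case (Some s)
    then have "s \<in> brauer_ideal \<C> r" "bran s = A" using a(2) \<beta> by (auto simp: lcomp1_def)
    then obtain E where E: "E \<in> \<C>" "s \<in> brauer_hom E A" by (auto elim!: brauer_idealE)
    have "s \<cdot> \<gamma> \<in> brauer_ideal \<C> r" using mult_ideal[OF E(1) obj(1,1) E(2) \<gamma>(1)] \<gamma>(2) r by simp
    moreover have "s \<cdot> \<gamma> \<cdot> \<alpha> = s \<cdot> \<beta>"
      using brauer_mult_assoc[OF E(2) \<gamma>(1) \<alpha>] fin E(1) obj \<gamma>(3) by simp
    ultimately have "\<delta> = lmult1 (brauer_I \<C> r) (Some (s \<cdot> \<gamma>)) \<alpha>" "lcomp1 (brauer_I \<C> r) (Some (s \<cdot> \<gamma>)) \<alpha>"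
      using a(1) Some bran_hom[OF mult_hom[OF E(1) obj(1,1) E(2) \<gamma>(1)]] bdom_hom[OF \<alpha>]
      by (simp_all add: lmult1_def lcomp1_def)
    then show ?thesis by blast
  qed
qed

lemma green_R_upper_subset:
  assumes obj: "A \<in> \<C>" "B \<in> \<C>" and \<alpha>: "\<alpha> \<in> brauer_hom A B" and \<beta>: "\<beta> \<in> brauer_hom A B"
    and rk: "brank \<alpha> = 1" "brank \<beta> = 1" and up: "upper \<alpha> = upper \<beta>" and r: "enat 1 \<le> r"
  shows "{rmult1 (brauer_I \<C> r) \<beta> a |a. rcomp1 (brauer_I \<C> r) \<beta> a} \<subseteq>
    {rmult1 (brauer_I \<C> r) \<alpha> a |a. rcomp1 (brauer_I \<C> r) \<alpha> a}" (is "?L \<subseteq> ?R")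
proof
  fix \<delta> assume "\<delta> \<in> ?L"
  then obtain a where a: "\<delta> = rmult1 (brauer_I \<C> r) \<beta> a" "rcomp1 (brauer_I \<C> r) \<beta> a" by blast
  obtain \<gamma> where \<gamma>: "\<gamma> \<in> brauer_hom B B" "brank \<gamma> = 1" "\<alpha> \<cdot> \<gamma> = \<beta>"
    using rank_one_right_factor[OF obj \<alpha> \<beta> rk up] .
  show "\<delta> \<in> ?R"
  proof (cases a)
    case None
    have "\<gamma> \<in> brauer_ideal \<C> r" using brauer_idealI[OF obj(2,2) \<gamma>(1)] \<gamma>(2) r by simp
    then have "\<delta> = rmult1 (brauer_I \<C> r) \<alpha> (Some \<gamma>)" "rcomp1 (brauer_I \<C> r) \<alpha> (Some \<gamma>)"
      using a(1) None \<gamma>(3) bdom_hom[OF \<gamma>(1)] bran_hom[OF \<alpha>] by (simp_all add: rmult1_def rcomp1_def)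
    then show ?thesis by blast
  next
    case (Some s)
    then have "s \<in> brauer_ideal \<C> r" "bdom s = B" using a(2) \<beta> by (auto simp: rcomp1_def)
    then obtain E where E: "E \<in> \<C>" "s \<in> brauer_hom B E" by (auto elim!: brauer_idealE)
    have "\<gamma> \<cdot> s \<in> brauer_ideal \<C> r" using mult_ideal[OF obj(2,2) E(1) \<gamma>(1) E(2)] \<gamma>(2) r by simp
    moreover have "\<alpha> \<cdot> (\<gamma> \<cdot> s) = \<beta> \<cdot> s"
      using brauer_mult_assoc[OF \<alpha> \<gamma>(1) E(2)] fin E(1) obj \<gamma>(3) by simp
    ultimately have "\<delta> = rmult1 (brauer_I \<C> r) \<alpha> (Some (\<gamma> \<cdot> s))" "rcomp1 (brauer_I \<C> r) \<alpha> (Some (\<gamma> \<cdot> s))"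
      using a(1) Some bdom_hom[OF mult_hom[OF obj(2,2) E(1) \<gamma>(1) E(2)]] bran_hom[OF \<alpha>]
      by (simp_all add: rmult1_def rcomp1_def)
    then show ?thesis by blast
  qed
qed

text \<open>Left multiplication never alters the lower matching of a rank 1 diagram. Conversely
  \<open>rank_one_left_factor\<close> reaches every rank 1 diagram with the same lower matching and
  the same domain.\<close>

lemma green_L_rank_one_iff:
  assumes obj: "A \<in> \<C>" "B \<in> \<C>" and \<alpha>: "\<alpha> \<in> brauer_hom A B" and \<beta>: "\<beta> \<in> brauer_hom A B"
    and rk: "brank \<alpha> = 1" "brank \<beta> = 1" and r: "enat 1 \<le> r"
  shows "(\<alpha>, \<beta>) \<in> green_L (brauer_I \<C> r) \<longleftrightarrow> lower \<alpha> = lower \<beta>"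
proof
  assume "(\<alpha>, \<beta>) \<in> green_L (brauer_I \<C> r)"
  moreover have "\<beta> \<in> {lmult1 (brauer_I \<C> r) a \<beta> |a. lcomp1 (brauer_I \<C> r) a \<beta>}"
    by (auto simp: lmult1_def lcomp1_def intro!: exI[of _ None])
  ultimately obtain a where a: "\<beta> = lmult1 (brauer_I \<C> r) a \<alpha>" "lcomp1 (brauer_I \<C> r) a \<alpha>"
    unfolding green_L_def by blast
  show "lower \<alpha> = lower \<beta>"
  proof (cases a)
    case (Some s)
    then have "s \<in> brauer_ideal \<C> r" "bran s = A" using a(2) \<alpha> by (auto simp: lcomp1_def)
    then obtain E where E: "E \<in> \<C>" "s \<in> brauer_hom E A" by (auto elim!: brauer_idealE)
    then show ?thesis
      using rank_one_mult_right[OF E(1) obj E(2) \<alpha> rk(1)] a(1) Some by (simp add: lmult1_def)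
  qed (use a in \<open>simp add: lmult1_def\<close>)
next
  assume lo: "lower \<alpha> = lower \<beta>"
  have "\<alpha> \<in> brauer_ideal \<C> r" "\<beta> \<in> brauer_ideal \<C> r"
    using brauer_idealI[OF obj \<alpha>] brauer_idealI[OF obj \<beta>] rk r by simp_all
  then show "(\<alpha>, \<beta>) \<in> green_L (brauer_I \<C> r)"
    using green_L_lower_subset[OF obj \<alpha> \<beta> rk lo r] green_L_lower_subset[OF obj \<beta> \<alpha> rk(2,1) lo[symmetric] r]
    unfolding green_L_def by auto
qed

lemma green_R_rank_one_iff:
  assumes obj: "A \<in> \<C>" "B \<in> \<C>" and \<alpha>: "\<alpha> \<in> brauer_hom A B" and \<beta>: "\<beta> \<in> brauer_hom A B"
    and rk: "brank \<alpha> = 1" "brank \<beta> = 1" and r: "enat 1 \<le> r"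
  shows "(\<alpha>, \<beta>) \<in> green_R (brauer_I \<C> r) \<longleftrightarrow> upper \<alpha> = upper \<beta>"
proof
  assume "(\<alpha>, \<beta>) \<in> green_R (brauer_I \<C> r)"
  moreover have "\<beta> \<in> {rmult1 (brauer_I \<C> r) \<beta> a |a. rcomp1 (brauer_I \<C> r) \<beta> a}"
    by (auto simp: rmult1_def rcomp1_def intro!: exI[of _ None])
  ultimately obtain a where a: "\<beta> = rmult1 (brauer_I \<C> r) \<alpha> a" "rcomp1 (brauer_I \<C> r) \<alpha> a"
    unfolding green_R_def by blast
  show "upper \<alpha> = upper \<beta>"
  proof (cases a)
    case (Some s)
    then have "s \<in> brauer_ideal \<C> r" "bdom s = B" using a(2) \<alpha> by (auto simp: rcomp1_def)
    then obtain E where E: "E \<in> \<C>" "s \<in> brauer_hom B E" by (auto elim!: brauer_idealE)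
    then show ?thesis
      using rank_one_mult_left[OF obj E(1) \<alpha> E(2) rk(1)] a(1) Some by (simp add: rmult1_def)
  qed (use a in \<open>simp add: rmult1_def\<close>)
next
  assume up: "upper \<alpha> = upper \<beta>"
  have "\<alpha> \<in> brauer_ideal \<C> r" "\<beta> \<in> brauer_ideal \<C> r"
    using brauer_idealI[OF obj \<alpha>] brauer_idealI[OF obj \<beta>] rk r by simp_all
  then show "(\<alpha>, \<beta>) \<in> green_R (brauer_I \<C> r)"
    using green_R_upper_subset[OF obj \<alpha> \<beta> rk up r] green_R_upper_subset[OF obj \<beta> \<alpha> rk(2,1) up[symmetric] r]
    unfolding green_R_def by auto
qed

text \<open>Common shape of the four smallest congruences: equality enlarged by pairs of rank 1.
  Taking for \<open>P\<close> falsity, equal lower parts, equal upper parts or truth gives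
  \<open>Delta\<close>, \<open>lambda_cong\<close>, \<open>rho_cong\<close> and
  \<open>R_cong\<close> of the minimal ideal.\<close>

definition rel_ideal :: "enat \<Rightarrow> ('a diagram \<Rightarrow> 'a diagram \<Rightarrow> bool) \<Rightarrow> 'a diagram rel" where
  "rel_ideal r P = {(\<alpha>, \<beta>). \<alpha> \<in> brauer_ideal \<C> r \<and> \<beta> \<in> brauer_ideal \<C> r \<and> bdom \<alpha> = bdom \<beta> \<and> bran \<alpha> = bran \<beta> \<and>
     (\<alpha> = \<beta> \<or> brank \<alpha> = 1 \<and> brank \<beta> = 1 \<and> P \<alpha> \<beta>)}"

lemma ideal_one_rank: "\<alpha> \<in> brauer_ideal \<C> r \<Longrightarrow> \<alpha> \<in> brauer_ideal \<C> 1 \<longleftrightarrow> brank \<alpha> = 1"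
  using ideal_one_iff[of \<alpha>] brauer_ideal_iff[of \<alpha> \<C> r] by blast

lemma rel_ideal_cases:
  assumes "\<alpha> \<in> brauer_ideal \<C> r" "\<beta> \<in> brauer_ideal \<C> r" "bdom \<alpha> = bdom \<beta>" "bran \<alpha> = bran \<beta>"
  obtains A B where "A \<in> \<C>" "B \<in> \<C>" "\<alpha> \<in> brauer_hom A B" "\<beta> \<in> brauer_hom A B"
  using assms by (auto elim!: brauer_idealE)

lemma lambda_eq:
  assumes r: "enat 1 \<le> r"
  shows "lambda_cong (brauer_I \<C> r) (brauer_ideal \<C> 1) = rel_ideal r (\<lambda>\<alpha> \<beta>. lower \<alpha> = lower \<beta>)"
proof (rule rel_eqI)
  fix \<alpha> \<beta>
  show "(\<alpha>, \<beta>) \<in> lambda_cong (brauer_I \<C> r) (brauer_ideal \<C> 1) \<longleftrightarrow>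
      (\<alpha>, \<beta>) \<in> rel_ideal r (\<lambda>\<alpha> \<beta>. lower \<alpha> = lower \<beta>)"
  proof (cases "\<alpha> \<in> brauer_ideal \<C> r \<and> \<beta> \<in> brauer_ideal \<C> r \<and> bdom \<alpha> = bdom \<beta> \<and> bran \<alpha> = bran \<beta>")
    case True
    then obtain A B where AB: "A \<in> \<C>" "B \<in> \<C>" "\<alpha> \<in> brauer_hom A B" "\<beta> \<in> brauer_hom A B"
      using rel_ideal_cases by metis
    show ?thesis
      using True green_L_rank_one_iff[OF AB _ _ r] ideal_one_rank[of \<alpha> r] ideal_one_rank[of \<beta> r]
      unfolding lambda_cong_def rel_ideal_def psg_sim_def Delta_def by auto
  next
    case False
    then show ?thesis unfolding lambda_cong_def rel_ideal_def psg_sim_def Delta_def by auto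
  qed
qed

lemma rho_eq:
  assumes r: "enat 1 \<le> r"
  shows "rho_cong (brauer_I \<C> r) (brauer_ideal \<C> 1) = rel_ideal r (\<lambda>\<alpha> \<beta>. upper \<alpha> = upper \<beta>)"
proof (rule rel_eqI)
  fix \<alpha> \<beta>
  show "(\<alpha>, \<beta>) \<in> rho_cong (brauer_I \<C> r) (brauer_ideal \<C> 1) \<longleftrightarrow>
      (\<alpha>, \<beta>) \<in> rel_ideal r (\<lambda>\<alpha> \<beta>. upper \<alpha> = upper \<beta>)"
  proof (cases "\<alpha> \<in> brauer_ideal \<C> r \<and> \<beta> \<in> brauer_ideal \<C> r \<and> bdom \<alpha> = bdom \<beta> \<and> bran \<alpha> = bran \<beta>")
    case True
    then obtain A B where AB: "A \<in> \<C>" "B \<in> \<C>" "\<alpha> \<in> brauer_hom A B" "\<beta> \<in> brauer_hom A B"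
      using rel_ideal_cases by metis
    show ?thesis
      using True green_R_rank_one_iff[OF AB _ _ r] ideal_one_rank[of \<alpha> r] ideal_one_rank[of \<beta> r]
      unfolding rho_cong_def rel_ideal_def psg_sim_def Delta_def by auto
  next
    case False
    then show ?thesis unfolding rho_cong_def rel_ideal_def psg_sim_def Delta_def by auto
  qed
qed

lemma R_cong_one_eq:
  "R_cong (brauer_I \<C> r) (brauer_ideal \<C> 1) = rel_ideal r (\<lambda>_ _. True)"
  using ideal_one_rank[of _ r] unfolding R_cong_def rel_ideal_def psg_sim_def Delta_def by auto

lemma Delta_eq: "Delta (brauer_I \<C> r) = rel_ideal r (\<lambda>_ _. False)"
  unfolding rel_ideal_def Delta_def by auto

lemma rel_ideal_lower_Cong: "rel_ideal r (\<lambda>\<alpha> \<beta>. lower \<alpha> = lower \<beta>) \<in> Cong (brauer_I \<C> r)" (is "?\<sigma> \<in> _")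
proof -
  have "equiv (brauer_ideal \<C> r) ?\<sigma>"
    by (rule equivI) (auto simp: rel_ideal_def refl_on_def sym_def trans_def)
  moreover have "(s \<cdot> \<alpha>, s \<cdot> \<beta>) \<in> ?\<sigma>" if ab: "(\<alpha>, \<beta>) \<in> ?\<sigma>" and s: "s \<in> brauer_ideal \<C> r" "bran s = bdom \<alpha>" for \<alpha> \<beta> s
  proof -
    obtain A B where AB: "A \<in> \<C>" "B \<in> \<C>" "\<alpha> \<in> brauer_hom A B" "\<beta> \<in> brauer_hom A B"
      using ab rel_ideal_cases unfolding rel_ideal_def by blast
    then obtain E where E: "E \<in> \<C>" "s \<in> brauer_hom E A" "enat (brank s) \<le> r"
      using s by (auto elim!: brauer_idealE)
    note I = mult_ideal[OF E(1) AB(1,2) E(2) AB(3) disjI1[OF E(3)]] mult_ideal[OF E(1) AB(1,2) E(2) AB(4) disjI1[OF E(3)]]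
    note h = mult_hom[OF E(1) AB(1,2) E(2) AB(3)] mult_hom[OF E(1) AB(1,2) E(2) AB(4)]
    have "\<alpha> = \<beta> \<or> brank (s \<cdot> \<alpha>) = 1 \<and> brank (s \<cdot> \<beta>) = 1 \<and> lower (s \<cdot> \<alpha>) = lower (s \<cdot> \<beta>)"
      using ab rank_one_mult_right[OF E(1) AB(1,2) E(2) AB(3)] rank_one_mult_right[OF E(1) AB(1,2) E(2) AB(4)]
      unfolding rel_ideal_def by auto
    then show ?thesis using I h unfolding rel_ideal_def by auto
  qed
  moreover have "(\<alpha> \<cdot> s, \<beta> \<cdot> s) \<in> ?\<sigma>" if ab: "(\<alpha>, \<beta>) \<in> ?\<sigma>" and s: "s \<in> brauer_ideal \<C> r" "bran \<alpha> = bdom s" for \<alpha> \<beta> s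
  proof -
    obtain A B where AB: "A \<in> \<C>" "B \<in> \<C>" "\<alpha> \<in> brauer_hom A B" "\<beta> \<in> brauer_hom A B"
      using ab rel_ideal_cases unfolding rel_ideal_def by blast
    then obtain E where E: "E \<in> \<C>" "s \<in> brauer_hom B E" "enat (brank s) \<le> r"
      using s by (auto elim!: brauer_idealE)
    note I = mult_ideal[OF AB(1,2) E(1) AB(3) E(2) disjI2[OF E(3)]] mult_ideal[OF AB(1,2) E(1) AB(4) E(2) disjI2[OF E(3)]]
    note h = mult_hom[OF AB(1,2) E(1) AB(3) E(2)] mult_hom[OF AB(1,2) E(1) AB(4) E(2)]
    have "brank (\<alpha> \<cdot> s) = 1 \<and> brank (\<beta> \<cdot> s) = 1 \<and> lower (\<alpha> \<cdot> s) = lower (\<beta> \<cdot> s)" if "\<alpha> \<noteq> \<beta>"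
    proof -
      have rk: "brank \<alpha> = 1" "brank \<beta> = 1" "lower \<alpha> = lower \<beta>" using ab that unfolding rel_ideal_def by auto
      \<comment> \<open>With \<open>\<beta> = \<gamma> \<cdot> \<alpha>\<close> the product
        \<open>\<beta> \<cdot> s\<close> is a left multiple of \<open>\<alpha> \<cdot> s\<close>,
        and a left multiple of a rank 1 diagram keeps its lower matching.\<close>
      obtain \<gamma> where \<gamma>: "\<gamma> \<in> brauer_hom A A" "\<gamma> \<cdot> \<alpha> = \<beta>"
        using rank_one_left_factor[OF AB rk] by metis
      have 1: "brank (\<alpha> \<cdot> s) = 1" "brank (\<beta> \<cdot> s) = 1"
        using rank_one_mult_left[OF AB(1,2) E(1) AB(3) E(2) rk(1)] rank_one_mult_left[OF AB(1,2) E(1) AB(4) E(2) rk(2)] by auto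
      have "\<beta> \<cdot> s = \<gamma> \<cdot> (\<alpha> \<cdot> s)"
        using brauer_mult_assoc[OF \<gamma>(1) AB(3) E(2)] fin AB(1,2) E(1) \<gamma>(2) by simp
      then show ?thesis
        using rank_one_mult_right[OF AB(1,1) E(1) \<gamma>(1) h(1) 1(1)] 1 by simp
    qed
    then show ?thesis using I h unfolding rel_ideal_def by auto
  qed
  moreover have "bdom \<alpha> = bdom \<beta> \<and> bran \<alpha> = bran \<beta>" if "(\<alpha>, \<beta>) \<in> ?\<sigma>" for \<alpha> \<beta>
    using that by (simp add: rel_ideal_def)
  ultimately show ?thesis unfolding Cong_iff by blast
qed

lemma rel_ideal_upper_Cong: "rel_ideal r (\<lambda>\<alpha> \<beta>. upper \<alpha> = upper \<beta>) \<in> Cong (brauer_I \<C> r)"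
proof -
  have rk: "brank (flip \<alpha>) = brank \<alpha>" if "\<alpha> \<in> brauer_ideal \<C> r" for \<alpha>
    using that by (auto elim!: brauer_idealE)
  have "flip_rel (rel_ideal r (\<lambda>\<alpha> \<beta>. lower \<alpha> = lower \<beta>)) = rel_ideal r (\<lambda>\<alpha> \<beta>. upper \<alpha> = upper \<beta>)"
  proof (rule rel_eqI)
    fix \<alpha> \<beta>
    show "(\<alpha>, \<beta>) \<in> flip_rel (rel_ideal r (\<lambda>\<alpha> \<beta>. lower \<alpha> = lower \<beta>)) \<longleftrightarrow>
        (\<alpha>, \<beta>) \<in> rel_ideal r (\<lambda>\<alpha> \<beta>. upper \<alpha> = upper \<beta>)"
    proof (cases "\<alpha> \<in> brauer_ideal \<C> r \<and> \<beta> \<in> brauer_ideal \<C> r")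
      case True
      then have I: "\<alpha> \<in> brauer_ideal \<C> r" "\<beta> \<in> brauer_ideal \<C> r" by auto
      show ?thesis
        using I by (auto simp: rel_ideal_def bdom_flip[OF I(1)] bdom_flip[OF I(2)]
            bran_flip[OF I(1)] bran_flip[OF I(2)] rk[OF I(1)] rk[OF I(2)])
    qed (auto simp: rel_ideal_def)
  qed
  then show ?thesis using flip_rel_Cong[OF rel_ideal_lower_Cong] by metis
qed

lemma Delta_Cong: "Delta (brauer_I \<C> r) \<in> Cong (brauer_I \<C> r)"
proof -
  have "equiv (brauer_ideal \<C> r) (Id_on (brauer_ideal \<C> r))"
    by (rule equivI) (auto simp: refl_on_def sym_def trans_def)
  moreover have "s \<cdot> \<alpha> \<in> brauer_ideal \<C> r" if "s \<in> brauer_ideal \<C> r" "\<alpha> \<in> brauer_ideal \<C> r" "bran s = bdom \<alpha>" for s \<alpha>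
    using that mult_ideal by (auto elim!: brauer_idealE)
  ultimately show ?thesis unfolding Cong_iff Delta_def by auto
qed

lemma Nabla_Cong: "Nabla (brauer_I \<C> r) \<in> Cong (brauer_I \<C> r)"
proof -
  have eq: "(\<alpha>, \<beta>) \<in> Nabla (brauer_I \<C> r) \<longleftrightarrow>
      \<alpha> \<in> brauer_ideal \<C> r \<and> \<beta> \<in> brauer_ideal \<C> r \<and> bdom \<alpha> = bdom \<beta> \<and> bran \<alpha> = bran \<beta>" for \<alpha> \<beta>
    unfolding Nabla_def psg_sim_def by simp
  have m: "s \<cdot> \<alpha> \<in> brauer_ideal \<C> r \<and> bdom (s \<cdot> \<alpha>) = bdom s \<and> bran (s \<cdot> \<alpha>) = bran \<alpha>"
    if s: "s \<in> brauer_ideal \<C> r" "\<alpha> \<in> brauer_ideal \<C> r" "bran s = bdom \<alpha>" for s \<alpha>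
  proof -
    obtain A B where AB: "A \<in> \<C>" "B \<in> \<C>" "s \<in> brauer_hom A B" "enat (brank s) \<le> r"
      using s(1) by (rule brauer_idealE)
    obtain C where C: "C \<in> \<C>" "\<alpha> \<in> brauer_hom B C" using s(2,3) AB(3) by (auto elim!: brauer_idealE)
    show ?thesis
      using mult_ideal[OF AB(1,2) C(1) AB(3) C(2)] mult_hom[OF AB(1,2) C(1) AB(3) C(2)] AB C by simp
  qed
  have "equiv (brauer_ideal \<C> r) (Nabla (brauer_I \<C> r))"
    by (rule equivI) (auto simp: eq refl_on_def sym_def trans_def)
  then show ?thesis unfolding Cong_iff eq using m by metis
qed

end

section \<open>Normal subgroups of symmetric groups of odd degree\<close>

lemma conj_transpose:
  assumes "\<sigma> permutes Z"
  shows "\<sigma> \<circ> transpose a c \<circ> inv' \<sigma> = transpose (\<sigma> a) (\<sigma> c)"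
proof
  fix k
  have 1: "\<sigma> (inv' \<sigma> k) = k" using permutes_inverses(1)[OF assms] .
  have 2: "inv' \<sigma> k = l \<longleftrightarrow> k = \<sigma> l" for l using permutes_inv_eq[OF assms, of k l] by auto
  show "(\<sigma> \<circ> transpose a c \<circ> inv' \<sigma>) k = transpose (\<sigma> a) (\<sigma> c) k"
    using 1 2 by (auto simp: transpose_def)
qed

lemma normal_conj':
  assumes "N \<lhd> sym_group n" "\<pi> \<in> N" "\<tau> permutes {1..n}"
  shows "\<tau> \<circ> \<pi> \<circ> inv' \<tau> \<in> N"
  using normal_conj[OF assms(1,2) permutes_inv[OF assms(3)]] permutes_inv_inv[OF assms(3)] by simp

lemma ex_permutation_three:
  assumes "{u, v, w} \<subseteq> S" "{a, b, c} \<subseteq> S" "distinct [u, v, w]" "distinct [a, b, c]" "finite S"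
  obtains \<tau> where "\<tau> permutes S" "\<tau> u = a" "\<tau> v = b" "\<tau> w = c"
proof -
  have "card (S - {u, v, w}) = card (S - {a, b, c})"
    using assms by (simp add: card_Diff_subset)
  then obtain g where g: "bij_betw g (S - {u, v, w}) (S - {a, b, c})"
    using assms(5) finite_same_card_bij by (metis finite_Diff)
  define k where "k x = (if x = u then a else if x = v then b else c)" for x
  have k: "bij_betw k {u, v, w} {a, b, c}"
    using assms(3,4) unfolding bij_betw_def inj_on_def k_def by auto
  define \<tau> where "\<tau> x = (if x \<in> {u, v, w} then k x else if x \<in> S then g x else x)" for x
  have "bij_betw \<tau> {u, v, w} {a, b, c}"
    using k by (subst bij_betw_cong[of _ _ k]) (simp_all add: \<tau>_def)
  moreover have "bij_betw \<tau> (S - {u, v, w}) (S - {a, b, c})"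
    using g by (subst bij_betw_cong[of _ _ g]) (simp_all add: \<tau>_def)
  ultimately have "bij_betw \<tau> ({u, v, w} \<union> (S - {u, v, w})) ({a, b, c} \<union> (S - {a, b, c}))"
    by (rule bij_betw_combine) auto
  then have "bij_betw \<tau> S S"
    using assms(1,2) by (metis Un_Diff_cancel sup.absorb2)
  then have "\<tau> permutes S"
    by (rule bij_imp_permutes) (use assms(1) in \<open>auto simp: \<tau>_def\<close>)
  moreover have "\<tau> u = a" "\<tau> v = b" "\<tau> w = c"
    using assms(3) unfolding \<tau>_def k_def by auto
  ultimately show ?thesis using that by blast
qed

text \<open>The commutator of \<open>\<sigma>\<close> with the transposition of \<open>a\<close> and
  \<open>c\<close> is a product of two transpositions. If these overlap, it is a three-cycle. If
  not, a fifth point \<open>e\<close> gives a second such product, and multiplying both cancels the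
  common transposition. Odd \<open>n\<close> supplies \<open>e\<close>; in degree 4 the Klein
  four-group contains no three-cycle.\<close>

lemma normal_contains_three_cycle:
  assumes N: "N \<lhd> sym_group n" and n: "odd n" "3 \<le> n" and ne: "N \<noteq> {id}"
  obtains u v w where "{u, v, w} \<subseteq> {1..n}" "distinct [u, v, w]" "transpose u v \<circ> transpose u w \<in> N"
proof -
  obtain \<sigma> where \<sigma>: "\<sigma> \<in> N" "\<sigma> \<noteq> id"
    using ne normal_id[OF N] by blast
  note \<sigma>p = normal_permutes[OF N \<sigma>(1)]
  obtain a where a: "\<sigma> a \<noteq> a" using \<sigma>(2) by (auto simp: fun_eq_iff)
  then have aS: "a \<in> {1..n}" using permutes_not_in[OF \<sigma>p] by blast
  define b where "b = \<sigma> a"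
  have bS: "b \<in> {1..n}" using permutes_in_image[OF \<sigma>p] aS unfolding b_def by blast
  have "\<not> {1..n} \<subseteq> {a, b}"
    using n(2) card_mono[of "{a, b}" "{1..n}"] card_insert_le_m1[of 2 "{b}" a] by fastforce
  then obtain c where c: "c \<in> {1..n}" "c \<noteq> a" "c \<noteq> b" by blast
  define d where "d = \<sigma> c"
  have dS: "d \<in> {1..n}" using permutes_in_image[OF \<sigma>p] c unfolding d_def by blast
  have inj: "\<sigma> i = \<sigma> j \<longleftrightarrow> i = j" for i j using permutes_inj[OF \<sigma>p] by (simp add: inj_eq)
  have db: "d \<noteq> b" unfolding d_def b_def inj using c by simp
  have ab: "a \<noteq> b" using a unfolding b_def by simp
  have t: "transpose a c permutes {1..n}" using aS c(1) by (rule permutes_swap_id)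
  have "inv' (transpose a c) \<circ> inv' \<sigma> \<circ> transpose a c \<in> N"
    by (rule normal_conj[OF N normal_inv[OF N \<sigma>(1)] t])
  then have "\<sigma> \<circ> (transpose a c \<circ> inv' \<sigma> \<circ> transpose a c) \<in> N"
    using normal_comp[OF N \<sigma>(1)] by simp
  moreover have "\<sigma> \<circ> (transpose a c \<circ> inv' \<sigma> \<circ> transpose a c) =
      (\<sigma> \<circ> transpose a c \<circ> inv' \<sigma>) \<circ> transpose a c"
    by (simp add: comp_assoc)
  ultimately have \<kappa>: "transpose b d \<circ> transpose a c \<in> N"
    unfolding conj_transpose[OF \<sigma>p] b_def d_def by simp
  consider "d = a" | "d = c" | "d \<noteq> a" "d \<noteq> c" by blast
  then show ?thesis
  proof cases
    case 1
    then have "transpose a b \<circ> transpose a c \<in> N" using \<kappa> by (simp add: transpose_commute)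
    then show ?thesis using that[of a b c] aS bS c ab by simp
  next
    case 2
    then have "transpose c b \<circ> transpose c a \<in> N" using \<kappa> by (simp add: transpose_commute)
    then show ?thesis using that[of c b a] aS bS c ab by simp
  next
    case 3
    have "card {a, b, c, d} = 4" using 3 ab c db by auto
    then have "4 \<le> n" using card_mono[of "{1..n}" "{a, b, c, d}"] aS bS c dS by simp
    then have "4 < n" using n(1) by (metis even_numeral le_neq_implies_less)
    then have "\<not> {1..n} \<subseteq> {a, b, c, d}"
      using card_mono[of "{a, b, c, d}" "{1..n}"] \<open>card {a, b, c, d} = 4\<close> by auto
    then obtain e where e: "e \<in> {1..n}" "e \<notin> {a, b, c, d}" by blast
    have tp: "transpose c e permutes {1..n}" using c(1) e(1) by (rule permutes_swap_id)
    have "transpose c e \<circ> (transpose b d \<circ> transpose a c) \<circ> inv' (transpose c e) \<in> N"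
      by (rule normal_conj'[OF N \<kappa> tp])
    moreover have "transpose c e \<circ> (transpose b d \<circ> transpose a c) \<circ> inv' (transpose c e) =
        transpose b d \<circ> transpose a e"
      using 3 ab c db e by (auto simp: fun_eq_iff transpose_def)
    ultimately have "(transpose b d \<circ> transpose a c) \<circ> (transpose b d \<circ> transpose a e) \<in> N"
      using normal_comp[OF N \<kappa>] by simp
    moreover have "(transpose b d \<circ> transpose a c) \<circ> (transpose b d \<circ> transpose a e) = transpose a c \<circ> transpose a e"
      using 3 ab c db e by (auto simp: fun_eq_iff transpose_def)
    ultimately show ?thesis using that[of a c e] aS c e by simp
  qed
qed

text \<open>All three-cycles are conjugate in the full symmetric group, so one of them in
  \<open>N\<close> brings in all of them, and these generate the alternating group.\<close>

lemma alt_group_subset_normal: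
  assumes N: "N \<lhd> sym_group n" and n: "odd n" "3 \<le> n" and ne: "N \<noteq> {id}"
  shows "carrier (alt_group n) \<subseteq> N"
proof -
  obtain u v w where uvw: "{u, v, w} \<subseteq> {1..n}" "distinct [u, v, w]" "transpose u v \<circ> transpose u w \<in> N"
    using normal_contains_three_cycle[OF assms] .
  \<comment> \<open>The point \<open>u\<close> shared by the given transpositions is sent to
    \<open>b\<close>, the point shared by the wanted ones.\<close>
  have all: "transpose a b \<circ> transpose b c \<in> N" if abc: "{a, b, c} \<subseteq> {1..n}" "distinct [a, b, c]" for a b c
  proof -
    obtain \<tau> where \<tau>: "\<tau> permutes {1..n}" "\<tau> u = b" "\<tau> v = a" "\<tau> w = c"
      using ex_permutation_three[OF uvw(1), of b a c] uvw(2) abc by auto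
    have "\<tau> \<circ> (transpose u v \<circ> transpose u w) \<circ> inv' \<tau> =
        (\<tau> \<circ> transpose u v \<circ> inv' \<tau>) \<circ> (\<tau> \<circ> transpose u w \<circ> inv' \<tau>)"
      using permutes_inverses(2)[OF \<tau>(1)] by (auto simp: fun_eq_iff)
    also have "\<dots> = transpose a b \<circ> transpose b c"
      unfolding conj_transpose[OF \<tau>(1)] \<tau>(2-4) by (simp add: transpose_commute)
    finally show ?thesis using normal_conj'[OF N uvw(3) \<tau>(1)] by simp
  qed
  have "three_cycles n \<subseteq> N"
  proof
    fix p assume "p \<in> three_cycles n"
    then obtain cs where cs: "p = cycle_of_list cs" "cycle cs" "length cs = 3" "set cs \<subseteq> {1..n}" by blast
    obtain a b c where "cs = [a, b, c]" using stupid_lemma[OF cs(3)] by blast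
    then show "p \<in> N" using all[of a b c] cs by simp
  qed
  have "p \<in> N" if "p \<in> generate (alt_group n) (three_cycles n)" for p
    using that
  proof induction
    case one
    then show ?case using normal_id[OF N] unfolding alt_group_one .
  next
    case (incl h)
    then show ?case using \<open>three_cycles n \<subseteq> N\<close> by blast
  next
    case (inv h)
    then have "inv\<^bsub>alt_group n\<^esub> h = inv' h"
      using three_cycles_incl alt_group_inv_equality by blast
    then show ?case using normal_inv[OF N] inv \<open>three_cycles n \<subseteq> N\<close> by auto
  next
    case (eng h1 h2)
    then show ?case using normal_comp[OF N] unfolding alt_group_mult by blast
  qed
  then show ?thesis unfolding alt_group_carrier_as_three_cycles by blast
qed

text \<open>Once \<open>N\<close> exceeds the alternating group it contains an odd permutation
  \<open>\<tau>\<close>. For odd \<open>\<pi>\<close> the permutation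
  \<open>inv' \<tau> \<circ> \<pi>\<close> is even, hence in \<open>N\<close>, and so is
  \<open>\<pi>\<close>.\<close>

lemma normal_sym_group_cases:
  assumes N: "N \<lhd> sym_group n" and n: "odd n" "3 \<le> n"
  shows "N = {id} \<or> N = carrier (alt_group n) \<or> N = carrier (sym_group n)"
proof (rule ccontr)
  assume c: "\<not> ?thesis"
  then have alt: "carrier (alt_group n) \<subseteq> N" using alt_group_subset_normal[OF assms] by blast
  then obtain \<tau> where \<tau>: "\<tau> \<in> N" "\<tau> \<notin> carrier (alt_group n)" using c by blast
  note \<tau>p = normal_permutes[OF N \<tau>(1)]
  have "\<not> evenperm \<tau>" using \<tau>(2) \<tau>p by (simp add: alt_group_carrier)
  have perm: "permutation \<pi>" if "\<pi> permutes {1..n}" for \<pi>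
    using that permutation_permutes by blast
  have "\<pi> \<in> N" if \<pi>: "\<pi> permutes {1..n}" for \<pi>
  proof (cases "evenperm \<pi>")
    case True
    then show ?thesis using alt \<pi> by (auto simp: alt_group_carrier)
  next
    case False
    have "evenperm (inv' \<tau> \<circ> \<pi>)"
      using False \<open>\<not> evenperm \<tau>\<close> evenperm_comp[OF perm[OF permutes_inv[OF \<tau>p]] perm[OF \<pi>]]
        evenperm_inv[OF perm[OF \<tau>p]] by simp
    moreover have "inv' \<tau> \<circ> \<pi> permutes {1..n}" by (rule permutes_compose[OF \<pi> permutes_inv[OF \<tau>p]])
    ultimately have "inv' \<tau> \<circ> \<pi> \<in> N" using alt by (auto simp: alt_group_carrier)
    from normal_comp[OF N \<tau>(1) this] show ?thesis
      using permutes_inv_o(1)[OF \<tau>p] by (simp add: comp_assoc[symmetric])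
  qed
  then have "N = carrier (sym_group n)"
    using normal_permutes[OF N] by (auto simp: sym_group_carrier)
  then show False using c by simp
qed

lemma normal_sym_group_chain:
  assumes "N \<lhd> sym_group n" "N' \<lhd> sym_group n" "odd n" "3 \<le> n"
  shows "N \<subseteq> N' \<or> N' \<subseteq> N"
proof -
  have "carrier (alt_group n) \<subseteq> carrier (sym_group n)" "{id} \<subseteq> carrier (alt_group n)"
    by (auto simp: alt_group_carrier sym_group_carrier permutes_id)
  then show ?thesis
    using normal_sym_group_cases[OF assms(1,3,4)] normal_sym_group_cases[OF assms(2,3,4)] by blast
qed

lemma trivial_normal: "{id} \<lhd> sym_group n"
proof -
  interpret group "sym_group n" by (rule sym_group_is_group)
  show ?thesis using one_is_normal by (simp add: sym_group_one)
qed

section \<open>Congruences of an ideal\<close>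

context brauer_cong
begin

lemma collapsed_mono: "collapsed m \<Longrightarrow> k \<le> m \<Longrightarrow> collapsed k"
  unfolding collapsed_def using order_trans by blast

text \<open>Above rank 1, a difference in rank, upper part or lower part collapses everything up to
  the larger rank. Only pairs with equal outer matchings leave their own rank undecided, and they
  still collapse all lower ranks.\<close>

lemma pair_cases:
  assumes \<sigma>: "(\<alpha>, \<beta>) \<in> \<sigma>" and ne: "\<alpha> \<noteq> \<beta>"
  obtains "brank \<alpha> = 1" "brank \<beta> = 1"
  | "collapsed (max (brank \<alpha>) (brank \<beta>))" "2 \<le> max (brank \<alpha>) (brank \<beta>)"
  | "3 \<le> brank \<alpha>" "brank \<beta> = brank \<alpha>" "upper \<alpha> = upper \<beta>" "lower \<alpha> = lower \<beta>" "collapsed (brank \<alpha> - 2)"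
proof -
  obtain A B where AB: "A \<in> \<C>" "B \<in> \<C>" "\<alpha> \<in> brauer_hom A B" "\<beta> \<in> brauer_hom A B"
    using cong_homE[OF \<sigma>] .
  have pos: "1 \<le> brank \<alpha>" "1 \<le> brank \<beta>" "odd (brank \<alpha>)" using rank_pos odd_rank AB by blast+
  consider "brank \<beta> < brank \<alpha>" | "brank \<alpha> < brank \<beta>" | "brank \<alpha> = brank \<beta>" "brank \<alpha> = 1"
    | "brank \<alpha> = brank \<beta>" "3 \<le> brank \<alpha>"
    using pos by (metis One_nat_def Suc_1 Suc_leI le_neq_implies_less nat_neq_iff numeral_3_eq_3 even_numeral)
  then show ?thesis
  proof cases
    case 1
    then show ?thesis using that(2) drop_collapse[OF \<sigma> 1] pos by (simp add: max_def)
  next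
    case 2
    then show ?thesis using that(2) drop_collapse[OF cong_sym[OF \<sigma>] 2] pos by (simp add: max_def)
  next
    case 3
    show ?thesis by (rule that(1)) (use 3 in simp_all)
  next
    case 4
    then have m: "max (brank \<alpha>) (brank \<beta>) = brank \<alpha>" "2 \<le> brank \<alpha>" by simp_all
    consider "upper \<alpha> \<noteq> upper \<beta>" | "lower \<alpha> \<noteq> lower \<beta>" | "upper \<alpha> = upper \<beta>" "lower \<alpha> = lower \<beta>" by blast
    then show ?thesis
    proof cases
      case 1
      then show ?thesis using that(2) upper_collapse[OF \<sigma> 4] m by metis
    next
      case 2
      then show ?thesis using that(2) lower_collapse[OF \<sigma> 4] m by metis
    next
      case 3
      show ?thesis by (rule that(3)[OF 4(2) 4(1)[symmetric] 3 H_related_collapse[OF \<sigma> 3 4(2) ne]])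
    qed
  qed
qed

lemma rel_ideal_subset:
  assumes "\<And>A B \<gamma> \<delta>. A \<in> \<C> \<Longrightarrow> B \<in> \<C> \<Longrightarrow> \<gamma> \<in> brauer_hom A B \<Longrightarrow> brank \<gamma> = 1 \<Longrightarrow>
    \<delta> \<in> brauer_hom A B \<Longrightarrow> brank \<delta> = 1 \<Longrightarrow> P \<gamma> \<delta> \<Longrightarrow> (\<gamma>, \<delta>) \<in> \<sigma>"
  shows "rel_ideal r P \<subseteq> \<sigma>"
proof
  fix z assume "z \<in> rel_ideal r P"
  then obtain \<gamma> \<delta> where z: "z = (\<gamma>, \<delta>)" and I: "\<gamma> \<in> brauer_ideal \<C> r" "\<delta> \<in> brauer_ideal \<C> r"
    "bdom \<gamma> = bdom \<delta>" "bran \<gamma> = bran \<delta>" "\<gamma> = \<delta> \<or> brank \<gamma> = 1 \<and> brank \<delta> = 1 \<and> P \<gamma> \<delta>"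
    unfolding rel_ideal_def by blast
  obtain A B where "A \<in> \<C>" "B \<in> \<C>" "\<gamma> \<in> brauer_hom A B" "\<delta> \<in> brauer_hom A B"
    using rel_ideal_cases[OF I(1-4)] .
  then show "z \<in> \<sigma>" using z I(5) cong_refl[OF I(1)] assms by metis
qed

lemma cong_sub_rel_ideal:
  assumes "\<And>\<alpha> \<beta>. (\<alpha>, \<beta>) \<in> \<sigma> \<Longrightarrow> \<alpha> \<noteq> \<beta> \<Longrightarrow> brank \<alpha> = 1 \<and> brank \<beta> = 1 \<and> P \<alpha> \<beta>"
  shows "\<sigma> \<subseteq> rel_ideal r P"
proof
  fix z assume z: "z \<in> \<sigma>"
  obtain \<alpha> \<beta> where ab: "z = (\<alpha>, \<beta>)" by (rule prod.exhaust)
  have "bdom \<alpha> = bdom \<beta> \<and> bran \<alpha> = bran \<beta>"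
    using cong_homE[OF z[unfolded ab]] by (metis bdom_hom bran_hom)
  then show "z \<in> rel_ideal r P"
    using assms[of \<alpha> \<beta>] z cong_mem[of \<alpha> \<beta>] unfolding ab rel_ideal_def by auto
qed

text \<open>A pair of distinct diagrams above rank 1 would collapse rank 1, so all of them have rank
  1. By \<open>collapsed_one\<close> upper and lower differences cannot both occur, and the kinds
  that do occur single out the congruence.\<close>

lemma not_collapsed_cases:
  assumes nc: "\<not> collapsed 1"
  shows "\<sigma> = rel_ideal r (\<lambda>_ _. False) \<or> \<sigma> = rel_ideal r (\<lambda>\<alpha> \<beta>. lower \<alpha> = lower \<beta>) \<or>
    \<sigma> = rel_ideal r (\<lambda>\<alpha> \<beta>. upper \<alpha> = upper \<beta>)"
proof -
  have rk: "brank \<alpha> = 1 \<and> brank \<beta> = 1" if "(\<alpha>, \<beta>) \<in> \<sigma>" "\<alpha> \<noteq> \<beta>" for \<alpha> \<beta>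
    using that
  proof (cases rule: pair_cases)
    case 2
    then have "collapsed 1" using collapsed_mono by (meson one_le_numeral order_trans)
    then show ?thesis using nc by simp
  next
    case 3
    then have "collapsed 1" using collapsed_mono[OF 3(5), of 1] by simp
    then show ?thesis using nc by simp
  qed auto
  have ne: "upper \<alpha> \<noteq> upper \<beta> \<or> lower \<alpha> \<noteq> lower \<beta>" if "(\<alpha>, \<beta>) \<in> \<sigma>" "\<alpha> \<noteq> \<beta>" for \<alpha> \<beta>
    using rank_one_eqI cong_homE[OF that(1)] rk[OF that] that(2) by metis
  show ?thesis
  proof (cases "\<exists>\<alpha> \<beta>. (\<alpha>, \<beta>) \<in> \<sigma> \<and> upper \<alpha> \<noteq> upper \<beta>")
    case True
    then obtain \<alpha> \<beta> where u: "(\<alpha>, \<beta>) \<in> \<sigma>" "upper \<alpha> \<noteq> upper \<beta>" by blast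
    then have r1: "brank \<alpha> = 1" "brank \<beta> = 1" using rk by blast+
    have lo: "lower \<alpha>' = lower \<beta>'" if "(\<alpha>', \<beta>') \<in> \<sigma>" for \<alpha>' \<beta>'
      using collapsed_one[OF u(1) r1 u(2) that] rk[OF that] nc by blast
    have "\<sigma> \<subseteq> rel_ideal r (\<lambda>\<alpha> \<beta>. lower \<alpha> = lower \<beta>)"
      by (rule cong_sub_rel_ideal) (use rk lo in blast)
    moreover have "rel_ideal r (\<lambda>\<alpha> \<beta>. lower \<alpha> = lower \<beta>) \<subseteq> \<sigma>"
      by (rule rel_ideal_subset) (rule rank_one_upper_collapse[OF u(1) r1 u(2)])
    ultimately show ?thesis by blast
  next
    case False
    then have up: "upper \<alpha>' = upper \<beta>'" if "(\<alpha>', \<beta>') \<in> \<sigma>" for \<alpha>' \<beta>' using that by blast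
    show ?thesis
    proof (cases "\<exists>\<alpha> \<beta>. (\<alpha>, \<beta>) \<in> \<sigma> \<and> lower \<alpha> \<noteq> lower \<beta>")
      case True
      then obtain \<alpha> \<beta> where u: "(\<alpha>, \<beta>) \<in> \<sigma>" "lower \<alpha> \<noteq> lower \<beta>" by blast
      then have r1: "brank \<alpha> = 1" "brank \<beta> = 1" using rk by blast+
      have "\<sigma> \<subseteq> rel_ideal r (\<lambda>\<alpha> \<beta>. upper \<alpha> = upper \<beta>)"
        by (rule cong_sub_rel_ideal) (use rk up in blast)
      moreover have "rel_ideal r (\<lambda>\<alpha> \<beta>. upper \<alpha> = upper \<beta>) \<subseteq> \<sigma>"
        by (rule rel_ideal_subset) (rule rank_one_lower_collapse[OF u(1) r1 u(2)])
      ultimately show ?thesis by blast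
    next
      case False
      then have "\<sigma> \<subseteq> rel_ideal r (\<lambda>_ _. False)"
        by (intro cong_sub_rel_ideal) (use ne up in blast)
      moreover have "rel_ideal r (\<lambda>_ _. False) \<subseteq> \<sigma>"
        by (rule rel_ideal_subset) simp
      ultimately show ?thesis by blast
    qed
  qed
qed

end

context numbered_object
begin

text \<open>Since rank \<open>p\<close> is not collapsed, two distinct related diagrams that are not
  both of rank at most \<open>q\<close> must have rank \<open>p\<close> and equal outer matchings.
  By \<open>transport\<close> such pairs are governed by a single group over
  \<open>Z\<close>.\<close>

lemma classify_twist:
  assumes cong: "brauer_cong \<C> r \<sigma>" and pq: "p = q + 2" and pr: "enat p \<le> r"
    and c: "brauer_cong.collapsed \<C> r \<sigma> q" and nc: "\<not> brauer_cong.collapsed \<C> r \<sigma> p"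
  shows "\<exists>N. N \<lhd> sym_group p \<and> \<sigma> = RT r q N"
proof -
  interpret brauer_cong \<C> r \<sigma> by (rule cong)
  \<comment> \<open>The part of the identity's class that lies in the group over \<open>Z\<close>;
    compatibility of \<open>\<sigma>\<close> makes it a normal subgroup.\<close>
  define N where "N = {\<pi>. \<pi> permutes {1..p} \<and> (nt \<pi>, nt id) \<in> \<sigma>}"
  have rn: "enat (brank (nt \<pi>)) \<le> r" if "\<pi> permutes {1..p}" for \<pi>
    using brank_nt[OF that] pr by simp
  \<comment> \<open>By \<open>nt_mult\<close> a right factor \<open>nt \<rho>\<close> composes with
    \<open>\<rho>\<close> on the left.\<close>
  have right: "(nt (\<rho> \<circ> \<pi>), nt (\<rho> \<circ> \<pi>')) \<in> \<sigma>"
    if "(nt \<pi>, nt \<pi>') \<in> \<sigma>" "\<pi> permutes {1..p}" "\<pi>' permutes {1..p}" "\<rho> permutes {1..p}" for \<pi> \<pi>' \<rho>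
    using cong_right[OF that(1) Z Z nt_hom[OF that(2)] nt_hom[OF that(4)] rn[OF that(4)]]
    unfolding nt_mult[OF that(2,4)] nt_mult[OF that(3,4)] .
  have left: "(nt (\<pi> \<circ> \<rho>), nt (\<pi>' \<circ> \<rho>)) \<in> \<sigma>"
    if "(nt \<pi>, nt \<pi>') \<in> \<sigma>" "\<pi> permutes {1..p}" "\<pi>' permutes {1..p}" "\<rho> permutes {1..p}" for \<pi> \<pi>' \<rho>
    using cong_left[OF that(1) Z Z nt_hom[OF that(2)] nt_hom[OF that(4)] rn[OF that(4)]]
    unfolding nt_mult[OF that(4,2)] nt_mult[OF that(4,3)] .
  interpret G: group "sym_group p" by (rule sym_group_is_group)
  have nid: "nt id \<in> brauer_ideal \<C> r"
    using brauer_idealI[OF Z Z nt_hom[OF permutes_id]] rn[OF permutes_id] by blast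
  have "subgroup N (sym_group p)"
  proof (rule G.subgroupI)
    show "N \<subseteq> carrier (sym_group p)" by (auto simp: N_def sym_group_carrier)
    show "N \<noteq> {}" using cong_refl[OF nid] permutes_id unfolding N_def by blast
    fix \<pi> assume "\<pi> \<in> N"
    then have \<pi>: "\<pi> permutes {1..p}" "(nt \<pi>, nt id) \<in> \<sigma>" by (auto simp: N_def)
    have "(nt (inv' \<pi> \<circ> \<pi>), nt (inv' \<pi> \<circ> id)) \<in> \<sigma>"
      by (rule right[OF \<pi>(2,1) permutes_id permutes_inv[OF \<pi>(1)]])
    then have "(nt (inv' \<pi>), nt id) \<in> \<sigma>"
      using permutes_inv_o(2)[OF \<pi>(1)] cong_sym by simp
    then show "inv\<^bsub>sym_group p\<^esub> \<pi> \<in> N"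
      using permutes_inv[OF \<pi>(1)] \<pi>(1) by (simp add: N_def sym_group_carrier)
    fix \<rho> assume "\<rho> \<in> N"
    then have \<rho>: "\<rho> permutes {1..p}" "(nt \<rho>, nt id) \<in> \<sigma>" by (auto simp: N_def)
    have "(nt (\<pi> \<circ> \<rho>), nt (\<pi> \<circ> id)) \<in> \<sigma>" by (rule right[OF \<rho>(2,1) permutes_id \<pi>(1)])
    then have "(nt (\<pi> \<circ> \<rho>), nt id) \<in> \<sigma>" using \<pi>(2) cong_trans by simp
    then show "\<pi> \<otimes>\<^bsub>sym_group p\<^esub> \<rho> \<in> N"
      using permutes_compose[OF \<rho>(1) \<pi>(1)] by (simp add: N_def sym_group_mult)
  qed
  moreover have "\<tau> \<circ> \<pi> \<circ> inv' \<tau> \<in> N" if "\<tau> permutes {1..p}" "\<pi> \<in> N" for \<tau> \<pi>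
  proof -
    have \<pi>: "\<pi> permutes {1..p}" "(nt \<pi>, nt id) \<in> \<sigma>" using that(2) by (auto simp: N_def)
    note ti = permutes_inv[OF that(1)]
    have "(nt (\<tau> \<circ> \<pi>), nt (\<tau> \<circ> id)) \<in> \<sigma>" by (rule right[OF \<pi>(2,1) permutes_id that(1)])
    then have "(nt (\<tau> \<circ> \<pi> \<circ> inv' \<tau>), nt (\<tau> \<circ> id \<circ> inv' \<tau>)) \<in> \<sigma>"
      by (rule left[OF _ permutes_compose[OF \<pi>(1) that(1)] permutes_compose[OF permutes_id that(1)] ti])
    then show ?thesis
      using permutes_inv_o(1)[OF that(1)] permutes_compose[OF ti permutes_compose[OF \<pi>(1) that(1)]]
      by (simp add: N_def)
  qed
  ultimately have N: "N \<lhd> sym_group p"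
    unfolding G.normal_inv_iff by (auto simp: sym_group_carrier sym_group_mult)
  \<comment> \<open>The multipliers of \<open>transport\<close> lead from the pair to its image over
    \<open>Z\<close> and back, so one is in \<open>\<sigma>\<close> exactly when the other
    is.\<close>
  have iff: "(\<alpha>, \<beta>) \<in> \<sigma> \<longleftrightarrow> \<pi> \<in> N"
    if t: "A \<in> \<C>" "B \<in> \<C>" "\<alpha> \<in> brauer_hom A B" "\<beta> \<in> brauer_hom A B" "upper \<alpha> = upper \<beta>" "lower \<alpha> = lower \<beta>"
      "bij_betw h {1..p} (A - \<Union>(upper \<alpha>))" and \<pi>: "\<pi> permutes {1..p}"
      and eq: "\<forall>i\<in>{1..p}. thr \<alpha> (h i) = thr \<beta> (h (\<pi> i))" for A B \<alpha> \<beta> h \<pi>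
  proof -
    obtain a b a' b' where ab: "a \<in> brauer_hom A Z" "b \<in> brauer_hom Z B" "a' \<in> brauer_hom Z A"
      "b' \<in> brauer_hom B Z" "brank a = p" "brank b = p" "brank a' = p" "brank b' = p"
      "a \<cdot> nt \<pi> \<cdot> b = \<alpha>" "a \<cdot> nt id \<cdot> b = \<beta>" "a' \<cdot> \<alpha> \<cdot> b' = nt \<pi>" "a' \<cdot> \<beta> \<cdot> b' = nt id"
      using transport[OF t \<pi> eq] by blast
    have rab: "enat (brank a) \<le> r" "enat (brank b) \<le> r" "enat (brank a') \<le> r" "enat (brank b') \<le> r"
      using ab(5-8) pr by simp_all
    note n\<pi> = nt_hom[OF \<pi>]
    show ?thesis
    proof
      assume s: "(\<alpha>, \<beta>) \<in> \<sigma>"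
      have "(a' \<cdot> \<alpha> \<cdot> b', a' \<cdot> \<beta> \<cdot> b') \<in> \<sigma>"
        by (rule cong_right[OF cong_left[OF s Z t(1,3) ab(3) rab(3)] t(2) Z mult_hom[OF Z t(1,2) ab(3) t(3)] ab(4) rab(4)])
      then show "\<pi> \<in> N" using \<pi> unfolding N_def ab(11,12) by simp
    next
      assume "\<pi> \<in> N"
      then have s: "(nt \<pi>, nt id) \<in> \<sigma>" unfolding N_def by simp
      have "(a \<cdot> nt \<pi> \<cdot> b, a \<cdot> nt id \<cdot> b) \<in> \<sigma>"
        by (rule cong_right[OF cong_left[OF s t(1) Z n\<pi> ab(1) rab(1)] Z t(2) mult_hom[OF t(1) Z Z ab(1) n\<pi>] ab(2) rab(2)])
      then show "(\<alpha>, \<beta>) \<in> \<sigma>" unfolding ab(9,10) .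
    qed
  qed
  have "\<sigma> \<subseteq> RT r q N"
  proof
    fix z assume "z \<in> \<sigma>"
    then obtain \<alpha> \<beta> where z: "z = (\<alpha>, \<beta>)" and s: "(\<alpha>, \<beta>) \<in> \<sigma>" by (metis prod.exhaust)
    obtain A B where AB: "A \<in> \<C>" "B \<in> \<C>" "\<alpha> \<in> brauer_hom A B" "\<beta> \<in> brauer_hom A B"
      using cong_homE[OF s] .
    show "z \<in> RT r q N"
    proof (cases "\<alpha> = \<beta> \<or> brank \<alpha> \<le> q \<and> brank \<beta> \<le> q")
      case True
      then have "(\<alpha>, \<beta>) \<in> R_cong (brauer_I \<C> r) (brauer_ideal \<C> (enat q))"
        using cong_mem[OF s] AB unfolding R_cong_iff by auto
      then show ?thesis unfolding z RT_def by blast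
    next
      case False
      then have ne: "\<alpha> \<noteq> \<beta>" and big: "q < max (brank \<alpha>) (brank \<beta>)" by auto
      have odd: "odd (brank \<alpha>)" "odd (brank \<beta>)" "odd q" using odd_rank AB p(1) pq by auto
      then have "q + 2 \<le> max (brank \<alpha>) (brank \<beta>)" using big unfolding max_def by (auto; presburger)
      have H: "brank \<alpha> = p \<and> upper \<alpha> = upper \<beta> \<and> lower \<alpha> = lower \<beta>"
        using s ne
      proof (cases rule: pair_cases)
        case 1
        then show ?thesis using big odd(3) by (simp add: odd_pos)
      next
        case 2
        then have "collapsed p" using collapsed_mono \<open>q + 2 \<le> max (brank \<alpha>) (brank \<beta>)\<close> pq by blast
        then show ?thesis using nc by simp
      next
        case 3
        \<comment> \<open>A pair of rank \<open>p + 2\<close> or more would collapse rank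
          \<open>p\<close>; with parity only rank \<open>p\<close> itself remains.\<close>
        have "\<not> p \<le> brank \<alpha> - 2" using collapsed_mono[OF 3(5)] nc by blast
        then have "brank \<alpha> < q + 4" using pq by linarith
        moreover have "q + 2 \<le> brank \<alpha>" using \<open>q + 2 \<le> max (brank \<alpha>) (brank \<beta>)\<close> 3(2) by simp
        ultimately have "brank \<alpha> = p" using odd pq by presburger
        then show ?thesis using 3 by simp
      qed
      obtain h where h: "bij_betw h {1..p} (A - \<Union>(upper \<alpha>))" using ex_numbering[OF AB(1,3)] H by blast
      \<comment> \<open>The point \<open>g i\<close> is the one from which \<open>\<beta>\<close>
        reaches the lower end of the strand of \<open>\<alpha>\<close> at \<open>h i\<close>.
        Comparing \<open>g\<close> with \<open>h\<close> yields the permutation.\<close>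
      define g where "g = inv_into (A - \<Union>(upper \<alpha>)) (thr \<beta>) \<circ> (thr \<alpha> \<circ> h)"
      have t\<beta>: "bij_betw (thr \<beta>) (A - \<Union>(upper \<alpha>)) (B - \<Union>(lower \<alpha>))" using thr_bij[OF AB(4)] H by simp
      have g: "bij_betw g {1..p} (A - \<Union>(upper \<alpha>))"
        unfolding g_def by (rule bij_betw_trans[OF bij_betw_trans[OF h thr_bij[OF AB(3)]] bij_betw_inv_into[OF t\<beta>]])
      obtain \<pi> where \<pi>: "\<pi> permutes {1..p}" "\<And>i. i \<in> {1..p} \<Longrightarrow> g i = h (\<pi> i)"
        using renumbering[OF h g] by blast
      have eq: "thr \<alpha> (h i) = thr \<beta> (h (\<pi> i))" if "i \<in> {1..p}" for i
      proof -
        have "thr \<alpha> (h i) \<in> B - \<Union>(lower \<alpha>)"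
          using bij_betwE[OF thr_bij[OF AB(3)]] bij_betwE[OF h] that by blast
        then have "thr \<beta> (g i) = thr \<alpha> (h i)"
          using bij_betw_inv_into_right[OF t\<beta>] unfolding g_def by simp
        then show ?thesis using \<pi>(2)[OF that] by simp
      qed
      have "\<pi> \<in> N" using iff[OF AB _ _ h \<pi>(1)] H eq s by blast
      then have "(\<alpha>, \<beta>) \<in> twist N p"
        using twistI[OF AB _ _ _ h _ eq] H by blast
      then show ?thesis unfolding z RT_def pq by blast
    qed
  qed
  moreover have "RT r q N \<subseteq> \<sigma>"
  proof
    fix z assume z: "z \<in> RT r q N"
    obtain \<alpha> \<beta> where ab: "z = (\<alpha>, \<beta>)" by (rule prod.exhaust)
    show "z \<in> \<sigma>"
    proof (cases "(\<alpha>, \<beta>) \<in> twist N p")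
      case True
      obtain A B h \<pi> where *: "A \<in> \<C>" "B \<in> \<C>" "\<alpha> \<in> brauer_hom A B" "\<beta> \<in> brauer_hom A B"
        "brank \<alpha> = p" "brank \<beta> = p" "upper \<alpha> = upper \<beta>" "lower \<alpha> = lower \<beta>"
        "bij_betw h {1..p} (A - \<Union>(upper \<alpha>))" "\<pi> \<in> N"
        "\<forall>i\<in>{1..p}. thr \<alpha> (h i) = thr \<beta> (h (\<pi> i))"
        using True by (rule twistE)
      show ?thesis unfolding ab using iff[OF *(1-4,7-9) normal_permutes[OF N *(10)] *(11)] *(10) by blast
    next
      case False
      then have R: "\<alpha> \<in> brauer_ideal \<C> r" "\<beta> \<in> brauer_ideal \<C> r" "bdom \<alpha> = bdom \<beta>" "bran \<alpha> = bran \<beta>"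
        "\<alpha> = \<beta> \<or> brank \<alpha> \<le> q \<and> brank \<beta> \<le> q"
        using z unfolding ab RT_def pq[symmetric] Un_iff R_cong_iff by blast+
      obtain A B where AB: "A \<in> \<C>" "B \<in> \<C>" "\<alpha> \<in> brauer_hom A B" "\<beta> \<in> brauer_hom A B"
        using rel_ideal_cases[OF R(1-4)] .
      show ?thesis
      proof (cases "\<alpha> = \<beta>")
        case True
        then show ?thesis using cong_refl[OF R(1)] ab by simp
      next
        case False
        have "enat (brank \<alpha>) \<le> r" "enat (brank \<beta>) \<le> r" using R(1,2) by (simp_all add: brauer_ideal_iff)
        then show ?thesis using c AB R(5) False unfolding ab collapsed_def by blast
      qed
    qed
  qed
  ultimately show ?thesis using N by blast
qed

end

section \<open>Lattices of congruences of partial rectangular bands\<close>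

text \<open>Binary suprema spelled out, a form that can be built componentwise and carried along
  order isomorphisms.\<close>

definition lub_of :: "'b gorder \<Rightarrow> 'b \<Rightarrow> 'b \<Rightarrow> 'b \<Rightarrow> bool" where
  "lub_of L s x y \<longleftrightarrow> s \<in> carrier L \<and> x \<sqsubseteq>\<^bsub>L\<^esub> s \<and> y \<sqsubseteq>\<^bsub>L\<^esub> s \<and>
     (\<forall>z\<in>carrier L. x \<sqsubseteq>\<^bsub>L\<^esub> z \<longrightarrow> y \<sqsubseteq>\<^bsub>L\<^esub> z \<longrightarrow> s \<sqsubseteq>\<^bsub>L\<^esub> z)"

definition glb_of :: "'b gorder \<Rightarrow> 'b \<Rightarrow> 'b \<Rightarrow> 'b \<Rightarrow> bool" where
  "glb_of L s x y \<longleftrightarrow> s \<in> carrier L \<and> s \<sqsubseteq>\<^bsub>L\<^esub> x \<and> s \<sqsubseteq>\<^bsub>L\<^esub> y \<and>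
     (\<forall>z\<in>carrier L. z \<sqsubseteq>\<^bsub>L\<^esub> x \<longrightarrow> z \<sqsubseteq>\<^bsub>L\<^esub> y \<longrightarrow> z \<sqsubseteq>\<^bsub>L\<^esub> s)"

definition order_on :: "'b gorder \<Rightarrow> bool" where
  "order_on L \<longleftrightarrow> eq L = (=) \<and> (\<forall>x\<in>carrier L. x \<sqsubseteq>\<^bsub>L\<^esub> x) \<and>
     (\<forall>x\<in>carrier L. \<forall>y\<in>carrier L. x \<sqsubseteq>\<^bsub>L\<^esub> y \<longrightarrow> y \<sqsubseteq>\<^bsub>L\<^esub> x \<longrightarrow> x = y) \<and>
     (\<forall>x\<in>carrier L. \<forall>y\<in>carrier L. \<forall>z\<in>carrier L. x \<sqsubseteq>\<^bsub>L\<^esub> y \<longrightarrow> y \<sqsubseteq>\<^bsub>L\<^esub> z \<longrightarrow> x \<sqsubseteq>\<^bsub>L\<^esub> z)"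

definition lattice_on :: "'b gorder \<Rightarrow> bool" where
  "lattice_on L \<longleftrightarrow> order_on L \<and>
     (\<forall>x\<in>carrier L. \<forall>y\<in>carrier L. (\<exists>s. lub_of L s x y) \<and> (\<exists>s. glb_of L s x y))"

lemma order_onD:
  assumes "order_on L"
  shows order_on_refl: "x \<in> carrier L \<Longrightarrow> x \<sqsubseteq>\<^bsub>L\<^esub> x"
    and order_on_antisym: "x \<in> carrier L \<Longrightarrow> y \<in> carrier L \<Longrightarrow> x \<sqsubseteq>\<^bsub>L\<^esub> y \<Longrightarrow> y \<sqsubseteq>\<^bsub>L\<^esub> x \<Longrightarrow> x = y"
    and order_on_trans: "x \<in> carrier L \<Longrightarrow> y \<in> carrier L \<Longrightarrow> z \<in> carrier L \<Longrightarrow> x \<sqsubseteq>\<^bsub>L\<^esub> y \<Longrightarrow> y \<sqsubseteq>\<^bsub>L\<^esub> z \<Longrightarrow> x \<sqsubseteq>\<^bsub>L\<^esub> z"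
proof -
  have 1: "\<forall>x\<in>carrier L. x \<sqsubseteq>\<^bsub>L\<^esub> x"
    using assms unfolding order_on_def by (elim conjE)
  have 2: "\<forall>x\<in>carrier L. \<forall>y\<in>carrier L. x \<sqsubseteq>\<^bsub>L\<^esub> y \<longrightarrow> y \<sqsubseteq>\<^bsub>L\<^esub> x \<longrightarrow> x = y"
    using assms unfolding order_on_def by (elim conjE)
  have 3: "\<forall>x\<in>carrier L. \<forall>y\<in>carrier L. \<forall>z\<in>carrier L. x \<sqsubseteq>\<^bsub>L\<^esub> y \<longrightarrow> y \<sqsubseteq>\<^bsub>L\<^esub> z \<longrightarrow> x \<sqsubseteq>\<^bsub>L\<^esub> z"
    using assms unfolding order_on_def by (elim conjE)
  show "x \<in> carrier L \<Longrightarrow> x \<sqsubseteq>\<^bsub>L\<^esub> x" by (rule 1[rule_format])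
  show "x \<in> carrier L \<Longrightarrow> y \<in> carrier L \<Longrightarrow> x \<sqsubseteq>\<^bsub>L\<^esub> y \<Longrightarrow> y \<sqsubseteq>\<^bsub>L\<^esub> x \<Longrightarrow> x = y"
    by (rule 2[rule_format])
  show "x \<in> carrier L \<Longrightarrow> y \<in> carrier L \<Longrightarrow> z \<in> carrier L \<Longrightarrow> x \<sqsubseteq>\<^bsub>L\<^esub> y \<Longrightarrow> y \<sqsubseteq>\<^bsub>L\<^esub> z \<Longrightarrow> x \<sqsubseteq>\<^bsub>L\<^esub> z"
    by (rule 3[rule_format])
qed

lemma order_on_partial_order: "order_on L \<Longrightarrow> partial_order L"
proof -
  assume L: "order_on L"
  then have eq: "eq L = (=)" unfolding order_on_def by simp
  show ?thesis
  proof
    fix x y z assume "x \<in> carrier L" "y \<in> carrier L" "z \<in> carrier L" "x \<sqsubseteq>\<^bsub>L\<^esub> y" "y \<sqsubseteq>\<^bsub>L\<^esub> z"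
    then show "x \<sqsubseteq>\<^bsub>L\<^esub> z" by (rule order_on_trans[OF L])
  next
    fix x y assume "x \<sqsubseteq>\<^bsub>L\<^esub> y" "y \<sqsubseteq>\<^bsub>L\<^esub> x" "x \<in> carrier L" "y \<in> carrier L"
    then show "x .=\<^bsub>L\<^esub> y" unfolding eq by (intro order_on_antisym[OF L])
  qed (simp_all add: eq order_on_refl[OF L])
qed

lemma least_Upper_iff:
  assumes "x \<in> carrier L" "y \<in> carrier L"
  shows "least L s (Upper L {x, y}) \<longleftrightarrow> lub_of L s x y"
  using assms unfolding least_def Upper_def lub_of_def by auto

lemma greatest_Lower_iff:
  assumes "x \<in> carrier L" "y \<in> carrier L"
  shows "greatest L s (Lower L {x, y}) \<longleftrightarrow> glb_of L s x y"
  using assms unfolding greatest_def Lower_def glb_of_def by auto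

lemma lattice_on_lattice:
  assumes "lattice_on L"
  shows "lattice L"
proof -
  interpret partial_order L using assms order_on_partial_order unfolding lattice_on_def by blast
  show ?thesis
  proof (unfold_locales)
    fix x y assume "x \<in> carrier L" "y \<in> carrier L"
    then show "\<exists>s. least L s (Upper L {x, y})" "\<exists>s. greatest L s (Lower L {x, y})"
      using assms least_Upper_iff greatest_Lower_iff unfolding lattice_on_def by metis+
  qed
qed

lemma join_eq_lub:
  assumes "order_on L" "x \<in> carrier L" "y \<in> carrier L" "lub_of L s x y"
  shows "x \<squnion>\<^bsub>L\<^esub> y = s"
proof -
  have "lub_of L (x \<squnion>\<^bsub>L\<^esub> y) x y"
    unfolding join_def sup_def least_Upper_iff[OF assms(2,3)] using assms(4) by (rule someI)
  then show ?thesis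
    using order_on_antisym[OF assms(1)] assms(4) unfolding lub_of_def by metis
qed

lemma meet_eq_glb:
  assumes "order_on L" "x \<in> carrier L" "y \<in> carrier L" "glb_of L s x y"
  shows "x \<sqinter>\<^bsub>L\<^esub> y = s"
proof -
  have "glb_of L (x \<sqinter>\<^bsub>L\<^esub> y) x y"
    unfolding meet_def inf_def greatest_Lower_iff[OF assms(2,3)] using assms(4) by (rule someI)
  then show ?thesis
    using order_on_antisym[OF assms(1)] assms(4) unfolding glb_of_def by metis
qed

text \<open>An order isomorphism carries suprema and infima along, so neither the lattice property
  of \<open>L\<close> nor its joins and meets have to be computed. The isomorphism from
  \<open>L\<close> to \<open>K\<close> is the inverse of \<open>f\<close>, because \<open>f\<close>
  is easier to give from the known product.\<close>

lemma lattice_isomorphicI: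
  assumes K: "lattice_on K" and eqL: "eq L = (=)"
    and f: "bij_betw f (carrier K) (carrier L)"
    and mono: "\<And>x y. x \<in> carrier K \<Longrightarrow> y \<in> carrier K \<Longrightarrow> f x \<sqsubseteq>\<^bsub>L\<^esub> f y \<longleftrightarrow> x \<sqsubseteq>\<^bsub>K\<^esub> y"
  shows "lattice_isomorphic L K"
proof -
  define g where "g = inv_into (carrier K) f"
  have g: "bij_betw g (carrier L) (carrier K)"
    unfolding g_def by (rule bij_betw_inv_into[OF f])
  have gm: "g x \<in> carrier K" if "x \<in> carrier L" for x using bij_betwE[OF g] that by blast
  have fm: "f x \<in> carrier L" if "x \<in> carrier K" for x using bij_betwE[OF f] that by blast
  have fg: "f (g x) = x" if "x \<in> carrier L" for x
    unfolding g_def by (rule bij_betw_inv_into_right[OF f that])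
  have gf: "g (f x) = x" if "x \<in> carrier K" for x
    unfolding g_def by (rule bij_betw_inv_into_left[OF f that])
  have le: "x \<sqsubseteq>\<^bsub>L\<^esub> y \<longleftrightarrow> g x \<sqsubseteq>\<^bsub>K\<^esub> g y" if "x \<in> carrier L" "y \<in> carrier L" for x y
    using mono[OF gm[OF that(1)] gm[OF that(2)]] fg that by simp
  have oK: "order_on K" using K unfolding lattice_on_def by simp
  have oL: "order_on L"
    unfolding order_on_def
  proof (intro conjI ballI impI)
    show "eq L = (=)" by (rule eqL)
    show "x \<sqsubseteq>\<^bsub>L\<^esub> x" if "x \<in> carrier L" for x
      using le[OF that that] order_on_refl[OF oK gm[OF that]] by simp
    show "x = y" if "x \<in> carrier L" "y \<in> carrier L" "x \<sqsubseteq>\<^bsub>L\<^esub> y" "y \<sqsubseteq>\<^bsub>L\<^esub> x" for x y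
    proof -
      have "g x \<sqsubseteq>\<^bsub>K\<^esub> g y" "g y \<sqsubseteq>\<^bsub>K\<^esub> g x" using that le by blast+
      then have "g x = g y" using order_on_antisym[OF oK gm[OF that(1)] gm[OF that(2)]] by simp
      then show ?thesis using fg that by metis
    qed
    show "x \<sqsubseteq>\<^bsub>L\<^esub> z" if "x \<in> carrier L" "y \<in> carrier L" "z \<in> carrier L" "x \<sqsubseteq>\<^bsub>L\<^esub> y" "y \<sqsubseteq>\<^bsub>L\<^esub> z" for x y z
    proof -
      have "g x \<sqsubseteq>\<^bsub>K\<^esub> g y" "g y \<sqsubseteq>\<^bsub>K\<^esub> g z" using that le by blast+
      then have "g x \<sqsubseteq>\<^bsub>K\<^esub> g z"
        using order_on_trans[OF oK gm[OF that(1)] gm[OF that(2)] gm[OF that(3)]] by simp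
      then show ?thesis using le that by blast
    qed
  qed
  have lub: "lub_of L (f s) x y"
    if "x \<in> carrier L" "y \<in> carrier L" "lub_of K s (g x) (g y)" for x y s
  proof -
    have s: "s \<in> carrier K" using that(3) unfolding lub_of_def by blast
    show ?thesis
      using that(3) unfolding lub_of_def
      using fm[OF s] gm gf[OF s] le[OF that(1) fm[OF s]] le[OF that(2) fm[OF s]] le[OF fm[OF s]]
        le[OF that(1)] le[OF that(2)] by simp
  qed
  have glb: "glb_of L (f s) x y"
    if "x \<in> carrier L" "y \<in> carrier L" "glb_of K s (g x) (g y)" for x y s
  proof -
    have s: "s \<in> carrier K" using that(3) unfolding glb_of_def by blast
    show ?thesis
      using that(3) unfolding glb_of_def
      using fm[OF s] gm gf[OF s] le[OF fm[OF s] that(1)] le[OF fm[OF s] that(2)] le[OF _ fm[OF s]]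
        le[OF _ that(1)] le[OF _ that(2)] by simp
  qed
  have ex: "(\<exists>s. lub_of K s (g x) (g y)) \<and> (\<exists>s. glb_of K s (g x) (g y))"
    if "x \<in> carrier L" "y \<in> carrier L" for x y
    using K gm that unfolding lattice_on_def by blast
  have "lattice_on L"
    unfolding lattice_on_def using oL ex lub glb by blast
  moreover have "g (x \<squnion>\<^bsub>L\<^esub> y) = g x \<squnion>\<^bsub>K\<^esub> g y \<and> g (x \<sqinter>\<^bsub>L\<^esub> y) = g x \<sqinter>\<^bsub>K\<^esub> g y"
    if xy: "x \<in> carrier L" "y \<in> carrier L" for x y
  proof -
    obtain s t where st: "lub_of K s (g x) (g y)" "glb_of K t (g x) (g y)" using ex[OF xy] by blast
    then have "s \<in> carrier K" "t \<in> carrier K" unfolding lub_of_def glb_of_def by blast+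
    then show ?thesis
      using join_eq_lub[OF oL xy lub[OF xy st(1)]] meet_eq_glb[OF oL xy glb[OF xy st(2)]]
        join_eq_lub[OF oK gm[OF xy(1)] gm[OF xy(2)] st(1)] meet_eq_glb[OF oK gm[OF xy(1)] gm[OF xy(2)] st(2)] gf
      by simp
  qed
  ultimately show ?thesis
    unfolding lattice_isomorphic_def using lattice_on_lattice[OF K] g
    by (intro conjI exI[of _ g] ballI) (simp_all add: lattice_on_lattice)
qed

lemma equiv_Inter:
  assumes "F \<noteq> {}" "\<And>\<epsilon>. \<epsilon> \<in> F \<Longrightarrow> equiv Z \<epsilon>"
  shows "equiv Z (\<Inter>F)"
proof (rule equivI)
  show "\<Inter>F \<subseteq> Z \<times> Z" using assms equiv_type by blast
  show "refl_on Z (\<Inter>F)" using assms(2) by (auto simp: refl_on_def equiv_def)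
  show "sym (\<Inter>F)" using assms(2) by (auto simp: sym_def equiv_def)
  show "trans (\<Inter>F)" using assms(2) unfolding trans_def equiv_def by (auto; blast)
qed

lemma lattice_on_EqLat: "lattice_on (EqLat Z)"
proof -
  have car: "carrier (EqLat Z) = {\<epsilon>. equiv Z \<epsilon>}" by (simp add: EqLat_def set_lattice_def)
  have ord: "order_on (EqLat Z)"
    unfolding order_on_def EqLat_def set_lattice_def by auto
  have full: "equiv Z (Z \<times> Z)" by (rule equivI) (auto simp: refl_on_def sym_def trans_def)
  have "lub_of (EqLat Z) (\<Inter>{\<gamma>. equiv Z \<gamma> \<and> \<alpha> \<subseteq> \<gamma> \<and> \<beta> \<subseteq> \<gamma>}) \<alpha> \<beta>"
    if "equiv Z \<alpha>" "equiv Z \<beta>" for \<alpha> \<beta>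
  proof -
    \<comment> \<open>The full relation keeps the family non-empty; the intersection of no sets
      would be the universal relation.\<close>
    have "Z \<times> Z \<in> {\<gamma>. equiv Z \<gamma> \<and> \<alpha> \<subseteq> \<gamma> \<and> \<beta> \<subseteq> \<gamma>}"
      using full equiv_type[OF that(1)] equiv_type[OF that(2)] by simp
    then have "equiv Z (\<Inter>{\<gamma>. equiv Z \<gamma> \<and> \<alpha> \<subseteq> \<gamma> \<and> \<beta> \<subseteq> \<gamma>})"
      by (intro equiv_Inter) auto
    then show ?thesis unfolding lub_of_def car by (auto simp: EqLat_def set_lattice_def)
  qed
  moreover have "glb_of (EqLat Z) (\<alpha> \<inter> \<beta>) \<alpha> \<beta>" if "equiv Z \<alpha>" "equiv Z \<beta>" for \<alpha> \<beta>
  proof -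
    have "equiv Z (\<Inter>{\<alpha>, \<beta>})" using that by (intro equiv_Inter) auto
    then show ?thesis unfolding glb_of_def car by (auto simp: EqLat_def set_lattice_def)
  qed
  ultimately show ?thesis
    unfolding lattice_on_def car using ord by blast
qed

lemma lattice_on_PiLat:
  assumes L: "\<And>j. j \<in> J \<Longrightarrow> lattice_on (L j)"
  shows "lattice_on (PiLat J L)"
proof -
  have o: "order_on (L j)" if "j \<in> J" for j using L[OF that] unfolding lattice_on_def by simp
  have ord: "order_on (PiLat J L)"
    unfolding order_on_def
  proof (intro conjI ballI impI)
    show "eq (PiLat J L) = (=)" by (simp add: PiLat_def)
    show "f \<sqsubseteq>\<^bsub>PiLat J L\<^esub> f" if "f \<in> carrier (PiLat J L)" for f
      using that order_on_refl[OF o] unfolding PiLat_def by (auto simp: PiE_iff)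
    show "f = g" if "f \<in> carrier (PiLat J L)" "g \<in> carrier (PiLat J L)" "f \<sqsubseteq>\<^bsub>PiLat J L\<^esub> g" "g \<sqsubseteq>\<^bsub>PiLat J L\<^esub> f" for f g
    proof (rule PiE_ext)
      show "f \<in> (\<Pi>\<^sub>E j\<in>J. carrier (L j))" "g \<in> (\<Pi>\<^sub>E j\<in>J. carrier (L j))"
        using that(1,2) by (simp_all add: PiLat_def)
      fix j assume j: "j \<in> J"
      then have "f j \<in> carrier (L j)" "g j \<in> carrier (L j)" "f j \<sqsubseteq>\<^bsub>L j\<^esub> g j" "g j \<sqsubseteq>\<^bsub>L j\<^esub> f j"
        using that by (auto simp: PiLat_def)
      then show "f j = g j" by (rule order_on_antisym[OF o[OF j]])
    qed
    show "f \<sqsubseteq>\<^bsub>PiLat J L\<^esub> h" if "f \<in> carrier (PiLat J L)" "g \<in> carrier (PiLat J L)" "h \<in> carrier (PiLat J L)"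
      "f \<sqsubseteq>\<^bsub>PiLat J L\<^esub> g" "g \<sqsubseteq>\<^bsub>PiLat J L\<^esub> h" for f g h
    proof -
      have "f j \<sqsubseteq>\<^bsub>L j\<^esub> h j" if j: "j \<in> J" for j
      proof -
        have "f j \<in> carrier (L j)" "g j \<in> carrier (L j)" "h j \<in> carrier (L j)" "f j \<sqsubseteq>\<^bsub>L j\<^esub> g j" "g j \<sqsubseteq>\<^bsub>L j\<^esub> h j"
          using j \<open>f \<in> _\<close> \<open>g \<in> _\<close> \<open>h \<in> _\<close> \<open>f \<sqsubseteq>\<^bsub>PiLat J L\<^esub> g\<close> \<open>g \<sqsubseteq>\<^bsub>PiLat J L\<^esub> h\<close> by (auto simp: PiLat_def)
        then show ?thesis by (rule order_on_trans[OF o[OF j]])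
      qed
      then show ?thesis by (simp add: PiLat_def)
    qed
  qed
  have "(\<exists>s. lub_of (PiLat J L) s f g) \<and> (\<exists>s. glb_of (PiLat J L) s f g)"
    if fg: "f \<in> carrier (PiLat J L)" "g \<in> carrier (PiLat J L)" for f g
  proof -
    have m: "f j \<in> carrier (L j)" "g j \<in> carrier (L j)" if "j \<in> J" for j
      using fg that by (auto simp: PiLat_def)
    have "\<forall>j\<in>J. \<exists>s. lub_of (L j) s (f j) (g j)" "\<forall>j\<in>J. \<exists>s. glb_of (L j) s (f j) (g j)"
      using L m unfolding lattice_on_def by blast+
    then obtain s t where st: "\<forall>j\<in>J. lub_of (L j) (s j) (f j) (g j)" "\<forall>j\<in>J. glb_of (L j) (t j) (f j) (g j)"
      by metis
    \<comment> \<open>Elements of the product are extensional functions, hence the restriction to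
      \<open>J\<close>.\<close>
    have "lub_of (PiLat J L) (restrict s J) f g"
      using st(1) unfolding lub_of_def PiLat_def by (auto simp: PiE_iff)
    moreover have "glb_of (PiLat J L) (restrict t J) f g"
      using st(2) unfolding glb_of_def PiLat_def by (auto simp: PiE_iff)
    ultimately show ?thesis by blast
  qed
  then show ?thesis unfolding lattice_on_def using ord by blast
qed

lemma lattice_on_ProdLat:
  assumes "lattice_on L" "lattice_on K"
  shows "lattice_on (ProdLat L K)"
proof -
  have oL: "order_on L" and oK: "order_on K" using assms unfolding lattice_on_def by auto
  have sel: "carrier (ProdLat L K) = carrier L \<times> carrier K" "eq (ProdLat L K) = (=)"
    "(a, b) \<sqsubseteq>\<^bsub>ProdLat L K\<^esub> (a', b') \<longleftrightarrow> a \<sqsubseteq>\<^bsub>L\<^esub> a' \<and> b \<sqsubseteq>\<^bsub>K\<^esub> b'" for a b a' b'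
    by (simp_all add: ProdLat_def)
  have ord: "order_on (ProdLat L K)"
    unfolding order_on_def sel(1,2)
  proof (intro conjI ballI impI)
    fix u v w assume uvw: "u \<in> carrier L \<times> carrier K" "v \<in> carrier L \<times> carrier K" "w \<in> carrier L \<times> carrier K"
      "u \<sqsubseteq>\<^bsub>ProdLat L K\<^esub> v" "v \<sqsubseteq>\<^bsub>ProdLat L K\<^esub> w"
    then show "u \<sqsubseteq>\<^bsub>ProdLat L K\<^esub> w"
      using order_on_trans[OF oL, of "fst u" "fst v" "fst w"] order_on_trans[OF oK, of "snd u" "snd v" "snd w"]
      by (auto simp: sel)
  qed (auto simp: sel intro: order_on_refl[OF oL] order_on_refl[OF oK] order_on_antisym[OF oL] order_on_antisym[OF oK])
  have "(\<exists>s. lub_of (ProdLat L K) s (a, b) (a', b')) \<and> (\<exists>s. glb_of (ProdLat L K) s (a, b) (a', b'))"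
    if "a \<in> carrier L" "a' \<in> carrier L" "b \<in> carrier K" "b' \<in> carrier K" for a b a' b'
  proof -
    have "(\<exists>s. lub_of L s a a') \<and> (\<exists>t. glb_of L t a a')" "(\<exists>s. lub_of K s b b') \<and> (\<exists>t. glb_of K t b b')"
      using assms that unfolding lattice_on_def by simp_all
    then obtain s s' t t' where "lub_of L s a a'" "lub_of K s' b b'" "glb_of L t a a'" "glb_of K t' b b'"
      by blast
    then have "lub_of (ProdLat L K) (s, s') (a, b) (a', b')" "glb_of (ProdLat L K) (t, t') (a, b) (a', b')"
      unfolding lub_of_def glb_of_def sel by (auto simp: sel)
    then show ?thesis by blast
  qed
  then show ?thesis unfolding lattice_on_def using ord by (auto simp: sel(1))
qed

section \<open>Congruences of a partial rectangular band\<close>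

locale rectangular_band =
  fixes \<C> :: "'o set" and X :: "'o \<Rightarrow> 'x set" and Y :: "'o \<Rightarrow> 'y set"
  assumes nonempty: "\<C> \<noteq> {}" and X: "band_family \<C> X" and Y: "band_family \<C> Y"
begin

lemma X_unique: "A \<in> \<C> \<Longrightarrow> B \<in> \<C> \<Longrightarrow> x \<in> X A \<Longrightarrow> x \<in> X B \<Longrightarrow> A = B"
  using X unfolding band_family_def disjoint_family_on_def by blast

lemma Y_unique: "A \<in> \<C> \<Longrightarrow> B \<in> \<C> \<Longrightarrow> y \<in> Y A \<Longrightarrow> y \<in> Y B \<Longrightarrow> A = B"
  using Y unfolding band_family_def disjoint_family_on_def by blast

lemma ex_X: "A \<in> \<C> \<Longrightarrow> \<exists>x. x \<in> X A" and ex_Y: "A \<in> \<C> \<Longrightarrow> \<exists>y. y \<in> Y A"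
  using X Y unfolding band_family_def by blast+

lemma band_carrier: "(x, y) \<in> carrier (prband \<C> X Y) \<longleftrightarrow> (\<exists>A\<in>\<C>. \<exists>B\<in>\<C>. x \<in> X A \<and> y \<in> Y B)"
  by (auto simp: prband_def)

lemma band_dom: "A \<in> \<C> \<Longrightarrow> x \<in> X A \<Longrightarrow> pdom (prband \<C> X Y) (x, y) = A"
  using X_unique by (auto simp: prband_def intro!: the_equality)

lemma band_ran: "B \<in> \<C> \<Longrightarrow> y \<in> Y B \<Longrightarrow> pran (prband \<C> X Y) (x, y) = B"
  using Y_unique by (auto simp: prband_def intro!: the_equality)

lemma band_mult: "(x1, y1) \<odot>\<^bsub>prband \<C> X Y\<^esub> (x2, y2) = (x1, y2)"
  by (simp add: prband_def)

lemma band_sim: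
  "((x, y), (x', y')) \<in> psg_sim (prband \<C> X Y) \<longleftrightarrow>
    (\<exists>A\<in>\<C>. \<exists>B\<in>\<C>. x \<in> X A \<and> x' \<in> X A \<and> y \<in> Y B \<and> y' \<in> Y B)"
  unfolding psg_sim_def using band_dom band_ran by (fastforce simp: band_carrier)

lemma band_sigma_iff:
  assumes "A \<in> \<C>" "B \<in> \<C>" "x \<in> X A" "y \<in> Y B"
  shows "((x, y), (x', y')) \<in> band_sigma \<C> X Y E1 E2 \<longleftrightarrow>
    x' \<in> X A \<and> y' \<in> Y B \<and> (x, x') \<in> E1 A \<and> (y, y') \<in> E2 B"
  using assms X_unique Y_unique unfolding band_sigma_def by (auto; metis)

lemma band_sigma_Cong:
  assumes E1: "\<And>A. A \<in> \<C> \<Longrightarrow> equiv (X A) (E1 A)" and E2: "\<And>A. A \<in> \<C> \<Longrightarrow> equiv (Y A) (E2 A)"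
  shows "band_sigma \<C> X Y E1 E2 \<in> Cong (prband \<C> X Y)"
proof -
  let ?\<sigma> = "band_sigma \<C> X Y E1 E2" and ?T = "prband \<C> X Y"
  have sim: "?\<sigma> \<subseteq> psg_sim ?T"
    unfolding subset_iff split_paired_All band_sim band_sigma_def by blast
  have "equiv (carrier ?T) ?\<sigma>"
  proof (rule equivI)
    show "?\<sigma> \<subseteq> carrier ?T \<times> carrier ?T" using sim unfolding psg_sim_def by blast
    show "refl_on (carrier ?T) ?\<sigma>"
    proof (rule refl_onI)
      fix z assume "z \<in> carrier ?T"
      then obtain x y A B where z: "z = (x, y)" "A \<in> \<C>" "B \<in> \<C>" "x \<in> X A" "y \<in> Y B"
        by (metis band_carrier prod.exhaust)
      then have "(x, x) \<in> E1 A" "(y, y) \<in> E2 B"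
        using E1 E2 by (meson equivE refl_onD)+
      then show "(z, z) \<in> ?\<sigma>" using z band_sigma_iff[of A B x y] by simp
    qed
    show "sym ?\<sigma>"
      using E1 E2 unfolding sym_def split_paired_All band_sigma_def by (auto; meson equivE symD)
    show "trans ?\<sigma>"
    proof (rule transI)
      fix u v w assume uv: "(u, v) \<in> ?\<sigma>" and vw: "(v, w) \<in> ?\<sigma>"
      obtain x y x' y' x'' y'' where p: "u = (x, y)" "v = (x', y')" "w = (x'', y'')" by (metis prod.exhaust)
      obtain A B where AB: "A \<in> \<C>" "B \<in> \<C>" "x \<in> X A" "x' \<in> X A" "y \<in> Y B" "y' \<in> Y B" "(x, x') \<in> E1 A" "(y, y') \<in> E2 B"
        using uv unfolding p band_sigma_def by auto
      then have "x'' \<in> X A" "y'' \<in> Y B" "(x', x'') \<in> E1 A" "(y', y'') \<in> E2 B"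
        using vw band_sigma_iff[OF AB(1,2,4,6)] unfolding p by auto
      moreover have "(x, x'') \<in> E1 A" "(y, y'') \<in> E2 B"
        using AB calculation E1[OF AB(1)] E2[OF AB(2)] by (meson equivE transD)+
      ultimately show "(u, w) \<in> ?\<sigma>" unfolding p using band_sigma_iff[OF AB(1,2,3,5)] by simp
    qed
  qed
  moreover have "(s \<odot>\<^bsub>?T\<^esub> u, s \<odot>\<^bsub>?T\<^esub> v) \<in> ?\<sigma> \<and> (pran ?T u = pdom ?T s \<longrightarrow> (u \<odot>\<^bsub>?T\<^esub> s, v \<odot>\<^bsub>?T\<^esub> s) \<in> ?\<sigma>)"
    if uv: "(u, v) \<in> ?\<sigma>" and s: "s \<in> carrier ?T" for u v s
  proof -
    obtain x y x' y' a b where p: "u = (x, y)" "v = (x', y')" "s = (a, b)" by (metis prod.exhaust)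
    obtain A B where AB: "A \<in> \<C>" "B \<in> \<C>" "x \<in> X A" "x' \<in> X A" "y \<in> Y B" "y' \<in> Y B" "(x, x') \<in> E1 A" "(y, y') \<in> E2 B"
      using uv unfolding p band_sigma_def by auto
    obtain A' B' where ab: "A' \<in> \<C>" "B' \<in> \<C>" "a \<in> X A'" "b \<in> Y B'" using s unfolding p band_carrier by blast
    have "(a, a) \<in> E1 A'" "(b, b) \<in> E2 B'" using E1 E2 ab by (meson equivE refl_onD)+
    then show ?thesis
      using AB ab band_sigma_iff[OF ab(1) AB(2) ab(3) AB(5)] band_sigma_iff[OF AB(1) ab(2) AB(3) ab(4)]
      unfolding p band_mult by simp
  qed
  ultimately show ?thesis using sim unfolding Cong_def by blast
qed

text \<open>A multiplier overwrites one coordinate of both members by a common value. A related pair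
  therefore splits into a relation of first and a relation of second coordinates, and transitivity
  through \<open>(x', y)\<close> reverses the splitting.\<close>

lemma Cong_band_sigma:
  assumes \<sigma>: "\<sigma> \<in> Cong (prband \<C> X Y)"
  shows "\<exists>E1 E2. \<sigma> = band_sigma \<C> X Y E1 E2 \<and> (\<forall>A\<in>\<C>. equiv (X A) (E1 A)) \<and> (\<forall>A\<in>\<C>. equiv (Y A) (E2 A))"
proof -
  let ?T = "prband \<C> X Y"
  have E: "equiv (carrier ?T) \<sigma>" and sim: "\<sigma> \<subseteq> psg_sim ?T"
    and L: "\<And>u v s. (u, v) \<in> \<sigma> \<Longrightarrow> s \<in> carrier ?T \<Longrightarrow> pran ?T s = pdom ?T u \<Longrightarrow> (s \<odot>\<^bsub>?T\<^esub> u, s \<odot>\<^bsub>?T\<^esub> v) \<in> \<sigma>"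
    and R: "\<And>u v s. (u, v) \<in> \<sigma> \<Longrightarrow> s \<in> carrier ?T \<Longrightarrow> pran ?T u = pdom ?T s \<Longrightarrow> (u \<odot>\<^bsub>?T\<^esub> s, v \<odot>\<^bsub>?T\<^esub> s) \<in> \<sigma>"
    using \<sigma> unfolding Cong_def by auto
  have refl: "(u, u) \<in> \<sigma>" if "u \<in> carrier ?T" for u using E that by (meson equivE refl_onD)
  have sym: "(v, u) \<in> \<sigma>" if "(u, v) \<in> \<sigma>" for u v using E that by (meson equivE symD)
  have trans: "(u, w) \<in> \<sigma>" if "(u, v) \<in> \<sigma>" "(v, w) \<in> \<sigma>" for u v w using E that by (meson equivE transD)
  have right: "((x, b), (x', b)) \<in> \<sigma>"
    if h: "((x, y), (x', y')) \<in> \<sigma>" "B \<in> \<C>" "B' \<in> \<C>" "y \<in> Y B" "b \<in> Y B'" for x x' y y' b B B'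
  proof -
    \<comment> \<open>Any \<open>a\<close> in \<open>X B\<close> makes \<open>(a, b)\<close>
      composable, and this first coordinate vanishes in the product.\<close>
    obtain a where a: "a \<in> X B" using ex_X[OF h(2)] by blast
    have "(a, b) \<in> carrier ?T" using h a by (auto simp: band_carrier)
    from R[OF h(1) this] show ?thesis
      using band_ran[OF h(2,4)] band_dom[OF h(2) a] by (simp add: band_mult)
  qed
  have left: "((a, y), (a, y')) \<in> \<sigma>"
    if h: "((x, y), (x', y')) \<in> \<sigma>" "A \<in> \<C>" "A' \<in> \<C>" "x \<in> X A" "a \<in> X A'" for x x' y y' a A A'
  proof -
    obtain b where b: "b \<in> Y A" using ex_Y[OF h(2)] by blast
    have "(a, b) \<in> carrier ?T" using h b by (auto simp: band_carrier)
    from L[OF h(1) this] show ?thesis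
      using band_dom[OF h(2,4)] band_ran[OF h(2) b] by (simp add: band_mult)
  qed
  have refl': "((x, y), (x, y)) \<in> \<sigma>" if "A \<in> \<C>" "B \<in> \<C>" "x \<in> X A" "y \<in> Y B" for A B x y
    by (rule refl) (use that in \<open>auto simp: band_carrier\<close>)
  \<comment> \<open>All common second coordinates are demanded at once; by \<open>right\<close> a
    single related pair already provides them.\<close>
  define E1 where "E1 A = {(x, x'). x \<in> X A \<and> x' \<in> X A \<and> (\<forall>B\<in>\<C>. \<forall>y\<in>Y B. ((x, y), (x', y)) \<in> \<sigma>)}" for A
  define E2 where "E2 B = {(y, y'). y \<in> Y B \<and> y' \<in> Y B \<and> (\<forall>A\<in>\<C>. \<forall>x\<in>X A. ((x, y), (x, y')) \<in> \<sigma>)}" for B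
  have eq1: "equiv (X A) (E1 A)" if A: "A \<in> \<C>" for A
  proof (rule equivI)
    show "E1 A \<subseteq> X A \<times> X A" unfolding E1_def by blast
    show "refl_on (X A) (E1 A)"
      unfolding E1_def refl_on_def using A refl' by simp
    show "sym (E1 A)" unfolding E1_def using sym by (auto simp: sym_def)
    show "trans (E1 A)" unfolding E1_def trans_def using trans by (auto; blast)
  qed
  have eq2: "equiv (Y A) (E2 A)" if A: "A \<in> \<C>" for A
  proof (rule equivI)
    show "E2 A \<subseteq> Y A \<times> Y A" unfolding E2_def by blast
    show "refl_on (Y A) (E2 A)"
      unfolding E2_def refl_on_def using A refl' by simp
    show "sym (E2 A)" unfolding E2_def using sym by (auto simp: sym_def)
    show "trans (E2 A)" unfolding E2_def trans_def using trans by (auto; blast)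
  qed
  have "((x, y), (x', y')) \<in> \<sigma> \<longleftrightarrow> ((x, y), (x', y')) \<in> band_sigma \<C> X Y E1 E2" for x y x' y'
  proof
    assume s: "((x, y), (x', y')) \<in> \<sigma>"
    then obtain A B where AB: "A \<in> \<C>" "B \<in> \<C>" "x \<in> X A" "x' \<in> X A" "y \<in> Y B" "y' \<in> Y B"
      using sim band_sim by blast
    have "(x, x') \<in> E1 A" "(y, y') \<in> E2 B"
      unfolding E1_def E2_def using AB right[OF s AB(2) _ AB(5)] left[OF s AB(1) _ AB(3)] by auto
    then show "((x, y), (x', y')) \<in> band_sigma \<C> X Y E1 E2"
      using AB unfolding band_sigma_def by blast
  next
    assume "((x, y), (x', y')) \<in> band_sigma \<C> X Y E1 E2"
    then obtain A B where AB: "A \<in> \<C>" "B \<in> \<C>" "x \<in> X A" "x' \<in> X A" "y \<in> Y B" "y' \<in> Y B"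
      "(x, x') \<in> E1 A" "(y, y') \<in> E2 B"
      unfolding band_sigma_def by auto
    have "((x, y), (x', y)) \<in> \<sigma>" "((x', y), (x', y')) \<in> \<sigma>"
      using AB unfolding E1_def E2_def by blast+
    then show "((x, y), (x', y')) \<in> \<sigma>" by (rule trans)
  qed
  then have "\<sigma> = band_sigma \<C> X Y E1 E2" by auto
  then show ?thesis using eq1 eq2 by blast
qed

text \<open>Pairing with a reflexive pair in the other coordinate isolates one coordinate, which is
  possible because the members of both families are non-empty.\<close>

lemma band_sigma_mono_iff:
  assumes E1: "\<And>A. A \<in> \<C> \<Longrightarrow> equiv (X A) (E1 A)" and E2: "\<And>A. A \<in> \<C> \<Longrightarrow> equiv (Y A) (E2 A)"
  shows "band_sigma \<C> X Y E1 E2 \<subseteq> band_sigma \<C> X Y F1 F2 \<longleftrightarrow>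
    (\<forall>A\<in>\<C>. E1 A \<subseteq> F1 A) \<and> (\<forall>A\<in>\<C>. E2 A \<subseteq> F2 A)"
proof
  assume sub: "band_sigma \<C> X Y E1 E2 \<subseteq> band_sigma \<C> X Y F1 F2"
  have "(x, x') \<in> F1 A" if A: "A \<in> \<C>" "(x, x') \<in> E1 A" for A x x'
  proof -
    have x: "x \<in> X A" "x' \<in> X A" using equiv_type[OF E1[OF A(1)]] A(2) by auto
    obtain y where y: "y \<in> Y A" using ex_Y A(1) by blast
    then have "(y, y) \<in> E2 A" using E2[OF A(1)] by (meson equivE refl_onD)
    then show ?thesis
      using sub band_sigma_iff[OF A(1,1) x(1) y, of x' y] x y A(2) by blast
  qed
  moreover have "(y, y') \<in> F2 A" if A: "A \<in> \<C>" "(y, y') \<in> E2 A" for A y y'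
  proof -
    have y: "y \<in> Y A" "y' \<in> Y A" using equiv_type[OF E2[OF A(1)]] A(2) by auto
    obtain x where x: "x \<in> X A" using ex_X A(1) by blast
    then have "(x, x) \<in> E1 A" using E1[OF A(1)] by (meson equivE refl_onD)
    then show ?thesis
      using sub band_sigma_iff[OF A(1,1) x y(1), of x y'] x y A(2) by blast
  qed
  ultimately show "(\<forall>A\<in>\<C>. E1 A \<subseteq> F1 A) \<and> (\<forall>A\<in>\<C>. E2 A \<subseteq> F2 A)" by auto
next
  assume "(\<forall>A\<in>\<C>. E1 A \<subseteq> F1 A) \<and> (\<forall>A\<in>\<C>. E2 A \<subseteq> F2 A)"
  then show "band_sigma \<C> X Y E1 E2 \<subseteq> band_sigma \<C> X Y F1 F2"
    unfolding band_sigma_def by blast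
qed

end

section \<open>Transport of congruences along isomorphisms\<close>

definition pullback :: "('m, 'o, 'z) psemigroup_scheme \<Rightarrow> ('m \<Rightarrow> 'n) \<Rightarrow> 'n rel \<Rightarrow> 'm rel" where
  "pullback S \<phi> \<tau> = {(\<alpha>, \<beta>). \<alpha> \<in> carrier S \<and> \<beta> \<in> carrier S \<and> (\<phi> \<alpha>, \<phi> \<beta>) \<in> \<tau>}"

text \<open>The record type does not enforce that products stay in the carrier, hence the closure
  hypothesis. Pushing a congruence forward along the bijection gives a congruence whose pullback is
  the original one.\<close>

lemma iso_Cong:
  assumes iso: "psg_iso \<phi> S T"
    and closed: "\<And>x y. x \<in> carrier S \<Longrightarrow> y \<in> carrier S \<Longrightarrow> pran S x = pdom S y \<Longrightarrow> x \<odot>\<^bsub>S\<^esub> y \<in> carrier S"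
  shows "Cong S = pullback S \<phi> ` Cong T"
proof -
  have bij: "bij_betw \<phi> (carrier S) (carrier T)"
    and dr: "\<And>x. x \<in> carrier S \<Longrightarrow> pdom T (\<phi> x) = pdom S x" "\<And>x. x \<in> carrier S \<Longrightarrow> pran T (\<phi> x) = pran S x"
    and mult: "\<And>x y. x \<in> carrier S \<Longrightarrow> y \<in> carrier S \<Longrightarrow> pran S x = pdom S y \<Longrightarrow>
      \<phi> (x \<odot>\<^bsub>S\<^esub> y) = \<phi> x \<odot>\<^bsub>T\<^esub> \<phi> y"
    using iso unfolding psg_iso_def by auto
  have \<phi>m: "\<phi> x \<in> carrier T" if "x \<in> carrier S" for x using bij_betwE[OF bij] that by blast
  have surj: "\<exists>x\<in>carrier S. \<phi> x = y" if "y \<in> carrier T" for y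
    using bij that unfolding bij_betw_def by (metis imageE)
  have inj: "\<phi> x = \<phi> y \<Longrightarrow> x = y" if "x \<in> carrier S" "y \<in> carrier S" for x y
    using bij that unfolding bij_betw_def inj_on_def by blast
  have "pullback S \<phi> \<tau> \<in> Cong S" if \<tau>: "\<tau> \<in> Cong T" for \<tau>
  proof -
    have E: "equiv (carrier T) \<tau>" and sim: "\<tau> \<subseteq> psg_sim T"
      and L: "\<And>u v s. (u, v) \<in> \<tau> \<Longrightarrow> s \<in> carrier T \<Longrightarrow> pran T s = pdom T u \<Longrightarrow> (s \<odot>\<^bsub>T\<^esub> u, s \<odot>\<^bsub>T\<^esub> v) \<in> \<tau>"
      and R: "\<And>u v s. (u, v) \<in> \<tau> \<Longrightarrow> s \<in> carrier T \<Longrightarrow> pran T u = pdom T s \<Longrightarrow> (u \<odot>\<^bsub>T\<^esub> s, v \<odot>\<^bsub>T\<^esub> s) \<in> \<tau>"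
      using \<tau> unfolding Cong_def by auto
    have "equiv (carrier S) (pullback S \<phi> \<tau>)"
    proof (rule equivI)
      show "pullback S \<phi> \<tau> \<subseteq> carrier S \<times> carrier S" unfolding pullback_def by blast
      show "refl_on (carrier S) (pullback S \<phi> \<tau>)"
        using E \<phi>m unfolding pullback_def by (auto simp: refl_on_def equiv_def)
      show "sym (pullback S \<phi> \<tau>)"
        using E unfolding pullback_def by (auto simp: sym_def equiv_def)
      show "trans (pullback S \<phi> \<tau>)"
        using E unfolding pullback_def trans_def equiv_def by (auto; blast)
    qed
    moreover have sim': "pullback S \<phi> \<tau> \<subseteq> psg_sim S"
    proof (clarify)
      fix a b assume "(a, b) \<in> pullback S \<phi> \<tau>"
      then have "a \<in> carrier S" "b \<in> carrier S" "(\<phi> a, \<phi> b) \<in> psg_sim T"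
        using sim unfolding pullback_def by blast+
      then show "(a, b) \<in> psg_sim S" using dr unfolding psg_sim_def by simp
    qed
    moreover have "(pran S s = pdom S a \<longrightarrow> (s \<odot>\<^bsub>S\<^esub> a, s \<odot>\<^bsub>S\<^esub> b) \<in> pullback S \<phi> \<tau>) \<and>
        (pran S a = pdom S s \<longrightarrow> (a \<odot>\<^bsub>S\<^esub> s, b \<odot>\<^bsub>S\<^esub> s) \<in> pullback S \<phi> \<tau>)"
      if ab: "(a, b) \<in> pullback S \<phi> \<tau>" and s: "s \<in> carrier S" for a b s
    proof -
      have m: "a \<in> carrier S" "b \<in> carrier S" "(\<phi> a, \<phi> b) \<in> \<tau>" using ab unfolding pullback_def by auto
      have d: "pdom S a = pdom S b" "pran S a = pran S b" using sim' ab unfolding psg_sim_def by auto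
      show ?thesis
        using L[OF m(3) \<phi>m[OF s]] R[OF m(3) \<phi>m[OF s]] m s d dr mult closed unfolding pullback_def by simp
    qed
    ultimately show ?thesis unfolding Cong_def by blast
  qed
  moreover have "\<sigma> \<in> pullback S \<phi> ` Cong T" if \<sigma>: "\<sigma> \<in> Cong S" for \<sigma>
  proof -
    have E: "equiv (carrier S) \<sigma>" and sim: "\<sigma> \<subseteq> psg_sim S"
      and L: "\<And>u v s. (u, v) \<in> \<sigma> \<Longrightarrow> s \<in> carrier S \<Longrightarrow> pran S s = pdom S u \<Longrightarrow> (s \<odot>\<^bsub>S\<^esub> u, s \<odot>\<^bsub>S\<^esub> v) \<in> \<sigma>"
      and R: "\<And>u v s. (u, v) \<in> \<sigma> \<Longrightarrow> s \<in> carrier S \<Longrightarrow> pran S u = pdom S s \<Longrightarrow> (u \<odot>\<^bsub>S\<^esub> s, v \<odot>\<^bsub>S\<^esub> s) \<in> \<sigma>"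
      using \<sigma> unfolding Cong_def by auto
    note sub = equiv_type[OF E]
    define \<tau> where "\<tau> = {(\<phi> a, \<phi> b) |a b. (a, b) \<in> \<sigma>}"
    have iff: "(\<phi> a, \<phi> b) \<in> \<tau> \<longleftrightarrow> (a, b) \<in> \<sigma>" if "a \<in> carrier S" "b \<in> carrier S" for a b
      using sub inj that unfolding \<tau>_def by blast
    have \<tau>E: "\<exists>a b. a \<in> carrier S \<and> b \<in> carrier S \<and> u = \<phi> a \<and> v = \<phi> b \<and> (a, b) \<in> \<sigma>" if "(u, v) \<in> \<tau>" for u v
      using that sub unfolding \<tau>_def by blast
    have "equiv (carrier T) \<tau>"
    proof (rule equivI)
      show "\<tau> \<subseteq> carrier T \<times> carrier T" using \<tau>E \<phi>m by fast
      show "refl_on (carrier T) \<tau>"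
      proof (rule refl_onI)
        fix u assume "u \<in> carrier T"
        then obtain a where a: "a \<in> carrier S" "\<phi> a = u" using surj by blast
        then have "(a, a) \<in> \<sigma>" using E by (meson equivE refl_onD)
        then show "(u, u) \<in> \<tau>" using a unfolding \<tau>_def by blast
      qed
      show "sym \<tau>"
      proof (rule symI)
        fix u v assume "(u, v) \<in> \<tau>"
        then obtain a b where "u = \<phi> a" "v = \<phi> b" "(a, b) \<in> \<sigma>" using \<tau>E by blast
        moreover from this have "(b, a) \<in> \<sigma>" using E by (meson equivE symD)
        ultimately show "(v, u) \<in> \<tau>" unfolding \<tau>_def by blast
      qed
      show "trans \<tau>"
      proof (rule transI)
        fix u v w assume uv: "(u, v) \<in> \<tau>" and vw: "(v, w) \<in> \<tau>"
        obtain a b where 1: "a \<in> carrier S" "b \<in> carrier S" "u = \<phi> a" "v = \<phi> b" "(a, b) \<in> \<sigma>"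
          using \<tau>E[OF uv] by blast
        obtain b' c where 2: "b' \<in> carrier S" "c \<in> carrier S" "v = \<phi> b'" "w = \<phi> c" "(b', c) \<in> \<sigma>"
          using \<tau>E[OF vw] by blast
        have "b' = b" using inj[OF 2(1) 1(2)] 1(4) 2(3) by simp
        then have "(a, c) \<in> \<sigma>" using 1(5) 2(5) E by (meson equivE transD)
        then show "(u, w) \<in> \<tau>" using 1(3) 2(4) unfolding \<tau>_def by blast
      qed
    qed
    moreover have "\<tau> \<subseteq> psg_sim T"
    proof (clarify)
      fix u v assume "(u, v) \<in> \<tau>"
      then obtain a b where ab: "a \<in> carrier S" "b \<in> carrier S" "u = \<phi> a" "v = \<phi> b" "(a, b) \<in> \<sigma>"
        using \<tau>E by blast
      have "pdom S a = pdom S b" "pran S a = pran S b" using sim ab(5) unfolding psg_sim_def by auto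
      then show "(u, v) \<in> psg_sim T" using ab \<phi>m dr unfolding psg_sim_def by simp
    qed
    moreover have "(pran T t = pdom T u \<longrightarrow> (t \<odot>\<^bsub>T\<^esub> u, t \<odot>\<^bsub>T\<^esub> v) \<in> \<tau>) \<and>
        (pran T u = pdom T t \<longrightarrow> (u \<odot>\<^bsub>T\<^esub> t, v \<odot>\<^bsub>T\<^esub> t) \<in> \<tau>)"
      if uv: "(u, v) \<in> \<tau>" and t: "t \<in> carrier T" for u v t
    proof -
      obtain a b where ab: "a \<in> carrier S" "b \<in> carrier S" "u = \<phi> a" "v = \<phi> b" "(a, b) \<in> \<sigma>"
        using \<tau>E[OF uv] by blast
      obtain s where s: "s \<in> carrier S" "\<phi> s = t" using surj[OF t] by blast
      have d: "pdom S a = pdom S b" "pran S a = pran S b" using sim ab(5) unfolding psg_sim_def by auto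
      have "(t \<odot>\<^bsub>T\<^esub> u, t \<odot>\<^bsub>T\<^esub> v) \<in> \<tau>" if "pran T t = pdom T u"
      proof -
        have c: "pran S s = pdom S a" "pran S s = pdom S b" using that dr s ab d by auto
        have "(\<phi> (s \<odot>\<^bsub>S\<^esub> a), \<phi> (s \<odot>\<^bsub>S\<^esub> b)) \<in> \<tau>"
          using L[OF ab(5) s(1) c(1)] unfolding \<tau>_def by blast
        then show ?thesis
          using mult[OF s(1) ab(1) c(1)] mult[OF s(1) ab(2) c(2)] ab(3,4) s(2) by simp
      qed
      moreover have "(u \<odot>\<^bsub>T\<^esub> t, v \<odot>\<^bsub>T\<^esub> t) \<in> \<tau>" if "pran T u = pdom T t"
      proof -
        have c: "pran S a = pdom S s" "pran S b = pdom S s" using that dr s ab d by auto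
        have "(\<phi> (a \<odot>\<^bsub>S\<^esub> s), \<phi> (b \<odot>\<^bsub>S\<^esub> s)) \<in> \<tau>"
          using R[OF ab(5) s(1) c(1)] unfolding \<tau>_def by blast
        then show ?thesis
          using mult[OF ab(1) s(1) c(1)] mult[OF ab(2) s(1) c(2)] ab(3,4) s(2) by simp
      qed
      ultimately show ?thesis by blast
    qed
    ultimately have "\<tau> \<in> Cong T" unfolding Cong_def by blast
    moreover have "\<sigma> = pullback S \<phi> \<tau>"
    proof (intro equalityI subsetI)
      fix z assume z: "z \<in> \<sigma>"
      then obtain a b where "z = (a, b)" "a \<in> carrier S" "b \<in> carrier S" using sub by blast
      then show "z \<in> pullback S \<phi> \<tau>" using z iff unfolding pullback_def by simp
    next
      fix z assume z: "z \<in> pullback S \<phi> \<tau>"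
      then obtain a b where "z = (a, b)" "a \<in> carrier S" "b \<in> carrier S" "(\<phi> a, \<phi> b) \<in> \<tau>"
        unfolding pullback_def by blast
      then show "z \<in> \<sigma>" using iff by simp
    qed
    ultimately show ?thesis by blast
  qed
  ultimately show ?thesis by blast
qed

context rectangular_band
begin

lemma Cong_iso_band:
  assumes iso: "psg_iso \<phi> S (prband \<C> X Y)"
    and closed: "\<And>x y. x \<in> carrier S \<Longrightarrow> y \<in> carrier S \<Longrightarrow> pran S x = pdom S y \<Longrightarrow> x \<odot>\<^bsub>S\<^esub> y \<in> carrier S"
  shows "Cong S = {pullback S \<phi> (band_sigma \<C> X Y E1 E2) |E1 E2.
    (\<forall>A\<in>\<C>. equiv (X A) (E1 A)) \<and> (\<forall>A\<in>\<C>. equiv (Y A) (E2 A))}" (is "_ = ?R")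
proof -
  have eq: "Cong S = pullback S \<phi> ` Cong (prband \<C> X Y)"
    by (rule iso_Cong[OF iso]) (rule closed)
  have "\<sigma> \<in> ?R" if "\<sigma> \<in> Cong S" for \<sigma>
  proof -
    obtain \<tau> where \<tau>: "\<tau> \<in> Cong (prband \<C> X Y)" "\<sigma> = pullback S \<phi> \<tau>"
      using \<open>\<sigma> \<in> Cong S\<close> unfolding eq by blast
    then show ?thesis using Cong_band_sigma[OF \<tau>(1)] by blast
  qed
  moreover have "\<sigma> \<in> Cong S" if "\<sigma> \<in> ?R" for \<sigma>
  proof -
    obtain E1 E2 where E: "\<sigma> = pullback S \<phi> (band_sigma \<C> X Y E1 E2)"
      "\<forall>A\<in>\<C>. equiv (X A) (E1 A)" "\<forall>A\<in>\<C>. equiv (Y A) (E2 A)" using \<open>\<sigma> \<in> ?R\<close> by blast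
    then have "band_sigma \<C> X Y E1 E2 \<in> Cong (prband \<C> X Y)" by (intro band_sigma_Cong) auto
    then show ?thesis unfolding eq E(1) by (rule imageI)
  qed
  ultimately show ?thesis by (intro equalityI subsetI)
qed

lemma CongLat_iso_band:
  assumes iso: "psg_iso \<phi> S (prband \<C> X Y)"
    and closed: "\<And>x y. x \<in> carrier S \<Longrightarrow> y \<in> carrier S \<Longrightarrow> pran S x = pdom S y \<Longrightarrow> x \<odot>\<^bsub>S\<^esub> y \<in> carrier S"
  shows "lattice_isomorphic (CongLat S)
    (ProdLat (PiLat \<C> (\<lambda>A. EqLat (X A))) (PiLat \<C> (\<lambda>A. EqLat (Y A))))"
proof (rule lattice_isomorphicI)
  let ?K = "ProdLat (PiLat \<C> (\<lambda>A. EqLat (X A))) (PiLat \<C> (\<lambda>A. EqLat (Y A)))"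
  show "lattice_on ?K"
    by (intro lattice_on_ProdLat lattice_on_PiLat lattice_on_EqLat)
  show "eq (CongLat S) = (=)" by (simp add: CongLat_def set_lattice_def)
  have cong_eq: "Cong S = {pullback S \<phi> (band_sigma \<C> X Y E1 E2) |E1 E2.
    (\<forall>A\<in>\<C>. equiv (X A) (E1 A)) \<and> (\<forall>A\<in>\<C>. equiv (Y A) (E2 A))}"
    by (rule Cong_iso_band[OF iso]) (rule closed)
  define f where "f = (\<lambda>(E1, E2). pullback S \<phi> (band_sigma \<C> X Y E1 E2))"
  have car: "(E1, E2) \<in> carrier ?K \<longleftrightarrow> E1 \<in> extensional \<C> \<and> E2 \<in> extensional \<C> \<and>
      (\<forall>A\<in>\<C>. equiv (X A) (E1 A)) \<and> (\<forall>A\<in>\<C>. equiv (Y A) (E2 A))" for E1 E2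
    by (auto simp: ProdLat_def PiLat_def EqLat_def set_lattice_def PiE_iff)
  have le: "(E1, E2) \<sqsubseteq>\<^bsub>?K\<^esub> (F1, F2) \<longleftrightarrow> (\<forall>A\<in>\<C>. E1 A \<subseteq> F1 A) \<and> (\<forall>A\<in>\<C>. E2 A \<subseteq> F2 A)" for E1 E2 F1 F2
    by (simp add: ProdLat_def PiLat_def EqLat_def set_lattice_def)
  have surj: "\<phi> ` carrier S = carrier (prband \<C> X Y)"
    using iso unfolding psg_iso_def bij_betw_def by blast
  have pull: "pullback S \<phi> \<tau> \<subseteq> pullback S \<phi> \<tau>' \<longleftrightarrow> \<tau> \<subseteq> \<tau>'"
    if \<tau>: "\<tau> \<subseteq> carrier (prband \<C> X Y) \<times> carrier (prband \<C> X Y)" for \<tau> \<tau>'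
  proof
    assume sub: "pullback S \<phi> \<tau> \<subseteq> pullback S \<phi> \<tau>'"
    show "\<tau> \<subseteq> \<tau>'"
    proof
      fix z assume z: "z \<in> \<tau>"
      then obtain u v where uv: "z = (u, v)" "u \<in> \<phi> ` carrier S" "v \<in> \<phi> ` carrier S"
        using \<tau> unfolding surj by blast
      then show "z \<in> \<tau>'" using sub z unfolding pullback_def by blast
    qed
  qed (auto simp: pullback_def)
  have bs: "band_sigma \<C> X Y E1 E2 \<subseteq> carrier (prband \<C> X Y) \<times> carrier (prband \<C> X Y)" for E1 E2
    unfolding band_sigma_def by (auto simp: band_carrier)
  have mono: "f (E1, E2) \<subseteq> f (F1, F2) \<longleftrightarrow> (\<forall>A\<in>\<C>. E1 A \<subseteq> F1 A) \<and> (\<forall>A\<in>\<C>. E2 A \<subseteq> F2 A)"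
    if "(E1, E2) \<in> carrier ?K" for E1 E2 F1 F2
    using that band_sigma_mono_iff[of E1 E2 F1 F2] pull[OF bs] unfolding f_def car by simp
  show "f u \<sqsubseteq>\<^bsub>CongLat S\<^esub> f v \<longleftrightarrow> u \<sqsubseteq>\<^bsub>?K\<^esub> v" if "u \<in> carrier ?K" "v \<in> carrier ?K" for u v
  proof -
    obtain E1 E2 F1 F2 where p: "u = (E1, E2)" "v = (F1, F2)" by (metis prod.exhaust)
    show ?thesis
      using mono[of E1 E2 F1 F2] that le unfolding p by (simp add: CongLat_def set_lattice_def)
  qed
  show "bij_betw f (carrier ?K) (carrier (CongLat S))"
  proof (rule bij_betw_imageI)
    show "inj_on f (carrier ?K)"
    proof (rule inj_onI)
      fix u v assume uv: "u \<in> carrier ?K" "v \<in> carrier ?K" "f u = f v"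
      obtain E1 E2 F1 F2 where p: "u = (E1, E2)" "v = (F1, F2)" by (metis prod.exhaust)
      have "\<forall>A\<in>\<C>. E1 A = F1 A \<and> E2 A = F2 A"
        using mono[of E1 E2 F1 F2] mono[of F1 F2 E1 E2] uv unfolding p by blast
      then show "u = v"
        using uv(1,2) unfolding p car by (metis extensionalityI)
    qed
    show "f ` carrier ?K = carrier (CongLat S)"
    proof (intro equalityI subsetI)
      fix \<sigma> assume "\<sigma> \<in> f ` carrier ?K"
      then show "\<sigma> \<in> carrier (CongLat S)"
        using car unfolding f_def CongLat_def set_lattice_def cong_eq by fastforce
    next
      fix \<sigma> assume "\<sigma> \<in> carrier (CongLat S)"
      then obtain E1 E2 where E: "\<sigma> = pullback S \<phi> (band_sigma \<C> X Y E1 E2)"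
        "\<forall>A\<in>\<C>. equiv (X A) (E1 A)" "\<forall>A\<in>\<C>. equiv (Y A) (E2 A)"
        unfolding CongLat_def set_lattice_def cong_eq by auto
      \<comment> \<open>The product lattice consists of extensional families. Cutting a family down
        to \<open>\<C>\<close> leaves \<open>band_sigma\<close> unchanged.\<close>
      have m: "(restrict E1 \<C>, restrict E2 \<C>) \<in> carrier ?K" using E unfolding car by simp
      have "band_sigma \<C> X Y (restrict E1 \<C>) (restrict E2 \<C>) = band_sigma \<C> X Y E1 E2"
        unfolding band_sigma_def by auto
      then have "\<sigma> = f (restrict E1 \<C>, restrict E2 \<C>)" using E(1) unfolding f_def by simp
      then show "\<sigma> \<in> f ` carrier ?K" using m by blast
    qed
  qed
qed

end

section \<open>The minimal ideal as a partial rectangular band\<close>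

text \<open>The classes are the blocks of \<open>U\<close> and the set of remaining points, a
  singleton when \<open>U\<close> is near-perfect. This translates matchings into elements of
  \<open>Eq2\<close>.\<close>

definition near_eqv :: "'a set \<Rightarrow> 'a set set \<Rightarrow> 'a rel" where
  "near_eqv A U = eqv_of (insert (A - \<Union>U) U)"

lemma near_perfect_partition:
  assumes "near_perfect A U"
  shows "partition_on A (insert (A - \<Union>U) U)"
proof -
  obtain z where z: "A - \<Union>U = {z}" and U: "matching A U" using near_perfectE[OF assms] .
  show ?thesis
  proof (rule partition_onI)
    show "\<Union>(insert (A - \<Union>U) U) = A" using U unfolding matching_def by auto
    show "{} \<notin> insert (A - \<Union>U) U" using U z unfolding matching_def by force
    fix P Q assume "P \<in> insert (A - \<Union>U) U" "Q \<in> insert (A - \<Union>U) U" "P \<noteq> Q"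
    then show "disjnt P Q"
      using matching_block_eq[OF U] by (auto simp: disjnt_iff)
  qed
qed

lemma near_eqv_quotient:
  assumes "near_perfect A U"
  shows "equiv A (near_eqv A U)" "A // near_eqv A U = insert (A - \<Union>U) U"
  using equiv_partition_on[OF near_perfect_partition[OF assms]]
    partition_on_eq_quotient[OF near_perfect_partition[OF assms]]
  unfolding near_eqv_def eqv_of_def by auto

lemma near_eqv_Eq2:
  assumes "near_perfect A U"
  shows "near_eqv A U \<in> Eq2 A"
proof -
  have U: "matching A U" "card (A - \<Union>U) = 1" using assms unfolding near_perfect_def by auto
  have two: "card P = 2" if "P \<in> U" for P using U(1) that unfolding matching_def by blast
  show ?thesis
    unfolding Eq2_def mem_Collect_eq near_eqv_quotient(2)[OF assms]
  proof (intro conjI near_eqv_quotient(1)[OF assms])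
    show "\<exists>!c. c \<in> insert (A - \<Union>U) U \<and> card c = 1"
      using U(2) two by (intro ex1I[of _ "A - \<Union>U"]) auto
    show "\<forall>c\<in>insert (A - \<Union>U) U. card c = 1 \<or> card c = 2"
      using U(2) two by auto
  qed
qed

text \<open>The matching is recovered as the set of classes of size 2.\<close>

lemma near_eqv_inj:
  assumes U: "near_perfect A U" and V: "near_perfect A V" and eq: "near_eqv A U = near_eqv A V"
  shows "U = V"
proof -
  have "W = {P \<in> A // near_eqv A W. card P = 2}" if W: "near_perfect A W" for W
    unfolding near_eqv_quotient(2)[OF W] using W unfolding near_perfect_def matching_def by auto
  from this[OF U] this[OF V] show ?thesis using eq by simp
qed

text \<open>The classes other than the unique singleton form the required matching.\<close>

lemma near_eqv_surj:
  assumes "\<epsilon> \<in> Eq2 A"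
  shows "\<exists>U. near_perfect A U \<and> near_eqv A U = \<epsilon>"
proof -
  have E: "equiv A \<epsilon>" and ex1: "\<exists>!c. c \<in> A // \<epsilon> \<and> card c = 1" and c12: "\<forall>c\<in>A // \<epsilon>. card c = 1 \<or> card c = 2"
    using assms unfolding Eq2_def by auto
  obtain c where c: "c \<in> A // \<epsilon>" "card c = 1" and uniq: "\<And>d. d \<in> A // \<epsilon> \<Longrightarrow> card d = 1 \<Longrightarrow> d = c"
    using ex1 by blast
  define U where "U = A // \<epsilon> - {c}"
  have P: "partition_on A (A // \<epsilon>)" by (rule partition_on_quotient[OF E])
  have "disjoint (A // \<epsilon>)" using partition_onD2[OF P] .
  then have disj: "P \<inter> Q = {}" if "P \<in> A // \<epsilon>" "Q \<in> A // \<epsilon>" "P \<noteq> Q" for P Q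
    using that by (meson disjointD)
  have Un: "\<Union>(A // \<epsilon>) = A" using partition_onD1[OF P] by simp
  have "matching A U"
    unfolding matching_def
  proof (intro conjI ballI)
    show "disjoint U" using disj unfolding U_def by (intro disjointI) blast
    show "\<Union>U \<subseteq> A" using Un unfolding U_def by blast
    fix P assume "P \<in> U"
    then show "card P = 2" using c12 uniq unfolding U_def by blast
  qed
  moreover have "A - \<Union>U = c"
  proof
    show "A - \<Union>U \<subseteq> c"
    proof
      fix w assume w: "w \<in> A - \<Union>U"
      then have "w \<in> \<Union>(A // \<epsilon>)" using Un by simp
      then obtain Q where "Q \<in> A // \<epsilon>" "w \<in> Q" by blast
      then show "w \<in> c" using w unfolding U_def by blast
    qed
    show "c \<subseteq> A - \<Union>U"
    proof
      fix w assume w: "w \<in> c"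
      have "w \<notin> Q" if "Q \<in> U" for Q
        using disj[OF c(1), of Q] that w unfolding U_def by blast
      moreover have "w \<in> \<Union>(A // \<epsilon>)" using w c(1) by blast
      ultimately show "w \<in> A - \<Union>U" unfolding Un by blast
    qed
  qed
  ultimately have np: "near_perfect A U" using c(2) unfolding near_perfect_def by simp
  have "insert (A - \<Union>U) U = A // \<epsilon>"
    unfolding \<open>A - \<Union>U = c\<close> using c(1) unfolding U_def by blast
  then have "near_eqv A U = eqv_of (A // \<epsilon>)" unfolding near_eqv_def by simp
  also have "\<dots> = \<epsilon>"
  proof (rule rel_eqI)
    fix a b
    show "(a, b) \<in> eqv_of (A // \<epsilon>) \<longleftrightarrow> (a, b) \<in> \<epsilon>"
      unfolding eqv_of_iff
    proof
      assume "\<exists>Q\<in>A // \<epsilon>. a \<in> Q \<and> b \<in> Q"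
      then show "(a, b) \<in> \<epsilon>" using quotient_eq_iff[OF E] by blast
    next
      assume ab: "(a, b) \<in> \<epsilon>"
      then have "a \<in> A" using equiv_type[OF E] by blast
      then have "\<epsilon> `` {a} \<in> A // \<epsilon>" by (rule quotientI)
      then show "\<exists>Q\<in>A // \<epsilon>. a \<in> Q \<and> b \<in> Q"
        using ab equiv_class_self[OF E \<open>a \<in> A\<close>] by blast
    qed
  qed
  finally show ?thesis using np by blast
qed

context odd_objects
begin

lemma band_family_Eq2: "band_family \<C> Eq2"
  unfolding band_family_def disjoint_family_on_def
proof (intro conjI ballI impI)
  fix A :: "'a set" assume "A \<in> \<C>"
  then show "Eq2 A \<noteq> {}" using ex_near_perfect_plain near_eqv_Eq2 by (metis empty_iff)
next
  fix A B :: "'a set" assume ne: "A \<noteq> B"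
  show "Eq2 A \<inter> Eq2 B = {}"
  proof (rule ccontr)
    assume "Eq2 A \<inter> Eq2 B \<noteq> {}"
    then obtain \<epsilon> where "equiv A \<epsilon>" "equiv B \<epsilon>" unfolding Eq2_def by blast
    \<comment> \<open>An equivalence determines the set it lives on, which separates the families of
      different objects.\<close>
    then have "Domain \<epsilon> = A" "Domain \<epsilon> = B"
      unfolding equiv_def refl_on_def by blast+
    then show False using ne by simp
  qed
qed

text \<open>The two coordinates of a rank 1 diagram in the rectangular band.\<close>

definition ends :: "'a diagram \<Rightarrow> 'a rel \<times> 'a rel" where
  "ends \<alpha> = (near_eqv (bdom \<alpha>) (upper \<alpha>), near_eqv (bran \<alpha>) (lower \<alpha>))"

lemma ends_eq: "\<alpha> \<in> brauer_hom A B \<Longrightarrow> ends \<alpha> = (near_eqv A (upper \<alpha>), near_eqv B (lower \<alpha>))"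
  by (simp add: ends_def)

lemma ends_Eq2:
  assumes "\<alpha> \<in> brauer_hom A B" "brank \<alpha> = 1"
  shows "near_eqv A (upper \<alpha>) \<in> Eq2 A" "near_eqv B (lower \<alpha>) \<in> Eq2 B"
  using near_eqv_Eq2 rank_one_upper[OF assms(1)] rank_one_lower[OF assms(1)] assms(2) by auto

lemma ideal_mult_closed:
  assumes "x \<in> carrier (brauer_I \<C> r)" "y \<in> carrier (brauer_I \<C> r)" "pran (brauer_I \<C> r) x = pdom (brauer_I \<C> r) y"
  shows "x \<odot>\<^bsub>brauer_I \<C> r\<^esub> y \<in> carrier (brauer_I \<C> r)"
proof -
  obtain A B where 1: "A \<in> \<C>" "B \<in> \<C>" "x \<in> brauer_hom A B" "enat (brank x) \<le> r"
    using assms(1) by (auto elim!: brauer_idealE)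
  obtain C where 2: "C \<in> \<C>" "y \<in> brauer_hom B C"
    using assms(2,3) 1 by (auto elim!: brauer_idealE)
  show ?thesis using mult_ideal[OF 1(1,2) 2(1) 1(3) 2(2)] 1(4) by simp
qed

text \<open>A product in rank 1 takes its upper matching from the first factor and its lower
  matching from the second, which is the band multiplication. Injectivity comes from
  \<open>rank_one_eqI\<close>, surjectivity from \<open>ex_rank_one\<close>.\<close>

lemma ends_iso:
  assumes "\<C> \<noteq> {}"
  shows "psg_iso ends (brauer_I \<C> 1) (prband \<C> Eq2 Eq2)"
proof -
  interpret rectangular_band \<C> Eq2 Eq2
    using assms band_family_Eq2 by unfold_locales
  have dr: "pdom (prband \<C> Eq2 Eq2) (ends \<alpha>) = A" "pran (prband \<C> Eq2 Eq2) (ends \<alpha>) = B"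
    "ends \<alpha> \<in> carrier (prband \<C> Eq2 Eq2)"
    if "A \<in> \<C>" "B \<in> \<C>" "\<alpha> \<in> brauer_hom A B" "brank \<alpha> = 1" for A B \<alpha>
    unfolding ends_eq[OF that(3)] using ends_Eq2[OF that(3,4)] band_dom[OF that(1)] band_ran[OF that(2)] that
    by (auto simp: band_carrier)
  have E: "\<exists>A\<in>\<C>. \<exists>B\<in>\<C>. \<alpha> \<in> brauer_hom A B \<and> brank \<alpha> = 1" if "\<alpha> \<in> brauer_ideal \<C> 1" for \<alpha>
    using that unfolding ideal_one_iff by blast
  have "bij_betw ends (brauer_ideal \<C> 1) (carrier (prband \<C> Eq2 Eq2))"
  proof (rule bij_betw_imageI)
    show "inj_on ends (brauer_ideal \<C> 1)"
    proof (rule inj_onI)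
      fix \<alpha> \<beta> assume "\<alpha> \<in> brauer_ideal \<C> 1" "\<beta> \<in> brauer_ideal \<C> 1" and eq: "ends \<alpha> = ends \<beta>"
      then obtain A B A' B' where ab: "A \<in> \<C>" "B \<in> \<C>" "\<alpha> \<in> brauer_hom A B" "brank \<alpha> = 1"
        "A' \<in> \<C>" "B' \<in> \<C>" "\<beta> \<in> brauer_hom A' B'" "brank \<beta> = 1"
        using E by meson
      have [simp]: "A' = A" "B' = B" using dr[OF ab(1-4)] dr[OF ab(5-8)] eq by simp_all
      have \<beta>: "\<beta> \<in> brauer_hom A B" using ab(7) by simp
      have "upper \<alpha> = upper \<beta>" "lower \<alpha> = lower \<beta>"
        using near_eqv_inj rank_one_upper[OF ab(3)] rank_one_upper[OF \<beta>] rank_one_lower[OF ab(3)]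
          rank_one_lower[OF \<beta>] ab(4,8) eq unfolding ends_eq[OF ab(3)] ends_eq[OF \<beta>] by blast+
      then show "\<alpha> = \<beta>" by (rule rank_one_eqI[OF ab(3) \<beta> ab(4)])
    qed
    show "ends ` brauer_ideal \<C> 1 = carrier (prband \<C> Eq2 Eq2)"
    proof (intro equalityI subsetI)
      fix z assume "z \<in> ends ` brauer_ideal \<C> 1"
      then show "z \<in> carrier (prband \<C> Eq2 Eq2)" using E dr(3) by blast
    next
      fix z assume "z \<in> carrier (prband \<C> Eq2 Eq2)"
      then obtain \<epsilon> \<delta> A B where z: "z = (\<epsilon>, \<delta>)" "A \<in> \<C>" "B \<in> \<C>" "\<epsilon> \<in> Eq2 A" "\<delta> \<in> Eq2 B"
        by (metis band_carrier prod.exhaust)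
      obtain U L where UL: "near_perfect A U" "near_eqv A U = \<epsilon>" "near_perfect B L" "near_eqv B L = \<delta>"
        using near_eqv_surj z(4,5) by metis
      obtain \<alpha> where \<alpha>: "\<alpha> \<in> brauer_hom A B" "upper \<alpha> = U" "lower \<alpha> = L" "brank \<alpha> = 1"
        using ex_rank_one[OF UL(1,3)] .
      have "\<alpha> \<in> brauer_ideal \<C> 1" using \<alpha> z(2,3) unfolding ideal_one_iff by blast
      moreover have "ends \<alpha> = z" unfolding ends_eq[OF \<alpha>(1)] \<alpha>(2,3) UL(2,4) z(1) ..
      ultimately show "z \<in> ends ` brauer_ideal \<C> 1" by blast
    qed
  qed
  moreover have "pdom (prband \<C> Eq2 Eq2) (ends \<alpha>) = bdom \<alpha> \<and> pran (prband \<C> Eq2 Eq2) (ends \<alpha>) = bran \<alpha>"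
    if h: "\<alpha> \<in> brauer_ideal \<C> 1" for \<alpha>
  proof -
    obtain A B where ab: "A \<in> \<C>" "B \<in> \<C>" "\<alpha> \<in> brauer_hom A B" "brank \<alpha> = 1" using E[OF h] by blast
    show ?thesis using dr[OF ab] ab(3) by simp
  qed
  moreover have "ends (\<alpha> \<cdot> \<beta>) = ends \<alpha> \<odot>\<^bsub>prband \<C> Eq2 Eq2\<^esub> ends \<beta>"
    if ab: "\<alpha> \<in> brauer_ideal \<C> 1" "\<beta> \<in> brauer_ideal \<C> 1" "bran \<alpha> = bdom \<beta>" for \<alpha> \<beta>
  proof -
    obtain A B where 1: "A \<in> \<C>" "B \<in> \<C>" "\<alpha> \<in> brauer_hom A B" "brank \<alpha> = 1" using E[OF ab(1)] by blast
    obtain B' C where 2: "B' \<in> \<C>" "C \<in> \<C>" "\<beta> \<in> brauer_hom B' C" "brank \<beta> = 1" using E[OF ab(2)] by blast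
    have "B' = B" using ab(3) 1(3) 2(3) by simp
    then have \<beta>: "\<beta> \<in> brauer_hom B C" using 2 by simp
    show ?thesis
      using rank_one_mult_left[OF 1(1,2) 2(2) 1(3) \<beta> 1(4)] rank_one_mult_right[OF 1(1,2) 2(2) 1(3) \<beta> 2(4)]
      unfolding ends_eq[OF mult_hom[OF 1(1,2) 2(2) 1(3) \<beta>]] ends_eq[OF 1(3)] ends_eq[OF \<beta>] band_mult by simp
  qed
  ultimately show ?thesis unfolding psg_iso_def by simp
qed

lemma ideal_one:
  assumes "\<C> \<noteq> {}"
  shows "psg_ideal (brauer \<C>) (brauer_ideal \<C> 1)"
proof -
  obtain A where A: "A \<in> \<C>" using assms by blast
  obtain U where U: "near_perfect A U" using ex_near_perfect_plain[OF A] .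
  obtain \<alpha> where "\<alpha> \<in> brauer_hom A A" "brank \<alpha> = 1" using ex_rank_one[OF U U] by metis
  then have "\<alpha> \<in> brauer_ideal \<C> 1" using A unfolding ideal_one_iff by blast
  moreover have "brauer_ideal \<C> 1 \<subseteq> carrier (brauer \<C>)" unfolding brauer_ideal_def by blast
  moreover have "(bran s = bdom x \<longrightarrow> s \<cdot> x \<in> brauer_ideal \<C> 1) \<and> (bran x = bdom s \<longrightarrow> x \<cdot> s \<in> brauer_ideal \<C> 1)"
    if x: "x \<in> brauer_ideal \<C> 1" and s: "s \<in> carrier (brauer \<C>)" for x s
  proof -
    obtain A B where 1: "A \<in> \<C>" "B \<in> \<C>" "x \<in> brauer_hom A B" "enat (brank x) \<le> 1" using x by (rule brauer_idealE)
    obtain A' B' where 2: "A' \<in> \<C>" "B' \<in> \<C>" "s \<in> brauer_hom A' B'" using s by auto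
    show ?thesis
      using mult_ideal[OF 2(1,2) 1(2) 2(3), of x 1] mult_ideal[OF 1(1,2) 2(2) 1(3), of s 1] 1 2 by auto
  qed
  ultimately show ?thesis unfolding psg_ideal_def by auto
qed

text \<open>Sandwiching any element of \<open>K\<close> between rank 1 diagrams with the outer
  matchings of \<open>\<gamma>\<close> overwrites both of its ends and gives exactly
  \<open>\<gamma>\<close>.\<close>

lemma ideal_one_minimal:
  assumes K: "psg_ideal (brauer \<C>) K"
  shows "brauer_ideal \<C> 1 \<subseteq> K"
proof
  fix \<gamma> assume "\<gamma> \<in> brauer_ideal \<C> 1"
  then obtain A B where \<gamma>: "A \<in> \<C>" "B \<in> \<C>" "\<gamma> \<in> brauer_hom A B" "brank \<gamma> = 1"
    unfolding ideal_one_iff by blast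
  obtain k where "k \<in> K" using K unfolding psg_ideal_def by blast
  then have "k \<in> carrier (brauer \<C>)" using K unfolding psg_ideal_def by blast
  then obtain A' B' where k: "A' \<in> \<C>" "B' \<in> \<C>" "k \<in> brauer_hom A' B'" by auto
  obtain U where U: "near_perfect A' U" using ex_near_perfect_plain[OF k(1)] .
  obtain L where L: "near_perfect B' L" using ex_near_perfect_plain[OF k(2)] .
  obtain s where s: "s \<in> brauer_hom A A'" "upper s = upper \<gamma>" "brank s = 1"
    using ex_rank_one[OF _ U] rank_one_upper[OF \<gamma>(3)] \<gamma>(4) by metis
  obtain t where t: "t \<in> brauer_hom B' B" "lower t = lower \<gamma>" "brank t = 1"
    using ex_rank_one[OF L] rank_one_lower[OF \<gamma>(3)] \<gamma>(4) by metis
  note sk = mult_hom[OF \<gamma>(1) k(1,2) s(1) k(3)]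
  note skt = mult_hom[OF \<gamma>(1) k(2) \<gamma>(2) sk t(1)]
  have sc: "s \<in> carrier (brauer \<C>)" "t \<in> carrier (brauer \<C>)" using s(1) t(1) \<gamma>(1,2) k(1,2) by auto
  have mult: "(bran z = bdom y \<longrightarrow> z \<cdot> y \<in> K) \<and> (bran y = bdom z \<longrightarrow> y \<cdot> z \<in> K)"
    if "y \<in> K" "z \<in> carrier (brauer \<C>)" for y z
    using K that unfolding psg_ideal_def brauer_sel(2-4) by blast
  have "s \<cdot> k \<in> K"
    using mult[OF \<open>k \<in> K\<close> sc(1)] bran_hom[OF s(1)] bdom_hom[OF k(3)] by simp
  then have "s \<cdot> k \<cdot> t \<in> K"
    using mult[OF _ sc(2)] bran_hom[OF sk] bdom_hom[OF t(1)] by simp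
  moreover have "s \<cdot> k \<cdot> t = \<gamma>"
    using rank_one_mult_left[OF \<gamma>(1) k(1,2) s(1) k(3) s(3)]
      rank_one_mult_left[OF \<gamma>(1) k(2) \<gamma>(2) sk t(1)] rank_one_mult_right[OF \<gamma>(1) k(2) \<gamma>(2) sk t(1) t(3)] s(2) t(2)
    by (intro rank_one_eqI[OF skt \<gamma>(3)]) auto
  ultimately show "\<gamma> \<in> K" by simp
qed

end

section \<open>The congruence lattice of an ideal\<close>

locale numbered_category = odd_objects \<C> for \<C> :: "'a set set" +
  fixes X :: "nat \<Rightarrow> 'a set" and x :: "nat \<Rightarrow> nat \<Rightarrow> 'a"
  assumes X: "\<And>q. odd q \<Longrightarrow> enat q < xi \<C> \<Longrightarrow> X q \<in> \<C> \<and> q \<le> card (X q)"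
    and x: "\<And>q. odd q \<Longrightarrow> enat q < xi \<C> \<Longrightarrow> bij_betw (x q) {1..card (X q)} (X q)"
begin

lemma numbered: "odd q \<Longrightarrow> enat q < xi \<C> \<Longrightarrow> numbered_object \<C> (X q) (x q) q"
  using X x by unfold_locales auto

context
  fixes r :: enat
  assumes r: "(\<exists>n. r = enat n \<and> odd n \<and> 3 \<le> n \<and> enat n < xi \<C>) \<or> (r = \<infinity> \<and> xi \<C> = \<infinity>)"
begin

abbreviation "S \<equiv> brauer_I \<C> r"
abbreviation "I1 \<equiv> brauer_ideal \<C> 1"

definition RN :: "nat \<Rightarrow> (nat \<Rightarrow> nat) set \<Rightarrow> 'a diagram rel" where
  "RN q N = RN_cong S (brauer_ideal \<C> (enat q)) (natural (x (q + 2)) (card (X (q + 2))) (q + 2) ` N)"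

definition idx :: "(nat \<times> (nat \<Rightarrow> nat) set) set" where
  "idx = {(q, N). 1 \<le> q \<and> enat q < r \<and> odd q \<and> N \<lhd> sym_group (q + 2)}"

lemma three_le_r: "3 \<le> r"
  using r by (auto simp: numeral_eq_enat)

lemma one_le_r: "enat 1 \<le> r"
  using r by auto

lemma rank_bounds:
  assumes "enat p \<le> r"
  shows "enat p < xi \<C>"
  using r assms by (auto intro: le_less_trans)

lemma idx_bounds:
  assumes "(q, N) \<in> idx"
  shows "odd (q + 2)" "enat (q + 2) \<le> r" "enat (q + 2) < xi \<C>" "odd q" "1 \<le> q" "N \<lhd> sym_group (q + 2)"
proof -
  show *: "odd (q + 2)" "odd q" "1 \<le> q" "N \<lhd> sym_group (q + 2)" using assms unfolding idx_def by auto
  show "enat (q + 2) \<le> r"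
    using r
  proof
    assume "\<exists>n. r = enat n \<and> odd n \<and> 3 \<le> n \<and> enat n < xi \<C>"
    then obtain n where n: "r = enat n" "odd n" by blast
    then have "q < n" using assms unfolding idx_def by simp
    \<comment> \<open>Both numbers are odd, so the strict inequality leaves a gap of at least
      two.\<close>
    then have "q + 2 \<le> n" using n(2) *(2) by presburger
    then show ?thesis using n(1) by simp
  qed simp
  then show "enat (q + 2) < xi \<C>" by (rule rank_bounds)
qed

lemma RN_RT: "(q, N) \<in> idx \<Longrightarrow> RN q N = RT r q N"
  unfolding RN_def
  by (rule numbered_object.RN_eq_RT[OF numbered]) (use idx_bounds in auto)

lemma id_idx: "(1, {id}) \<in> idx"
  using r trivial_normal by (auto simp: idx_def)

text \<open>Twisting by the trivial group is equality, so the bottom of the chain adds nothing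
  beyond rank 1.\<close>

lemma R_cong_I1: "R_cong S I1 = RN 1 {id}"
proof -
  have "(\<alpha>, \<beta>) \<in> R_cong S I1" if tw: "(\<alpha>, \<beta>) \<in> twist {id} (1 + 2)" for \<alpha> \<beta>
  proof -
    obtain A B h \<pi> where *: "A \<in> \<C>" "B \<in> \<C>" "\<alpha> \<in> brauer_hom A B" "\<beta> \<in> brauer_hom A B"
      "brank \<alpha> = 1 + 2" "brank \<beta> = 1 + 2" "upper \<alpha> = upper \<beta>" "lower \<alpha> = lower \<beta>"
      "bij_betw h {1..1 + (2::nat)} (A - \<Union>(upper \<alpha>))" "\<pi> \<in> {id}"
      "\<forall>i\<in>{1..1 + (2::nat)}. thr \<alpha> (h i) = thr \<beta> (h (\<pi> i))"
      using tw by (rule twistE)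
    have "thr \<alpha> a = thr \<beta> a" if "a \<in> A - \<Union>(upper \<alpha>)" for a
    proof -
      have "a \<in> h ` {1..1 + (2::nat)}" using *(9) that unfolding bij_betw_def by simp
      then show ?thesis using *(10,11) by auto
    qed
    then have "\<alpha> = \<beta>" by (rule hom_eqI'[OF *(3,4,7,8)])
    moreover have "\<alpha> \<in> brauer_ideal \<C> r"
      using twist_ideal(1)[OF tw] idx_bounds(2)[OF id_idx] by simp
    ultimately show ?thesis unfolding R_cong_def Delta_def by (simp add: Id_on_iff)
  qed
  then have "twist {id} (1 + 2) \<subseteq> R_cong S I1" by auto
  then show ?thesis
    unfolding RN_RT[OF id_idx] RT_def one_enat_def by (simp add: one_enat_def subset_Un_eq Un_commute)
qed

lemma RN_Cong: "(q, N) \<in> idx \<Longrightarrow> RN q N \<in> Cong S"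
  unfolding RN_RT by (rule RT_Cong) (use idx_bounds in auto)

text \<open>The least uncollapsed rank decides: if there is none, the congruence is the top; if it
  lies above 1, \<open>classify_twist\<close> applies just below it; otherwise only rank 1 is
  involved.\<close>

lemma congruences_classified:
  assumes "\<sigma> \<in> Cong S"
  shows "\<sigma> \<in> {Delta S, lambda_cong S I1, rho_cong S I1, R_cong S I1} \<union> {RN q N |q N. (q, N) \<in> idx} \<union> {Nabla S}"
proof -
  interpret brauer_cong \<C> r \<sigma>
    using assms three_le_r by unfold_locales
  show ?thesis
  proof (cases "collapsed 1")
    case False
    then show ?thesis
      using not_collapsed_cases unfolding Delta_eq lambda_eq[OF one_le_r] rho_eq[OF one_le_r] by blast
  next
    case c1: True
    show ?thesis
    proof (cases "\<forall>m. collapsed m")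
      case True
      have "Nabla S \<subseteq> \<sigma>"
      proof
        fix z assume "z \<in> Nabla S"
        then obtain \<alpha> \<beta> where z: "z = (\<alpha>, \<beta>)" and I: "\<alpha> \<in> brauer_ideal \<C> r" "\<beta> \<in> brauer_ideal \<C> r"
          "bdom \<alpha> = bdom \<beta>" "bran \<alpha> = bran \<beta>"
          unfolding Nabla_def psg_sim_def by auto
        obtain A B where AB: "A \<in> \<C>" "B \<in> \<C>" "\<alpha> \<in> brauer_hom A B" "\<beta> \<in> brauer_hom A B"
          using rel_ideal_cases[OF I] .
        have "collapsed (max (brank \<alpha>) (brank \<beta>))" using True by blast
        then show "z \<in> \<sigma>"
          using AB I(1,2) unfolding z collapsed_def brauer_ideal_iff by (meson max.cobounded1 max.cobounded2)
      qed
      moreover have "\<sigma> \<subseteq> Nabla S" using assms unfolding Cong_def Nabla_def by blast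
      ultimately show ?thesis by blast
    next
      case False
      \<comment> \<open>By minimality, an unrelated pair witnessing that \<open>m\<close> is not
        collapsed involves a diagram of rank exactly \<open>m\<close>. Hence \<open>m\<close> is an
        odd rank occurring in the ideal, and everything up to \<open>q = m - 2\<close> is
        collapsed.\<close>
      define m where "m = (LEAST m. \<not> collapsed m)"
      have m: "\<not> collapsed m" "\<And>k. k < m \<Longrightarrow> collapsed k"
        using False LeastI_ex[of "\<lambda>m. \<not> collapsed m"] not_less_Least[of _ "\<lambda>m. \<not> collapsed m"] unfolding m_def by blast+
      then have "1 < m" using c1 collapsed_mono by (metis linorder_not_less)
      then have "collapsed (m - 1)" using m(2) by simp
      obtain A B \<gamma> \<delta> where AB: "A \<in> \<C>" "B \<in> \<C>" and \<gamma>: "\<gamma> \<in> brauer_hom A B" and \<delta>: "\<delta> \<in> brauer_hom A B"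
        and le: "enat (brank \<gamma>) \<le> r" "enat (brank \<delta>) \<le> r" "brank \<gamma> \<le> m" "brank \<delta> \<le> m" and "(\<gamma>, \<delta>) \<notin> \<sigma>"
        using m(1) unfolding collapsed_def by blast
      then have "\<not> (brank \<gamma> \<le> m - 1 \<and> brank \<delta> \<le> m - 1)"
        using \<open>collapsed (m - 1)\<close> unfolding collapsed_def by blast
      then have "brank \<gamma> = m \<or> brank \<delta> = m" using le by linarith
      then have "odd m" "enat m \<le> r" using odd_rank[OF AB(1)] \<gamma> \<delta> le by auto
      then have mx: "enat m < xi \<C>" using rank_bounds by blast
      define q where "q = m - 2"
      have q: "m = q + 2" "odd q" "1 \<le> q" using \<open>1 < m\<close> \<open>odd m\<close> unfolding q_def by presburger+
      have "enat q < r" using \<open>enat m \<le> r\<close> unfolding q(1) by (meson enat_ord_simps(2) less_add_same_cancel1 less_le_trans zero_less_numeral)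
      obtain N where N: "N \<lhd> sym_group m" "\<sigma> = RT r q N"
        using numbered_object.classify_twist[OF numbered[OF \<open>odd m\<close> mx] brauer_cong_axioms q(1) \<open>enat m \<le> r\<close>]
          m(1) m(2)[of q] q(1) by auto
      then have i: "(q, N) \<in> idx" unfolding idx_def using q \<open>enat q < r\<close> by simp
      then have "\<sigma> = RN q N" using RN_RT N(2) by simp
      then show ?thesis using i by blast
    qed
  qed
qed

lemma congruence_list:
  "Cong S = {Delta S, lambda_cong S I1, rho_cong S I1, R_cong S I1} \<union> {RN q N |q N. (q, N) \<in> idx} \<union> {Nabla S}"
proof (intro equalityI subsetI)
  fix \<sigma> assume "\<sigma> \<in> Cong S"
  then show "\<sigma> \<in> {Delta S, lambda_cong S I1, rho_cong S I1, R_cong S I1} \<union> {RN q N |q N. (q, N) \<in> idx} \<union> {Nabla S}"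
    by (rule congruences_classified)
next
  fix \<sigma> assume "\<sigma> \<in> {Delta S, lambda_cong S I1, rho_cong S I1, R_cong S I1} \<union> {RN q N |q N. (q, N) \<in> idx} \<union> {Nabla S}"
  then show "\<sigma> \<in> Cong S"
    using Delta_Cong rel_ideal_lower_Cong rel_ideal_upper_Cong RN_Cong Nabla_Cong RN_Cong[OF id_idx]
    unfolding lambda_eq[OF one_le_r] rho_eq[OF one_le_r] R_cong_I1 by auto
qed

text \<open>Since \<open>3 < xi \<C>\<close>, some object has at least three points. Near-perfect
  matchings with different free points are different.\<close>

lemma ex_rank_one_pair:
  obtains A U V where "A \<in> \<C>" "near_perfect A U" "near_perfect A V" "U \<noteq> V"
proof -
  have "enat 3 < xi \<C>" using rank_bounds[of 3] three_le_r by (simp add: numeral_eq_enat)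
  then have X3: "X 3 \<in> \<C>" "3 \<le> card (X 3)" using X[of 3] by auto
  obtain a b c where abc: "a \<in> X 3" "b \<in> X 3" "c \<in> X 3" "distinct [a, b, c]" using three_subset[OF X3(2)] .
  obtain U where U: "near_perfect (X 3) U" "X 3 - \<Union>U = {a}"
    using ex_near_perfect[OF X3(1) matching_empty, of a] abc(1) by auto
  obtain V where V: "near_perfect (X 3) V" "X 3 - \<Union>V = {b}"
    using ex_near_perfect[OF X3(1) matching_empty, of b] abc(2) by auto
  have "U \<noteq> V" using U(2) V(2) abc(4) by auto
  then show ?thesis using that X3(1) U(1) V(1) by blast
qed

text \<open>The witnesses combine \<open>U\<close> and \<open>V\<close> so that
  \<open>\<alpha>\<close> and \<open>\<gamma>\<close> share only the lower matching,
  \<open>\<alpha>\<close> and \<open>\<beta>\<close> only the upper one.\<close>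

lemma incomparable:
  shows "Delta S \<subset> lambda_cong S I1" "Delta S \<subset> rho_cong S I1"
    "lambda_cong S I1 \<subset> R_cong S I1" "rho_cong S I1 \<subset> R_cong S I1"
    "\<not> lambda_cong S I1 \<subseteq> rho_cong S I1" "\<not> rho_cong S I1 \<subseteq> lambda_cong S I1"
proof -
  obtain A U V where A: "A \<in> \<C>" and U: "near_perfect A U" and V: "near_perfect A V" and ne: "U \<noteq> V"
    by (rule ex_rank_one_pair)
  obtain \<alpha> where \<alpha>: "\<alpha> \<in> brauer_hom A A" "upper \<alpha> = U" "lower \<alpha> = U" "brank \<alpha> = 1" by (rule ex_rank_one[OF U U])
  obtain \<beta> where \<beta>: "\<beta> \<in> brauer_hom A A" "upper \<beta> = U" "lower \<beta> = V" "brank \<beta> = 1" by (rule ex_rank_one[OF U V])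
  obtain \<gamma> where \<gamma>: "\<gamma> \<in> brauer_hom A A" "upper \<gamma> = V" "lower \<gamma> = U" "brank \<gamma> = 1" by (rule ex_rank_one[OF V U])
  have I: "\<alpha> \<in> brauer_ideal \<C> r" "\<beta> \<in> brauer_ideal \<C> r" "\<gamma> \<in> brauer_ideal \<C> r"
    using brauer_idealI[OF A A] \<alpha> \<beta> \<gamma> one_le_r by simp_all
  have 1: "(\<alpha>, \<gamma>) \<in> rel_ideal r (\<lambda>\<alpha> \<beta>. lower \<alpha> = lower \<beta>)" "(\<alpha>, \<gamma>) \<notin> rel_ideal r (\<lambda>\<alpha> \<beta>. upper \<alpha> = upper \<beta>)"
    "(\<alpha>, \<beta>) \<in> rel_ideal r (\<lambda>\<alpha> \<beta>. upper \<alpha> = upper \<beta>)" "(\<alpha>, \<beta>) \<notin> rel_ideal r (\<lambda>\<alpha> \<beta>. lower \<alpha> = lower \<beta>)"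
    using I \<alpha> \<beta> \<gamma> ne unfolding rel_ideal_def by auto
  have 2: "rel_ideal r (\<lambda>_ _. False) \<subseteq> rel_ideal r P" "rel_ideal r P \<subseteq> rel_ideal r (\<lambda>_ _. True)" for P
    unfolding rel_ideal_def by auto
  note eqs = Delta_eq lambda_eq[OF one_le_r] rho_eq[OF one_le_r] R_cong_one_eq
  show "Delta S \<subset> lambda_cong S I1" "Delta S \<subset> rho_cong S I1"
    "lambda_cong S I1 \<subset> R_cong S I1" "rho_cong S I1 \<subset> R_cong S I1"
    "\<not> lambda_cong S I1 \<subseteq> rho_cong S I1" "\<not> rho_cong S I1 \<subseteq> lambda_cong S I1"
    unfolding eqs using 1 2 by blast+
qed

lemma RN_mono_iff:
  assumes i: "(q, N) \<in> idx" and j: "(q', N') \<in> idx"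
  shows "RN q N \<subseteq> RN q' N' \<longleftrightarrow> q < q' \<or> (q = q' \<and> N \<subseteq> N')"
proof -
  note bi = idx_bounds[OF i] and bj = idx_bounds[OF j]
  have tw_rank: "brank \<alpha> = p" "brank \<beta> = p" if "(\<alpha>, \<beta>) \<in> twist M p" for \<alpha> \<beta> M p
    using that by (auto elim: twistE)
  have le: "RT r q N \<subseteq> RT r q' N'" if qq: "q < q'"
  proof
    fix z assume z: "z \<in> RT r q N"
    obtain \<alpha> \<beta> where ab: "z = (\<alpha>, \<beta>)" by (rule prod.exhaust)
    \<comment> \<open>Parity leaves a gap of two, so the twisted pairs of rank \<open>q + 2\<close>
      lie inside the collapsed part of the larger congruence.\<close>
    have "q + 2 \<le> q'" using qq bi(4) bj(4) by presburger
    have "\<alpha> = \<beta> \<or> brank \<alpha> \<le> q' \<and> brank \<beta> \<le> q'"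
    proof (cases "(\<alpha>, \<beta>) \<in> twist N (q + 2)")
      case True
      then show ?thesis using tw_rank[OF True] \<open>q + 2 \<le> q'\<close> by simp
    next
      case False
      then show ?thesis using z qq unfolding ab RT_def Un_iff R_cong_iff by auto
    qed
    then have "(\<alpha>, \<beta>) \<in> R_cong S (brauer_ideal \<C> (enat q'))"
      using RT_mem[OF z[unfolded ab] bi(2)] unfolding R_cong_iff by simp
    then show "z \<in> RT r q' N'" unfolding ab RT_def by blast
  qed
  \<comment> \<open>The congruence for \<open>q\<close> identifies the identity diagram of rank
    \<open>q' + 2\<close> with a diagram of rank 1, whereas the one for \<open>q'\<close> keeps them
    apart.\<close>
  have gt: "\<not> RT r q N \<subseteq> RT r q' N'" if qq: "q' < q"
  proof
    assume sub: "RT r q N \<subseteq> RT r q' N'"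
    interpret numbered_object \<C> "X (q' + 2)" "x (q' + 2)" "q' + 2" by (rule numbered[OF bj(1,3)])
    note h = nt_hom[OF permutes_id] and rk = brank_nt[OF permutes_id]
    have "q' + 2 \<le> q" using qq bi(4) bj(4) by presburger
    obtain U where U: "near_perfect (X (q' + 2)) U" using ex_near_perfect_plain[OF Z] .
    obtain \<epsilon> where \<epsilon>: "\<epsilon> \<in> brauer_hom (X (q' + 2)) (X (q' + 2))" "brank \<epsilon> = 1" using ex_rank_one[OF U U] by metis
    have "nt id \<in> brauer_ideal \<C> r" "\<epsilon> \<in> brauer_ideal \<C> r"
      using brauer_idealI[OF Z Z h] brauer_idealI[OF Z Z \<epsilon>(1)] rk \<epsilon>(2) bj(2) one_le_r by simp_all
    then have "(nt id, \<epsilon>) \<in> R_cong S (brauer_ideal \<C> (enat q))"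
      using h \<epsilon> rk \<open>q' + 2 \<le> q\<close> unfolding R_cong_iff by simp
    then have "(nt id, \<epsilon>) \<in> RT r q' N'" using sub unfolding RT_def by blast
    moreover have "(nt id, \<epsilon>) \<notin> twist N' (q' + 2)" using tw_rank(2) \<epsilon>(2) by fastforce
    ultimately have "nt id = \<epsilon> \<or> brank (nt id) \<le> q'" unfolding RT_def Un_iff R_cong_iff by blast
    then show False using rk \<epsilon>(2) by auto
  qed
  \<comment> \<open>Diagrams of permutations have rank \<open>q + 2\<close>, so a related pair of
    them is twisted or equal, and \<open>twist_nt_iff\<close> reads off membership in
    \<open>N'\<close>.\<close>
  have eq: "RT r q N \<subseteq> RT r q N' \<longleftrightarrow> N \<subseteq> N'" if qq: "q = q'"
  proof
    assume "N \<subseteq> N'"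
    then show "RT r q N \<subseteq> RT r q N'" unfolding RT_def twist_def by blast
  next
    assume sub: "RT r q N \<subseteq> RT r q N'"
    interpret numbered_object \<C> "X (q + 2)" "x (q + 2)" "q + 2" by (rule numbered[OF bi(1,3)])
    have N': "N' \<lhd> sym_group (q + 2)" using bj(6) qq by simp
    show "N \<subseteq> N'"
    proof
      fix \<pi> assume \<pi>: "\<pi> \<in> N"
      note \<pi>p = normal_permutes[OF bi(6) \<pi>]
      have "(nt \<pi>, nt id) \<in> RT r q N'"
        using twist_nt_iff[OF bi(6) \<pi>p] \<pi> sub unfolding RT_def by blast
      then have "(nt \<pi>, nt id) \<in> twist N' (q + 2) \<or> nt \<pi> = nt id"
        using brank_nt[OF \<pi>p] unfolding RT_def Un_iff R_cong_iff by auto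
      moreover have "(nt id, nt id) \<in> twist N' (q + 2)" using twist_nt_iff[OF N' permutes_id] normal_id[OF N'] by blast
      ultimately have "(nt \<pi>, nt id) \<in> twist N' (q + 2)" by auto
      then show "\<pi> \<in> N'" using twist_nt_iff[OF N' \<pi>p] by blast
    qed
  qed
  show ?thesis
    unfolding RN_RT[OF i] RN_RT[OF j] using le gt eq by (metis nat_neq_iff)
qed

lemma RN_chain:
  assumes i: "(q, N) \<in> idx" and j: "(q', N') \<in> idx"
  shows "RN q N \<subseteq> RN q' N' \<or> RN q' N' \<subseteq> RN q N"
proof (cases "q = q'")
  case True
  have "N \<subseteq> N' \<or> N' \<subseteq> N"
    using normal_sym_group_chain[of N "q + 2" N'] idx_bounds[OF i] idx_bounds[OF j] True by simp
  then show ?thesis using RN_mono_iff[OF i j] RN_mono_iff[OF j i] True by blast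
next
  case False
  then show ?thesis using RN_mono_iff[OF i j] RN_mono_iff[OF j i] by (meson nat_neq_iff)
qed

lemma R_cong_least:
  assumes i: "(q, N) \<in> idx"
  shows "R_cong S I1 \<subseteq> RN q N"
  unfolding R_cong_I1 using RN_mono_iff[OF id_idx i] idx_bounds[OF i] normal_id[of N "q + 2"]
  by (cases "q = 1") auto

end

end

theorem theorem7p7:
  fixes \<C> :: "'a set set"
    and X :: "nat \<Rightarrow> 'a set"
    and x :: "nat \<Rightarrow> nat \<Rightarrow> 'a"
  assumes nonempty: "\<C> \<noteq> {}"
    and odd_sets: "\<And>A. A \<in> \<C> \<Longrightarrow> finite A \<and> odd (card A)"
    and X: "\<And>q. odd q \<Longrightarrow> enat q < xi \<C> \<Longrightarrow> X q \<in> \<C> \<and> q \<le> card (X q)"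
    and x: "\<And>q. odd q \<Longrightarrow> enat q < xi \<C> \<Longrightarrow> bij_betw (x q) {1..card (X q)} (X q)"
  shows
    "(psg_ideal (brauer \<C>) (brauer_ideal \<C> 1) \<and>
      (\<forall>K. psg_ideal (brauer \<C>) K \<longrightarrow> brauer_ideal \<C> 1 \<subseteq> K) \<and>
      band_family \<C> Eq2 \<and>
      (\<exists>\<phi>. psg_iso \<phi> (brauer_I \<C> 1) (prband \<C> Eq2 Eq2) \<and>
           Cong (brauer_I \<C> 1) =
             {{(\<alpha>, \<beta>). \<alpha> \<in> brauer_ideal \<C> 1 \<and> \<beta> \<in> brauer_ideal \<C> 1 \<and>
                       (\<phi> \<alpha>, \<phi> \<beta>) \<in> band_sigma \<C> Eq2 Eq2 E1 E2} |E1 E2.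
              (\<forall>A\<in>\<C>. equiv (Eq2 A) (E1 A)) \<and> (\<forall>A\<in>\<C>. equiv (Eq2 A) (E2 A))}) \<and>
      lattice_isomorphic (CongLat (brauer_I \<C> 1))
        (ProdLat (PiLat \<C> (\<lambda>A. EqLat (Eq2 A))) (PiLat \<C> (\<lambda>A. EqLat (Eq2 A)))))
     \<and>
     (\<forall>r. (\<exists>n. r = enat n \<and> odd n \<and> 3 \<le> n \<and> enat n < xi \<C>) \<or> (r = \<infinity> \<and> xi \<C> = \<infinity>) \<longrightarrow>
       (let S = brauer_I \<C> r;
            I1 = brauer_ideal \<C> 1;
            RN = (\<lambda>q N. RN_cong S (brauer_ideal \<C> (enat q))
                    (natural (x (q + 2)) (card (X (q + 2))) (q + 2) ` N));
            idx = {(q, N). 1 \<le> q \<and> enat q < r \<and> odd q \<and> N \<lhd> sym_group (q + 2)}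
        in
          Cong S = {Delta S, lambda_cong S I1, rho_cong S I1, R_cong S I1} \<union>
                   {RN q N |q N. (q, N) \<in> idx} \<union> {Nabla S} \<and>
          Delta S \<subset> lambda_cong S I1 \<and> Delta S \<subset> rho_cong S I1 \<and>
          lambda_cong S I1 \<subset> R_cong S I1 \<and> rho_cong S I1 \<subset> R_cong S I1 \<and>
          \<not> lambda_cong S I1 \<subseteq> rho_cong S I1 \<and> \<not> rho_cong S I1 \<subseteq> lambda_cong S I1 \<and>
          R_cong S I1 = RN 1 {id} \<and>
          (\<forall>(q, N)\<in>idx. R_cong S I1 \<subseteq> RN q N) \<and>
          (\<forall>(q, N)\<in>idx. \<forall>(q', N')\<in>idx. RN q N \<subseteq> RN q' N' \<or> RN q' N' \<subseteq> RN q N) \<and>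
          (\<forall>(q, N)\<in>idx. \<forall>(q', N')\<in>idx.
             RN q N \<subseteq> RN q' N' \<longleftrightarrow> q < q' \<or> (q = q' \<and> N \<subseteq> N')) \<and>
          (\<forall>\<sigma>\<in>Cong S. \<sigma> \<subseteq> Nabla S)))"
proof -
  interpret numbered_category \<C> X x
    using odd_sets X x by unfold_locales
  interpret B: rectangular_band \<C> Eq2 Eq2
    using nonempty band_family_Eq2 by unfold_locales
  note iso = ends_iso[OF nonempty]
  have cong: "Cong (brauer_I \<C> 1) = {pullback (brauer_I \<C> 1) ends (band_sigma \<C> Eq2 Eq2 E1 E2) |E1 E2.
      (\<forall>A\<in>\<C>. equiv (Eq2 A) (E1 A)) \<and> (\<forall>A\<in>\<C>. equiv (Eq2 A) (E2 A))}"
    by (rule B.Cong_iso_band[OF iso]) (rule ideal_mult_closed)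
  have lat: "lattice_isomorphic (CongLat (brauer_I \<C> 1))
        (ProdLat (PiLat \<C> (\<lambda>A. EqLat (Eq2 A))) (PiLat \<C> (\<lambda>A. EqLat (Eq2 A))))"
    by (rule B.CongLat_iso_band[OF iso]) (rule ideal_mult_closed)
  have part1: "psg_ideal (brauer \<C>) (brauer_ideal \<C> 1) \<and>
      (\<forall>K. psg_ideal (brauer \<C>) K \<longrightarrow> brauer_ideal \<C> 1 \<subseteq> K) \<and>
      band_family \<C> Eq2 \<and>
      (\<exists>\<phi>. psg_iso \<phi> (brauer_I \<C> 1) (prband \<C> Eq2 Eq2) \<and>
           Cong (brauer_I \<C> 1) =
             {{(\<alpha>, \<beta>). \<alpha> \<in> brauer_ideal \<C> 1 \<and> \<beta> \<in> brauer_ideal \<C> 1 \<and>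
                       (\<phi> \<alpha>, \<phi> \<beta>) \<in> band_sigma \<C> Eq2 Eq2 E1 E2} |E1 E2.
              (\<forall>A\<in>\<C>. equiv (Eq2 A) (E1 A)) \<and> (\<forall>A\<in>\<C>. equiv (Eq2 A) (E2 A))}) \<and>
      lattice_isomorphic (CongLat (brauer_I \<C> 1))
        (ProdLat (PiLat \<C> (\<lambda>A. EqLat (Eq2 A))) (PiLat \<C> (\<lambda>A. EqLat (Eq2 A))))"
    using ideal_one[OF nonempty] ideal_one_minimal band_family_Eq2 iso lat
      cong[unfolded pullback_def brauer_I_sel] by blast
  show ?thesis
  proof (intro conjI[OF part1] allI impI, goal_cases)
    case (1 r)
    note list = congruence_list[OF 1] and inc = incomparable[OF 1]
    have least: "\<forall>(q, N)\<in>idx r. R_cong (S r) I1 \<subseteq> RN r q N"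
      using R_cong_least[OF 1] by blast
    have chain: "\<forall>(q, N)\<in>idx r. \<forall>(q', N')\<in>idx r. RN r q N \<subseteq> RN r q' N' \<or> RN r q' N' \<subseteq> RN r q N"
      using RN_chain[OF 1] by blast
    have mono: "\<forall>(q, N)\<in>idx r. \<forall>(q', N')\<in>idx r. RN r q N \<subseteq> RN r q' N' \<longleftrightarrow> q < q' \<or> (q = q' \<and> N \<subseteq> N')"
      using RN_mono_iff[OF 1] by blast
    have top: "\<forall>\<sigma>\<in>Cong (S r). \<sigma> \<subseteq> Nabla (S r)"
      unfolding Cong_def Nabla_def by blast
    show ?case
      unfolding Let_def RN_def[OF 1, symmetric] idx_def[OF 1, symmetric]
      by (intro conjI list inc R_cong_I1[OF 1] least chain mono top)
  qed
qed

end
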